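(* The group $\operatorname{Pic}\mathcal{M}_{1,1}$ of isomorphism classes of holomorphic line bundles over the orbifold $\mathcal{M}_{1,1}$ is cyclic of order $12$. It is generated by the class of the line bundle $\mathcal{L}_1$.
   Context: Let $\mathfrak{h}$ be the upper half plane. $\mathcal{M}_{1,1}$ is the orbifold quotient of $\mathfrak{h}$ by $\mathrm{SL}_2(\mathbb{Z})$ acting by $\gamma\tau=(a\tau+b)/(c\tau+d)$ for $\gamma=\begin{pmatrix}a&b\\c&d\end{pmatrix}$. A holomorphic line bundle over $\mathcal{M}_{1,1}$ is a holomorphic line bundle $L\to\mathfrak{h}$ together with a lift of the $\mathrm{SL}_2(\mathbb{Z})$-action on $\mathfrak{h}$ to an action on $L$ by biholomorphisms that are linear on fibers; isomorphisms are $\mathrm{SL}_2(\mathbb{Z})$-equivariant isomorphisms of holomorphic line bundles covering the identity of $\mathfrak{h}$. The group operation of $\operatorname{Pic}\mathcal{M}_{1,1}$ is tensor product. For $k\in\mathbb{Z}$, $\mathcal{L}_k$ is the line bundle over $\mathcal{M}_{1,1}$ given by the trivial bundle $\mathbb{C}\times\mathfrak{h}\to\mathfrak{h}$ with action $\gamma:(z,\tau)\mapsto\big((c\tau+d)^kz,\gamma\tau\big)$. *)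

theory Defs
  imports "HOL-Analysis.Analysis" "HOL-Algebra.Elementary_Groups"
begin

definition upper_half_plane :: "complex set" where
  "upper_half_plane = {\<tau>. Im \<tau> > 0}"

definition SL2Z :: "(int^2^2) set" where
  "SL2Z = {\<gamma>. det \<gamma> = 1}"

definition moebius_act :: "int^2^2 \<Rightarrow> complex \<Rightarrow> complex" where
  "moebius_act \<gamma> = moebius (of_int (\<gamma>$1$1)) (of_int (\<gamma>$1$2)) (of_int (\<gamma>$2$1)) (of_int (\<gamma>$2$2))"

text \<open>Complex differentiability, in the sense of a complex linear total derivative, of a function
  of two complex variables.\<close>

definition holomorphic2_on :: "(complex \<times> complex \<Rightarrow> complex) \<Rightarrow> (complex \<times> complex) set \<Rightarrow> bool" where
  "holomorphic2_on G S \<longleftrightarrow>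
     (\<forall>p\<in>S. \<exists>a b. (G has_derivative (\<lambda>(h, k). a * h + b * k)) (at p within S))"

text \<open>A bundle is given by its total space, the projection to the base, addition and scalar
  multiplication in the fibres, and an atlas of local trivialisations.  A pair \<open>(U, \<phi>)\<close> in the
  atlas stands for the trivialisation \<open>v \<mapsto> (proj v, \<phi> v)\<close> from the restriction of the bundle
  to \<open>U\<close> onto \<open>U \<times> \<complex>\<close>; only the fibre coordinate \<open>\<phi>\<close> is recorded.  The atlas need not be maximal.
  Values of the operations outside the total space are irrelevant.\<close>

record 'a lbundle =
  total :: "'a set"
  proj :: "'a \<Rightarrow> complex"
  add :: "'a \<Rightarrow> 'a \<Rightarrow> 'a"
  scale :: "complex \<Rightarrow> 'a \<Rightarrow> 'a"
  trivs :: "(complex set \<times> ('a \<Rightarrow> complex)) set"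

definition fibre :: "('a, 'z) lbundle_scheme \<Rightarrow> complex \<Rightarrow> 'a set" where
  "fibre L \<tau> = {v \<in> total L. proj L v = \<tau>}"

definition fibrewise_linear_over ::
  "(complex \<Rightarrow> complex) \<Rightarrow> ('a \<Rightarrow> 'b) \<Rightarrow> ('a, 'y) lbundle_scheme \<Rightarrow> ('b, 'z) lbundle_scheme \<Rightarrow> bool" where
  "fibrewise_linear_over f F L M \<longleftrightarrow>
     (\<forall>\<tau>\<in>upper_half_plane. \<forall>v\<in>fibre L \<tau>.
        F v \<in> fibre M (f \<tau>) \<and>
        (\<forall>w\<in>fibre L \<tau>. F (add L v w) = add M (F v) (F w)) \<and>
        (\<forall>c. F (scale L c v) = scale M c (F v)))"

text \<open>A map \<open>F\<close> of total spaces covering \<open>f\<close> reads \<open>(\<tau>, z) \<mapsto> (f \<tau>, G (\<tau>, z))\<close> in local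
  coordinates.  The first component is holomorphic as soon as \<open>f\<close> is, so only the second one has to
  be tested.\<close>

definition holomorphic_over ::
  "(complex \<Rightarrow> complex) \<Rightarrow> ('a \<Rightarrow> 'b) \<Rightarrow> ('a, 'y) lbundle_scheme \<Rightarrow> ('b, 'z) lbundle_scheme \<Rightarrow> bool" where
  "holomorphic_over f F L M \<longleftrightarrow>
     f holomorphic_on upper_half_plane \<and>
     (\<forall>(U, \<phi>)\<in>trivs L. \<forall>(V, \<psi>)\<in>trivs M.
        \<exists>G. holomorphic2_on G {(\<tau>, z). \<tau> \<in> U \<and> f \<tau> \<in> V} \<and>
            (\<forall>\<tau>\<in>U. \<forall>v\<in>fibre L \<tau>. f \<tau> \<in> V \<longrightarrow> \<psi> (F v) = G (\<tau>, \<phi> v)))"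

definition bundle_map_over ::
  "(complex \<Rightarrow> complex) \<Rightarrow> ('a \<Rightarrow> 'b) \<Rightarrow> ('a, 'y) lbundle_scheme \<Rightarrow> ('b, 'z) lbundle_scheme \<Rightarrow> bool" where
  "bundle_map_over f F L M \<longleftrightarrow> fibrewise_linear_over f F L M \<and> holomorphic_over f F L M"

text \<open>Being in linear bijection with \<open>\<complex>\<close>, each fibre is a one-dimensional complex vector space.
  The last clause says that any two trivialisations in the atlas are holomorphically compatible:
  it takes the identity in two possibly different local coordinates.\<close>

definition holomorphic_line_bundle :: "('a, 'z) lbundle_scheme \<Rightarrow> bool" where
  "holomorphic_line_bundle L \<longleftrightarrow>
     proj L ` total L \<subseteq> upper_half_plane \<and>
     (\<forall>(U, \<phi>)\<in>trivs L. open U \<and> U \<subseteq> upper_half_plane \<and>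
        (\<forall>\<tau>\<in>U. bij_betw \<phi> (fibre L \<tau>) UNIV \<and>
           (\<forall>v\<in>fibre L \<tau>.
              (\<forall>w\<in>fibre L \<tau>. add L v w \<in> fibre L \<tau> \<and> \<phi> (add L v w) = \<phi> v + \<phi> w) \<and>
              (\<forall>c. scale L c v \<in> fibre L \<tau> \<and> \<phi> (scale L c v) = c * \<phi> v)))) \<and>
     (\<forall>\<tau>\<in>upper_half_plane. \<exists>(U, \<phi>)\<in>trivs L. \<tau> \<in> U) \<and>
     holomorphic_over id id L L"

record 'a orbi_bundle = "'a lbundle" +
  act :: "int^2^2 \<Rightarrow> 'a \<Rightarrow> 'a"

text \<open>Each \<open>act L \<gamma>\<close> is biholomorphic, since its inverse is \<open>act L\<close> of the inverse matrix.\<close>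

definition orbi_line_bundle :: "'a orbi_bundle \<Rightarrow> bool" where
  "orbi_line_bundle L \<longleftrightarrow>
     holomorphic_line_bundle L \<and>
     (\<forall>\<gamma>\<in>SL2Z. bundle_map_over (moebius_act \<gamma>) (act L \<gamma>) L L) \<and>
     (\<forall>v\<in>total L. act L (mat 1) v = v) \<and>
     (\<forall>\<gamma>\<in>SL2Z. \<forall>\<delta>\<in>SL2Z. \<forall>v\<in>total L. act L (\<gamma> ** \<delta>) v = act L \<gamma> (act L \<delta> v))"

definition orbi_hom :: "('a \<Rightarrow> 'b) \<Rightarrow> 'a orbi_bundle \<Rightarrow> 'b orbi_bundle \<Rightarrow> bool" where
  "orbi_hom F L M \<longleftrightarrow>
     bundle_map_over id F L M \<and>
     (\<forall>\<gamma>\<in>SL2Z. \<forall>v\<in>total L. F (act L \<gamma> v) = act M \<gamma> (F v))"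

definition orbi_iso :: "'a orbi_bundle \<Rightarrow> 'b orbi_bundle \<Rightarrow> bool" where
  "orbi_iso L M \<longleftrightarrow>
     (\<exists>F G. orbi_hom F L M \<and> orbi_hom G M L \<and>
        (\<forall>v\<in>total L. G (F v) = v) \<and> (\<forall>w\<in>total M. F (G w) = w))"

text \<open>The line bundle written \<open>\<L>\<^sub>k\<close>.\<close>

definition weight_bundle :: "int \<Rightarrow> (complex \<times> complex) orbi_bundle" where
  "weight_bundle k =
     \<lparr>total = UNIV \<times> upper_half_plane,
      proj = snd,
      add = (\<lambda>(z, \<tau>) (w, _). (z + w, \<tau>)),
      scale = (\<lambda>c (z, \<tau>). (c * z, \<tau>)),
      trivs = {(upper_half_plane, fst)},
      act = (\<lambda>\<gamma> (z, \<tau>). ((of_int (\<gamma>$2$1) * \<tau> + of_int (\<gamma>$2$2)) powi k * z, moebius_act \<gamma> \<tau>))\<rparr>"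

text \<open>The fibre at \<open>\<tau>\<close> of the tensor product of \<open>L\<close> and \<open>M\<close> is the dual of the space of bilinear
  forms on the product of the fibres of \<open>L\<close> and \<open>M\<close>, the pure tensor of \<open>v\<close> and \<open>w\<close> being
  evaluation at \<open>(v, w)\<close>; for finite-dimensional spaces this is the usual tensor product.
  Forms and functionals are extended by 0 outside their domains, so that they are determined by
  their values on them.\<close>

definition bilinear_forms :: "'a orbi_bundle \<Rightarrow> 'b orbi_bundle \<Rightarrow> complex \<Rightarrow> ('a \<Rightarrow> 'b \<Rightarrow> complex) set" where
  "bilinear_forms L M \<tau> =
     {\<beta>. (\<forall>v w. \<not> (v \<in> fibre L \<tau> \<and> w \<in> fibre M \<tau>) \<longrightarrow> \<beta> v w = 0) \<and>
         (\<forall>v\<in>fibre L \<tau>. \<forall>w\<in>fibre M \<tau>.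
            (\<forall>v'\<in>fibre L \<tau>. \<beta> (add L v v') w = \<beta> v w + \<beta> v' w) \<and>
            (\<forall>w'\<in>fibre M \<tau>. \<beta> v (add M w w') = \<beta> v w + \<beta> v w') \<and>
            (\<forall>c. \<beta> (scale L c v) w = c * \<beta> v w \<and> \<beta> v (scale M c w) = c * \<beta> v w))}"

definition extend_by_zero ::
  "'a orbi_bundle \<Rightarrow> 'b orbi_bundle \<Rightarrow> complex \<Rightarrow> ('a \<Rightarrow> 'b \<Rightarrow> complex) \<Rightarrow> 'a \<Rightarrow> 'b \<Rightarrow> complex" where
  "extend_by_zero L M \<tau> \<beta> = (\<lambda>v w. if v \<in> fibre L \<tau> \<and> w \<in> fibre M \<tau> then \<beta> v w else 0)"

definition tensor_fibre ::
  "'a orbi_bundle \<Rightarrow> 'b orbi_bundle \<Rightarrow> complex \<Rightarrow> (('a \<Rightarrow> 'b \<Rightarrow> complex) \<Rightarrow> complex) set" where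
  "tensor_fibre L M \<tau> =
     {\<theta>. (\<forall>\<beta>. \<beta> \<notin> bilinear_forms L M \<tau> \<longrightarrow> \<theta> \<beta> = 0) \<and>
         (\<forall>\<beta>\<in>bilinear_forms L M \<tau>.
            (\<forall>\<beta>'\<in>bilinear_forms L M \<tau>. \<theta> (\<lambda>v w. \<beta> v w + \<beta>' v w) = \<theta> \<beta> + \<theta> \<beta>') \<and>
            (\<forall>c. \<theta> (\<lambda>v w. c * \<beta> v w) = c * \<theta> \<beta>))}"

text \<open>The local trivialisations send the pure tensor of \<open>v\<close> and \<open>w\<close> to \<open>\<phi> v * \<psi> w\<close>, and \<open>\<gamma>\<close>
  sends it to the pure tensor of \<open>\<gamma> v\<close> and \<open>\<gamma> w\<close>.\<close>

definition tensor_bundle ::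
  "'a orbi_bundle \<Rightarrow> 'b orbi_bundle \<Rightarrow> (complex \<times> (('a \<Rightarrow> 'b \<Rightarrow> complex) \<Rightarrow> complex)) orbi_bundle" where
  "tensor_bundle L M =
     \<lparr>total = (SIGMA \<tau>:upper_half_plane. tensor_fibre L M \<tau>),
      proj = fst,
      add = (\<lambda>(\<tau>, \<theta>) (_, \<eta>). (\<tau>, \<lambda>\<beta>. \<theta> \<beta> + \<eta> \<beta>)),
      scale = (\<lambda>c (\<tau>, \<theta>). (\<tau>, \<lambda>\<beta>. c * \<theta> \<beta>)),
      trivs = {(U \<inter> V, \<lambda>(\<tau>, \<theta>). \<theta> (extend_by_zero L M \<tau> (\<lambda>v w. \<phi> v * \<psi> w))) | U \<phi> V \<psi>.
                 (U, \<phi>) \<in> trivs L \<and> (V, \<psi>) \<in> trivs M},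
      act = (\<lambda>\<gamma> (\<tau>, \<theta>). (moebius_act \<gamma> \<tau>,
               \<lambda>\<beta>. if \<beta> \<in> bilinear_forms L M (moebius_act \<gamma> \<tau>)
                   then \<theta> (extend_by_zero L M \<tau> (\<lambda>v w. \<beta> (act L \<gamma> v) (act M \<gamma> w)))
                   else 0))\<rparr>"

text \<open>The type \<open>'a\<close> is the universe in which the total spaces live.  As \<open>orbi_iso\<close> compares bundles
  with total spaces in different types, every bundle, whatever its type, has an isomorphism class in
  this universe (nonempty if \<open>'a\<close> has room for a total space, that is, if \<open>\<complex> \<times> \<complex>\<close> embeds in \<open>'a\<close>).\<close>

definition iso_class :: "'b orbi_bundle \<Rightarrow> 'a orbi_bundle set" where
  "iso_class L = {N. orbi_line_bundle N \<and> orbi_iso N L}"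

definition Pic :: "'a itself \<Rightarrow> 'a orbi_bundle set monoid" where
  "Pic _ =
     \<lparr>carrier = {L. orbi_line_bundle L} //
                 {(L, M). orbi_line_bundle L \<and> orbi_line_bundle M \<and> orbi_iso L M},
      mult = (\<lambda>A B. \<Union>L\<in>A. \<Union>M\<in>B. iso_class (tensor_bundle L M)),
      one = iso_class (weight_bundle 0)\<rparr>"

end

theory Submission
  imports Defs "HOL-Complex_Analysis.Conformal_Mappings"
begin

text \<open>Every bundle turns out to be isomorphic to some \<open>\<L>\<^sub>k\<close>, and \<open>\<L>\<^sub>k\<close> to depend, up to isomorphism, exactly on
  \<open>k\<close> modulo \<open>12\<close>; as \<open>\<L>\<^sub>k\<close> and \<open>\<L>\<^sub>l\<close> have tensor product \<open>\<L>\<^bsub>k+l\<^esub>\<close>, this is the assertion.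

  Two bundles \<open>\<L>\<^sub>k\<close> and \<open>\<L>\<^sub>l\<close> can only be isomorphic if the stabilisers of \<open>i\<close> and of
  \<open>\<rho> = exp (2 \<pi> i / 3)\<close> act in the same way on the fibres there.  The matrices \<open>mat_S\<close> and \<open>mat_U\<close>, of orders
  \<open>4\<close> and \<open>6\<close>, act on the fibres of \<open>\<L>\<^sub>k\<close> by \<open>i\<^sup>k\<close> and by the \<open>k\<close>-th power of a primitive sixth root of unity;
  so \<open>4\<close> and \<open>6\<close> divide \<open>k - l\<close> (\<open>orbi_iso_weights_cong\<close>).  Conversely the discriminant is a
  nowhere vanishing modular form of weight \<open>12\<close>, that is, an isomorphism between \<open>\<L>\<^sub>k\<close> and \<open>\<L>\<^bsub>k+12\<^esub>\<close>
  (\<open>framed_change_weight\<close>).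

  Now let \<open>L\<close> be any bundle.  The multiplicative Cousin problem is solvable on the upper half plane
  (\<open>cousin_half_plane\<close>), so that \<open>L\<close> has a global frame (\<open>global_frame_exists\<close>), and the action is given by a
  factor of automorphy, a holomorphic cocycle \<open>J \<gamma> \<tau>\<close>.  Its restrictions to the two stabilisers are
  characters agreeing on \<open>-1\<close>, and these are the characters of some weight \<open>k\<close> (\<open>root_of_unity_pairs\<close>).
  Dividing \<open>J\<close> by \<open>(c \<tau> + d)\<^sup>k\<close> leaves a factor that is trivial on all stabilisers, because all other points
  have the stabiliser \<open>{1, -1}\<close> or are equivalent to \<open>i\<close> or \<open>\<rho>\<close> (\<open>fixed_point_cases\<close>).  Such a factor is locally, over
  small discs in the quotient, the coboundary of a nonvanishing function \<open>u\<close>, and two choices of \<open>u\<close> differ by an invariant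
  function.  The modular invariant \<open>j\<close> identifies the quotient with the plane (\<open>jinv_surj\<close>, \<open>jinv_eqD\<close>,
  \<open>descend_along_jinv\<close>), so these invariant functions form transition functions on the plane, where the Cousin
  problem is solvable as well (\<open>cousin_plane\<close>).  Hence the factor is globally a coboundary
  (\<open>automorphy_factor_trivial\<close>), and \<open>L\<close> is isomorphic to \<open>\<L>\<^sub>k\<close>.

  The properties of \<open>j\<close> and of the discriminant rest on one fact, \<open>eisenstein_determine_lattice\<close>: the Eisenstein series
  of weights \<open>4\<close> and \<open>6\<close> determine the lattice.  They are the coefficients that enter the second-order
  differential equation of the \<open>\<wp>\<close>-function and its initial condition at the pole, hence they determine the \<open>\<wp>\<close>-function,
  whose poles are the lattice points.  This makes \<open>j\<close> injective on orbits, and it also prevents the discriminant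
  from vanishing.\<close>

section \<open>Cauchy integrals along an edge and entire approximation\<close>

text \<open>Differentiation under the integral sign, for the Cauchy kernel.\<close>

lemma holomorphic_on_Cauchy_segment:
  assumes "continuous_on (closed_segment a b) f"
  shows "(\<lambda>z. contour_integral (linepath a b) (\<lambda>w. f w / (w - z))) holomorphic_on - closed_segment a b"
proof -
  have "((\<lambda>z. contour_integral (linepath a b) (\<lambda>w. f w / (w - z))) has_field_derivative
      of_nat 1 * contour_integral (linepath a b) (\<lambda>u. f u / (u - z)^Suc 1)) (at z)"
    if z: "z \<in> - closed_segment a b" for z
  proof (rule Cauchy_next_derivative(2)[where S = UNIV and B = "norm (b - a)"])
    show "((\<lambda>u. f u / (u - w) ^ 1) has_contour_integral
        contour_integral (linepath a b) (\<lambda>u. f u / (u - w))) (linepath a b)"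
      if "w \<in> UNIV - path_image (linepath a b)" for w
    proof -
      have "(\<lambda>u. f u / (u - w)) contour_integrable_on linepath a b"
        using that by (intro contour_integrable_continuous_linepath continuous_intros assms) auto
      then show ?thesis
        by (simp add: has_contour_integral_integral)
    qed
  qed (use assms z in \<open>auto simp: vector_derivative_linepath_at valid_path_linepath\<close>)
  then show ?thesis
    unfolding holomorphic_on_def by (meson field_differentiable_at_within field_differentiable_def)
qed

text \<open>The Cauchy formula over the boundary of a rectangle slightly larger than the overlap gives the splitting: the integral over
  an edge is holomorphic off that edge, so that the four edges can be distributed over the two sides.\<close>

lemma split_across_vertical_edge:
  assumes f: "f holomorphic_on {z. x - \<epsilon> < Re z \<and> Re z < x + \<epsilon> \<and> c - \<epsilon> < Im z \<and> Im z < d + \<epsilon>}"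
    and \<eta>: "0 < \<eta>" "\<eta> < \<epsilon>" and cd: "c \<le> d"
  obtains F1 F2 where
    "F1 holomorphic_on {z. Re z < x + \<eta> \<and> c - \<eta> < Im z \<and> Im z < d + \<eta>}"
    "F2 holomorphic_on {z. x - \<eta> < Re z \<and> c - \<eta> < Im z \<and> Im z < d + \<eta>}"
    "\<And>z. x - \<eta> < Re z \<Longrightarrow> Re z < x + \<eta> \<Longrightarrow> c - \<eta> < Im z \<Longrightarrow> Im z < d + \<eta> \<Longrightarrow> f z = F1 z + F2 z"
proof -
  define a1 where "a1 = Complex (x - \<eta>) (c - \<eta>)"
  define a2 where "a2 = Complex (x + \<eta>) (c - \<eta>)"
  define a3 where "a3 = Complex (x + \<eta>) (d + \<eta>)"
  define a4 where "a4 = Complex (x - \<eta>) (d + \<eta>)"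
  note a = a1_def a2_def a3_def a4_def
  define Q where "Q = {z. x - \<epsilon> < Re z \<and> Re z < x + \<epsilon> \<and> c - \<epsilon> < Im z \<and> Im z < d + \<epsilon>}"
  have Q_alt: "Q = box (Complex (x - \<epsilon>) (c - \<epsilon>)) (Complex (x + \<epsilon>) (d + \<epsilon>))"
    by (auto simp: Q_def in_box_complex_iff)
  have contf: "continuous_on Q f"
    using f holomorphic_on_imp_continuous_on by (auto simp: Q_def)
  have convQ: "convex Q" "open Q"
    by (auto simp: Q_alt convex_box open_box)
  have inQ: "a1 \<in> Q" "a2 \<in> Q" "a3 \<in> Q" "a4 \<in> Q"
    using \<eta> cd by (auto simp: a Q_def)
  have segQ: "closed_segment u v \<subseteq> Q" if "u \<in> Q" "v \<in> Q" for u v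
    using that convQ by (simp add: closed_segment_subset)
  define I where "I u v z = contour_integral (linepath u v) (\<lambda>w. f w / (w - z))" for u v z
  have Ihol: "I u v holomorphic_on - closed_segment u v" if "u \<in> Q" "v \<in> Q" for u v
    unfolding I_def using segQ[OF that] contf
    by (intro holomorphic_on_Cauchy_segment) (auto intro: continuous_on_subset)
  have seg: "z \<in> closed_segment a1 a2 \<Longrightarrow> Im z = c - \<eta>"
      "z \<in> closed_segment a2 a3 \<Longrightarrow> Re z = x + \<eta>"
      "z \<in> closed_segment a3 a4 \<Longrightarrow> Im z = d + \<eta>"
      "z \<in> closed_segment a4 a1 \<Longrightarrow> Re z = x - \<eta>" for z
    by (auto simp: a closed_segment_same_Im closed_segment_same_Re)
  let ?k = "1 / (2 * of_real pi * \<i>)"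
  show ?thesis
  proof (rule that[of "\<lambda>z. ?k * (I a1 a2 z + I a2 a3 z + I a3 a4 z)" "\<lambda>z. ?k * I a4 a1 z"])
    show "(\<lambda>z. ?k * (I a1 a2 z + I a2 a3 z + I a3 a4 z)) holomorphic_on
        {z. Re z < x + \<eta> \<and> c - \<eta> < Im z \<and> Im z < d + \<eta>}"
      by (intro holomorphic_intros holomorphic_on_subset[OF Ihol] inQ) (auto dest: seg)
    show "(\<lambda>z. ?k * I a4 a1 z) holomorphic_on {z. x - \<eta> < Re z \<and> c - \<eta> < Im z \<and> Im z < d + \<eta>}"
      by (intro holomorphic_intros holomorphic_on_subset[OF Ihol] inQ) (auto dest: seg)
    show "f z = ?k * (I a1 a2 z + I a2 a3 z + I a3 a4 z) + ?k * I a4 a1 z"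
      if z: "x - \<eta> < Re z" "Re z < x + \<eta>" "c - \<eta> < Im z" "Im z < d + \<eta>" for z
    proof -
      have rect: "rectpath a1 a3 = linepath a1 a2 +++ linepath a2 a3 +++ linepath a3 a4 +++ linepath a4 a1"
        by (simp add: rectpath_def Let_def a)
      have notin: "z \<notin> closed_segment a1 a2" "z \<notin> closed_segment a2 a3"
        "z \<notin> closed_segment a3 a4" "z \<notin> closed_segment a4 a1"
        using seg[of z] z by auto
      have int: "((\<lambda>w. f w / (w - z)) has_contour_integral I u v z) (linepath u v)"
        if "u \<in> Q" "v \<in> Q" "z \<notin> closed_segment u v" for u v
        unfolding I_def
        by (intro has_contour_integral_integral contour_integrable_continuous_linepath continuous_intros
            continuous_on_subset[OF contf] segQ that) (use that in auto)
      have zQ: "z \<in> Q"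
        using z \<eta> by (auto simp: Q_def)
      have "((\<lambda>w. f w / (w - z)) has_contour_integral
          (I a1 a2 z + (I a2 a3 z + (I a3 a4 z + I a4 a1 z)))) (rectpath a1 a3)"
        unfolding rect by (intro has_contour_integral_join int inQ notin) auto
      moreover have "((\<lambda>w. f w / (w - z)) has_contour_integral
          (2 * pi * \<i> * winding_number (rectpath a1 a3) z * f z)) (rectpath a1 a3)"
      proof (rule Cauchy_integral_formula_convex_simple[where S = Q])
        show "path_image (rectpath a1 a3) \<subseteq> Q - {z}"
          unfolding rect using notin segQ inQ by (auto simp: path_image_join)
      qed (use convQ f zQ in \<open>auto simp: Q_def interior_open\<close>)
      moreover have "winding_number (rectpath a1 a3) z = 1"
        by (rule winding_number_rectpath) (use z in \<open>auto simp: a in_box_complex_iff\<close>)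
      ultimately have "I a1 a2 z + (I a2 a3 z + (I a3 a4 z + I a4 a1 z)) = 2 * pi * \<i> * f z"
        using has_contour_integral_unique by fastforce
      then have "f z = ?k * (I a1 a2 z + (I a2 a3 z + (I a3 a4 z + I a4 a1 z)))"
        by simp
      then show ?thesis
        by (simp only: distrib_left add.assoc)
    qed
  qed
qed

text \<open>Rotation by a right angle reduces this to vertical edges.\<close>

lemma split_across_horizontal_edge:
  assumes f: "f holomorphic_on {z. y - \<epsilon> < Im z \<and> Im z < y + \<epsilon> \<and> a - \<epsilon> < Re z \<and> Re z < b + \<epsilon>}"
    and \<eta>: "0 < \<eta>" "\<eta> < \<epsilon>" and ab: "a \<le> b"
  obtains F1 F2 where
    "F1 holomorphic_on {z. Im z < y + \<eta> \<and> a - \<eta> < Re z \<and> Re z < b + \<eta>}"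
    "F2 holomorphic_on {z. y - \<eta> < Im z \<and> a - \<eta> < Re z \<and> Re z < b + \<eta>}"
    "\<And>z. y - \<eta> < Im z \<Longrightarrow> Im z < y + \<eta> \<Longrightarrow> a - \<eta> < Re z \<Longrightarrow> Re z < b + \<eta> \<Longrightarrow> f z = F1 z + F2 z"
proof -
  have hol: "(f \<circ> (*) \<i>) holomorphic_on
      {z. y - \<epsilon> < Re z \<and> Re z < y + \<epsilon> \<and> - b - \<epsilon> < Im z \<and> Im z < - a + \<epsilon>}"
    by (intro holomorphic_on_compose_gen[OF _ f] holomorphic_intros) auto
  have "- b \<le> - a"
    using ab by simp
  from split_across_vertical_edge[OF hol \<eta> this] obtain F1 F2 where
    F1: "F1 holomorphic_on {z. Re z < y + \<eta> \<and> - b - \<eta> < Im z \<and> Im z < - a + \<eta>}"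
    and F2: "F2 holomorphic_on {z. y - \<eta> < Re z \<and> - b - \<eta> < Im z \<and> Im z < - a + \<eta>}"
    and eq: "\<And>z. y - \<eta> < Re z \<Longrightarrow> Re z < y + \<eta> \<Longrightarrow> - b - \<eta> < Im z \<Longrightarrow> Im z < - a + \<eta> \<Longrightarrow>
      (f \<circ> (*) \<i>) z = F1 z + F2 z"
    by blast
  show ?thesis
  proof (rule that[of "F1 \<circ> (*) (- \<i>)" "F2 \<circ> (*) (- \<i>)"])
    show "(F1 \<circ> (*) (- \<i>)) holomorphic_on {z. Im z < y + \<eta> \<and> a - \<eta> < Re z \<and> Re z < b + \<eta>}"
      by (intro holomorphic_on_compose_gen[OF _ F1] holomorphic_intros) auto
    show "(F2 \<circ> (*) (- \<i>)) holomorphic_on {z. y - \<eta> < Im z \<and> a - \<eta> < Re z \<and> Re z < b + \<eta>}"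
      by (intro holomorphic_on_compose_gen[OF _ F2] holomorphic_intros) auto
    show "f z = (F1 \<circ> (*) (- \<i>)) z + (F2 \<circ> (*) (- \<i>)) z"
      if "y - \<eta> < Im z" "Im z < y + \<eta>" "a - \<eta> < Re z" "Re z < b + \<eta>" for z
      using eq[of "- \<i> * z"] that by (simp add: algebra_simps)
  qed
qed

text \<open>The Taylor polynomials of \<open>f\<close> converge uniformly on every smaller concentric disc.\<close>

lemma entire_approximation_on_disc:
  assumes f: "f holomorphic_on ball z r" and K: "compact K" "K \<subseteq> ball z r" and e: "e > 0"
  obtains p where "p holomorphic_on UNIV" "\<And>x. x \<in> K \<Longrightarrow> norm (f x - p x) < e"
proof -
  consider \<rho> where "0 < \<rho>" "\<rho> < r" "K \<subseteq> cball z \<rho>" | "K = {}"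
  proof (cases "K = {}")
    case False
    have "continuous_on K (dist z)"
      by (intro continuous_intros)
    then obtain x where x: "x \<in> K" "\<And>y. y \<in> K \<Longrightarrow> dist z y \<le> dist z x"
      using continuous_attains_sup[OF K(1) False] by blast
    have "dist z x < r"
      using x K by auto
    moreover have "0 < r"
      using \<open>dist z x < r\<close> zero_le_dist[of z x] by linarith
    then have "0 < (dist z x + r) / 2"
      by (simp add: add_nonneg_pos)
    moreover have "(dist z x + r) / 2 < r"
      using \<open>dist z x < r\<close> by simp
    moreover have "K \<subseteq> cball z ((dist z x + r) / 2)"
      using x(2) \<open>dist z x < r\<close> by force
    ultimately show ?thesis
      using that(1) by blast
  next
    case True
    then show ?thesis
      using that(2) by blast
  qed
  then show ?thesis
  proof cases
    case 1
    define a where "a n = (deriv ^^ n) f z / fact n" for n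
    have sums: "(\<lambda>n. a n * (w - z) ^ n) sums f w" if "w \<in> ball z r" for w
      unfolding a_def using holomorphic_power_series[OF f that] .
    define \<sigma> where "\<sigma> = (\<rho> + r) / 2"
    have \<sigma>: "\<rho> < \<sigma>" "\<sigma> < r" using 1 by (auto simp: \<sigma>_def)
    have "summable (\<lambda>n. a n * of_real \<sigma> ^ n)"
      using sums[of "z + of_real \<sigma>"] \<sigma> 1 by (auto simp: dist_norm sums_iff)
    then have "summable (\<lambda>n. norm (a n * of_real \<rho> ^ n))"
      by (rule powser_insidea) (use \<sigma> 1 in auto)
    then have "uniform_limit (cball z \<rho>) (\<lambda>n x. \<Sum>i<n. a i * (x - z) ^ i) (\<lambda>x. \<Sum>i. a i * (x - z) ^ i) sequentially"
    proof (rule Weierstrass_m_test[rotated])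
      show "norm (a n * (x - z) ^ n) \<le> norm (a n * complex_of_real \<rho> ^ n)" if "x \<in> cball z \<rho>" for n x
        using that 1 unfolding norm_mult norm_power
        by (intro mult_left_mono power_mono) (auto simp: dist_norm norm_minus_commute)
    qed
    then have "\<forall>\<^sub>F n in sequentially. \<forall>x\<in>cball z \<rho>. dist (\<Sum>i<n. a i * (x - z) ^ i) (\<Sum>i. a i * (x - z) ^ i) < e"
      using e by (auto simp: uniform_limit_iff)
    then obtain n where n: "\<And>x. x \<in> cball z \<rho> \<Longrightarrow> dist (\<Sum>i<n. a i * (x - z) ^ i) (\<Sum>i. a i * (x - z) ^ i) < e"
      unfolding eventually_sequentially by blast
    show ?thesis
    proof (rule that[of "\<lambda>x. \<Sum>i<n. a i * (x - z) ^ i"])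
      show "(\<lambda>x. \<Sum>i<n. a i * (x - z) ^ i) holomorphic_on UNIV"
        by (intro holomorphic_intros)
      show "norm (f x - (\<Sum>i<n. a i * (x - z) ^ i)) < e" if "x \<in> K" for x
      proof -
        have "x \<in> cball z \<rho>" "x \<in> ball z r"
          using that 1 K by auto
        then show ?thesis
          using n[of x] sums_unique[OF sums[of x]] by (metis dist_commute dist_norm)
      qed
    qed
  next
    case 2
    then show ?thesis using that[of "\<lambda>_. 0"] by auto
  qed
qed

section \<open>The multiplicative Cousin problem on rectangles\<close>

definition rect :: "real \<Rightarrow> real \<Rightarrow> real \<Rightarrow> real \<Rightarrow> complex set" where
  "rect a b c d = {z. a \<le> Re z \<and> Re z \<le> b \<and> c \<le> Im z \<and> Im z \<le> d}"

lemma rect_eq_cbox: "rect a b c d = cbox (Complex a c) (Complex b d)"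
  by (auto simp: rect_def in_cbox_complex_iff)

lemma open_rect_neighbourhood:
  assumes V: "open V" "rect a b c d \<subseteq> V" and ab: "a \<le> b" "c \<le> d"
  obtains \<epsilon> where "\<epsilon> > 0" "{z. a - \<epsilon> < Re z \<and> Re z < b + \<epsilon> \<and> c - \<epsilon> < Im z \<and> Im z < d + \<epsilon>} \<subseteq> V"
proof -
  have "compact (rect a b c d)"
    by (simp add: rect_eq_cbox compact_cbox)
  then obtain e where e: "e > 0" "(\<Union>x\<in>rect a b c d. ball x e) \<subseteq> V"
    using compact_subset_open_imp_ball_epsilon_subset[of "rect a b c d" V] V by blast
  show ?thesis
  proof (rule that[of "e / 2"])
    show "{z. a - e / 2 < Re z \<and> Re z < b + e / 2 \<and> c - e / 2 < Im z \<and> Im z < d + e / 2} \<subseteq> V"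
    proof
      fix z assume z: "z \<in> {z. a - e / 2 < Re z \<and> Re z < b + e / 2 \<and> c - e / 2 < Im z \<and> Im z < d + e / 2}"
      define w where "w = Complex (max a (min b (Re z))) (max c (min d (Im z)))"
      have "w \<in> rect a b c d"
        using ab by (auto simp: w_def rect_def)
      moreover have "norm (w - z) < e"
      proof -
        have clamp: "\<bar>max l (min u t) - t\<bar> < e / 2" if "l \<le> u" "l - e / 2 < t" "t < u + e / 2" for l u t :: real
          using that e(1) by linarith
        have "\<bar>Re (w - z)\<bar> < e / 2" "\<bar>Im (w - z)\<bar> < e / 2"
          using z clamp[OF ab(1), of "Re z"] clamp[OF ab(2), of "Im z"] by (simp_all add: w_def)
        then show ?thesis
          using cmod_le[of "w - z"] by linarith
      qed
      ultimately have "w \<in> rect a b c d" "z \<in> ball w e"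
        by (auto simp: dist_norm)
      then show "z \<in> V"
        using e(2) by blast
    qed
  qed (use e in auto)
qed

text \<open>A holomorphic line bundle on an open set, given by its transition functions.\<close>

locale multiplicative_cocycle =
  fixes D :: "complex set" and U :: "'i \<Rightarrow> complex set" and g :: "'i \<Rightarrow> 'i \<Rightarrow> complex \<Rightarrow> complex"
  assumes open_D: "open D"
    and open_U: "open (U i)"
    and cover: "D \<subseteq> (\<Union>i. U i)"
    and hol_g: "g i j holomorphic_on U i \<inter> U j"
    and g_nonzero: "z \<in> U i \<Longrightarrow> z \<in> U j \<Longrightarrow> g i j z \<noteq> 0"
    and g_mult: "z \<in> U i \<Longrightarrow> z \<in> U j \<Longrightarrow> z \<in> U k \<Longrightarrow> g i j z * g j k z = g i k z"
begin

text \<open>A trivialisation over \<open>V\<close>: its coordinates with respect to the given cover.\<close>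

definition splits_on :: "complex set \<Rightarrow> ('i \<Rightarrow> complex \<Rightarrow> complex) \<Rightarrow> bool" where
  "splits_on V h \<longleftrightarrow> open V \<and> V \<subseteq> D \<and>
     (\<forall>i. h i holomorphic_on U i \<inter> V) \<and>
     (\<forall>i. \<forall>z\<in>U i \<inter> V. h i z \<noteq> 0) \<and>
     (\<forall>i j. \<forall>z\<in>U i \<inter> U j \<inter> V. h i z = g i j z * h j z)"

text \<open>Trivialisations over a neighbourhood of a closed rectangle are what can be glued along a
  common edge, since splitting a function across the edge loses a little room.\<close>

definition splits_near :: "complex set \<Rightarrow> bool" where
  "splits_near K \<longleftrightarrow> (\<exists>V h. K \<subseteq> V \<and> splits_on V h)"

lemma splits_nearE:
  assumes "splits_near K"
  obtains V h where "K \<subseteq> V" "splits_on V h"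
  using assms unfolding splits_near_def by blast

lemma splits_nearI: "K \<subseteq> V \<Longrightarrow> splits_on V h \<Longrightarrow> splits_near K"
  unfolding splits_near_def by blast

lemma splits_onD:
  assumes "splits_on V h"
  shows "open V" "V \<subseteq> D" "h i holomorphic_on U i \<inter> V"
    "z \<in> U i \<Longrightarrow> z \<in> V \<Longrightarrow> h i z \<noteq> 0"
    "z \<in> U i \<Longrightarrow> z \<in> U j \<Longrightarrow> z \<in> V \<Longrightarrow> h i z = g i j z * h j z"
  using assms unfolding splits_on_def by blast+

lemma covered: "z \<in> D \<Longrightarrow> \<exists>i. z \<in> U i"
  using cover by blast

lemma splits_on_subset:
  assumes "splits_on V h" "open W" "W \<subseteq> V"
  shows "splits_on W h"
  unfolding splits_on_def
proof (intro conjI allI ballI)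
  show "h i holomorphic_on U i \<inter> W" for i
    by (rule holomorphic_on_subset[OF splits_onD(3)[OF assms(1)]]) (use assms(3) in blast)
  show "h i z = g i j z * h j z" if "z \<in> U i \<inter> U j \<inter> W" for i j z
    by (rule splits_onD(5)[OF assms(1)]) (use that assms(3) in blast)+
qed (use assms splits_onD(2,4)[OF assms(1)] in blast)+

lemma splits_near_mono: "splits_near K \<Longrightarrow> L \<subseteq> K \<Longrightarrow> splits_near L"
  unfolding splits_near_def by blast

lemma splits_locally:
  assumes "x \<in> D" shows "splits_near {x}"
proof -
  obtain i where i: "x \<in> U i"
    using cover assms by auto
  have "splits_on (U i \<inter> D) (\<lambda>j. g j i)"
    unfolding splits_on_def
  proof (intro conjI allI ballI)
    show "g j i holomorphic_on U j \<inter> (U i \<inter> D)" for j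
      by (rule holomorphic_on_subset[OF hol_g]) blast
    show "g j i z = g j k z * g k i z" if "z \<in> U j \<inter> U k \<inter> (U i \<inter> D)" for j k z
      by (rule g_mult[symmetric]) (use that in blast)+
  qed (use open_U open_D g_nonzero in blast)+
  then show ?thesis
    unfolding splits_near_def using i assms by blast
qed

text \<open>Two trivialisations over the same set differ by a nonvanishing holomorphic function.\<close>

lemma splits_ratio:
  assumes h: "splits_on V h" and h': "splits_on V h'"
  obtains q where "q holomorphic_on V" "\<And>z. z \<in> V \<Longrightarrow> q z \<noteq> 0"
    "\<And>i z. z \<in> U i \<Longrightarrow> z \<in> V \<Longrightarrow> h i z = q z * h' i z"
proof -
  define q where "q z = (let i = SOME i. z \<in> U i in h i z / h' i z)" for z
  have q: "q z = h i z / h' i z" if "z \<in> U i" "z \<in> V" for z i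
  proof -
    define j where "j = (SOME i. z \<in> U i)"
    have j: "z \<in> U j"
      unfolding j_def by (rule someI[of "\<lambda>i. z \<in> U i", OF that(1)])
    have "q z = h j z / h' j z"
      by (simp add: q_def j_def Let_def)
    also have "\<dots> = (g j i z * h i z) / (g j i z * h' i z)"
      using splits_onD(5)[OF h j that] splits_onD(5)[OF h' j that] by simp
    finally show ?thesis
      using g_nonzero[OF j that(1)] by simp
  qed
  note VD = splits_onD(1,2)[OF h]
  show ?thesis
  proof (rule that[of q])
    show "q z \<noteq> 0" if zV: "z \<in> V" for z
    proof -
      obtain i where "z \<in> U i" using covered VD(2) zV by blast
      then show ?thesis
        using q zV splits_onD(4)[OF h] splits_onD(4)[OF h'] by simp
    qed
    show "h i z = q z * h' i z" if "z \<in> U i" "z \<in> V" for i z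
      using q that splits_onD(4)[OF h'] by simp
    show "q holomorphic_on V"
    proof -
      have "q holomorphic_on (\<Union>i. U i \<inter> V)"
      proof (rule holomorphic_on_UN_open)
        fix i
        have "(\<lambda>z. h i z / h' i z) holomorphic_on U i \<inter> V"
          using splits_onD(3,4)[OF h'] splits_onD(3)[OF h] by (intro holomorphic_intros) auto
        then show "q holomorphic_on U i \<inter> V"
          by (rule holomorphic_transform) (metis IntD1 IntD2 q)
      qed (use open_U VD in auto)
      then show ?thesis
        by (rule holomorphic_on_subset) (use covered VD(2) in blast)
    qed
  qed
qed

lemma splits_on_mult:
  assumes h: "splits_on V h" and q: "q holomorphic_on V" "\<And>z. z \<in> V \<Longrightarrow> q z \<noteq> 0"
  shows "splits_on V (\<lambda>i z. q z * h i z)"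
  unfolding splits_on_def
proof (intro conjI allI ballI)
  show "(\<lambda>z. q z * h i z) holomorphic_on U i \<inter> V" for i
    by (intro holomorphic_intros splits_onD(3)[OF h] holomorphic_on_subset[OF q(1)]) auto
  show "q z * h i z = g i j z * (q z * h j z)" if "z \<in> U i \<inter> U j \<inter> V" for i j z
    using splits_onD(5)[OF h, of z i j] that by simp
  show "q z * h i z \<noteq> 0" if "z \<in> U i \<inter> V" for i z
    using splits_onD(4)[OF h] q(2) that by simp
qed (use splits_onD(1,2)[OF h] in auto)

lemma splits_on_union:
  assumes h1: "splits_on V h1" and h2: "splits_on W h2"
    and eq: "\<And>i z. z \<in> U i \<Longrightarrow> z \<in> V \<Longrightarrow> z \<in> W \<Longrightarrow> h1 i z = h2 i z"
  shows "splits_on (V \<union> W) (\<lambda>i z. if z \<in> V then h1 i z else h2 i z)"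
  unfolding splits_on_def
proof (intro conjI allI ballI)
  fix i
  let ?h = "\<lambda>z. if z \<in> V then h1 i z else h2 i z"
  have "?h holomorphic_on (U i \<inter> V) \<union> (U i \<inter> W)"
  proof (rule holomorphic_on_Un)
    show "?h holomorphic_on U i \<inter> V"
      by (rule holomorphic_transform[OF splits_onD(3)[OF h1]]) auto
    show "?h holomorphic_on U i \<inter> W"
      by (rule holomorphic_transform[OF splits_onD(3)[OF h2]]) (use eq in auto)
  qed (use open_U splits_onD(1)[OF h1] splits_onD(1)[OF h2] in auto)
  then show "?h holomorphic_on U i \<inter> (V \<union> W)"
    by (simp add: Int_Un_distrib)
next
  fix i j z assume "z \<in> U i \<inter> U j \<inter> (V \<union> W)"
  then show "(if z \<in> V then h1 i z else h2 i z) = g i j z * (if z \<in> V then h1 j z else h2 j z)"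
    using splits_onD(5)[OF h1, of z i j] splits_onD(5)[OF h2, of z i j] by auto
next
  fix i z assume "z \<in> U i \<inter> (V \<union> W)"
  then show "(if z \<in> V then h1 i z else h2 i z) \<noteq> 0"
    using splits_onD(4)[OF h1] splits_onD(4)[OF h2] by auto
qed (use splits_onD(1,2)[OF h1] splits_onD(1,2)[OF h2] in auto)

text \<open>The transition function between two trivialisations on a convex overlap has a logarithm;
  an additive splitting of the logarithm makes the two trivialisations agree.\<close>

lemma splits_on_glue:
  assumes h1: "splits_on V1 h1" and h2: "splits_on V2 h2"
    and W: "open W1" "W1 \<subseteq> V1" "open W2" "W2 \<subseteq> V2"
    and Q: "open Q" "convex Q" "Q \<noteq> {}" "Q \<subseteq> V1 \<inter> V2" "W1 \<inter> W2 \<subseteq> Q"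
    and split: "\<And>f. f holomorphic_on Q \<Longrightarrow> \<exists>F1 F2. F1 holomorphic_on W1 \<and> F2 holomorphic_on W2 \<and>
      (\<forall>z\<in>W1 \<inter> W2. f z = F1 z + F2 z)"
  shows "\<exists>h. splits_on (W1 \<union> W2) h"
proof -
  have hQ: "splits_on Q h1" "splits_on Q h2"
    using Q by (auto intro: splits_on_subset[OF h1] splits_on_subset[OF h2])
  obtain q where q: "q holomorphic_on Q" "\<And>z. z \<in> Q \<Longrightarrow> q z \<noteq> 0"
    "\<And>i z. z \<in> U i \<Longrightarrow> z \<in> Q \<Longrightarrow> h1 i z = q z * h2 i z"
    using splits_ratio[OF hQ] by metis
  obtain z0 where "z0 \<in> Q" using Q by auto
  obtain f where f: "f holomorphic_on Q" "\<And>z. z \<in> Q \<Longrightarrow> exp (f z) = q z"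
    using holomorphic_logarithm_exists[OF Q(2,1) q(1,2) \<open>z0 \<in> Q\<close>] by metis
  obtain F1 F2 where F: "F1 holomorphic_on W1" "F2 holomorphic_on W2"
    "\<And>z. z \<in> W1 \<inter> W2 \<Longrightarrow> f z = F1 z + F2 z"
    using split[OF f(1)] by blast
  have "splits_on (W1 \<union> W2) (\<lambda>i z. if z \<in> W1 then exp (- F1 z) * h1 i z else exp (F2 z) * h2 i z)"
  proof (rule splits_on_union)
    show "splits_on W1 (\<lambda>i z. exp (- F1 z) * h1 i z)"
      by (intro splits_on_mult splits_on_subset[OF h1] W holomorphic_intros F) auto
    show "splits_on W2 (\<lambda>i z. exp (F2 z) * h2 i z)"
      by (intro splits_on_mult splits_on_subset[OF h2] W holomorphic_intros F) auto
    show "exp (- F1 z) * h1 i z = exp (F2 z) * h2 i z" if "z \<in> U i" "z \<in> W1" "z \<in> W2" for i z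
    proof -
      have "z \<in> Q" using that Q by auto
      then have "h1 i z = exp (F1 z + F2 z) * h2 i z"
        using q(3)[OF that(1)] f(2)[of z] F(3)[of z] that by simp
      then show ?thesis
        by (simp add: exp_add exp_minus mult.assoc[symmetric])
    qed
  qed
  then show ?thesis by blast
qed

lemma splits_near_rect_glue_vertical:
  assumes "splits_near (rect a b c d)" "splits_near (rect b b' c d)" "a \<le> b" "b \<le> b'" "c \<le> d"
  shows "splits_near (rect a b' c d)"
proof -
  obtain V1 h1 where V1: "rect a b c d \<subseteq> V1" "splits_on V1 h1"
    using assms(1) unfolding splits_near_def by blast
  obtain V2 h2 where V2: "rect b b' c d \<subseteq> V2" "splits_on V2 h2"
    using assms(2) unfolding splits_near_def by blast
  have op: "open V1" "open V2"
    using splits_onD(1) V1 V2 by blast+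
  have "rect b b c d \<subseteq> rect a b c d" "rect b b c d \<subseteq> rect b b' c d"
    using assms by (auto simp: rect_def)
  then have "rect b b c d \<subseteq> V1 \<inter> V2"
    using V1(1) V2(1) by blast
  then obtain \<epsilon> where \<epsilon>: "\<epsilon> > 0"
    "{z. b - \<epsilon> < Re z \<and> Re z < b + \<epsilon> \<and> c - \<epsilon> < Im z \<and> Im z < d + \<epsilon>} \<subseteq> V1 \<inter> V2"
    using open_rect_neighbourhood[of "V1 \<inter> V2" b b c d] op assms by blast
  define Q where "Q = {z. b - \<epsilon> < Re z \<and> Re z < b + \<epsilon> \<and> c - \<epsilon> < Im z \<and> Im z < d + \<epsilon>}"
  have Q_box: "Q = box (Complex (b - \<epsilon>) (c - \<epsilon>)) (Complex (b + \<epsilon>) (d + \<epsilon>))"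
    by (auto simp: Q_def in_box_complex_iff)
  define \<eta> where "\<eta> = \<epsilon> / 2"
  have \<eta>: "0 < \<eta>" "\<eta> < \<epsilon>"
    using \<epsilon> by (auto simp: \<eta>_def)
  define S1 where "S1 = {z. Re z < b + \<eta> \<and> c - \<eta> < Im z \<and> Im z < d + \<eta>}"
  define S2 where "S2 = {z. b - \<eta> < Re z \<and> c - \<eta> < Im z \<and> Im z < d + \<eta>}"
  have opS: "open S1" "open S2"
    unfolding S1_def S2_def by (intro open_Collect_conj open_Collect_less continuous_intros)+
  have "\<exists>h. splits_on ((V1 \<inter> S1) \<union> (V2 \<inter> S2)) h"
  proof (rule splits_on_glue[OF V1(2) V2(2)])
    have "Complex b c \<in> Q"
      using \<epsilon>(1) assms by (auto simp: Q_def)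
    then show "Q \<noteq> {}" by blast
    show "V1 \<inter> S1 \<inter> (V2 \<inter> S2) \<subseteq> Q"
      using \<eta> by (auto simp: Q_def S1_def S2_def)
    fix f assume "f holomorphic_on Q"
    from split_across_vertical_edge[OF this[unfolded Q_def] \<eta> \<open>c \<le> d\<close>] obtain F1 F2 where F:
      "F1 holomorphic_on S1" "F2 holomorphic_on S2"
      "\<And>z. b - \<eta> < Re z \<Longrightarrow> Re z < b + \<eta> \<Longrightarrow> c - \<eta> < Im z \<Longrightarrow> Im z < d + \<eta> \<Longrightarrow> f z = F1 z + F2 z"
      unfolding S1_def S2_def by blast
    have "F1 holomorphic_on V1 \<inter> S1" "F2 holomorphic_on V2 \<inter> S2"
      using F by (auto intro: holomorphic_on_subset)
    moreover have "\<forall>z\<in>V1 \<inter> S1 \<inter> (V2 \<inter> S2). f z = F1 z + F2 z"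
      using F(3) by (auto simp: S1_def S2_def)
    ultimately show "\<exists>F1 F2. F1 holomorphic_on V1 \<inter> S1 \<and> F2 holomorphic_on V2 \<inter> S2 \<and>
        (\<forall>z\<in>V1 \<inter> S1 \<inter> (V2 \<inter> S2). f z = F1 z + F2 z)"
      by blast
  qed (use \<epsilon>(2) op opS in \<open>auto simp: Q_box convex_box open_box in_box_complex_iff\<close>)
  moreover have "rect a b' c d \<subseteq> (V1 \<inter> S1) \<union> (V2 \<inter> S2)"
  proof
    fix z assume z: "z \<in> rect a b' c d"
    show "z \<in> (V1 \<inter> S1) \<union> (V2 \<inter> S2)"
    proof (cases "Re z \<le> b")
      case True
      then have "z \<in> rect a b c d" "z \<in> S1"
        using z \<eta> by (auto simp: rect_def S1_def)
      then show ?thesis using V1(1) by blast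
    next
      case False
      then have "z \<in> rect b b' c d" "z \<in> S2"
        using z \<eta> by (auto simp: rect_def S2_def)
      then show ?thesis using V2(1) by blast
    qed
  qed
  ultimately show ?thesis
    unfolding splits_near_def by blast
qed

lemma splits_near_rect_glue_horizontal:
  assumes "splits_near (rect a b c d)" "splits_near (rect a b d d')" "a \<le> b" "c \<le> d" "d \<le> d'"
  shows "splits_near (rect a b c d')"
proof -
  obtain V1 h1 where V1: "rect a b c d \<subseteq> V1" "splits_on V1 h1"
    using assms(1) unfolding splits_near_def by blast
  obtain V2 h2 where V2: "rect a b d d' \<subseteq> V2" "splits_on V2 h2"
    using assms(2) unfolding splits_near_def by blast
  have op: "open V1" "open V2"
    using splits_onD(1) V1 V2 by blast+
  have "rect a b d d \<subseteq> rect a b c d" "rect a b d d \<subseteq> rect a b d d'"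
    using assms by (auto simp: rect_def)
  then have "rect a b d d \<subseteq> V1 \<inter> V2"
    using V1(1) V2(1) by blast
  then obtain \<epsilon> where \<epsilon>: "\<epsilon> > 0"
    "{z. a - \<epsilon> < Re z \<and> Re z < b + \<epsilon> \<and> d - \<epsilon> < Im z \<and> Im z < d + \<epsilon>} \<subseteq> V1 \<inter> V2"
    using open_rect_neighbourhood[of "V1 \<inter> V2" a b d d] op assms by blast
  define Q where "Q = {z. d - \<epsilon> < Im z \<and> Im z < d + \<epsilon> \<and> a - \<epsilon> < Re z \<and> Re z < b + \<epsilon>}"
  have Q_box: "Q = box (Complex (a - \<epsilon>) (d - \<epsilon>)) (Complex (b + \<epsilon>) (d + \<epsilon>))"
    by (auto simp: Q_def in_box_complex_iff)
  define \<eta> where "\<eta> = \<epsilon> / 2"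
  have \<eta>: "0 < \<eta>" "\<eta> < \<epsilon>"
    using \<epsilon> by (auto simp: \<eta>_def)
  define S1 where "S1 = {z. Im z < d + \<eta> \<and> a - \<eta> < Re z \<and> Re z < b + \<eta>}"
  define S2 where "S2 = {z. d - \<eta> < Im z \<and> a - \<eta> < Re z \<and> Re z < b + \<eta>}"
  have opS: "open S1" "open S2"
    unfolding S1_def S2_def by (intro open_Collect_conj open_Collect_less continuous_intros)+
  have "\<exists>h. splits_on ((V1 \<inter> S1) \<union> (V2 \<inter> S2)) h"
  proof (rule splits_on_glue[OF V1(2) V2(2)])
    have "Complex a d \<in> Q"
      using \<epsilon>(1) assms by (auto simp: Q_def)
    then show "Q \<noteq> {}" by blast
    show "V1 \<inter> S1 \<inter> (V2 \<inter> S2) \<subseteq> Q"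
      using \<eta> by (auto simp: Q_def S1_def S2_def)
    fix f assume "f holomorphic_on Q"
    from split_across_horizontal_edge[OF this[unfolded Q_def] \<eta> \<open>a \<le> b\<close>] obtain F1 F2 where F:
      "F1 holomorphic_on S1" "F2 holomorphic_on S2"
      "\<And>z. d - \<eta> < Im z \<Longrightarrow> Im z < d + \<eta> \<Longrightarrow> a - \<eta> < Re z \<Longrightarrow> Re z < b + \<eta> \<Longrightarrow> f z = F1 z + F2 z"
      unfolding S1_def S2_def by blast
    have "F1 holomorphic_on V1 \<inter> S1" "F2 holomorphic_on V2 \<inter> S2"
      using F by (auto intro: holomorphic_on_subset)
    moreover have "\<forall>z\<in>V1 \<inter> S1 \<inter> (V2 \<inter> S2). f z = F1 z + F2 z"
      using F(3) by (auto simp: S1_def S2_def)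
    ultimately show "\<exists>F1 F2. F1 holomorphic_on V1 \<inter> S1 \<and> F2 holomorphic_on V2 \<inter> S2 \<and>
        (\<forall>z\<in>V1 \<inter> S1 \<inter> (V2 \<inter> S2). f z = F1 z + F2 z)"
      by blast
  qed (use \<epsilon>(2) op opS in \<open>auto simp: Q_box convex_box open_box in_box_complex_iff\<close>)
  moreover have "rect a b c d' \<subseteq> (V1 \<inter> S1) \<union> (V2 \<inter> S2)"
  proof
    fix z assume z: "z \<in> rect a b c d'"
    show "z \<in> (V1 \<inter> S1) \<union> (V2 \<inter> S2)"
    proof (cases "Im z \<le> d")
      case True
      then have "z \<in> rect a b c d" "z \<in> S1"
        using z \<eta> by (auto simp: rect_def S1_def)
      then show ?thesis using V1(1) by blast
    next
      case False
      then have "z \<in> rect a b d d'" "z \<in> S2"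
        using z \<eta> by (auto simp: rect_def S2_def)
      then show ?thesis using V2(1) by blast
    qed
  qed
  ultimately show ?thesis
    unfolding splits_near_def by blast
qed

text \<open>Bisection in both directions: a rectangle is split into rectangles so small that each lies in a
  member of the cover, and neighbouring rectangles are glued along their common edges.\<close>

lemma splits_near_rect:
  assumes D: "rect a b c d \<subseteq> D" and ab: "a \<le> b" "c \<le> d"
  shows "splits_near (rect a b c d)"
proof -
  have strip: "\<exists>\<epsilon>>0. splits_near (rect a b (y - \<epsilon>) (y + \<epsilon>))" if y: "c \<le> y" "y \<le> d" for y
    using \<open>a \<le> b\<close>
  proof (induction a b rule: Bolzano)
    case (trans a' b' c')
    obtain e1 where e1: "e1 > 0" "splits_near (rect a' b' (y - e1) (y + e1))"
      using trans(1) by metis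
    obtain e2 where e2: "e2 > 0" "splits_near (rect b' c' (y - e2) (y + e2))"
      using trans(2) by metis
    define e where "e = min e1 e2"
    have e: "e > 0" "e \<le> e1" "e \<le> e2"
      using e1 e2 by (auto simp: e_def)
    have 1: "splits_near (rect a' b' (y - e) (y + e))"
      by (rule splits_near_mono[OF e1(2)]) (use e in \<open>auto simp: rect_def\<close>)
    have 2: "splits_near (rect b' c' (y - e) (y + e))"
      by (rule splits_near_mono[OF e2(2)]) (use e in \<open>auto simp: rect_def\<close>)
    have "y - e \<le> y + e"
      using e(1) by simp
    from splits_near_rect_glue_vertical[OF 1 2 trans(3,4) this] e(1) show ?case
      by metis
  next
    case (local x)
    have "Complex x y \<in> D"
      using D local y by (auto simp: rect_def)
    obtain V h where V: "{Complex x y} \<subseteq> V" "splits_on V h"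
      by (rule splits_nearE[OF splits_locally[OF \<open>Complex x y \<in> D\<close>]])
    have "rect x x y y = {Complex x y}"
      by (auto simp: rect_def complex_eq_iff)
    then have rV: "rect x x y y \<subseteq> V"
      using V(1) by simp
    obtain e where e: "e > 0" "{z. x - e < Re z \<and> Re z < x + e \<and> y - e < Im z \<and> Im z < y + e} \<subseteq> V"
      by (rule open_rect_neighbourhood[OF splits_onD(1)[OF V(2)] rV order_refl order_refl])
    have "splits_near (rect a' b' (y - e / 2) (y + e / 2))" if "a' \<le> x \<and> x \<le> b' \<and> b' - a' < e" for a' b'
    proof -
      have "rect a' b' (y - e / 2) (y + e / 2) \<subseteq>
          {z. x - e < Re z \<and> Re z < x + e \<and> y - e < Im z \<and> Im z < y + e}"
        using that e(1) by (auto simp: rect_def)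
      then show ?thesis
        using splits_nearI[OF _ V(2)] e(2) by (meson order_trans)
    qed
    then have "\<forall>a' b'. a' \<le> x \<and> x \<le> b' \<and> b' - a' < e \<longrightarrow>
        (\<exists>\<epsilon>>0. splits_near (rect a' b' (y - \<epsilon>) (y + \<epsilon>)))"
      using half_gt_zero[OF e(1)] by metis
    with e(1) show ?case
      by metis
  qed
  show ?thesis
    using \<open>c \<le> d\<close>
  proof (induction c d rule: Bolzano)
    case (trans c' d' e')
    then show ?case
      by (intro splits_near_rect_glue_horizontal[of a b c' d' e'] \<open>a \<le> b\<close>)
  next
    case (local y)
    from strip[OF this] obtain e where e: "e > 0" "splits_near (rect a b (y - e) (y + e))"
      by metis
    have "splits_near (rect a b c' d')" if "c' \<le> y \<and> y \<le> d' \<and> d' - c' < e" for c' d'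
      by (rule splits_near_mono[OF e(2)]) (use that in \<open>auto simp: rect_def\<close>)
    with e(1) show ?case
      by metis
  qed
qed

end

section \<open>The multiplicative Cousin problem on the plane and the half plane\<close>

context multiplicative_cocycle
begin

text \<open>Trivialisations over the discs of an exhaustion are corrected by entire functions, which
  approximate the logarithms of their successive ratios, so that they converge.\<close>

theorem splits_on_disc_exhaustion:
  fixes c :: "nat \<Rightarrow> complex" and r :: "nat \<Rightarrow> real"
  assumes r: "\<And>n. r n > 0"
    and nested: "\<And>n. cball (c n) (r n) \<subseteq> ball (c (Suc n)) (r (Suc n))"
    and exhausts: "D = (\<Union>n. ball (c n) (r n))"
    and square: "\<And>n. rect (Re (c n) - r n) (Re (c n) + r n) (Im (c n) - r n) (Im (c n) + r n) \<subseteq> D"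
  shows "\<exists>h. splits_on D h"
proof -
  define B where "B n = ball (c n) (r n)" for n
  have B_sub: "B n \<subseteq> B (Suc n)" for n
    using nested[of n] ball_subset_cball[of "c n" "r n"] by (auto simp: B_def)
  have B_mono: "B m \<subseteq> B n" if "m \<le> n" for m n
    using lift_Suc_mono_le[of B, OF B_sub that] .
  have BD: "B n \<subseteq> D" for n
    unfolding exhausts B_def by blast
  have "\<exists>h. splits_on (B n) h" for n
  proof -
    have "splits_near (rect (Re (c n) - r n) (Re (c n) + r n) (Im (c n) - r n) (Im (c n) + r n))"
      by (rule splits_near_rect[OF square]) (use r[of n] in simp_all)
    then obtain V h where V: "rect (Re (c n) - r n) (Re (c n) + r n) (Im (c n) - r n) (Im (c n) + r n) \<subseteq> V"
      "splits_on V h"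
      by (rule splits_nearE)
    have "B n \<subseteq> rect (Re (c n) - r n) (Re (c n) + r n) (Im (c n) - r n) (Im (c n) + r n)"
    proof
      fix z assume "z \<in> B n"
      then have "norm (z - c n) < r n"
        by (simp add: B_def dist_norm norm_minus_commute)
      then have "\<bar>Re (z - c n)\<bar> < r n" "\<bar>Im (z - c n)\<bar> < r n"
        using abs_Re_le_cmod[of "z - c n"] abs_Im_le_cmod[of "z - c n"] by linarith+
      then show "z \<in> rect (Re (c n) - r n) (Re (c n) + r n) (Im (c n) - r n) (Im (c n) + r n)"
        by (auto simp: rect_def)
    qed
    then have "splits_on (B n) h"
      by (intro splits_on_subset[OF V(2)]) (use V(1) in \<open>auto simp: B_def\<close>)
    then show ?thesis by metis
  qed
  then obtain H where H: "\<And>n. splits_on (B n) (H n)"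
    by metis
  have opB: "open (B n)" "convex (B n)" "c n \<in> B n" for n
    using r[of n] by (auto simp: B_def)
  have "\<exists>f. f holomorphic_on B n \<and> (\<forall>i. \<forall>z\<in>U i \<inter> B n. H (Suc n) i z = exp (f z) * H n i z)" for n
  proof -
    have "splits_on (B n) (H (Suc n))"
      by (rule splits_on_subset[OF H opB(1) B_sub])
    from splits_ratio[OF this H[of n]] obtain q where q: "q holomorphic_on B n"
      "\<And>z. z \<in> B n \<Longrightarrow> q z \<noteq> 0" "\<And>i z. z \<in> U i \<Longrightarrow> z \<in> B n \<Longrightarrow> H (Suc n) i z = q z * H n i z"
      by metis
    obtain f where f: "f holomorphic_on B n" "\<And>z. z \<in> B n \<Longrightarrow> exp (f z) = q z"
      using holomorphic_logarithm_exists[OF opB(2,1) q(1,2) opB(3)] by metis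
    show ?thesis
      by (rule exI[of _ f]) (use f q(3) in simp)
  qed
  then obtain f where f: "\<And>n. f n holomorphic_on B n"
    "\<And>n i z. z \<in> U i \<Longrightarrow> z \<in> B n \<Longrightarrow> H (Suc n) i z = exp (f n z) * H n i z"
    by (metis IntI)
  have "\<exists>p. p holomorphic_on UNIV \<and> (\<forall>z\<in>cball (c n) (r n). norm (f (Suc n) z - p z) < (1 / 2) ^ n)" for n
  proof -
    have "f (Suc n) holomorphic_on ball (c (Suc n)) (r (Suc n))"
      using f(1)[of "Suc n"] by (simp add: B_def)
    from entire_approximation_on_disc[OF this compact_cball nested[of n], of "(1 / 2) ^ n"]
    show ?thesis
      by (metis half_gt_zero_iff zero_less_one zero_less_power)
  qed
  then obtain p where p: "\<And>n. p n holomorphic_on UNIV"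
    "\<And>n z. z \<in> cball (c n) (r n) \<Longrightarrow> norm (f (Suc n) z - p n z) < (1 / 2) ^ n"
    by metis
  define d where "d n z = f (Suc n) z - p n z" for n z
  define K where "K n i z = exp (- (\<Sum>k<n. p k z)) * H (Suc n) i z" for n i z
  have d_hol: "d n holomorphic_on B (Suc n)" for n
    unfolding d_def by (intro holomorphic_intros f(1) holomorphic_on_subset[OF p(1)]) auto
  have K_splits: "splits_on (B (Suc n)) (K n)" for n
    unfolding K_def
    by (intro splits_on_mult[OF H] holomorphic_intros holomorphic_on_subset[OF p(1)]) auto
  have K_Suc: "K (Suc n) i z = exp (d n z) * K n i z" if "z \<in> U i" "z \<in> B (Suc n)" for n i z
    using f(2)[OF that] by (simp add: K_def d_def exp_diff exp_minus exp_add field_simps)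
  have K_add: "K (m + n) i z = exp (\<Sum>k<n. d (m + k) z) * K m i z"
    if "z \<in> U i" "z \<in> B m" for m n i z
  proof (induction n)
    case (Suc n)
    have "z \<in> B (Suc (m + n))"
      using B_mono[of m "Suc (m + n)"] that(2) by auto
    then show ?case
      using K_Suc[OF that(1), of "m + n"] Suc by (simp add: exp_add)
  qed simp
  define S where "S m z = (\<Sum>k. d (m + k) z)" for m z
  have S_lim: "uniform_limit (B m) (\<lambda>n z. \<Sum>k<n. d (m + k) z) (S m) sequentially" for m
    unfolding S_def
  proof (rule Weierstrass_m_test)
    show "summable (\<lambda>k. (1 / 2) ^ (m + k) :: real)"
      by (simp add: power_add summable_mult)
    show "norm (d (m + k) z) \<le> (1 / 2) ^ (m + k)" if "z \<in> B m" for k z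
    proof -
      have "z \<in> B (m + k)"
        using B_mono[of m "m + k"] that by auto
      then have "z \<in> cball (c (m + k)) (r (m + k))"
        by (simp add: B_def)
      from p(2)[OF this] show ?thesis
        by (simp add: d_def)
    qed
  qed
  have S_hol: "S m holomorphic_on B m" for m
  proof (rule holomorphic_uniform_sequence[OF opB(1)])
    show "(\<lambda>z. \<Sum>k<n. d (m + k) z) holomorphic_on B m" for n
    proof (intro holomorphic_on_sum holomorphic_on_subset[OF d_hol])
      show "B m \<subseteq> B (Suc (m + k))" for k
        by (rule B_mono) simp
    qed
    fix x assume "x \<in> B m"
    then obtain e where e: "e > 0" "cball x e \<subseteq> B m"
      using opB(1) open_contains_cball by metis
    then show "\<exists>e>0. cball x e \<subseteq> B m \<and>
        uniform_limit (cball x e) (\<lambda>n z. \<Sum>k<n. d (m + k) z) (S m) sequentially"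
      using uniform_limit_on_subset[OF S_lim] by metis
  qed
  define h where "h i z = lim (\<lambda>n. K n i z)" for i z
  have h_eq: "h i z = exp (S m z) * K m i z" if "z \<in> U i" "z \<in> B m" for m i z
  proof -
    have "(\<lambda>n. \<Sum>k<n. d (m + k) z) \<longlonglongrightarrow> S m z"
      using tendsto_uniform_limitI[OF S_lim that(2)] .
    then have "(\<lambda>n. exp (\<Sum>k<n. d (m + k) z) * K m i z) \<longlonglongrightarrow> exp (S m z) * K m i z"
      by (intro tendsto_intros)
    then have "(\<lambda>n. K (n + m) i z) \<longlonglongrightarrow> exp (S m z) * K m i z"
      using K_add[OF that] by (simp add: add.commute)
    then have "(\<lambda>n. K n i z) \<longlonglongrightarrow> exp (S m z) * K m i z"
      by (rule LIMSEQ_offset)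
    then show ?thesis
      unfolding h_def by (rule limI)
  qed
  have Dx: "\<exists>m. z \<in> B m" if "z \<in> D" for z
    using that unfolding exhausts B_def by blast
  have hB: "splits_on (B m) (\<lambda>i z. exp (S m z) * K m i z)" for m
    by (intro splits_on_mult splits_on_subset[OF K_splits opB(1) B_sub] holomorphic_intros S_hol) auto
  have "splits_on D h"
    unfolding splits_on_def
  proof (intro conjI allI ballI)
    fix i
    have "h i holomorphic_on (\<Union>m. U i \<inter> B m)"
    proof (rule holomorphic_on_UN_open)
      fix m
      show "h i holomorphic_on U i \<inter> B m"
        by (rule holomorphic_transform[OF splits_onD(3)[OF hB]]) (metis IntD1 IntD2 h_eq)
    qed (use open_U opB in auto)
    then show "h i holomorphic_on U i \<inter> D"
      by (rule holomorphic_on_subset) (use Dx in blast)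
  next
    fix i z assume "z \<in> U i \<inter> D"
    with Dx obtain m where m: "z \<in> B m" "z \<in> U i" by blast
    then show "h i z \<noteq> 0"
      using splits_onD(4)[OF hB m(2,1)] h_eq[OF m(2,1)] by simp
  next
    fix i j z assume "z \<in> U i \<inter> U j \<inter> D"
    with Dx obtain m where m: "z \<in> B m" "z \<in> U i" "z \<in> U j" by blast
    then show "h i z = g i j z * h j z"
      using splits_onD(5)[OF hB m(2,3,1)] h_eq[OF m(2,1)] h_eq[OF m(3,1)] by simp
  qed (use open_D in auto)
  then show ?thesis by metis
qed

end

text \<open>The discs with centre \<open>0\<close> and integral radius exhaust the plane.\<close>

theorem cousin_plane:
  assumes "multiplicative_cocycle UNIV U g"
  shows "\<exists>h. multiplicative_cocycle.splits_on UNIV U g UNIV h"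
proof -
  interpret multiplicative_cocycle UNIV U g by fact
  show ?thesis
  proof (rule splits_on_disc_exhaustion[of "\<lambda>n. real n + 1" "\<lambda>_. 0"])
    show "cball 0 (real n + 1) \<subseteq> ball (0::complex) (real (Suc n) + 1)" for n
      by auto
    show "UNIV = (\<Union>n. ball (0::complex) (real n + 1))"
    proof -
      have "\<exists>n. norm z < real n + 1" for z :: complex
        using real_arch_simple[of "norm z"] by (meson less_add_one order_le_less_trans)
      then show ?thesis by auto
    qed
  qed auto
qed

text \<open>The disc with centre \<open>i n\<close> and radius \<open>n - 1/n\<close>, for \<open>n \<ge> 2\<close>, and even the square around it
  lie in the upper half plane.\<close>

theorem cousin_half_plane:
  assumes "multiplicative_cocycle {z. Im z > 0} U g"
  shows "\<exists>h. multiplicative_cocycle.splits_on {z. Im z > 0} U g {z. Im z > 0} h"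
proof -
  interpret multiplicative_cocycle "{z. Im z > 0}" U g by fact
  define m where "m n = real n + 2" for n
  define r where "r n = m n - 1 / m n" for n
  have m: "m n \<ge> 2" "m (Suc n) = m n + 1" for n
    by (auto simp: m_def)
  have inv: "1 / m n \<le> 1 / 2" "1 / m n > 0" for n
    using m(1)[of n] by (auto simp: field_simps)
  show ?thesis
  proof (rule splits_on_disc_exhaustion[of r "\<lambda>n. Complex 0 (m n)"])
    show "r n > 0" for n
      unfolding r_def using m(1)[of n] inv(1)[of n] by linarith
    show "cball (Complex 0 (m n)) (r n) \<subseteq> ball (Complex 0 (m (Suc n))) (r (Suc n))" for n
    proof
      fix z assume "z \<in> cball (Complex 0 (m n)) (r n)"
      then have "dist (Complex 0 (m n)) z \<le> r n" by simp
      moreover have "dist (Complex 0 (m (Suc n))) (Complex 0 (m n)) = 1"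
        by (simp add: m dist_norm complex_diff cmod_def)
      moreover have "1 / m (Suc n) < 1 / m n"
        using m[of n] by (simp add: field_simps)
      ultimately show "z \<in> ball (Complex 0 (m (Suc n))) (r (Suc n))"
        using dist_triangle[of "Complex 0 (m (Suc n))" z "Complex 0 (m n)"] m(2)[of n]
        by (simp add: r_def)
    qed
    show "{z. Im z > 0} = (\<Union>n. ball (Complex 0 (m n)) (r n))"
    proof (intro equalityI subsetI)
      fix z assume "z \<in> (\<Union>n. ball (Complex 0 (m n)) (r n))"
      then obtain n where "norm (z - Complex 0 (m n)) < r n"
        by (auto simp: dist_norm norm_minus_commute)
      then have "\<bar>Im z - m n\<bar> < r n"
        using abs_Im_le_cmod[of "z - Complex 0 (m n)"] by simp
      then show "z \<in> {z. Im z > 0}"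
        using inv(2)[of n] unfolding r_def mem_Collect_eq by linarith
    next
      fix z :: complex assume z: "z \<in> {z. Im z > 0}"
      obtain n where n: "((norm z)\<^sup>2 + 2) / (2 * Im z) < real n"
        using reals_Archimedean2 by blast
      then have "((norm z)\<^sup>2 + 2) / (2 * Im z) < m n"
        by (simp add: m_def)
      then have *: "(norm z)\<^sup>2 + 2 < m n * (2 * Im z)"
        using z by (simp add: pos_divide_less_eq)
      have "(norm (z - Complex 0 (m n)))\<^sup>2 = (norm z)\<^sup>2 - 2 * m n * Im z + (m n)\<^sup>2"
        unfolding cmod_power2 by (simp add: power2_eq_square algebra_simps)
      also have "\<dots> < (m n)\<^sup>2 - 2"
        using * by simp
      also have "\<dots> \<le> (r n)\<^sup>2"
        using m(1)[of n] by (simp add: r_def power2_diff)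
      finally have "norm (z - Complex 0 (m n)) < r n"
        by (rule power_less_imp_less_base) (unfold r_def, use m(1)[of n] inv(1)[of n] in linarith)
      then show "z \<in> (\<Union>n. ball (Complex 0 (m n)) (r n))"
        by (auto simp: dist_norm norm_minus_commute)
    qed
    show "rect (Re (Complex 0 (m n)) - r n) (Re (Complex 0 (m n)) + r n)
        (Im (Complex 0 (m n)) - r n) (Im (Complex 0 (m n)) + r n) \<subseteq> {z. 0 < Im z}" for n
    proof
      fix z assume "z \<in> rect (Re (Complex 0 (m n)) - r n) (Re (Complex 0 (m n)) + r n)
        (Im (Complex 0 (m n)) - r n) (Im (Complex 0 (m n)) + r n)"
      then have "m n - r n \<le> Im z" by (simp add: rect_def)
      then show "z \<in> {z. 0 < Im z}"
        using inv(2)[of n] unfolding r_def mem_Collect_eq by linarith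
    qed
  qed
qed

section \<open>The action of the modular group\<close>

definition mat2 :: "int \<Rightarrow> int \<Rightarrow> int \<Rightarrow> int \<Rightarrow> int^2^2" where
  "mat2 a b c d = vector [vector [a, b], vector [c, d]]"

definition denom :: "int^2^2 \<Rightarrow> complex \<Rightarrow> complex" where
  "denom \<gamma> \<tau> = of_int (\<gamma>$2$1) * \<tau> + of_int (\<gamma>$2$2)"

lemma mat2_nth [simp]:
  "mat2 a b c d $1$1 = a" "mat2 a b c d $1$2 = b" "mat2 a b c d $2$1 = c" "mat2 a b c d $2$2 = d"
  unfolding mat2_def vector_2 by (rule refl)+

lemma mat2_eq_iff:
  fixes \<gamma> \<delta> :: "int^2^2"
  shows "\<gamma> = \<delta> \<longleftrightarrow> \<gamma>$1$1 = \<delta>$1$1 \<and> \<gamma>$1$2 = \<delta>$1$2 \<and> \<gamma>$2$1 = \<delta>$2$1 \<and> \<gamma>$2$2 = \<delta>$2$2"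
  unfolding vec_eq_iff forall_2 by (rule conj_assoc)

lemma mat2_surj: "mat2 (\<gamma>$1$1) (\<gamma>$1$2) (\<gamma>$2$1) (\<gamma>$2$2) = \<gamma>"
  by (simp add: mat2_eq_iff)

lemma mat_1_nth [simp]:
  "(mat 1 :: int^2^2)$1$1 = 1" "(mat 1 :: int^2^2)$1$2 = 0"
  "(mat 1 :: int^2^2)$2$1 = 0" "(mat 1 :: int^2^2)$2$2 = 1"
  by (simp_all add: mat_def)

lemma matrix_mult_nth_2:
  fixes \<gamma> \<delta> :: "int^2^2"
  shows "(\<gamma> ** \<delta>)$i$j = \<gamma>$i$1 * \<delta>$1$j + \<gamma>$i$2 * \<delta>$2$j"
  by (simp add: matrix_matrix_mult_def sum_2)

lemma SL2Z_iff: "\<gamma> \<in> SL2Z \<longleftrightarrow> \<gamma>$1$1 * \<gamma>$2$2 - \<gamma>$1$2 * \<gamma>$2$1 = 1"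
  by (simp add: SL2Z_def det_2)

lemma mat2_in_SL2Z: "mat2 a b c d \<in> SL2Z \<longleftrightarrow> a * d - b * c = 1"
  by (simp add: SL2Z_iff)

lemma SL2Z_one [simp, intro]: "mat 1 \<in> SL2Z"
  by (simp add: SL2Z_iff)

lemma SL2Z_mult [simp, intro]: "\<gamma> \<in> SL2Z \<Longrightarrow> \<delta> \<in> SL2Z \<Longrightarrow> \<gamma> ** \<delta> \<in> SL2Z"
  by (simp add: SL2Z_def det_mul)

definition inv2 :: "int^2^2 \<Rightarrow> int^2^2" where
  "inv2 \<gamma> = mat2 (\<gamma>$2$2) (- \<gamma>$1$2) (- \<gamma>$2$1) (\<gamma>$1$1)"

lemma inv2_in_SL2Z [simp, intro]: "\<gamma> \<in> SL2Z \<Longrightarrow> inv2 \<gamma> \<in> SL2Z"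
  by (simp add: SL2Z_iff inv2_def mult.commute)

lemma inv2_mult:
  assumes "\<gamma> \<in> SL2Z" shows "\<gamma> ** inv2 \<gamma> = mat 1" "inv2 \<gamma> ** \<gamma> = mat 1"
  using assms by (simp_all add: mat2_eq_iff matrix_mult_nth_2 inv2_def SL2Z_iff algebra_simps)

lemma denom_nonzero:
  assumes "\<gamma> \<in> SL2Z" "\<tau> \<in> upper_half_plane" shows "denom \<gamma> \<tau> \<noteq> 0"
proof
  assume "denom \<gamma> \<tau> = 0"
  then have "real_of_int (\<gamma>$2$1) * Im \<tau> = 0" "real_of_int (\<gamma>$2$1) * Re \<tau> + real_of_int (\<gamma>$2$2) = 0"
    by (auto simp: denom_def complex_eq_iff)
  then have "\<gamma>$2$1 = 0" "\<gamma>$2$2 = 0"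
    using assms(2) by (auto simp: upper_half_plane_def)
  then show False
    using assms(1) by (simp add: SL2Z_iff)
qed

lemma moebius_act_eq: "moebius_act \<gamma> \<tau> = (of_int (\<gamma>$1$1) * \<tau> + of_int (\<gamma>$1$2)) / denom \<gamma> \<tau>"
  by (simp add: moebius_act_def moebius_def denom_def)

lemma Im_moebius_act:
  assumes "\<gamma> \<in> SL2Z"
  shows "Im (moebius_act \<gamma> \<tau>) = Im \<tau> / (norm (denom \<gamma> \<tau>))\<^sup>2"
proof -
  let ?a = "real_of_int (\<gamma>$1$1)" and ?b = "real_of_int (\<gamma>$1$2)"
  let ?c = "real_of_int (\<gamma>$2$1)" and ?d = "real_of_int (\<gamma>$2$2)"
  have "real_of_int (\<gamma>$1$1 * \<gamma>$2$2 - \<gamma>$1$2 * \<gamma>$2$1) = 1"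
    using assms by (simp only: SL2Z_iff of_int_1)
  then have det: "?a * ?d - ?b * ?c = 1" by simp
  have "Im (moebius_act \<gamma> \<tau>) =
      (?a * Im \<tau> * (?c * Re \<tau> + ?d) - (?a * Re \<tau> + ?b) * (?c * Im \<tau>)) / (norm (denom \<gamma> \<tau>))\<^sup>2"
    by (simp add: moebius_act_eq Im_divide cmod_power2 denom_def)
  also have "?a * Im \<tau> * (?c * Re \<tau> + ?d) - (?a * Re \<tau> + ?b) * (?c * Im \<tau>) = (?a * ?d - ?b * ?c) * Im \<tau>"
    by (simp add: algebra_simps)
  finally show ?thesis using det by simp
qed

lemma moebius_act_in_half_plane [simp, intro]:
  assumes "\<gamma> \<in> SL2Z" "\<tau> \<in> upper_half_plane" shows "moebius_act \<gamma> \<tau> \<in> upper_half_plane"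
  using assms denom_nonzero[OF assms] by (simp add: upper_half_plane_def Im_moebius_act)

lemma moebius_act_one [simp]: "moebius_act (mat 1) \<tau> = \<tau>"
  by (simp add: moebius_act_eq denom_def)

lemma denom_one [simp]: "denom (mat 1) \<tau> = 1"
  by (simp add: denom_def)

lemma denom_mult:
  assumes "\<delta> \<in> SL2Z" "\<tau> \<in> upper_half_plane"
  shows "denom (\<gamma> ** \<delta>) \<tau> = denom \<gamma> (moebius_act \<delta> \<tau>) * denom \<delta> \<tau>"
proof -
  have "denom \<gamma> (moebius_act \<delta> \<tau>) * denom \<delta> \<tau> =
      of_int (\<gamma>$2$1) * (moebius_act \<delta> \<tau> * denom \<delta> \<tau>) + of_int (\<gamma>$2$2) * denom \<delta> \<tau>"
    by (simp add: denom_def[of \<gamma>] algebra_simps)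
  also have "moebius_act \<delta> \<tau> * denom \<delta> \<tau> = of_int (\<delta>$1$1) * \<tau> + of_int (\<delta>$1$2)"
    using denom_nonzero[OF assms] by (simp add: moebius_act_eq)
  finally show ?thesis
    by (simp add: denom_def matrix_mult_nth_2 algebra_simps)
qed

lemma moebius_act_mult:
  assumes "\<gamma> \<in> SL2Z" "\<delta> \<in> SL2Z" "\<tau> \<in> upper_half_plane"
  shows "moebius_act (\<gamma> ** \<delta>) \<tau> = moebius_act \<gamma> (moebius_act \<delta> \<tau>)"
proof -
  let ?n = "of_int (\<gamma>$1$1) * moebius_act \<delta> \<tau> + of_int (\<gamma>$1$2)"
  note nz = denom_nonzero[OF assms(2,3)]
  have "?n * denom \<delta> \<tau> = of_int (\<gamma>$1$1) * (moebius_act \<delta> \<tau> * denom \<delta> \<tau>) + of_int (\<gamma>$1$2) * denom \<delta> \<tau>"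
    by (simp add: algebra_simps)
  also have "moebius_act \<delta> \<tau> * denom \<delta> \<tau> = of_int (\<delta>$1$1) * \<tau> + of_int (\<delta>$1$2)"
    using nz by (simp add: moebius_act_eq)
  finally have "of_int ((\<gamma> ** \<delta>)$1$1) * \<tau> + of_int ((\<gamma> ** \<delta>)$1$2) = ?n * denom \<delta> \<tau>"
    by (simp add: denom_def matrix_mult_nth_2 algebra_simps)
  then have "moebius_act (\<gamma> ** \<delta>) \<tau> = (?n * denom \<delta> \<tau>) / (denom \<gamma> (moebius_act \<delta> \<tau>) * denom \<delta> \<tau>)"
    by (simp add: moebius_act_eq[of "\<gamma> ** \<delta>"] denom_mult[OF assms(2,3)])
  also have "\<dots> = ?n / denom \<gamma> (moebius_act \<delta> \<tau>)"
    using nz by simp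
  finally show ?thesis
    by (simp add: moebius_act_eq[of \<gamma>])
qed

lemma moebius_act_inv2:
  assumes "\<gamma> \<in> SL2Z" "\<tau> \<in> upper_half_plane"
  shows "moebius_act (inv2 \<gamma>) (moebius_act \<gamma> \<tau>) = \<tau>" "moebius_act \<gamma> (moebius_act (inv2 \<gamma>) \<tau>) = \<tau>"
  using assms inv2_mult[OF assms(1)] moebius_act_mult[of "inv2 \<gamma>" \<gamma> \<tau>] moebius_act_mult[of \<gamma> "inv2 \<gamma>" \<tau>]
  by simp_all

lemma open_upper_half_plane: "open upper_half_plane"
  unfolding upper_half_plane_def by (intro open_Collect_less continuous_intros)

lemma convex_upper_half_plane: "convex upper_half_plane"
  unfolding upper_half_plane_def by (rule convex_halfspace_Im_gt)

lemma connected_upper_half_plane: "connected upper_half_plane"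
  by (rule convex_connected[OF convex_upper_half_plane])

lemma denom_holomorphic [holomorphic_intros]: "denom \<gamma> holomorphic_on S"
  unfolding denom_def by (intro holomorphic_intros)

lemma moebius_act_holomorphic:
  assumes "\<gamma> \<in> SL2Z" shows "moebius_act \<gamma> holomorphic_on upper_half_plane"
  unfolding moebius_act_eq
  by (intro holomorphic_intros) (use denom_nonzero[OF assms] in auto)

text \<open>The norm of \<open>m \<tau> + n\<close> controls the size of \<open>m\<close> and \<open>n\<close>, uniformly for \<open>\<tau>\<close> in a half strip: this gives
  the finiteness statements about the modular group and the convergence of the lattice sums.\<close>

lemma lattice_norm_bound:
  assumes "A \<ge> 0" "B > 0" "\<bar>Re \<tau>\<bar> \<le> A" "Im \<tau> \<ge> B"
  shows "real_of_int (\<bar>m\<bar> + \<bar>n\<bar>) \<le> (1 + (A + 1) / B) * norm (of_int m * \<tau> + of_int n)"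
proof -
  let ?w = "of_int m * \<tau> + of_int n"
  have "\<bar>real_of_int m\<bar> * B \<le> \<bar>real_of_int m\<bar> * Im \<tau>"
    using assms by (intro mult_left_mono) auto
  also have "\<dots> = \<bar>Im ?w\<bar>"
    using assms by (simp add: abs_mult)
  also have "\<dots> \<le> norm ?w" by (rule abs_Im_le_cmod)
  finally have m: "\<bar>real_of_int m\<bar> \<le> norm ?w / B"
    using assms by (simp add: pos_le_divide_eq)
  have "\<bar>real_of_int m * Re \<tau>\<bar> \<le> \<bar>real_of_int m\<bar> * A"
    unfolding abs_mult using assms by (intro mult_left_mono) auto
  moreover have "\<bar>Re ?w\<bar> \<le> norm ?w" by (rule abs_Re_le_cmod)
  ultimately have "\<bar>real_of_int n\<bar> \<le> norm ?w + A * \<bar>real_of_int m\<bar>"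
    by (simp add: algebra_simps)
  moreover have "(A + 1) * \<bar>real_of_int m\<bar> \<le> (A + 1) * (norm ?w / B)"
    using assms m by (intro mult_left_mono) auto
  ultimately show ?thesis
    by (simp add: algebra_simps)
qed

lemma Im_moebius_act_le:
  assumes "\<gamma> \<in> SL2Z" "\<tau> \<in> upper_half_plane"
  shows "Im (moebius_act \<gamma> \<tau>) \<le> max (Im \<tau>) (1 / Im \<tau>)"
proof -
  have pos: "Im \<tau> > 0" using assms by (simp add: upper_half_plane_def)
  show ?thesis
  proof (cases "\<gamma>$2$1 = 0")
    case True
    then have "\<gamma>$1$1 * \<gamma>$2$2 = 1" using assms by (simp add: SL2Z_iff)
    then have "\<bar>\<gamma>$2$2\<bar> = 1" using zmult_eq_1_iff[of "\<gamma>$1$1" "\<gamma>$2$2"] by auto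
    then have "norm (denom \<gamma> \<tau>) = 1"
      using True by (simp add: denom_def flip: of_int_abs)
    then show ?thesis using assms by (simp add: Im_moebius_act)
  next
    case False
    then have "1 \<le> \<bar>\<gamma>$2$1\<bar>" by linarith
    then have "1 \<le> \<bar>real_of_int (\<gamma>$2$1)\<bar>" by linarith
    then have "1 * Im \<tau> \<le> \<bar>real_of_int (\<gamma>$2$1)\<bar> * Im \<tau>"
      using pos by (intro mult_right_mono) auto
    also have "\<dots> = \<bar>Im (denom \<gamma> \<tau>)\<bar>"
      using pos by (simp add: denom_def abs_mult)
    also have "\<dots> \<le> norm (denom \<gamma> \<tau>)" by (rule abs_Im_le_cmod)
    finally have le: "(Im \<tau>)\<^sup>2 \<le> (norm (denom \<gamma> \<tau>))\<^sup>2"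
      using pos by (intro power_mono) auto
    have "Im (moebius_act \<gamma> \<tau>) \<le> Im \<tau> / (Im \<tau>)\<^sup>2"
      unfolding Im_moebius_act[OF assms(1)] using pos le denom_nonzero[OF assms]
      by (intro divide_left_mono) auto
    then show ?thesis
      using pos by (simp add: power2_eq_square)
  qed
qed

lemma countable_SL2Z: "countable SL2Z"
proof -
  have "SL2Z \<subseteq> (\<lambda>(a, b, c, d). mat2 a b c d) ` UNIV"
  proof
    fix \<gamma> :: "int^2^2"
    show "\<gamma> \<in> (\<lambda>(a, b, c, d). mat2 a b c d) ` UNIV"
      by (rule image_eqI[of _ _ "(\<gamma>$1$1, \<gamma>$1$2, \<gamma>$2$1, \<gamma>$2$2)"]) (simp_all add: mat2_surj)
  qed
  then show ?thesis
    by (rule countable_subset) simp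
qed

lemma finite_bounded_mat2:
  fixes N :: int
  shows "finite {\<gamma> :: int^2^2. \<bar>\<gamma>$1$1\<bar> \<le> N \<and> \<bar>\<gamma>$1$2\<bar> \<le> N \<and> \<bar>\<gamma>$2$1\<bar> \<le> N \<and> \<bar>\<gamma>$2$2\<bar> \<le> N}"
proof (rule finite_subset)
  let ?I = "{-N..N}"
  show "{\<gamma> :: int^2^2. \<bar>\<gamma>$1$1\<bar> \<le> N \<and> \<bar>\<gamma>$1$2\<bar> \<le> N \<and> \<bar>\<gamma>$2$1\<bar> \<le> N \<and> \<bar>\<gamma>$2$2\<bar> \<le> N}
      \<subseteq> (\<lambda>(a, b, c, d). mat2 a b c d) ` (?I \<times> ?I \<times> ?I \<times> ?I)"
  proof
    fix \<gamma> :: "int^2^2"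
    assume "\<gamma> \<in> {\<gamma>. \<bar>\<gamma>$1$1\<bar> \<le> N \<and> \<bar>\<gamma>$1$2\<bar> \<le> N \<and> \<bar>\<gamma>$2$1\<bar> \<le> N \<and> \<bar>\<gamma>$2$2\<bar> \<le> N}"
    then show "\<gamma> \<in> (\<lambda>(a, b, c, d). mat2 a b c d) ` (?I \<times> ?I \<times> ?I \<times> ?I)"
      by (intro image_eqI[of _ _ "(\<gamma>$1$1, \<gamma>$1$2, \<gamma>$2$1, \<gamma>$2$2)"]) (auto simp: mat2_surj abs_le_iff)
  qed
qed simp

text \<open>Proper discontinuity of the action, for the rectangles \<open>\<bar>Re \<tau>\<bar> \<le> A\<close>, \<open>B \<le> Im \<tau> \<le> C\<close>.  A bound
  below for \<open>Im (\<gamma> \<tau>)\<close> bounds \<open>c\<close> and \<open>d\<close>; the numerator of \<open>\<gamma> \<tau>\<close> is then bounded as well, and with it \<open>a\<close> and \<open>b\<close>.\<close>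

lemma finite_SL2Z_meeting:
  assumes "B > 0"
  shows "finite {\<gamma> \<in> SL2Z. \<exists>\<tau>. \<bar>Re \<tau>\<bar> \<le> A \<and> B \<le> Im \<tau> \<and> Im \<tau> \<le> C \<and>
    \<bar>Re (moebius_act \<gamma> \<tau>)\<bar> \<le> A \<and> B \<le> Im (moebius_act \<gamma> \<tau>) \<and> Im (moebius_act \<gamma> \<tau>) \<le> C}"
proof -
  define K where "K = 1 + (\<bar>A\<bar> + 1) / B"
  define s where "s = C / B + 1"
  define N where "N = \<lceil>max (K * s) (K * ((\<bar>A\<bar> + C) * s))\<rceil>"
  have K: "K \<ge> 0" using assms by (simp add: K_def)
  show ?thesis
  proof (rule finite_subset[OF _ finite_bounded_mat2[of N]], intro subsetI)
    fix \<gamma> assume "\<gamma> \<in> {\<gamma> \<in> SL2Z. \<exists>\<tau>. \<bar>Re \<tau>\<bar> \<le> A \<and> B \<le> Im \<tau> \<and> Im \<tau> \<le> C \<and>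
      \<bar>Re (moebius_act \<gamma> \<tau>)\<bar> \<le> A \<and> B \<le> Im (moebius_act \<gamma> \<tau>) \<and> Im (moebius_act \<gamma> \<tau>) \<le> C}"
    then obtain \<tau> where \<gamma>: "\<gamma> \<in> SL2Z" and \<tau>: "\<bar>Re \<tau>\<bar> \<le> A" "B \<le> Im \<tau>" "Im \<tau> \<le> C"
      "\<bar>Re (moebius_act \<gamma> \<tau>)\<bar> \<le> A" "B \<le> Im (moebius_act \<gamma> \<tau>)" "Im (moebius_act \<gamma> \<tau>) \<le> C"
      by blast
    have \<tau>h: "\<tau> \<in> upper_half_plane" using \<tau> assms by (simp add: upper_half_plane_def)
    note nz = denom_nonzero[OF \<gamma> \<tau>h]
    have "B * (norm (denom \<gamma> \<tau>))\<^sup>2 \<le> Im \<tau>"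
      using \<tau>(5) nz unfolding Im_moebius_act[OF \<gamma>] by (simp add: pos_le_divide_eq)
    then have "B * (norm (denom \<gamma> \<tau>))\<^sup>2 \<le> C" using \<tau>(3) by linarith
    then have "(norm (denom \<gamma> \<tau>))\<^sup>2 \<le> C / B"
      using assms by (simp add: pos_le_divide_eq mult.commute)
    moreover have "norm (denom \<gamma> \<tau>) \<le> (norm (denom \<gamma> \<tau>))\<^sup>2 + 1"
      using zero_le_power2[of "norm (denom \<gamma> \<tau>) - 1"] by (simp add: power2_diff) (smt (verit) norm_ge_zero)
    ultimately have den: "norm (denom \<gamma> \<tau>) \<le> s" by (simp add: s_def)
    have num: "norm (of_int (\<gamma>$1$1) * \<tau> + of_int (\<gamma>$1$2)) \<le> (\<bar>A\<bar> + C) * s"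
    proof -
      have "norm (moebius_act \<gamma> \<tau>) \<le> \<bar>A\<bar> + C"
        using cmod_le[of "moebius_act \<gamma> \<tau>"] \<tau> assms by linarith
      moreover have "of_int (\<gamma>$1$1) * \<tau> + of_int (\<gamma>$1$2) = moebius_act \<gamma> \<tau> * denom \<gamma> \<tau>"
        using nz by (simp add: moebius_act_eq)
      moreover have "0 \<le> \<bar>A\<bar> + C" using \<tau> assms by linarith
      ultimately show ?thesis
        using den by (simp add: norm_mult mult_mono)
    qed
    have bound: "real_of_int (\<bar>m\<bar> + \<bar>n\<bar>) \<le> K * norm (of_int m * \<tau> + of_int n)" for m n
      unfolding K_def by (rule lattice_norm_bound) (use \<tau> assms in auto)
    have "K * norm (denom \<gamma> \<tau>) \<le> K * s"
      using den K by (intro mult_left_mono)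
    then have "real_of_int (\<bar>\<gamma>$2$1\<bar> + \<bar>\<gamma>$2$2\<bar>) \<le> of_int N"
      using bound[of "\<gamma>$2$1" "\<gamma>$2$2"] unfolding denom_def[symmetric] N_def by linarith
    moreover have "K * norm (of_int (\<gamma>$1$1) * \<tau> + of_int (\<gamma>$1$2)) \<le> K * ((\<bar>A\<bar> + C) * s)"
      using num K by (intro mult_left_mono)
    then have "real_of_int (\<bar>\<gamma>$1$1\<bar> + \<bar>\<gamma>$1$2\<bar>) \<le> of_int N"
      using bound[of "\<gamma>$1$1" "\<gamma>$1$2"] unfolding N_def by linarith
    ultimately show "\<gamma> \<in> {\<gamma>. \<bar>\<gamma>$1$1\<bar> \<le> N \<and> \<bar>\<gamma>$1$2\<bar> \<le> N \<and> \<bar>\<gamma>$2$1\<bar> \<le> N \<and> \<bar>\<gamma>$2$2\<bar> \<le> N}"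
      unfolding of_int_le_iff mem_Collect_eq
      using abs_ge_zero[of "\<gamma>$1$1"] abs_ge_zero[of "\<gamma>$1$2"] abs_ge_zero[of "\<gamma>$2$1"] abs_ge_zero[of "\<gamma>$2$2"]
      by (intro conjI; linarith)
  qed
qed

definition mat_S :: "int^2^2" where "mat_S = mat2 0 (-1) 1 0"
definition mat_U :: "int^2^2" where "mat_U = mat2 0 (-1) 1 1"
definition mat_T :: "int \<Rightarrow> int^2^2" where "mat_T n = mat2 1 n 0 1"

lemma mat_STU_in_SL2Z [simp, intro]: "mat_S \<in> SL2Z" "mat_U \<in> SL2Z" "mat_T n \<in> SL2Z"
  by (simp_all add: mat_S_def mat_U_def mat_T_def mat2_in_SL2Z)

lemma moebius_act_T [simp]: "moebius_act (mat_T n) \<tau> = \<tau> + of_int n"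
  by (simp add: moebius_act_eq denom_def mat_T_def)

lemma denom_S [simp]: "denom mat_S \<tau> = \<tau>"
  by (simp add: denom_def mat_S_def)

text \<open>Minimising the denominator over the orbit maximises the imaginary part.\<close>

lemma reduce_to_fundamental_domain:
  assumes \<tau>: "\<tau> \<in> upper_half_plane"
  obtains \<gamma> where "\<gamma> \<in> SL2Z" "\<bar>Re (moebius_act \<gamma> \<tau>)\<bar> \<le> 1 / 2" "norm (moebius_act \<gamma> \<tau>) \<ge> 1"
proof -
  define K where "K = 1 + (\<bar>Re \<tau>\<bar> + 1) / Im \<tau>"
  have K: "K \<ge> 0" using \<tau> by (simp add: K_def upper_half_plane_def)
  define N where "N = \<lceil>K\<rceil>"
  define A where "A = {(c, d). \<exists>\<gamma>\<in>SL2Z. \<gamma>$2$1 = c \<and> \<gamma>$2$2 = d \<and> norm (denom \<gamma> \<tau>) \<le> 1}"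
  have "A \<subseteq> {-N..N} \<times> {-N..N}"
  proof
    fix x assume "x \<in> A"
    then obtain \<gamma> where \<gamma>: "x = (\<gamma>$2$1, \<gamma>$2$2)" "norm (denom \<gamma> \<tau>) \<le> 1"
      by (auto simp: A_def)
    have "real_of_int (\<bar>\<gamma>$2$1\<bar> + \<bar>\<gamma>$2$2\<bar>) \<le> K * norm (denom \<gamma> \<tau>)"
      unfolding K_def denom_def by (rule lattice_norm_bound) (use \<tau> in \<open>auto simp: upper_half_plane_def\<close>)
    also have "\<dots> \<le> K * 1"
      using \<gamma>(2) K by (intro mult_left_mono)
    finally have "\<bar>\<gamma>$2$1\<bar> + \<bar>\<gamma>$2$2\<bar> \<le> N"
      unfolding N_def by linarith
    then show "x \<in> {-N..N} \<times> {-N..N}"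
      unfolding \<gamma>(1) by auto
  qed
  then have "finite A" by (rule finite_subset) simp
  moreover have "(0, 1) \<in> A"
    unfolding A_def by (auto intro!: bexI[of _ "mat 1"])
  ultimately obtain x where x: "x \<in> A" "\<And>y. y \<in> A \<Longrightarrow>
      norm (of_int (fst x) * \<tau> + of_int (snd x)) \<le> norm (of_int (fst y) * \<tau> + of_int (snd y))"
    using ex_is_arg_min_if_finite[of A "\<lambda>x. norm (of_int (fst x) * \<tau> + of_int (snd x) :: complex)"]
    unfolding is_arg_min_linorder by blast
  then obtain \<gamma>0 where \<gamma>0: "\<gamma>0 \<in> SL2Z" "x = (\<gamma>0$2$1, \<gamma>0$2$2)" "norm (denom \<gamma>0 \<tau>) \<le> 1"
    by (auto simp: A_def)
  have min: "norm (denom \<gamma>0 \<tau>) \<le> norm (denom \<gamma> \<tau>)" if "\<gamma> \<in> SL2Z" for \<gamma>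
  proof (cases "norm (denom \<gamma> \<tau>) \<le> 1")
    case True
    then have "(\<gamma>$2$1, \<gamma>$2$2) \<in> A" using that by (auto simp: A_def)
    from x(2)[OF this] show ?thesis by (simp add: \<gamma>0(2) denom_def)
  qed (use \<gamma>0(3) in linarith)
  define n where "n = round (Re (moebius_act \<gamma>0 \<tau>))"
  define \<gamma> where "\<gamma> = mat_T (- n) ** \<gamma>0"
  have \<gamma>: "\<gamma> \<in> SL2Z" using \<gamma>0(1) by (simp add: \<gamma>_def)
  have act: "moebius_act \<gamma> \<tau> = moebius_act \<gamma>0 \<tau> - of_int n"
    using \<gamma>0(1) \<tau> by (simp add: \<gamma>_def moebius_act_mult)
  have den: "denom \<gamma> \<tau> = denom \<gamma>0 \<tau>"
    by (simp add: \<gamma>_def denom_def matrix_mult_nth_2 mat_T_def)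
  show ?thesis
  proof (rule that[OF \<gamma>])
    show "\<bar>Re (moebius_act \<gamma> \<tau>)\<bar> \<le> 1 / 2"
      using of_int_round_abs_le[of "Re (moebius_act \<gamma>0 \<tau>)"] 
      unfolding act n_def by (simp add: abs_minus_commute)
    show "norm (moebius_act \<gamma> \<tau>) \<ge> 1"
    proof (rule ccontr)
      assume "\<not> ?thesis"
      then have lt: "norm (moebius_act \<gamma> \<tau>) < 1" by simp
      have "denom (mat_S ** \<gamma>) \<tau> = moebius_act \<gamma> \<tau> * denom \<gamma> \<tau>"
        using denom_mult[OF \<gamma> \<tau>, of mat_S] by (simp add: denom_S)
      then have "norm (denom (mat_S ** \<gamma>) \<tau>) = norm (moebius_act \<gamma> \<tau>) * norm (denom \<gamma>0 \<tau>)"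
        by (simp add: norm_mult den)
      also have "\<dots> < 1 * norm (denom \<gamma>0 \<tau>)"
        using lt denom_nonzero[OF \<gamma>0(1) \<tau>] by (intro mult_strict_right_mono) auto
      finally show False
        using min[of "mat_S ** \<gamma>"] \<gamma> by simp
    qed
  qed
qed

lemma fundamental_domain_Im:
  assumes "\<tau> \<in> upper_half_plane" "\<bar>Re \<tau>\<bar> \<le> 1 / 2" "norm \<tau> \<ge> 1"
  shows "(Im \<tau>)\<^sup>2 \<ge> 3 / 4" "Im \<tau> \<ge> 1 / 2"
proof -
  have "(Re \<tau>)\<^sup>2 \<le> (1 / 2)\<^sup>2"
    using assms(2) by (intro abs_le_square_iff[THEN iffD1]) simp
  moreover have "1 \<le> (norm \<tau>)\<^sup>2" using assms(3) by simp
  ultimately show *: "(Im \<tau>)\<^sup>2 \<ge> 3 / 4"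
    unfolding cmod_power2 power2_eq_square[of "1 / 2"] by linarith
  show "Im \<tau> \<ge> 1 / 2"
    by (rule power2_le_imp_le) (use * assms(1) in \<open>auto simp: upper_half_plane_def power2_eq_square\<close>)
qed

definition rho :: complex where "rho = Complex (- 1 / 2) (sqrt 3 / 2)"

lemma rho_in_half_plane [simp, intro]: "rho \<in> upper_half_plane"
  by (simp add: rho_def upper_half_plane_def)

lemma i_in_half_plane [simp, intro]: "\<i> \<in> upper_half_plane"
  by (simp add: upper_half_plane_def)

lemma rho_square: "rho * rho = - 1 - rho"
  by (simp add: rho_def complex_eq_iff)

text \<open>Up to the group, only the points \<open>i\<close> and \<open>\<rho>\<close> have a stabiliser larger than \<open>{1, -1}\<close>.\<close>

lemma fixed_point_cases:
  assumes \<gamma>: "\<gamma> \<in> SL2Z" and \<tau>: "\<tau> \<in> upper_half_plane" and fx: "moebius_act \<gamma> \<tau> = \<tau>"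
  shows "\<gamma> = mat 1 \<or> \<gamma> = - mat 1 \<or>
    (\<exists>\<delta>\<in>SL2Z. \<tau> = moebius_act \<delta> \<i>) \<or> (\<exists>\<delta>\<in>SL2Z. \<tau> = moebius_act \<delta> rho)"
proof -
  have reduced: "\<gamma> = mat 1 \<or> \<gamma> = - mat 1 \<or> (norm \<tau> = 1 \<and> (Re \<tau> = 0 \<or> Re \<tau> = 1 / 2 \<or> Re \<tau> = - 1 / 2))"
    if \<gamma>: "\<gamma> \<in> SL2Z" and \<tau>: "\<tau> \<in> upper_half_plane" and fx: "moebius_act \<gamma> \<tau> = \<tau>"
      and F: "\<bar>Re \<tau>\<bar> \<le> 1 / 2" "norm \<tau> \<ge> 1" for \<gamma> \<tau>
  proof -
    define a b c d where "a = \<gamma>$1$1" "b = \<gamma>$1$2" "c = \<gamma>$2$1" "d = \<gamma>$2$2"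
    note abcd = this
    have det: "a * d - b * c = 1" using \<gamma> by (simp add: SL2Z_iff abcd)
    have pos: "Im \<tau> > 0" using \<tau> by (simp add: upper_half_plane_def)
    have "Im \<tau> = Im \<tau> / (norm (denom \<gamma> \<tau>))\<^sup>2"
      using Im_moebius_act[OF \<gamma>, of \<tau>] fx by simp
    then have den: "(norm (denom \<gamma> \<tau>))\<^sup>2 = 1"
      using pos denom_nonzero[OF \<gamma> \<tau>] by (simp add: field_simps)
    have den_eq: "(norm (denom \<gamma> \<tau>))\<^sup>2 = (c * Re \<tau> + d)\<^sup>2 + (c * Im \<tau>)\<^sup>2"
      by (simp add: denom_def abcd cmod_power2)
    have eq: "of_int a * \<tau> + of_int b = \<tau> * (of_int c * \<tau> + of_int d)"
      using fx denom_nonzero[OF \<gamma> \<tau>] by (simp add: moebius_act_eq divide_eq_eq denom_def abcd)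
    show ?thesis
    proof (cases "c = 0")
      case True
      then have ad: "a * d = 1" using det by simp
      have "Im (of_int a * \<tau> + of_int b) = Im (\<tau> * of_int d)" "Re (of_int a * \<tau> + of_int b) = Re (\<tau> * of_int d)"
        using eq True by simp_all
      then have "a = d" "b = 0" using pos by auto
      moreover have "a = 1 \<or> a = - 1" using ad zmult_eq_1_iff by auto
      ultimately have "\<gamma> = mat 1 \<or> \<gamma> = - mat 1"
        using True by (auto simp: mat2_eq_iff abcd[symmetric])
      then show ?thesis by blast
    next
      case False
      have "(real_of_int c)\<^sup>2 * (3 / 4) \<le> (real_of_int c)\<^sup>2 * (Im \<tau>)\<^sup>2"
        by (intro mult_left_mono fundamental_domain_Im[OF \<tau> F]) simp
      also have "\<dots> \<le> 1"
        using den zero_le_power2[of "c * Re \<tau> + d"] unfolding den_eq power_mult_distrib by linarith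
      finally have "real_of_int (c\<^sup>2) < real_of_int 2" by simp
      then have c2: "c\<^sup>2 < 2" by (simp only: of_int_less_iff)
      have "\<bar>c\<bar> < 2"
      proof (rule ccontr)
        assume "\<not> \<bar>c\<bar> < 2"
        then have "2 * 2 \<le> \<bar>c\<bar> * \<bar>c\<bar>" by (intro mult_mono) auto
        then show False using c2 by (simp add: power2_eq_square)
      qed
      with False have c: "c = 1 \<or> c = - 1" by linarith
      then have cc: "c * c = 1" by auto
      define e where "e = c * d"
      have "(c * Re \<tau> + d)\<^sup>2 + (c * Im \<tau>)\<^sup>2 = (Re \<tau> + e)\<^sup>2 + (Im \<tau>)\<^sup>2"
        using c by (auto simp: e_def power2_eq_square algebra_simps)
      also have "\<dots> = (norm \<tau>)\<^sup>2 + 2 * e * Re \<tau> + e\<^sup>2"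
        unfolding cmod_power2 by (simp add: power2_eq_square algebra_simps)
      finally have sq: "(norm \<tau>)\<^sup>2 + 2 * e * Re \<tau> + e\<^sup>2 = 1"
        using den den_eq by simp
      have n1: "(norm \<tau>)\<^sup>2 \<ge> 1" using F(2) by simp
      have "\<bar>real_of_int e\<bar> * \<bar>Re \<tau>\<bar> \<le> \<bar>real_of_int e\<bar> * (1 / 2)"
        using F(1) by (intro mult_left_mono) auto
      then have "2 * e * Re \<tau> \<ge> - \<bar>real_of_int e\<bar>"
        by (simp add: abs_mult[symmetric])
      with sq n1 have "real_of_int (e\<^sup>2) \<le> real_of_int \<bar>e\<bar>" by simp
      then have "e\<^sup>2 \<le> \<bar>e\<bar>" by linarith
      have "\<bar>e\<bar> \<le> 1"
      proof (rule ccontr)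
        assume "\<not> \<bar>e\<bar> \<le> 1"
        then have "2 * \<bar>e\<bar> \<le> \<bar>e\<bar> * \<bar>e\<bar>" by (intro mult_right_mono) auto
        then show False using \<open>e\<^sup>2 \<le> \<bar>e\<bar>\<close> \<open>\<not> \<bar>e\<bar> \<le> 1\<close> by (simp add: power2_eq_square)
      qed
      then consider "e = 0" | "e = 1" | "e = - 1" by linarith
      then show ?thesis
      proof cases
        case 1
        then have d: "d = 0" using c by (auto simp: e_def)
        have b: "b = - c" using det c d by auto
        have n: "(norm \<tau>)\<^sup>2 = 1" using sq 1 by simp
        then have n': "norm \<tau> = 1" using abs_square_eq_1[of "norm \<tau>"] by simp
        have im: "of_int a * Im \<tau> = 2 * c * Re \<tau> * Im \<tau>"
          using arg_cong[OF eq, of Im] d by (simp add: algebra_simps)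
        then have re: "of_int a = 2 * c * Re \<tau>" using pos by simp
        then have "\<bar>real_of_int a\<bar> \<le> 1" using c F(1) by auto
        then have "a = 0 \<or> a = 1 \<or> a = - 1" by linarith
        then show ?thesis using n' re c by auto
      next
        case 2
        then have "(norm \<tau>)\<^sup>2 = - 2 * Re \<tau>" using sq by simp
        then have "Re \<tau> = - 1 / 2" "(norm \<tau>)\<^sup>2 = 1" using n1 F(1) by auto
        then show ?thesis using abs_square_eq_1[of "norm \<tau>"] by simp
      next
        case 3
        then have "(norm \<tau>)\<^sup>2 = 2 * Re \<tau>" using sq by simp
        then have "Re \<tau> = 1 / 2" "(norm \<tau>)\<^sup>2 = 1" using n1 F(1) by auto
        then show ?thesis using abs_square_eq_1[of "norm \<tau>"] by simp
      qed
    qed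
  qed
  obtain \<delta> where \<delta>: "\<delta> \<in> SL2Z" "\<bar>Re (moebius_act \<delta> \<tau>)\<bar> \<le> 1 / 2" "norm (moebius_act \<delta> \<tau>) \<ge> 1"
    using reduce_to_fundamental_domain[OF \<tau>] .
  define \<sigma> where "\<sigma> = moebius_act \<delta> \<tau>"
  have \<sigma>: "\<sigma> \<in> upper_half_plane" using \<delta>(1) \<tau> by (simp add: \<sigma>_def)
  have \<tau>_eq: "\<tau> = moebius_act (inv2 \<delta>) \<sigma>"
    using moebius_act_inv2(1)[OF \<delta>(1) \<tau>] by (simp add: \<sigma>_def)
  define \<gamma>' where "\<gamma>' = \<delta> ** (\<gamma> ** inv2 \<delta>)"
  have \<gamma>': "\<gamma>' \<in> SL2Z" using \<gamma> \<delta>(1) by (simp add: \<gamma>'_def)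
  have "moebius_act \<gamma>' \<sigma> = moebius_act \<delta> (moebius_act \<gamma> (moebius_act (inv2 \<delta>) \<sigma>))"
    using \<gamma> \<delta>(1) \<sigma> by (simp add: \<gamma>'_def moebius_act_mult)
  also have "\<dots> = \<sigma>"
    using \<tau>_eq fx \<sigma>_def by metis
  finally have "moebius_act \<gamma>' \<sigma> = \<sigma>" .
  from reduced[OF \<gamma>' \<sigma> this] \<delta>
  consider "\<gamma>' = mat 1" | "\<gamma>' = - mat 1" | "norm \<sigma> = 1" "Re \<sigma> = 0 \<or> Re \<sigma> = 1 / 2 \<or> Re \<sigma> = - 1 / 2"
    unfolding \<sigma>_def by blast
  then show ?thesis
  proof cases
    case 3
    have pos: "Im \<sigma> > 0" using \<sigma> by (simp add: upper_half_plane_def)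
    have n: "(Re \<sigma>)\<^sup>2 + (Im \<sigma>)\<^sup>2 = 1" using 3(1) cmod_power2[of \<sigma>] by simp
    from 3(2) consider "Re \<sigma> = 0" | "Re \<sigma> = 1 / 2" | "Re \<sigma> = - 1 / 2" by blast
    then show ?thesis
    proof cases
      case 1
      then have "Im \<sigma> = 1" using n pos by (simp add: power2_eq_1_iff)
      with 1 have "\<sigma> = \<i>" by (simp add: complex_eq_iff)
      then show ?thesis using \<tau>_eq \<delta>(1) by blast
    next
      case 2
      have "(Im \<sigma>)\<^sup>2 = (sqrt 3 / 2)\<^sup>2" using n unfolding 2 by (simp add: power_divide)
      then have "Im \<sigma> = sqrt 3 / 2" by (rule power2_eq_imp_eq) (use pos in auto)
      with 2 have "\<sigma> = moebius_act (mat_T 1) rho" by (simp add: complex_eq_iff rho_def)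
      then have "\<tau> = moebius_act (inv2 \<delta> ** mat_T 1) rho"
        using \<tau>_eq \<delta>(1) by (simp add: moebius_act_mult)
      then show ?thesis using \<delta>(1) by blast
    next
      case 3
      then have "(Im \<sigma>)\<^sup>2 = (sqrt 3 / 2)\<^sup>2" using n by (simp add: power_divide)
      then have "Im \<sigma> = sqrt 3 / 2" by (rule power2_eq_imp_eq) (use pos in auto)
      with 3 have "\<sigma> = rho" by (simp add: complex_eq_iff rho_def)
      then show ?thesis using \<tau>_eq \<delta>(1) by blast
    qed
  next
    case 1
    have "inv2 \<delta> ** (\<gamma>' ** \<delta>) = (inv2 \<delta> ** \<delta>) ** \<gamma> ** (inv2 \<delta> ** \<delta>)"
      by (simp only: \<gamma>'_def matrix_mul_assoc)
    then have "\<gamma> = inv2 \<delta> ** (\<gamma>' ** \<delta>)"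
      by (simp add: inv2_mult[OF \<delta>(1)])
    then have "\<gamma> = mat 1" using 1 by (simp add: inv2_mult[OF \<delta>(1)])
    then show ?thesis by blast
  next
    case 2
    have "inv2 \<delta> ** (\<gamma>' ** \<delta>) = (inv2 \<delta> ** \<delta>) ** \<gamma> ** (inv2 \<delta> ** \<delta>)"
      by (simp only: \<gamma>'_def matrix_mul_assoc)
    then have "\<gamma> = inv2 \<delta> ** (\<gamma>' ** \<delta>)"
      by (simp add: inv2_mult[OF \<delta>(1)])
    moreover have "- mat 1 ** \<delta> = - \<delta>" "inv2 \<delta> ** (- \<delta>) = - (inv2 \<delta> ** \<delta>)"
      by (simp_all add: mat2_eq_iff matrix_mult_nth_2)
    ultimately have "\<gamma> = - mat 1" using 2 by (simp add: inv2_mult[OF \<delta>(1)])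
    then show ?thesis by blast
  qed
qed

text \<open>The stabiliser of \<open>i\<close> consists of the powers of \<open>mat_S\<close>.\<close>

lemma stabiliser_i_induct:
  assumes \<gamma>: "\<gamma> \<in> SL2Z" and fx: "moebius_act \<gamma> \<i> = \<i>"
    and one: "P (mat 1)"
    and step: "\<And>\<delta>. \<delta> \<in> SL2Z \<Longrightarrow> moebius_act \<delta> \<i> = \<i> \<Longrightarrow> P \<delta> \<Longrightarrow> P (mat_S ** \<delta>)"
  shows "P \<gamma>"
proof -
  define a b c d where "a = \<gamma>$1$1" "b = \<gamma>$1$2" "c = \<gamma>$2$1" "d = \<gamma>$2$2"
  note abcd = this
  have det: "a * d - b * c = 1" using \<gamma> by (simp add: SL2Z_iff abcd)
  have eq: "of_int a * \<i> + of_int b = \<i> * (of_int c * \<i> + of_int d)"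
    using fx denom_nonzero[OF \<gamma>, of \<i>] by (simp add: moebius_act_eq divide_eq_eq denom_def abcd)
  have ab: "a = d" "b = - c"
    using arg_cong[OF eq, of Im] arg_cong[OF eq, of Re] by simp_all
  have sq: "d\<^sup>2 + c\<^sup>2 = 1" using det ab by (simp add: power2_eq_square)
  have "c\<^sup>2 \<le> 1" "d\<^sup>2 \<le> 1" using sq zero_le_power2[of c] zero_le_power2[of d] by linarith+
  then have "\<bar>c\<bar> \<le> 1" "\<bar>d\<bar> \<le> 1" by (simp_all add: abs_square_le_1)
  then have "c \<in> {-1, 0, 1}" "d \<in> {-1, 0, 1}" by auto
  have cd: "(c, d) \<in> {(0, 1), (1, 0), (0, -1), (-1, 0)}"
    using sq \<open>c \<in> {-1, 0, 1}\<close> \<open>d \<in> {-1, 0, 1}\<close> by auto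
  have fS: "moebius_act mat_S \<i> = \<i>" by (simp add: moebius_act_eq denom_def mat_S_def divide_simps)
  have 1: "P (mat_S ** mat 1)" by (rule step) (use one in auto)
  have 2: "P (mat_S ** (mat_S ** mat 1))" by (rule step[OF _ _ 1]) (auto simp: fS)
  have 3: "P (mat_S ** (mat_S ** (mat_S ** mat 1)))"
    by (rule step[OF _ _ 2]) (auto simp: fS moebius_act_mult)
  have "\<gamma> \<in> {mat 1, mat_S ** mat 1, mat_S ** (mat_S ** mat 1), mat_S ** (mat_S ** (mat_S ** mat 1))}"
    using cd ab by (auto simp: mat2_eq_iff matrix_mult_nth_2 mat_S_def abcd[symmetric])
  then show ?thesis using one 1 2 3 by blast
qed

text \<open>The stabiliser of \<open>\<rho>\<close> consists of the powers of \<open>mat_U\<close>.\<close>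

lemma stabiliser_rho_induct:
  assumes \<gamma>: "\<gamma> \<in> SL2Z" and fx: "moebius_act \<gamma> rho = rho"
    and one: "P (mat 1)"
    and step: "\<And>\<delta>. \<delta> \<in> SL2Z \<Longrightarrow> moebius_act \<delta> rho = rho \<Longrightarrow> P \<delta> \<Longrightarrow> P (mat_U ** \<delta>)"
  shows "P \<gamma>"
proof -
  define a b c d where "a = \<gamma>$1$1" "b = \<gamma>$1$2" "c = \<gamma>$2$1" "d = \<gamma>$2$2"
  note abcd = this
  have det: "a * d - b * c = 1" using \<gamma> by (simp add: SL2Z_iff abcd)
  have eq: "of_int a * rho + of_int b = of_int c * (- 1 - rho) + of_int d * rho"
    using fx denom_nonzero[OF \<gamma>, of rho]
    by (simp add: moebius_act_eq divide_eq_eq denom_def abcd algebra_simps flip: rho_square)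
  have "(real_of_int a + c - d) * sqrt 3 = 0"
    using arg_cong[OF eq, of Im] by (simp add: rho_def field_simps)
  then have "real_of_int a = - c + d" by simp
  then have a: "a = d - c" by linarith
  have "real_of_int b = - c" using arg_cong[OF eq, of Re] a by (simp add: rho_def field_simps)
  then have b: "b = - c" by linarith
  have sq: "d\<^sup>2 - c * d + c\<^sup>2 = 1" using det a b by (simp add: power2_eq_square algebra_simps)
  have "(2 * d - c)\<^sup>2 + 3 * c\<^sup>2 = 4" "(2 * c - d)\<^sup>2 + 3 * d\<^sup>2 = 4"
    using sq by (simp_all add: power2_eq_square algebra_simps)
  then have "c\<^sup>2 \<le> 1" "d\<^sup>2 \<le> 1"
    using zero_le_power2[of "2 * d - c"] zero_le_power2[of "2 * c - d"] by linarith+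
  then have "\<bar>c\<bar> \<le> 1" "\<bar>d\<bar> \<le> 1" by (simp_all add: abs_square_le_1)
  then have "c \<in> {-1, 0, 1}" "d \<in> {-1, 0, 1}" by auto
  then have cd: "(c, d) \<in> {(0, 1), (1, 0), (0, -1), (-1, 0), (1, 1), (-1, -1)}"
    using sq by auto
  have fU: "moebius_act mat_U rho = rho"
  proof -
    have "rho + 1 \<noteq> 0"
      using denom_nonzero[OF mat_STU_in_SL2Z(2) rho_in_half_plane] by (simp add: denom_def mat_U_def)
    moreover have "rho * (rho + 1) = - 1"
      by (simp add: rho_square distrib_left)
    ultimately have "- 1 / (rho + 1) = rho"
      by (metis nonzero_mult_div_cancel_right)
    then show ?thesis
      by (simp add: moebius_act_eq denom_def mat_U_def)
  qed
  have mult_U: "mat_U ** mat2 p q r t = mat2 (- r) (- t) (p + r) (q + t)" for p q r t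
    by (simp add: mat2_eq_iff matrix_mult_nth_2 mat_U_def)
  define R where "R \<delta> \<longleftrightarrow> \<delta> \<in> SL2Z \<and> moebius_act \<delta> rho = rho \<and> P \<delta>" for \<delta>
  have R: "R (mat_U ** \<delta>)" if "R \<delta>" for \<delta>
    using that step[of \<delta>] by (simp add: R_def moebius_act_mult fU)
  have "mat 1 = mat2 1 0 0 1"
    by (simp add: mat2_eq_iff)
  then have R0: "R (mat2 1 0 0 1)"
    using one by (metis R_def SL2Z_one moebius_act_one)
  note R1 = R[OF R0, unfolded mult_U]
  note R2 = R[OF R1, unfolded mult_U]
  note R3 = R[OF R2, unfolded mult_U]
  note R4 = R[OF R3, unfolded mult_U]
  note R5 = R[OF R4, unfolded mult_U]
  have "\<gamma> = mat2 (d - c) (- c) c d"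
    using a b by (simp add: mat2_eq_iff abcd[symmetric])
  then have "R \<gamma>"
    using cd R0 R1 R2 R3 R4 R5 by auto
  then show ?thesis by (simp add: R_def)
qed

section \<open>The Weierstrass function of a lattice\<close>

text \<open>Termwise differentiation of a normally convergent series; finitely many terms are exempted
  from the majorant, which for lattice sums are the terms with a pole near the disc.\<close>

lemma has_field_derivative_infsum:
  fixes f f' :: "'i \<Rightarrow> complex \<Rightarrow> complex"
  assumes der: "\<And>p z. p \<in> I \<Longrightarrow> z \<in> S \<Longrightarrow> (f p has_field_derivative f' p z) (at z)"
    and z: "z \<in> S"
    and bound: "r > 0" "cball z r \<subseteq> S" "finite F" "M summable_on I"
      "\<And>p w. p \<in> I - F \<Longrightarrow> w \<in> cball z r \<Longrightarrow> norm (f p w) \<le> M p"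
  shows "((\<lambda>w. \<Sum>\<^sub>\<infinity>p\<in>I. f p w) has_field_derivative (\<Sum>\<^sub>\<infinity>p\<in>I. f' p z)) (at z)"
    and "(\<lambda>p. f' p z) summable_on I"
proof -
  have cont: "continuous_on (cball z r) (f p)" if "p \<in> I" for p
    by (rule DERIV_continuous_on[where D = "f' p"], rule has_field_derivative_at_within,
        rule der[OF that], rule subsetD[OF bound(2)])
  have "\<exists>B. \<forall>w\<in>cball z r. norm (f p w) \<le> B" if "p \<in> I" for p
  proof -
    have "bounded (f p ` cball z r)"
      by (intro compact_imp_bounded compact_continuous_image cont that compact_cball)
    then show ?thesis
      by (auto simp: bounded_iff)
  qed
  then obtain B where B: "\<And>p w. p \<in> I \<Longrightarrow> w \<in> cball z r \<Longrightarrow> norm (f p w) \<le> B p"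
    by metis
  define M' where "M' p = M p + (if p \<in> F then B p - M p else 0)" for p
  have fin: "(\<lambda>p. if p \<in> F then B p - M p else 0) summable_on I"
    by (rule finite_nonzero_values_imp_summable_on) (rule finite_subset[OF _ bound(3)], auto)
  have M'_sum: "M' summable_on I"
    unfolding M'_def by (rule summable_on_add[OF bound(4) fin])
  have M'_bound: "norm (f p w) \<le> M' p" if "p \<in> I" "w \<in> cball z r" for p w
    using B[OF that] bound(5)[of p w] that by (auto simp: M'_def)
  have lim: "uniform_limit (cball z r) (\<lambda>X w. \<Sum>p\<in>X. f p w) (\<lambda>w. \<Sum>\<^sub>\<infinity>p\<in>I. f p w)
      (finite_subsets_at_top I)"
    by (rule Weierstrass_m_test_general[OF M'_bound M'_sum])
  have "\<forall>\<^sub>F X in finite_subsets_at_top I. continuous_on (cball z r) (\<lambda>w. \<Sum>p\<in>X. f p w) \<and>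
      (\<forall>w\<in>ball z r. ((\<lambda>w. \<Sum>p\<in>X. f p w) has_field_derivative (\<Sum>p\<in>X. f' p w)) (at w))"
  proof (rule eventually_finite_subsets_at_top_weakI, intro conjI ballI)
    fix X assume X: "finite X" "X \<subseteq> I"
    then show "continuous_on (cball z r) (\<lambda>w. \<Sum>p\<in>X. f p w)"
      by (intro continuous_on_sum cont) auto
    fix w assume "w \<in> ball z r"
    then have "w \<in> S" using bound(2) ball_subset_cball by blast
    then show "((\<lambda>w. \<Sum>p\<in>X. f p w) has_field_derivative (\<Sum>p\<in>X. f' p w)) (at w)"
      by (intro DERIV_sum der) (use X in auto)
  qed
  then obtain g' where g':
    "\<And>w. w \<in> ball z r \<Longrightarrow> ((\<lambda>w. \<Sum>\<^sub>\<infinity>p\<in>I. f p w) has_field_derivative g' w) (at w) \<and>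
      ((\<lambda>X. \<Sum>p\<in>X. f' p w) \<longlongrightarrow> g' w) (finite_subsets_at_top I)"
    by (rule has_complex_derivative_uniform_limit[OF _ lim finite_subsets_at_top_neq_bot bound(1)]) blast
  have "z \<in> ball z r" using bound(1) by simp
  note der_z = conjunct1[OF g'[OF this]]
  have sum_z: "((\<lambda>p. f' p z) has_sum g' z) I"
    using conjunct2[OF g'[OF \<open>z \<in> ball z r\<close>]] unfolding has_sum_def .
  show "(\<lambda>p. f' p z) summable_on I"
    using sum_z by (rule has_sum_imp_summable)
  show "((\<lambda>w. \<Sum>\<^sub>\<infinity>p\<in>I. f p w) has_field_derivative (\<Sum>\<^sub>\<infinity>p\<in>I. f' p z)) (at z)"
    using der_z unfolding infsumI[OF sum_z] .
qed

text \<open>The size of an index of a lattice point, comparable to the norm of the point itself but independent of \<open>\<tau>\<close>.\<close>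

definition wgt :: "int \<times> int \<Rightarrow> real" where
  "wgt p = real_of_int (\<bar>fst p\<bar> + \<bar>snd p\<bar>)"

definition lat :: "complex \<Rightarrow> int \<times> int \<Rightarrow> complex" where
  "lat \<tau> p = of_int (fst p) * \<tau> + of_int (snd p)"

abbreviation nonzero_index :: "(int \<times> int) set" where
  "nonzero_index \<equiv> - {(0, 0)}"

lemma wgt_ge_1:
  assumes "p \<in> nonzero_index" shows "wgt p \<ge> 1"
proof -
  have "1 \<le> \<bar>fst p\<bar> + \<bar>snd p\<bar>"
    using assms by (cases p) auto
  then show ?thesis
    unfolding wgt_def by linarith
qed

lemma summable_on_int_powr:
  "(\<lambda>m::int. (1 + \<bar>real_of_int m\<bar>) powr (- 3 / 2)) summable_on UNIV"
proof -
  let ?f = "\<lambda>m::int. (1 + \<bar>real_of_int m\<bar>) powr (- 3 / 2)"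
  have s: "(\<lambda>n::nat. (1 + real n) powr (- 3 / 2)) summable_on UNIV"
  proof (rule summable_nonneg_imp_summable_on)
    have "summable (\<lambda>n. real n powr (- 3 / 2))"
      by (simp add: summable_real_powr_iff)
    then have "summable (\<lambda>n. real (Suc n) powr (- 3 / 2))"
      by (subst summable_Suc_iff)
    then show "summable (\<lambda>n::nat. (1 + real n) powr (- 3 / 2))"
      by simp
  qed simp
  have "?f summable_on range int"
    by (subst summable_on_reindex) (use s in \<open>auto simp: o_def\<close>)
  moreover have "?f summable_on (\<lambda>n. - int n) ` UNIV"
    by (subst summable_on_reindex) (use s in \<open>auto simp: o_def inj_on_def\<close>)
  ultimately have "?f summable_on (range int \<union> (\<lambda>n. - int n) ` UNIV)"
    by (rule summable_on_union)
  moreover have "range int \<union> (\<lambda>n. - int n) ` UNIV = UNIV"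
  proof -
    have "m \<in> range int \<union> (\<lambda>n. - int n) ` UNIV" for m
      by (cases m rule: int_cases2) auto
    then show ?thesis by blast
  qed
  ultimately show ?thesis by simp
qed

lemma summable_on_wgt: "(\<lambda>p. 1 / wgt p ^ 3) summable_on nonzero_index"
proof -
  let ?u = "\<lambda>m::int. (1 + \<bar>real_of_int m\<bar>) powr (- 3 / 2)"
  have "(\<lambda>p. norm (?u (fst p) * ?u (snd p))) summable_on (UNIV \<times> UNIV)"
    unfolding Infinite_Sum.abs_summable_on_Sigma_iff
    using summable_on_int_powr by (simp add: abs_mult infsum_cmult_right' summable_on_cmult_left summable_on_cmult_right)
  then have "(\<lambda>p. ?u (fst p) * ?u (snd p)) summable_on UNIV"
    by simp
  then have "(\<lambda>p. ?u (fst p) * ?u (snd p)) summable_on nonzero_index"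
    by (rule summable_on_subset_banach) simp
  then have s: "(\<lambda>p. 8 * (?u (fst p) * ?u (snd p))) summable_on nonzero_index"
    by (rule summable_on_cmult_right)
  show ?thesis
  proof (rule summable_on_comparison_test[OF s])
    fix p assume p: "p \<in> nonzero_index"
    let ?a = "1 + \<bar>real_of_int (fst p)\<bar>" and ?b = "1 + \<bar>real_of_int (snd p)\<bar>"
    have w: "wgt p \<ge> 1" by (rule wgt_ge_1[OF p])
    have "?a * ?b \<le> (2 * wgt p)\<^sup>2"
    proof -
      have "?a \<le> 2 * wgt p" "?b \<le> 2 * wgt p"
        using w by (auto simp: wgt_def)
      then show ?thesis
        unfolding power2_eq_square by (intro mult_mono) auto
    qed
    then have "(?a * ?b) powr (3 / 2) \<le> ((2 * wgt p)\<^sup>2) powr (3 / 2)"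
      by (intro powr_mono2) auto
    also have "(2 * wgt p)\<^sup>2 = (2 * wgt p) powr 2"
      using w by simp
    also have "((2 * wgt p) powr 2) powr (3 / 2) = (2 * wgt p) powr 3"
      unfolding powr_powr by simp
    also have "\<dots> = 8 * wgt p ^ 3"
      using w by (simp add: power_mult_distrib)
    finally have le: "(?a * ?b) powr (3 / 2) \<le> 8 * wgt p ^ 3" .
    have "1 / wgt p ^ 3 = 8 / (8 * wgt p ^ 3)" by simp
    also have "\<dots> \<le> 8 / (?a * ?b) powr (3 / 2)"
      using le w by (intro divide_left_mono) (auto intro!: mult_pos_pos)
    also have "\<dots> = 8 * (?u (fst p) * ?u (snd p))"
      by (simp add: powr_mult powr_minus divide_simps)
    finally show "1 / wgt p ^ 3 \<le> 8 * (?u (fst p) * ?u (snd p))" .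
    show "0 \<le> 1 / wgt p ^ 3" using w by simp
  qed
qed

lemma wgt_le_lat:
  assumes "A \<ge> 0" "B > 0"
  obtains K where "K > 0"
    "\<And>\<tau> p. \<bar>Re \<tau>\<bar> \<le> A \<Longrightarrow> Im \<tau> \<ge> B \<Longrightarrow> wgt p \<le> K * norm (lat \<tau> p)"
proof (rule that[of "1 + (A + 1) / B"])
  show "wgt p \<le> (1 + (A + 1) / B) * norm (lat \<tau> p)" if "\<bar>Re \<tau>\<bar> \<le> A" "Im \<tau> \<ge> B" for \<tau> p
    unfolding wgt_def lat_def by (rule lattice_norm_bound[OF assms that])
qed (use assms in \<open>auto intro!: add_pos_nonneg\<close>)

lemma finite_wgt_le: "finite {p. wgt p \<le> R}"
proof (rule finite_subset)
  show "{p. wgt p \<le> R} \<subseteq> {- \<lceil>R\<rceil>..\<lceil>R\<rceil>} \<times> {- \<lceil>R\<rceil>..\<lceil>R\<rceil>}"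
  proof
    fix p assume "p \<in> {p. wgt p \<le> R}"
    then have "\<bar>fst p\<bar> + \<bar>snd p\<bar> \<le> \<lceil>R\<rceil>" unfolding wgt_def mem_Collect_eq by linarith
    then show "p \<in> {- \<lceil>R\<rceil>..\<lceil>R\<rceil>} \<times> {- \<lceil>R\<rceil>..\<lceil>R\<rceil>}" by (cases p) auto
  qed
qed simp

lemma lat_add: "lat \<tau> (p + q) = lat \<tau> p + lat \<tau> q"
  by (simp add: lat_def algebra_simps)

lemma lat_uminus: "lat \<tau> (- p) = - lat \<tau> p"
  by (simp add: lat_def algebra_simps)

lemma lat_zero [simp]: "lat \<tau> (0, 0) = 0"
  by (simp add: lat_def)

locale half_plane_point =
  fixes \<tau> :: complex
  assumes \<tau>: "\<tau> \<in> upper_half_plane"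
begin

lemma Im_pos: "Im \<tau> > 0"
  using \<tau> by (simp add: upper_half_plane_def)

lemma lat_eq_iff: "lat \<tau> p = lat \<tau> q \<longleftrightarrow> p = q"
proof
  assume "lat \<tau> p = lat \<tau> q"
  then have "Im (lat \<tau> p) = Im (lat \<tau> q)" "Re (lat \<tau> p) = Re (lat \<tau> q)" by simp_all
  then show "p = q" using Im_pos by (auto simp: lat_def prod_eq_iff)
qed simp

lemma lat_eq_0_iff: "lat \<tau> p = 0 \<longleftrightarrow> p = (0, 0)"
  using lat_eq_iff[of p "(0, 0)"] by simp

lemma wgt_bound: "\<exists>K>0. \<forall>p. wgt p \<le> K * norm (lat \<tau> p)"
proof -
  obtain K where "K > 0" "\<And>t p. \<bar>Re t\<bar> \<le> \<bar>Re \<tau>\<bar> \<Longrightarrow> Im t \<ge> Im \<tau> \<Longrightarrow> wgt p \<le> K * norm (lat t p)"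
    using wgt_le_lat[of "\<bar>Re \<tau>\<bar>" "Im \<tau>"] Im_pos by auto
  then show ?thesis by auto
qed

lemma finite_lat_le: "finite {p. norm (lat \<tau> p) \<le> R}"
proof -
  obtain K where K: "K > 0" "\<And>p. wgt p \<le> K * norm (lat \<tau> p)"
    using wgt_bound by blast
  show ?thesis
  proof (rule finite_subset[OF _ finite_wgt_le[of "K * R"]], intro subsetI)
    fix p assume "p \<in> {p. norm (lat \<tau> p) \<le> R}"
    then have "K * norm (lat \<tau> p) \<le> K * R" using K(1) by simp
    then show "p \<in> {p. wgt p \<le> K * R}" using K(2)[of p] by simp
  qed
qed

definition Omega0 :: "complex set" where
  "Omega0 = - (lat \<tau> ` nonzero_index)"

definition Omega :: "complex set" where
  "Omega = - range (lat \<tau>)"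

lemma open_Compl_lat: "open (- (lat \<tau> ` X))"
proof -
  have "- (lat \<tau> ` X) = (\<Union>n. ball 0 (real n) - lat \<tau> ` (X \<inter> {p. norm (lat \<tau> p) \<le> real n}))"
  proof (intro equalityI subsetI)
    fix z assume z: "z \<in> - (lat \<tau> ` X)"
    obtain n where "norm z < real n" using reals_Archimedean2 by blast
    with z show "z \<in> (\<Union>n. ball 0 (real n) - lat \<tau> ` (X \<inter> {p. norm (lat \<tau> p) \<le> real n}))" by auto
  qed (auto simp: less_imp_le)
  also have "open \<dots>"
    by (intro open_UN ballI open_Diff finite_imp_closed finite_imageI finite_Int disjI2 finite_lat_le) auto
  finally show ?thesis .
qed

lemma open_Omega: "open Omega0" "open Omega"
  using open_Compl_lat by (simp_all add: Omega0_def Omega_def)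

lemma zero_in_Omega0 [simp]: "0 \<in> Omega0"
  using lat_eq_0_iff by (auto simp: Omega0_def)

lemma Omega_eq: "Omega = Omega0 - {0}"
  using lat_eq_0_iff by (auto simp: Omega0_def Omega_def image_iff)

lemma Omega_iff: "z \<in> Omega \<longleftrightarrow> z \<in> Omega0 \<and> z \<noteq> 0"
  by (auto simp: Omega_eq)

lemma Omega_translate: "z + lat \<tau> q \<in> Omega \<longleftrightarrow> z \<in> Omega"
proof -
  have "z + lat \<tau> q = lat \<tau> p \<longleftrightarrow> z = lat \<tau> (p - q)" for p
    using lat_add[of \<tau> "p - q" q] by (auto simp: algebra_simps)
  moreover have "z = lat \<tau> p \<longleftrightarrow> z + lat \<tau> q = lat \<tau> (p + q)" for p
    by (auto simp: lat_add)
  ultimately show ?thesis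
    unfolding Omega_def by (metis ComplD ComplI rangeE rangeI)
qed

lemma Omega_uminus: "- z \<in> Omega \<longleftrightarrow> z \<in> Omega"
proof -
  have "- z = lat \<tau> p \<longleftrightarrow> z = lat \<tau> (- p)" for p
    unfolding lat_uminus by (metis minus_minus)
  moreover have "z = lat \<tau> p \<longleftrightarrow> - z = lat \<tau> (- p)" for p
    unfolding lat_uminus by (metis minus_minus)
  ultimately show ?thesis
    unfolding Omega_def by blast
qed

lemma connected_Omega: "connected Omega"
  unfolding Omega_def
  by (intro path_connected_imp_connected path_connected_complement_countable) auto

text \<open>The part of \<open>\<Sum> 1 / (z - \<omega>)\<^sup>k\<close> over the lattice that is regular at \<open>0\<close>.\<close>

definition RR :: "nat \<Rightarrow> complex \<Rightarrow> complex" where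
  "RR k z = (\<Sum>\<^sub>\<infinity>p\<in>nonzero_index. 1 / (z - lat \<tau> p) ^ k)"

text \<open>The \<open>\<wp>\<close>-function without its polar part \<open>1 / z\<^sup>2\<close> at \<open>0\<close>.\<close>

definition wpr :: "complex \<Rightarrow> complex" where
  "wpr z = (\<Sum>\<^sub>\<infinity>p\<in>nonzero_index. 1 / (z - lat \<tau> p)\<^sup>2 - 1 / (lat \<tau> p)\<^sup>2)"

lemma majorant:
  assumes z: "z \<in> Omega0"
  obtains r F M where "r > 0" "cball z r \<subseteq> Omega0" "finite F" "M summable_on nonzero_index"
    "\<And>p w k. p \<in> nonzero_index - F \<Longrightarrow> w \<in> cball z r \<Longrightarrow> k \<ge> 3 \<Longrightarrow> norm (1 / (w - lat \<tau> p) ^ k) \<le> 2 ^ k * M p"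
    "\<And>p w. p \<in> nonzero_index - F \<Longrightarrow> w \<in> cball z r \<Longrightarrow> norm (1 / (w - lat \<tau> p)\<^sup>2 - 1 / (lat \<tau> p)\<^sup>2) \<le> M p"
proof -
  obtain K where K: "K > 0" "\<And>p. wgt p \<le> K * norm (lat \<tau> p)"
    using wgt_bound by blast
  obtain r0 where r0: "r0 > 0" "cball z r0 \<subseteq> Omega0"
    using open_Omega(1) z open_contains_cball by blast
  define r where "r = min r0 1"
  define R where "R = norm z + 1"
  have R: "R \<ge> 1" by (simp add: R_def)
  define F where "F = {p. norm (lat \<tau> p) \<le> 2 * R}"
  define M where "M p = (10 * R * K ^ 3) * (1 / wgt p ^ 3)" for p
  have cube: "1 / norm (lat \<tau> p) ^ 3 \<le> K ^ 3 * (1 / wgt p ^ 3)" if "p \<in> nonzero_index" for p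
  proof -
    have w: "wgt p > 0" using wgt_ge_1[OF that] by linarith
    have "wgt p ^ 3 \<le> (K * norm (lat \<tau> p)) ^ 3"
      using w K(2) by (intro power_mono) auto
    moreover have "norm (lat \<tau> p) > 0"
      using that lat_eq_0_iff by auto
    ultimately show ?thesis
      using w K(1) by (simp add: field_simps power_mult_distrib)
  qed
  have far: "norm (w - lat \<tau> p) \<ge> norm (lat \<tau> p) / 2" "norm (lat \<tau> p) > 2 * R" "norm w \<le> R"
    if "p \<in> nonzero_index - F" "w \<in> cball z r" for p w
  proof -
    have "dist z w \<le> 1" using that(2) by (simp add: r_def)
    then show w: "norm w \<le> R"
      using norm_triangle_ineq2[of w z] by (simp add: R_def dist_norm norm_minus_commute)
    show l: "norm (lat \<tau> p) > 2 * R" using that(1) by (simp add: F_def)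
    show "norm (w - lat \<tau> p) \<ge> norm (lat \<tau> p) / 2"
      using norm_triangle_ineq2[of "lat \<tau> p" w] w l by (simp add: norm_minus_commute)
  qed
  show ?thesis
  proof (rule that[of r F M])
    show "r > 0" "cball z r \<subseteq> Omega0" using r0 by (auto simp: r_def)
    show "finite F" unfolding F_def by (rule finite_lat_le)
    show "M summable_on nonzero_index"
      unfolding M_def by (intro summable_on_cmult_right summable_on_wgt)
    fix p w assume p: "p \<in> nonzero_index - F" and w: "w \<in> cball z r"
    let ?l = "norm (lat \<tau> p)"
    note f = far[OF p w]
    have l1: "?l > 1" using f(2) R by linarith
    show "norm (1 / (w - lat \<tau> p) ^ k) \<le> 2 ^ k * M p" if k: "k \<ge> 3" for k
    proof -
      have "norm (1 / (w - lat \<tau> p) ^ k) = 1 / norm (w - lat \<tau> p) ^ k"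
        by (simp add: norm_divide norm_power)
      also have "\<dots> \<le> 1 / (?l / 2) ^ k"
        using f l1 by (intro divide_left_mono power_mono mult_pos_pos zero_less_power) auto
      also have "\<dots> = 2 ^ k * (1 / ?l ^ k)"
        by (simp add: power_divide)
      also have "\<dots> \<le> 2 ^ k * (1 / ?l ^ 3)"
        using l1 k by (intro mult_left_mono divide_left_mono power_increasing mult_pos_pos zero_less_power) auto
      also have "\<dots> \<le> 2 ^ k * (1 * (K ^ 3 * (1 / wgt p ^ 3)))"
        using cube[of p] p by (intro mult_left_mono) auto
      also have "\<dots> \<le> 2 ^ k * (10 * R * (K ^ 3 * (1 / wgt p ^ 3)))"
        using R K(1) wgt_ge_1[of p] p by (intro mult_left_mono mult_right_mono) auto
      finally show ?thesis by (simp add: M_def)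
    qed
    show "norm (1 / (w - lat \<tau> p)\<^sup>2 - 1 / (lat \<tau> p)\<^sup>2) \<le> M p"
    proof -
      have nz: "w - lat \<tau> p \<noteq> 0" "lat \<tau> p \<noteq> 0" using f(1) l1 by auto
      have "1 / (w - lat \<tau> p)\<^sup>2 - 1 / (lat \<tau> p)\<^sup>2 =
          w * (2 * lat \<tau> p - w) / ((lat \<tau> p)\<^sup>2 * (w - lat \<tau> p)\<^sup>2)"
        using nz by (simp add: divide_simps) (simp add: power2_eq_square algebra_simps)
      then have "norm (1 / (w - lat \<tau> p)\<^sup>2 - 1 / (lat \<tau> p)\<^sup>2) =
          norm w * norm (2 * lat \<tau> p - w) / (?l\<^sup>2 * (norm (w - lat \<tau> p))\<^sup>2)"
        by (simp add: norm_mult norm_divide norm_power)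
      also have "\<dots> \<le> R * (5 / 2 * ?l) / (?l\<^sup>2 * (?l / 2)\<^sup>2)"
      proof (rule frac_le)
        have "norm (2 * lat \<tau> p - w) \<le> 5 / 2 * ?l"
          using norm_triangle_ineq4[of "2 * lat \<tau> p" w] f by (simp add: norm_mult)
        then show "norm w * norm (2 * lat \<tau> p - w) \<le> R * (5 / 2 * ?l)"
          using f R by (intro mult_mono) auto
        show "?l\<^sup>2 * (?l / 2)\<^sup>2 \<le> ?l\<^sup>2 * (norm (w - lat \<tau> p))\<^sup>2"
          using f l1 by (intro mult_left_mono power_mono) auto
        show "0 < ?l\<^sup>2 * (?l / 2)\<^sup>2"
          using l1 by (intro mult_pos_pos zero_less_power) auto
        show "0 \<le> R * (5 / 2 * ?l)"
          using R by simp
      qed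
      also have "\<dots> = 10 * R * (1 / ?l ^ 3)"
        using l1 by (simp add: field_simps power2_eq_square power3_eq_cube)
      also have "\<dots> \<le> 10 * R * (K ^ 3 * (1 / wgt p ^ 3))"
        using cube[of p] p R by (intro mult_left_mono) auto
      finally show ?thesis by (simp add: M_def)
    qed
  qed
qed

lemma DERIV_pole:
  fixes z c :: complex
  assumes "z \<noteq> c"
  shows "((\<lambda>z. 1 / (z - c) ^ k) has_field_derivative - of_nat k * (1 / (z - c) ^ Suc k)) (at z)"
proof (cases k)
  case (Suc n)
  have nz: "(z - c) ^ Suc n \<noteq> 0" using assms by simp
  have "((\<lambda>z. (z - c) ^ Suc n) has_field_derivative of_nat (Suc n) * (z - c) ^ n) (at z)"
    by (rule DERIV_cong[OF DERIV_power[OF DERIV_diff[OF DERIV_ident DERIV_const]]]) simp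
  from DERIV_inverse_fun[OF this nz]
  have "((\<lambda>z. inverse ((z - c) ^ Suc n)) has_field_derivative
      - (of_nat (Suc n) * (z - c) ^ n * inverse (((z - c) ^ Suc n) ^ Suc (Suc 0)))) (at z)" .
  note der = this
  have cancel: "- (S * w ^ n * inverse ((w ^ Suc n) ^ Suc (Suc 0))) = - S * (1 / w ^ Suc (Suc n))"
    if "w \<noteq> 0" for w S :: complex
  proof -
    have "(w ^ Suc n) ^ Suc (Suc 0) = w ^ n * w ^ Suc (Suc n)"
      by (simp add: algebra_simps)
    then have "S * w ^ n * inverse ((w ^ Suc n) ^ Suc (Suc 0)) = S * (w ^ n / (w ^ n * w ^ Suc (Suc n)))"
      by (simp only: divide_inverse mult.assoc)
    also have "w ^ n / (w ^ n * w ^ Suc (Suc n)) = 1 / w ^ Suc (Suc n)"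
      using that by (simp del: power_Suc)
    finally show ?thesis by simp
  qed
  have "- (of_nat (Suc n) * (z - c) ^ n * inverse (((z - c) ^ Suc n) ^ Suc (Suc 0))) =
      - of_nat (Suc n) * (1 / (z - c) ^ Suc (Suc n))"
    by (rule cancel) (use assms in simp)
  with der show ?thesis
    unfolding Suc by (simp only: inverse_eq_divide)
qed simp

lemma not_lat: "z \<in> Omega0 \<Longrightarrow> p \<in> nonzero_index \<Longrightarrow> z \<noteq> lat \<tau> p"
  by (auto simp: Omega0_def)

lemma RR_deriv:
  assumes z: "z \<in> Omega0" and k: "k \<ge> 3"
  shows "(RR k has_field_derivative - of_nat k * RR (Suc k) z) (at z)"
proof -
  obtain r F M where b: "r > 0" "cball z r \<subseteq> Omega0" "finite F" "M summable_on nonzero_index"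
    "\<And>p w k. p \<in> nonzero_index - F \<Longrightarrow> w \<in> cball z r \<Longrightarrow> k \<ge> 3 \<Longrightarrow> norm (1 / (w - lat \<tau> p) ^ k) \<le> 2 ^ k * M p"
    using majorant[OF z] by metis
  have "((\<lambda>w. \<Sum>\<^sub>\<infinity>p\<in>nonzero_index. 1 / (w - lat \<tau> p) ^ k) has_field_derivative
      (\<Sum>\<^sub>\<infinity>p\<in>nonzero_index. - of_nat k * (1 / (z - lat \<tau> p) ^ Suc k))) (at z)"
  proof (rule has_field_derivative_infsum(1)[OF _ z b(1-3), where M = "\<lambda>p. 2 ^ k * M p"])
    show "((\<lambda>z. 1 / (z - lat \<tau> p) ^ k) has_field_derivative - of_nat k * (1 / (w - lat \<tau> p) ^ Suc k)) (at w)"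
      if "p \<in> nonzero_index" "w \<in> Omega0" for p w
      by (rule DERIV_pole[OF not_lat[OF that(2,1)]])
  qed (use summable_on_cmult_right[OF b(4)] b(5)[OF _ _ k] in blast)+
  then show ?thesis
    unfolding RR_def infsum_cmult_right' .
qed

lemma wpr_deriv:
  assumes z: "z \<in> Omega0"
  shows "(wpr has_field_derivative - 2 * RR 3 z) (at z)"
    and "(\<lambda>p. 1 / (z - lat \<tau> p) ^ 3) summable_on nonzero_index"
proof -
  obtain r F M where b: "r > 0" "cball z r \<subseteq> Omega0" "finite F" "M summable_on nonzero_index"
    "\<And>p w. p \<in> nonzero_index - F \<Longrightarrow> w \<in> cball z r \<Longrightarrow> norm (1 / (w - lat \<tau> p)\<^sup>2 - 1 / (lat \<tau> p)\<^sup>2) \<le> M p"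
    using majorant[OF z] by metis
  have d: "((\<lambda>z. 1 / (z - lat \<tau> p)\<^sup>2 - 1 / (lat \<tau> p)\<^sup>2) has_field_derivative
      - 2 * (1 / (w - lat \<tau> p) ^ 3)) (at w)" if "p \<in> nonzero_index" "w \<in> Omega0" for p w
    using DERIV_diff[OF DERIV_pole[OF not_lat[OF that(2,1)], of 2] DERIV_const[of "1 / (lat \<tau> p)\<^sup>2"]]
    by (simp add: numeral_3_eq_3)
  note main = has_field_derivative_infsum[OF d z b(1-4)]
  have "((\<lambda>w. \<Sum>\<^sub>\<infinity>p\<in>nonzero_index. 1 / (w - lat \<tau> p)\<^sup>2 - 1 / (lat \<tau> p)\<^sup>2) has_field_derivative
      (\<Sum>\<^sub>\<infinity>p\<in>nonzero_index. - 2 * (1 / (z - lat \<tau> p) ^ 3))) (at z)"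
    by (rule main(1)) (assumption | (rule b(5); assumption))+
  then show "(wpr has_field_derivative - 2 * RR 3 z) (at z)"
    unfolding wpr_def RR_def infsum_cmult_right' .
  have "(\<lambda>p. - 2 * (1 / (z - lat \<tau> p) ^ 3)) summable_on nonzero_index"
    by (rule main(2)) (assumption | (rule b(5); assumption))+
  then have "(\<lambda>p. (- 1 / 2) * (- 2 * (1 / (z - lat \<tau> p) ^ 3))) summable_on nonzero_index"
    by (rule summable_on_cmult_right)
  then show "(\<lambda>p. 1 / (z - lat \<tau> p) ^ 3) summable_on nonzero_index"
    by simp
qed

lemma RR_summable:
  assumes z: "z \<in> Omega0" and k: "k \<ge> 3"
  shows "(\<lambda>p. 1 / (z - lat \<tau> p) ^ k) summable_on nonzero_index"
proof (cases "k = 3")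
  case False
  define j where "j = k - 1"
  have j: "k = Suc j" "j \<ge> 3" using False k by (auto simp: j_def)
  obtain r F M where b: "r > 0" "cball z r \<subseteq> Omega0" "finite F" "M summable_on nonzero_index"
    "\<And>p w k. p \<in> nonzero_index - F \<Longrightarrow> w \<in> cball z r \<Longrightarrow> k \<ge> 3 \<Longrightarrow> norm (1 / (w - lat \<tau> p) ^ k) \<le> 2 ^ k * M p"
    using majorant[OF z] by metis
  have "(\<lambda>p. - of_nat j * (1 / (z - lat \<tau> p) ^ Suc j)) summable_on nonzero_index"
  proof (rule has_field_derivative_infsum(2)[OF _ z b(1-3),
        where M = "\<lambda>p. 2 ^ j * M p" and f = "\<lambda>p z. 1 / (z - lat \<tau> p) ^ j"])
    show "((\<lambda>z. 1 / (z - lat \<tau> p) ^ j) has_field_derivative - of_nat j * (1 / (w - lat \<tau> p) ^ Suc j)) (at w)"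
      if "p \<in> nonzero_index" "w \<in> Omega0" for p w
      by (rule DERIV_pole[OF not_lat[OF that(2,1)]])
  qed (use summable_on_cmult_right[OF b(4)] b(5)[OF _ _ j(2)] in blast)+
  then have "(\<lambda>p. (- 1 / of_nat j) * (- of_nat j * (1 / (z - lat \<tau> p) ^ Suc j))) summable_on nonzero_index"
    by (rule summable_on_cmult_right)
  then show ?thesis using j by simp
qed (use wpr_deriv(2)[OF z] in simp)

lemma wpr_0 [simp]: "wpr 0 = 0"
  by (simp add: wpr_def)

lemma wpr_even: "wpr (- z) = wpr z"
proof -
  have "wpr (- z) = (\<Sum>\<^sub>\<infinity>p\<in>nonzero_index. 1 / (- z - lat \<tau> (- p))\<^sup>2 - 1 / (lat \<tau> (- p))\<^sup>2)"
    unfolding wpr_def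
    by (rule infsum_reindex_bij_witness[of _ uminus uminus]) (auto simp: uminus_prod_def prod_eq_iff)
  also have "\<dots> = wpr z"
    unfolding wpr_def lat_uminus by (intro infsum_cong) (auto simp: power2_commute)
  finally show ?thesis .
qed

lemma RR3_0: "RR 3 0 = 0"
proof -
  have "RR 3 0 = (\<Sum>\<^sub>\<infinity>p\<in>nonzero_index. 1 / (0 - lat \<tau> (- p)) ^ 3)"
    unfolding RR_def
    by (rule infsum_reindex_bij_witness[of _ uminus uminus]) (auto simp: uminus_prod_def prod_eq_iff)
  also have "\<dots> = (\<Sum>\<^sub>\<infinity>p\<in>nonzero_index. - 1 * (1 / (0 - lat \<tau> p) ^ 3))"
    unfolding lat_uminus by (intro infsum_cong) simp
  also have "\<dots> = - RR 3 0"
    unfolding infsum_cmult_right' RR_def by simp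
  finally show ?thesis by simp
qed

definition wp :: "complex \<Rightarrow> complex" where
  "wp z = 1 / z\<^sup>2 + wpr z"

text \<open>Up to constants, the derivatives of the \<open>\<wp>\<close>-function for \<open>k \<ge> 3\<close>, which are visibly periodic.\<close>

definition PP :: "nat \<Rightarrow> complex \<Rightarrow> complex" where
  "PP k z = (\<Sum>\<^sub>\<infinity>p. 1 / (z - lat \<tau> p) ^ k)"

lemma PP_eq:
  assumes "z \<in> Omega" "k \<ge> 3"
  shows "PP k z = 1 / z ^ k + RR k z"
proof -
  have U: "UNIV = insert (0, 0) nonzero_index" by auto
  have "z \<in> Omega0" using assms(1) by (simp add: Omega_iff)
  from RR_summable[OF this assms(2)] show ?thesis
    unfolding PP_def RR_def U by (subst infsum_insert) auto
qed

lemma PP_periodic: "PP k (z + lat \<tau> q) = PP k z"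
proof -
  have "PP k z = (\<Sum>\<^sub>\<infinity>p. 1 / (z - lat \<tau> (p - q)) ^ k)"
    unfolding PP_def
    by (rule infsum_reindex_bij_witness[of _ "\<lambda>p. p - q" "\<lambda>p. p + q"]) auto
  moreover have "z - lat \<tau> (p - q) = z + lat \<tau> q - lat \<tau> p" for p
    using lat_add[of \<tau> "p - q" q] by (simp add: algebra_simps)
  ultimately show ?thesis by (simp add: PP_def)
qed

lemma wp_deriv:
  assumes "z \<in> Omega"
  shows "(wp has_field_derivative - 2 * PP 3 z) (at z)"
proof -
  have z: "z \<in> Omega0" "z \<noteq> 0" using assms by (auto simp: Omega_iff)
  have "(wp has_field_derivative (- of_nat 2 * (1 / (z - 0) ^ Suc 2) + - 2 * RR 3 z)) (at z)"
    unfolding wp_def using DERIV_add[OF DERIV_pole[OF z(2), of 2] wpr_deriv(1)[OF z(1)]] by simp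
  then show ?thesis
    using PP_eq[OF assms, of 3] by (simp add: numeral_3_eq_3 algebra_simps)
qed

lemma wp_even: "wp (- z) = wp z"
  by (simp add: wp_def wpr_even)

text \<open>The period of an even function whose derivative is periodic cannot be a nonzero constant.\<close>

lemma wp_periodic:
  assumes "z \<in> Omega" shows "wp (z + lat \<tau> q) = wp z"
proof -
  have "((\<lambda>z. wp (z + lat \<tau> q) - wp z) has_field_derivative 0) (at w)" if w: "w \<in> Omega" for w
  proof -
    have "w + lat \<tau> q \<in> Omega" using w Omega_translate by simp
    then have "((\<lambda>z. wp (z + lat \<tau> q)) has_field_derivative - 2 * PP 3 (w + lat \<tau> q)) (at w)"
      using wp_deriv DERIV_shift by blast
    from DERIV_diff[OF this wp_deriv[OF w]] show ?thesis
      by (simp add: PP_periodic)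
  qed
  then obtain c where c: "\<And>w. w \<in> Omega \<Longrightarrow> wp (w + lat \<tau> q) - wp w = c"
    using has_field_derivative_0_imp_constant_on[of Omega "\<lambda>z. wp (z + lat \<tau> q) - wp z"]
      connected_Omega open_Omega(2) unfolding constant_on_def by blast
  have "- (z + lat \<tau> q) \<in> Omega" using assms by (simp only: Omega_uminus Omega_translate)
  from c[OF this] have "wp z - wp (z + lat \<tau> q) = c"
    using wp_even[of z] wp_even[of "z + lat \<tau> q"] by (simp add: algebra_simps)
  with c[OF assms] have "2 * (wp (z + lat \<tau> q) - wp z) = 0" by (simp add: algebra_simps)
  then show ?thesis by simp
qed

end

section \<open>The differential equation of the Weierstrass function\<close>

text \<open>Second derivative of a power times a holomorphic function, in closed form.\<close>

lemma second_deriv_power_mult: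
  assumes g: "g holomorphic_on ball 0 \<rho>" "\<rho> > 0"
    and eq: "\<And>z. z \<in> ball 0 \<rho> \<Longrightarrow> \<phi> z = z ^ m * g z"
    and d1: "\<And>z. z \<in> ball 0 \<rho> \<Longrightarrow> (\<phi> has_field_derivative \<phi>1 z) (at z)"
    and d2: "\<And>z. z \<in> ball 0 \<rho> \<Longrightarrow> (\<phi>1 has_field_derivative \<phi>2 z) (at z)"
    and m: "m \<ge> 2" and z: "z \<in> ball 0 \<rho>"
  shows "\<phi>2 z = z ^ (m - 2) * (of_nat (m * (m - 1)) * g z + 2 * of_nat m * z * deriv g z
      + z\<^sup>2 * deriv (deriv g) z)"
proof -
  have op: "open (ball (0::complex) \<rho>)" by simp
  have g1: "(g has_field_derivative deriv g w) (at w)" if "w \<in> ball 0 \<rho>" for w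
    using holomorphic_derivI[OF g(1) op that] .
  have g2: "(deriv g has_field_derivative deriv (deriv g) w) (at w)" if "w \<in> ball 0 \<rho>" for w
    using holomorphic_derivI[OF holomorphic_deriv[OF g(1) op] op that] .
  obtain n where n: "m = Suc (Suc n)"
    using m by (metis Suc_le_D numeral_2_eq_2 Suc_le_mono)
  have pw: "((\<lambda>w. w ^ k) has_field_derivative of_nat k * w ^ (k - 1)) (at w)" for k and w :: complex
    by (rule DERIV_cong[OF DERIV_power[OF DERIV_ident]]) simp
  have phi1: "\<phi>1 w = of_nat m * w ^ Suc n * g w + w ^ m * deriv g w" if w: "w \<in> ball 0 \<rho>" for w
  proof -
    have "((\<lambda>w. w ^ m * g w) has_field_derivative of_nat m * w ^ (m - 1) * g w + deriv g w * w ^ m) (at w)"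
      by (rule DERIV_mult[OF pw g1[OF w]])
    then have "(\<phi> has_field_derivative of_nat m * w ^ (m - 1) * g w + deriv g w * w ^ m) (at w)"
      by (rule has_field_derivative_transform_within_open[OF _ op w]) (simp add: eq)
    from DERIV_unique[OF d1[OF w] this] show ?thesis
      by (simp add: n mult.commute)
  qed
  have "((\<lambda>w. of_nat m * (w ^ Suc n * g w) + w ^ m * deriv g w) has_field_derivative
      of_nat m * (of_nat (Suc n) * z ^ (Suc n - 1) * g z + deriv g z * z ^ Suc n)
      + (of_nat m * z ^ (m - 1) * deriv g z + deriv (deriv g) z * z ^ m)) (at z)"
    by (rule DERIV_add[OF DERIV_cmult[OF DERIV_mult[OF pw g1[OF z]]] DERIV_mult[OF pw g2[OF z]]])
  then have "(\<phi>1 has_field_derivative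
      of_nat m * (of_nat (Suc n) * z ^ (Suc n - 1) * g z + deriv g z * z ^ Suc n)
      + (of_nat m * z ^ (m - 1) * deriv g z + deriv (deriv g) z * z ^ m)) (at z)"
    by (rule has_field_derivative_transform_within_open[OF _ op z]) (simp add: phi1 mult.assoc)
  from DERIV_unique[OF d2[OF z] this] show ?thesis
    by (simp add: n power2_eq_square algebra_simps)
qed

text \<open>Near \<open>0\<close> the difference of two solutions of the equation for the \<open>\<wp>\<close>-function vanishes to an
  order \<open>n\<close> with \<open>n (n - 1) = 12\<close>, so its fourth derivative decides whether it is zero.\<close>

lemma resonant_ode_unique:
  assumes e: "e > 0"
    and d1: "\<And>z. z \<in> ball 0 e \<Longrightarrow> (\<delta> has_field_derivative \<delta>1 z) (at z)"
    and d2: "\<And>z. z \<in> ball 0 e \<Longrightarrow> (\<delta>1 has_field_derivative \<delta>2 z) (at z)"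
    and d3: "\<And>z. z \<in> ball 0 e \<Longrightarrow> (\<delta>2 has_field_derivative \<delta>3 z) (at z)"
    and d4: "\<And>z. z \<in> ball 0 e \<Longrightarrow> (\<delta>3 has_field_derivative \<delta>4 z) (at z)"
    and init: "\<delta> 0 = 0" "\<delta>4 0 = 0"
    and h: "continuous_on (ball 0 e) h"
    and ode: "\<And>z. z \<in> ball 0 e \<Longrightarrow> z\<^sup>2 * \<delta>2 z = (12 + z\<^sup>2 * h z) * \<delta> z"
    and z: "z \<in> ball 0 e"
  shows "\<delta> z = (0::complex)"
proof (rule ccontr)
  assume nz: "\<delta> z \<noteq> 0"
  have hol: "\<delta> holomorphic_on ball 0 e"
    unfolding holomorphic_on_open[OF open_ball] using d1 by blast
  have e0: "0 \<in> ball (0::complex) e" using e by simp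
  have nonconst: "\<not> \<delta> constant_on ball 0 e"
    using nz z init(1) e0 unfolding constant_on_def by metis
  obtain g \<rho> n where n: "0 < n" and \<rho>: "0 < \<rho>" "ball 0 \<rho> \<subseteq> ball (0::complex) e"
    and g: "g holomorphic_on ball 0 \<rho>" and fac: "\<And>w. w \<in> ball 0 \<rho> \<Longrightarrow> \<delta> w = (w - 0) ^ n * g w"
    and gnz: "\<And>w. w \<in> ball 0 \<rho> \<Longrightarrow> g w \<noteq> 0"
    by (rule holomorphic_factor_zero_nonconstant[OF hol open_ball connected_ball e0 init(1) nonconst]) blast
  define m where "m = Suc (Suc n)"
  define k where "k w = of_nat (n * (n - 1)) * g w + 2 * of_nat n * w * deriv g w + w\<^sup>2 * deriv (deriv g) w" for w
  have op: "open (ball (0::complex) \<rho>)" by simp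
  have g': "deriv g holomorphic_on ball 0 \<rho>" "deriv (deriv g) holomorphic_on ball 0 \<rho>"
    by (rule holomorphic_deriv[OF g op], rule holomorphic_deriv[OF holomorphic_deriv[OF g op] op])
  have k: "k holomorphic_on ball 0 \<rho>"
    unfolding k_def by (intro holomorphic_intros g g')
  have in_e: "w \<in> ball 0 e" if "w \<in> ball 0 \<rho>" for w :: complex
    using \<rho>(2) that by blast
  have d0: "0 \<in> ball (0::complex) \<rho>" using \<rho> by simp
  have cl: "(f \<longlongrightarrow> f 0) (at 0)" if "continuous_on (ball 0 \<rho>) f" for f :: "complex \<Rightarrow> complex"
  proof -
    have "isCont f 0"
      using that d0 unfolding continuous_on_eq_continuous_at[OF op] by blast
    then show ?thesis by (simp only: isCont_def)
  qed
  have unique: "f 0 = f' 0"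
    if "continuous_on (ball 0 \<rho>) f" "continuous_on (ball 0 \<rho>) f'"
      "\<And>w. w \<in> ball 0 \<rho> - {0} \<Longrightarrow> f w = f' w" for f f' :: "complex \<Rightarrow> complex"
  proof (rule tendsto_unique[OF at_neq_bot cl[OF that(1)]])
    have "\<forall>\<^sub>F w in at (0::complex). w \<in> ball 0 \<rho> - {0}"
      using eventually_at_in_open[OF op] \<rho>(1) by simp
    then have "\<forall>\<^sub>F w in at 0. f w = f' w"
      by (rule eventually_mono) (rule that(3))
    from tendsto_cong[OF this] cl[OF that(2)] show "(f \<longlongrightarrow> f' 0) (at 0)" by blast
  qed
  have rhs: "continuous_on (ball 0 \<rho>) (\<lambda>w. (12 + w\<^sup>2 * h w) * g w)"
    by (intro continuous_intros continuous_on_subset[OF h \<rho>(2)] holomorphic_on_imp_continuous_on[OF g])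
  have fac': "\<delta> w = w ^ n * g w" if "w \<in> ball 0 \<rho>" for w using fac[OF that] by simp
  have "\<not> n = 1"
  proof
    assume n1: "n = 1"
    \<comment> \<open>at order one the right-hand side of the equation has order one, the left-hand side at least two\<close>
    have e1: "w * \<delta>2 w = (12 + w\<^sup>2 * h w) * g w" if "w \<in> ball 0 \<rho> - {0}" for w
    proof -
      have "w * (w * \<delta>2 w) = w\<^sup>2 * \<delta>2 w"
        by (simp only: power2_eq_square mult.assoc)
      also have "\<dots> = (12 + w\<^sup>2 * h w) * (w * g w)"
        using ode[OF in_e, of w] fac'[of w] that n1 by simp
      also have "\<dots> = w * ((12 + w\<^sup>2 * h w) * g w)"
        by (simp only: mult_ac)
      finally show ?thesis
        using that mult_left_cancel[of w] by blast
    qed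
    have "continuous_on (ball 0 \<rho>) \<delta>2"
      by (rule DERIV_continuous_on[where D = \<delta>3], rule has_field_derivative_at_within, rule d3, rule in_e)
    then have c1: "continuous_on (ball 0 \<rho>) (\<lambda>w. w * \<delta>2 w)"
      by (rule continuous_on_mult[OF continuous_on_id])
    have "0 * \<delta>2 0 = (12 + 0\<^sup>2 * h 0) * g 0"
      by (rule unique[OF c1 rhs e1])
    then show False using gnz[OF d0] by simp
  qed
  with n have n2: "n \<ge> 2" by simp
  have del2: "\<delta>2 w = w ^ (n - 2) * k w" if "w \<in> ball 0 \<rho>" for w
    unfolding k_def by (rule second_deriv_power_mult[OF g \<rho>(1) fac' d1[OF in_e] d2[OF in_e] n2 that])
  have kg: "k w = (12 + w\<^sup>2 * h w) * g w" if w: "w \<in> ball 0 \<rho> - {0}" for w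
  proof -
    obtain n0 where "n = 2 + n0"
      using n2 le_Suc_ex by blast
    then have "w\<^sup>2 * w ^ (n - 2) = w ^ n"
      by (simp add: power_add power2_eq_square)
    then have "w ^ n * k w = w\<^sup>2 * (w ^ (n - 2) * k w)"
      by (simp only: mult.assoc[symmetric])
    also have "\<dots> = (12 + w\<^sup>2 * h w) * (w ^ n * g w)"
      using ode[OF in_e, of w] del2[of w] fac'[of w] w by simp
    also have "\<dots> = w ^ n * ((12 + w\<^sup>2 * h w) * g w)"
      by (simp only: mult_ac)
    finally have "w ^ n * k w = w ^ n * ((12 + w\<^sup>2 * h w) * g w)" .
    then show ?thesis using w by simp
  qed
  have "k 0 = (12 + 0\<^sup>2 * h 0) * g 0"
    using unique[OF holomorphic_on_imp_continuous_on[OF k] rhs kg] .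
  then have "of_nat (n * (n - 1)) * g 0 = of_nat 12 * g 0" by (simp add: k_def)
  then have "(of_nat (n * (n - 1)) :: complex) = of_nat 12"
    using mult_right_cancel[OF gnz[OF d0]] by blast
  then have n12: "n * (n - 1) = 12" by (simp only: of_nat_eq_iff)
  have "n = 4"
  proof (rule ccontr)
    assume "n \<noteq> 4"
    then consider "n \<le> 3" | "n \<ge> 5" by linarith
    then show False
    proof cases
      case 1
      then have "n * (n - 1) \<le> 3 * 2" by (intro mult_le_mono) auto
      then show False using n12 by simp
    next
      case 2
      then have "5 * 4 \<le> n * (n - 1)" by (intro mult_le_mono) auto
      then show False using n12 by simp
    qed
  qed
  then have "\<delta>2 w = w ^ 2 * k w" if "w \<in> ball 0 \<rho>" for w using del2[OF that] by simp
  from second_deriv_power_mult[OF k \<rho>(1) this d3[OF in_e] d4[OF in_e] order_refl d0]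
  have "\<delta>4 0 = 2 * k 0" by simp
  then have "k 0 = 0" using init(2) by simp
  moreover have "k 0 = 12 * g 0" using n12 unfolding k_def by simp
  ultimately show False using gnz[OF d0] by simp
qed

definition eisenstein :: "nat \<Rightarrow> complex \<Rightarrow> complex" where
  "eisenstein k \<tau> = (\<Sum>\<^sub>\<infinity>p\<in>nonzero_index. 1 / lat \<tau> p ^ k)"

context half_plane_point
begin

lemma RR_0:
  assumes "even k" shows "RR k 0 = eisenstein k \<tau>"
  unfolding RR_def eisenstein_def using assms by (simp add: power_minus_even)

lemma wpr_holomorphic: "wpr holomorphic_on Omega0"
  using wpr_deriv(1) open_Omega(1) by (auto simp: holomorphic_on_open)

lemma RR_holomorphic: "k \<ge> 3 \<Longrightarrow> RR k holomorphic_on Omega0"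
  using RR_deriv open_Omega(1) by (auto simp: holomorphic_on_open)

lemma wpr_derivs:
  assumes "z \<in> Omega0"
  shows "(wpr has_field_derivative - 2 * RR 3 z) (at z)"
    "((\<lambda>z. - 2 * RR 3 z) has_field_derivative 6 * RR 4 z) (at z)"
    "((\<lambda>z. 6 * RR 4 z) has_field_derivative - 24 * RR 5 z) (at z)"
    "((\<lambda>z. - 24 * RR 5 z) has_field_derivative 120 * RR 6 z) (at z)"
  using wpr_deriv(1)[OF assms] DERIV_cmult[OF RR_deriv[OF assms, of 3], of "- 2"]
    DERIV_cmult[OF RR_deriv[OF assms, of 4], of 6] DERIV_cmult[OF RR_deriv[OF assms, of 5], of "- 24"]
  by simp_all

lemma ball_in_Omega0: obtains e where "e > 0" "ball 0 e \<subseteq> Omega0"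
  using open_Omega(1) zero_in_Omega0 open_contains_ball by metis

lemma wpr_div_square:
  obtains q where "q holomorphic_on Omega0" "\<And>z. z \<in> Omega0 \<Longrightarrow> wpr z = z\<^sup>2 * q z"
    "q 0 = 3 * eisenstein 4 \<tau>"
proof -
  have int: "0 \<in> interior Omega0" using open_Omega(1) by (simp add: interior_open)
  define q1 where "q1 z = (if z = 0 then deriv wpr 0 else (wpr z - wpr 0) / (z - 0))" for z
  have q1: "q1 holomorphic_on Omega0"
    unfolding q1_def by (rule pole_lemma[OF wpr_holomorphic int])
  define q where "q z = (if z = 0 then deriv q1 0 else (q1 z - q1 0) / (z - 0))" for z
  have q: "q holomorphic_on Omega0"
    unfolding q_def by (rule pole_lemma[OF q1 int])
  have "deriv wpr 0 = 0"
    using DERIV_imp_deriv[OF wpr_deriv(1)[OF zero_in_Omega0]] RR3_0 by simp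
  then have "q1 0 = 0" by (simp add: q1_def)
  then have eq: "wpr z = z\<^sup>2 * q z" if "z \<in> Omega0" for z
    by (simp add: q_def q1_def power2_eq_square)
  obtain e where e: "e > 0" "ball 0 e \<subseteq> Omega0" by (rule ball_in_Omega0)
  have sub: "z \<in> Omega0" if "z \<in> ball 0 e" for z using e(2) that by blast
  have "6 * RR 4 0 = 0 ^ (2 - 2) * (of_nat (2 * (2 - 1)) * q 0 + 2 * of_nat 2 * 0 * deriv q 0
      + 0\<^sup>2 * deriv (deriv q) 0)"
    by (rule second_deriv_power_mult[OF holomorphic_on_subset[OF q e(2)] e(1) eq[OF sub]
          wpr_derivs(1)[OF sub] wpr_derivs(2)[OF sub]]) (use e in auto)
  then have "q 0 = 3 * eisenstein 4 \<tau>" by (simp add: RR_0)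
  with that q eq show ?thesis by blast
qed

text \<open>The difference of both sides of the differential equation extends to an entire doubly periodic
  function with value \<open>0\<close> at \<open>0\<close>.\<close>

lemma wp_ode:
  assumes "z \<in> Omega"
  shows "6 * PP 4 z - 6 * (wp z)\<^sup>2 + 30 * eisenstein 4 \<tau> = 0"
proof -
  obtain q where q: "q holomorphic_on Omega0" "\<And>z. z \<in> Omega0 \<Longrightarrow> wpr z = z\<^sup>2 * q z"
    "q 0 = 3 * eisenstein 4 \<tau>" using wpr_div_square by blast
  define f where "f z = 6 * PP 4 z - 6 * (wp z)\<^sup>2 + 30 * eisenstein 4 \<tau>" for z
  define F where "F z = 6 * RR 4 z - 12 * q z - 6 * (wpr z)\<^sup>2 + 30 * eisenstein 4 \<tau>" for z
  define f' where "f' z = (if z \<in> Omega then f z else 0)" for z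
  have F: "F holomorphic_on Omega0"
    unfolding F_def by (intro holomorphic_intros RR_holomorphic q(1) wpr_holomorphic) simp
  have F0: "F 0 = 0" by (simp add: F_def q(3) RR_0)
  have fF: "f z = F z" if "z \<in> Omega" for z
  proof -
    have z: "z \<in> Omega0" "z \<noteq> 0" using that by (auto simp: Omega_iff)
    have "6 * (wp z)\<^sup>2 = 6 * (1 / z ^ 4 + 2 * (wpr z / z\<^sup>2) + (wpr z)\<^sup>2)"
      by (simp add: wp_def power2_eq_square power4_eq_xxxx algebra_simps)
    moreover have "wpr z / z\<^sup>2 = q z" using q(2)[OF z(1)] z(2) by simp
    ultimately show ?thesis
      by (simp add: f_def F_def PP_eq[OF that] algebra_simps)
  qed
  have f_per: "f (z + lat \<tau> p) = f z" if "z \<in> Omega" for z p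
    by (simp add: f_def PP_periodic wp_periodic[OF that])
  have f'_per: "f' (z + lat \<tau> p) = f' z" for z p
    by (simp add: f'_def Omega_translate f_per)
  have f'F: "f' z = F z" if "z \<in> Omega0" for z
    using that fF F0 by (cases "z = 0") (auto simp: f'_def Omega_iff)
  have "f' holomorphic_on UNIV"
  proof -
    have "\<exists>D. (f' has_field_derivative D) (at z)" for z
    proof (cases "z \<in> Omega")
      case True
      then have z: "z \<in> Omega0" by (simp add: Omega_iff)
      obtain D where "(F has_field_derivative D) (at z)"
        using F[unfolded holomorphic_on_open[OF open_Omega(1)]] z by blast
      then have "(f' has_field_derivative D) (at z)"
        by (rule has_field_derivative_transform_within_open[OF _ open_Omega(1) z]) (simp add: f'F)
      then show ?thesis by blast
    next
      case False
      then obtain p where p: "z = lat \<tau> p" by (auto simp: Omega_def)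
      obtain D where "(F has_field_derivative D) (at 0)"
        using F[unfolded holomorphic_on_open[OF open_Omega(1)]] zero_in_Omega0 by blast
      then have "(f' has_field_derivative D) (at 0)"
        by (rule has_field_derivative_transform_within_open[OF _ open_Omega(1) zero_in_Omega0]) (simp add: f'F)
      then have "(f' has_field_derivative D) (at (z + lat \<tau> (- p)))"
        by (simp add: p lat_uminus)
      then have "((\<lambda>w. f' (w + lat \<tau> (- p))) has_field_derivative D) (at z)"
        by (simp only: DERIV_shift)
      then show ?thesis by (auto simp: f'_per)
    qed
    then show ?thesis by (simp add: holomorphic_on_open)
  qed
  moreover have "bounded (range f')"
  proof -
    define Q where "Q = (\<lambda>(s, t). of_real s * \<tau> + of_real t) ` ({0..1} \<times> {0..1::real})"
    have "compact Q"
      unfolding Q_def by (intro compact_continuous_image compact_Times)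
        (auto simp: case_prod_unfold intro!: continuous_intros)
    then have "compact (f' ` Q)"
      using \<open>f' holomorphic_on UNIV\<close>
      by (intro compact_continuous_image holomorphic_on_imp_continuous_on)
        (auto intro: holomorphic_on_subset)
    moreover have "range f' \<subseteq> f' ` Q"
    proof
      fix y assume "y \<in> range f'"
      then obtain z where y: "y = f' z" by blast
      define s where "s = Im z / Im \<tau>"
      define t where "t = Re z - s * Re \<tau>"
      have z: "z = of_real s * \<tau> + of_real t"
        using Im_pos by (simp add: complex_eq_iff s_def t_def)
      have "z = (of_real (frac s) * \<tau> + of_real (frac t)) + lat \<tau> (\<lfloor>s\<rfloor>, \<lfloor>t\<rfloor>)"
        by (simp add: z lat_def frac_def algebra_simps)
      then have "y = f' (of_real (frac s) * \<tau> + of_real (frac t))"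
        using f'_per y by metis
      moreover have "of_real (frac s) * \<tau> + of_real (frac t) \<in> Q"
        unfolding Q_def by (intro image_eqI[of _ _ "(frac s, frac t)"])
          (auto simp: frac_ge_0 less_imp_le[OF frac_lt_1])
      ultimately show "y \<in> f' ` Q" by blast
    qed
    ultimately show ?thesis
      using compact_imp_bounded bounded_subset by blast
  qed
  ultimately have "f' constant_on UNIV" by (rule Liouville_theorem)
  then have "f' z = f' 0" unfolding constant_on_def by (metis UNIV_I)
  also have "f' 0 = 0" by (simp add: f'F F0)
  finally show ?thesis using assms by (simp add: f'_def f_def)
qed

text \<open>The equation \<open>\<wp>'' = 6 \<wp>\<^sup>2 - 30 G\<^sub>4\<close>, written for the regular part of \<open>\<wp>\<close>.\<close>

lemma wpr_ode:
  assumes z: "z \<in> Omega0"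
  shows "z\<^sup>2 * (6 * RR 4 z) = 12 * wpr z + 6 * z\<^sup>2 * (wpr z)\<^sup>2 - 30 * eisenstein 4 \<tau> * z\<^sup>2"
proof (cases "z = 0")
  case False
  then have zO: "z \<in> Omega" using z by (simp add: Omega_iff)
  have "z\<^sup>2 * (6 * (1 / z ^ 4 + RR 4 z) - 6 * (1 / z\<^sup>2 + wpr z)\<^sup>2 + 30 * eisenstein 4 \<tau>) = 0"
    using wp_ode[OF zO] by (simp add: PP_eq[OF zO] wp_def)
  moreover have "z\<^sup>2 * (6 * (1 / z ^ 4 + RR 4 z) - 6 * (1 / z\<^sup>2 + wpr z)\<^sup>2 + 30 * eisenstein 4 \<tau>) =
      z\<^sup>2 * (6 * RR 4 z) - 12 * wpr z - 6 * z\<^sup>2 * (wpr z)\<^sup>2 + 30 * eisenstein 4 \<tau> * z\<^sup>2"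
    using False by (simp add: field_simps power2_eq_square power4_eq_xxxx)
  ultimately show ?thesis by (simp add: algebra_simps)
qed simp

lemma wp_pole:
  shows "((\<lambda>z. (z - lat \<tau> p)\<^sup>2 * wp z) \<longlongrightarrow> 1) (at (lat \<tau> p))"
proof -
  define w where "w = lat \<tau> p"
  have "(wpr \<longlongrightarrow> wpr 0) (at 0)"
    using DERIV_isCont[OF wpr_deriv(1)[OF zero_in_Omega0]] by (simp add: isCont_def)
  then have lim: "((\<lambda>z. 1 + z\<^sup>2 * wpr z) \<longlongrightarrow> 1 + 0\<^sup>2 * wpr 0) (at 0)"
    by (intro tendsto_intros)
  have ev: "\<forall>\<^sub>F z in at 0. 1 + z\<^sup>2 * wpr z = z\<^sup>2 * wp (z + w)"
    using eventually_at_in_open[OF open_Omega(1) zero_in_Omega0]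
  proof (rule eventually_mono)
    fix z assume "z \<in> Omega0 - {0}"
    then have "z \<in> Omega" by (simp add: Omega_iff)
    from wp_periodic[OF this, of p] show "1 + z\<^sup>2 * wpr z = z\<^sup>2 * wp (z + w)"
      unfolding w_def using \<open>z \<in> Omega0 - {0}\<close> by (simp add: wp_def[of z] distrib_left)
  qed
  have "((\<lambda>z. z\<^sup>2 * wp (z + w)) \<longlongrightarrow> 1) (at 0)"
    using lim[unfolded tendsto_cong[OF ev]] by simp
  then have "((\<lambda>h. (w + h - w)\<^sup>2 * wp (w + h)) \<longlongrightarrow> 1) (at 0)"
    by (simp add: add.commute)
  then show ?thesis
    unfolding w_def[symmetric] by (rule LIM_offset_zero_cancel)
qed

lemma wp_continuous: "z \<in> Omega \<Longrightarrow> isCont wp z"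
  using wp_deriv DERIV_isCont by blast

end

section \<open>Eisenstein series\<close>

lemma eisenstein_summable:
  assumes "\<tau> \<in> upper_half_plane" "k \<ge> 3"
  shows "(\<lambda>p. 1 / lat \<tau> p ^ k) summable_on nonzero_index"
proof -
  interpret half_plane_point \<tau> by standard (rule assms)
  have "(\<lambda>p. (- 1) ^ k * (1 / (0 - lat \<tau> p) ^ k)) summable_on nonzero_index"
    by (intro summable_on_cmult_right RR_summable) (use assms in auto)
  moreover have "(- 1) ^ k * (1 / (0 - lat \<tau> p) ^ k) = 1 / lat \<tau> p ^ k" for p
    by (cases "even k") (auto simp: power_minus_even power_minus_odd)
  ultimately show ?thesis by simp
qed

lemma lat_pow_bound:
  assumes K: "K > 0" "wgt p \<le> K * norm (lat \<tau> p)" and p: "p \<in> nonzero_index" and k: "k \<ge> 3"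
  shows "norm (1 / lat \<tau> p ^ k) \<le> K ^ k * (1 / wgt p ^ 3)"
proof -
  have w: "wgt p \<ge> 1" by (rule wgt_ge_1[OF p])
  have "0 < K * norm (lat \<tau> p)" using K(2) w by linarith
  then have l: "norm (lat \<tau> p) > 0" using K(1) by (simp add: zero_less_mult_iff)
  have "wgt p ^ 3 \<le> wgt p ^ k" using w k by (intro power_increasing)
  also have "\<dots> \<le> (K * norm (lat \<tau> p)) ^ k" using w K(2) by (intro power_mono) auto
  finally have "wgt p ^ 3 \<le> K ^ k * norm (lat \<tau> p) ^ k" by (simp add: power_mult_distrib)
  moreover have "0 < wgt p ^ 3" "0 < norm (lat \<tau> p) ^ k" using w l by auto
  ultimately have "1 / norm (lat \<tau> p) ^ k \<le> K ^ k * (1 / wgt p ^ 3)"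
    by (simp add: field_simps)
  then show ?thesis by (simp add: norm_divide norm_power)
qed

lemma eisenstein_holomorphic:
  assumes k: "k \<ge> 3" shows "eisenstein k holomorphic_on upper_half_plane"
proof -
  have "\<exists>D. (eisenstein k has_field_derivative D) (at \<tau>)" if \<tau>: "\<tau> \<in> upper_half_plane" for \<tau>
  proof -
    have pos: "Im \<tau> > 0" using \<tau> by (simp add: upper_half_plane_def)
    define r where "r = Im \<tau> / 2"
    have r: "r > 0" using pos by (simp add: r_def)
    obtain K where K: "K > 0" "\<And>t p. \<bar>Re t\<bar> \<le> \<bar>Re \<tau>\<bar> + r \<Longrightarrow> Im t \<ge> r \<Longrightarrow> wgt p \<le> K * norm (lat t p)"
      using wgt_le_lat[of "\<bar>Re \<tau>\<bar> + r" r] r by auto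
    have near: "\<bar>Re t\<bar> \<le> \<bar>Re \<tau>\<bar> + r" "Im t \<ge> r" if "t \<in> cball \<tau> r" for t
    proof -
      have "norm (t - \<tau>) \<le> r" using that by (simp add: dist_norm norm_minus_commute)
      then have "\<bar>Re (t - \<tau>)\<bar> \<le> r" "\<bar>Im (t - \<tau>)\<bar> \<le> r"
        using abs_Re_le_cmod[of "t - \<tau>"] abs_Im_le_cmod[of "t - \<tau>"] by linarith+
      then have "\<bar>Re t - Re \<tau>\<bar> \<le> r" "\<bar>Im t - Im \<tau>\<bar> \<le> r" by simp_all
      moreover have "Im \<tau> = 2 * r" by (simp add: r_def)
      ultimately show "\<bar>Re t\<bar> \<le> \<bar>Re \<tau>\<bar> + r" "Im t \<ge> r" by linarith+
    qed
    have sub: "cball \<tau> r \<subseteq> upper_half_plane"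
    proof
      fix t assume "t \<in> cball \<tau> r"
      then show "t \<in> upper_half_plane"
        using near(2)[of t] r unfolding upper_half_plane_def mem_Collect_eq by linarith
    qed
    have D: "((\<lambda>t. 1 / lat t p ^ k) has_field_derivative deriv (\<lambda>t. 1 / lat t p ^ k) t) (at t)"
      if p: "p \<in> nonzero_index" and t: "t \<in> upper_half_plane" for p t
    proof (rule holomorphic_derivI[OF _ open_upper_half_plane t])
      have "lat u p \<noteq> 0" if "u \<in> upper_half_plane" for u
        using half_plane_point.lat_eq_0_iff[OF half_plane_point.intro[OF that]] p by simp
      then show "(\<lambda>t. 1 / lat t p ^ k) holomorphic_on upper_half_plane"
        unfolding lat_def by (intro holomorphic_intros) auto
    qed
    have "((\<lambda>t. \<Sum>\<^sub>\<infinity>p\<in>nonzero_index. 1 / lat t p ^ k) has_field_derivative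
        (\<Sum>\<^sub>\<infinity>p\<in>nonzero_index. deriv (\<lambda>t. 1 / lat t p ^ k) \<tau>)) (at \<tau>)"
    proof (rule has_field_derivative_infsum(1)[OF D \<tau> r sub finite.emptyI
          summable_on_cmult_right[OF summable_on_wgt, of "K ^ k"]])
      fix p t assume "p \<in> nonzero_index - {}" and t: "t \<in> cball \<tau> r"
      then have p: "p \<in> nonzero_index" by blast
      show "norm (1 / lat t p ^ k) \<le> K ^ k * (1 / wgt p ^ 3)"
        by (rule lat_pow_bound[OF K(1) K(2)[OF near[OF t]] p k])
    qed
    then show ?thesis
      unfolding eisenstein_def by blast
  qed
  then show ?thesis
    unfolding holomorphic_on_open[OF open_upper_half_plane] by blast
qed

text \<open>The group acts linearly on the indices of the lattice, so that it only permutes the terms, up to the factor \<open>(c \<tau> + d)\<^sup>k\<close>.\<close>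

lemma eisenstein_modular:
  assumes \<gamma>: "\<gamma> \<in> SL2Z" and \<tau>: "\<tau> \<in> upper_half_plane"
  shows "eisenstein k (moebius_act \<gamma> \<tau>) = denom \<gamma> \<tau> ^ k * eisenstein k \<tau>"
proof -
  define a b c d where "a = \<gamma>$1$1" "b = \<gamma>$1$2" "c = \<gamma>$2$1" "d = \<gamma>$2$2"
  note abcd = this
  have det: "a * d - b * c = 1" using \<gamma> by (simp add: SL2Z_iff abcd)
  define f where "f p = (a * fst p + c * snd p, b * fst p + d * snd p)" for p
  define f' where "f' p = (d * fst p - c * snd p, - b * fst p + a * snd p)" for p
  have inv: "f' (f p) = p" "f (f' p) = p" for p
  proof -
    have "f' (f p) = ((a * d - b * c) * fst p, (a * d - b * c) * snd p)"
      by (simp add: f_def f'_def algebra_simps)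
    moreover have "f (f' p) = ((a * d - b * c) * fst p, (a * d - b * c) * snd p)"
      by (simp add: f_def f'_def algebra_simps)
    ultimately show "f' (f p) = p" "f (f' p) = p" by (simp_all add: det)
  qed
  have f0: "f (0, 0) = (0, 0)" "f' (0, 0) = (0, 0)" by (simp_all add: f_def f'_def)
  note nz = denom_nonzero[OF \<gamma> \<tau>]
  have "moebius_act \<gamma> \<tau> * denom \<gamma> \<tau> = of_int a * \<tau> + of_int b"
    using nz by (simp add: moebius_act_eq abcd)
  moreover have "lat (moebius_act \<gamma> \<tau>) p * denom \<gamma> \<tau> =
      of_int (fst p) * (moebius_act \<gamma> \<tau> * denom \<gamma> \<tau>) + of_int (snd p) * denom \<gamma> \<tau>" for p
    by (simp add: lat_def algebra_simps)
  ultimately have "lat (moebius_act \<gamma> \<tau>) p * denom \<gamma> \<tau> = lat \<tau> (f p)" for p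
    by (simp add: lat_def f_def denom_def abcd algebra_simps)
  then have lat_eq: "lat (moebius_act \<gamma> \<tau>) p = lat \<tau> (f p) / denom \<gamma> \<tau>" for p
    using nz by (metis nonzero_eq_divide_eq)
  have "eisenstein k (moebius_act \<gamma> \<tau>) = (\<Sum>\<^sub>\<infinity>p\<in>nonzero_index. denom \<gamma> \<tau> ^ k * (1 / lat \<tau> (f p) ^ k))"
    unfolding eisenstein_def lat_eq by (simp add: power_divide)
  also have "\<dots> = (\<Sum>\<^sub>\<infinity>p\<in>nonzero_index. denom \<gamma> \<tau> ^ k * (1 / lat \<tau> p ^ k))"
  proof (rule infsum_reindex_bij_witness[of _ f' f])
    show "f p \<in> nonzero_index" if "p \<in> nonzero_index" for p
    proof -
      have "f p \<noteq> (0, 0)" using that inv(1)[of p] f0(2) by auto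
      then show ?thesis by simp
    qed
    show "f' p \<in> nonzero_index" if "p \<in> nonzero_index" for p
    proof -
      have "f' p \<noteq> (0, 0)" using that inv(2)[of p] f0(1) by auto
      then show ?thesis by simp
    qed
  qed (simp_all add: inv)
  finally show ?thesis
    by (simp only: infsum_cmult_right' eisenstein_def)
qed

text \<open>The value of the Eisenstein series at the cusp: only the terms without \<open>\<tau>\<close> survive.\<close>

definition eisenstein_cusp :: "nat \<Rightarrow> complex" where
  "eisenstein_cusp k = (\<Sum>\<^sub>\<infinity>p\<in>{p. fst p = 0 \<and> snd p \<noteq> 0}. 1 / of_int (snd (p :: int \<times> int)) ^ k)"

lemma nonzero_index_split:
  "nonzero_index = {p. fst p = 0 \<and> snd p \<noteq> 0} \<union> {p. fst p \<noteq> 0}"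
  "{p :: int \<times> int. fst p = 0 \<and> snd p \<noteq> 0} \<inter> {p. fst p \<noteq> 0} = {}"
  by (auto simp: prod_eq_iff)

text \<open>The terms with \<open>m \<noteq> 0\<close> gain a factor \<open>1 / Im \<tau>\<close>.\<close>

lemma eisenstein_cusp_bound:
  assumes k: "k \<ge> 4"
  obtains C where "C \<ge> 0" "\<And>\<tau>. \<bar>Re \<tau>\<bar> \<le> 1 / 2 \<Longrightarrow> Im \<tau> \<ge> 1 \<Longrightarrow>
    norm (eisenstein k \<tau> - eisenstein_cusp k) \<le> C / Im \<tau>"
proof -
  obtain K where K: "K > 0" "\<And>t p. \<bar>Re t\<bar> \<le> 1 / 2 \<Longrightarrow> Im t \<ge> 1 \<Longrightarrow> wgt p \<le> K * norm (lat t p)"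
    using wgt_le_lat[of "1 / 2" 1] by auto
  let ?N = "{p :: int \<times> int. fst p \<noteq> 0}"
  have sub: "?N \<subseteq> nonzero_index" by auto
  have ws: "(\<lambda>p. K ^ (k - 1) * (1 / wgt p ^ 3)) summable_on ?N"
    by (rule summable_on_subset_banach[OF summable_on_cmult_right[OF summable_on_wgt] sub])
  define C where "C = (\<Sum>\<^sub>\<infinity>p\<in>?N. K ^ (k - 1) * (1 / wgt p ^ 3))"
  have wn: "0 \<le> wgt p" for p by (simp add: wgt_def)
  have C: "C \<ge> 0"
    unfolding C_def by (intro infsum_nonneg) (use K wn in simp)
  show ?thesis
  proof (rule that[OF C])
    fix \<tau> assume \<tau>: "\<bar>Re \<tau>\<bar> \<le> 1 / 2" "Im \<tau> \<ge> 1"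
    then have h: "\<tau> \<in> upper_half_plane" by (simp add: upper_half_plane_def)
    have s: "(\<lambda>p. 1 / lat \<tau> p ^ k) summable_on nonzero_index"
      by (rule eisenstein_summable[OF h]) (use k in simp)
    have sN: "(\<lambda>p. 1 / lat \<tau> p ^ k) summable_on ?N"
      by (rule summable_on_subset_banach[OF s sub])
    have s0: "(\<lambda>p. 1 / lat \<tau> p ^ k) summable_on {p. fst p = 0 \<and> snd p \<noteq> 0}"
      by (rule summable_on_subset_banach[OF s]) auto
    have "eisenstein k \<tau> = (\<Sum>\<^sub>\<infinity>p\<in>{p. fst p = 0 \<and> snd p \<noteq> 0}. 1 / lat \<tau> p ^ k) + (\<Sum>\<^sub>\<infinity>p\<in>?N. 1 / lat \<tau> p ^ k)"
      unfolding eisenstein_def nonzero_index_split(1)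
      by (rule infsum_Un_disjoint[OF s0 sN nonzero_index_split(2)])
    moreover have "(\<Sum>\<^sub>\<infinity>p\<in>{p. fst p = 0 \<and> snd p \<noteq> 0}. 1 / lat \<tau> p ^ k) = eisenstein_cusp k"
      unfolding eisenstein_cusp_def by (rule infsum_cong) (simp add: lat_def)
    ultimately have eq: "eisenstein k \<tau> - eisenstein_cusp k = (\<Sum>\<^sub>\<infinity>p\<in>?N. 1 / lat \<tau> p ^ k)"
      by simp
    have "norm (\<Sum>\<^sub>\<infinity>p\<in>?N. 1 / lat \<tau> p ^ k) \<le> (1 / Im \<tau>) * C"
    proof (rule norm_infsum_le[OF has_sum_infsum[OF sN]])
      show "((\<lambda>p. (1 / Im \<tau>) * (K ^ (k - 1) * (1 / wgt p ^ 3))) has_sum (1 / Im \<tau>) * C) ?N"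
        unfolding C_def by (rule has_sum_cmult_right[OF has_sum_infsum[OF ws]])
      fix p assume p: "p \<in> ?N"
      have "1 \<le> \<bar>fst p\<bar>" using p by simp
      then have "1 \<le> \<bar>real_of_int (fst p)\<bar>" by linarith
      then have "1 * Im \<tau> \<le> \<bar>real_of_int (fst p)\<bar> * Im \<tau>"
        using \<tau> by (intro mult_right_mono) auto
      also have "\<dots> = \<bar>Im (lat \<tau> p)\<bar>" using \<tau> by (simp add: lat_def abs_mult)
      also have "\<dots> \<le> norm (lat \<tau> p)" by (rule abs_Im_le_cmod)
      finally have l: "Im \<tau> \<le> norm (lat \<tau> p)" by simp
      have "norm (1 / lat \<tau> p ^ k) = 1 / norm (lat \<tau> p) * norm (1 / lat \<tau> p ^ (k - 1))"
        using k by (cases k) (simp_all add: norm_divide norm_power norm_mult)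
      also have "\<dots> \<le> (1 / Im \<tau>) * (K ^ (k - 1) * (1 / wgt p ^ 3))"
      proof (rule mult_mono)
        show "1 / norm (lat \<tau> p) \<le> 1 / Im \<tau>" using l \<tau> by (intro divide_left_mono mult_pos_pos) auto
        show "norm (1 / lat \<tau> p ^ (k - 1)) \<le> K ^ (k - 1) * (1 / wgt p ^ 3)"
          by (rule lat_pow_bound[OF K(1) K(2)[OF \<tau>]]) (use p sub k in auto)
      qed (use \<tau> in auto)
      finally show "norm (1 / lat \<tau> p ^ k) \<le> (1 / Im \<tau>) * (K ^ (k - 1) * (1 / wgt p ^ 3))" .
    qed
    then show "norm (eisenstein k \<tau> - eisenstein_cusp k) \<le> C / Im \<tau>"
      by (simp add: eq)
  qed
qed

lemma eisenstein_cusp_nonzero: "eisenstein_cusp 4 \<noteq> 0"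
proof -
  let ?Z = "{p :: int \<times> int. fst p = 0 \<and> snd p \<noteq> 0}"
  let ?f = "\<lambda>p :: int \<times> int. 1 / (of_int (snd p) :: complex) ^ 4"
  have "(\<lambda>p. 1 / lat \<i> p ^ 4) summable_on ?Z"
    by (rule summable_on_subset_banach[OF eisenstein_summable[of \<i> 4]]) auto
  moreover have "(\<lambda>p. 1 / lat \<i> p ^ 4) summable_on ?Z \<longleftrightarrow> ?f summable_on ?Z"
    by (rule summable_on_cong) (simp add: lat_def)
  ultimately have s: "?f summable_on ?Z" by blast
  have re: "Re (?f p) = 1 / real_of_int (snd p) ^ 4" for p
  proof -
    have "?f p = of_real (1 / real_of_int (snd p) ^ 4)" by simp
    then show ?thesis by (simp only: Re_complex_of_real)
  qed
  have sR: "(\<lambda>p. Re (?f p)) summable_on ?Z"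
    by (rule summable_on_Re[OF s])
  have "infsum (\<lambda>p. Re (?f p)) {(0, 1)} \<le> infsum (\<lambda>p. Re (?f p)) ?Z"
    by (rule infsum_mono2[OF _ sR]) (auto simp: re simp del: of_int_power)
  then have "1 \<le> infsum (\<lambda>p. Re (?f p)) ?Z" by simp
  also have "\<dots> = Re (eisenstein_cusp 4)"
    unfolding eisenstein_cusp_def by (rule infsum_Re[OF s])
  finally show ?thesis by auto
qed

section \<open>The values of the Eisenstein series determine the lattice\<close>

text \<open>The \<open>\<wp>\<close>-function has a pole at each lattice point.\<close>

lemma wp_not_continuous_extension:
  assumes t: "\<tau>' \<in> upper_half_plane"
    and W: "open W" "lat \<tau>' p \<in> W"
    and eq: "\<And>z. z \<in> W - {lat \<tau>' p} \<Longrightarrow> half_plane_point.wp \<tau>' z = F z"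
    and F: "isCont F (lat \<tau>' p)"
  shows False
proof -
  interpret A: half_plane_point \<tau>' by standard (rule t)
  let ?w = "lat \<tau>' p"
  have lim: "((\<lambda>z. (z - ?w)\<^sup>2 * F z) \<longlongrightarrow> (?w - ?w)\<^sup>2 * F ?w) (at ?w)"
    using F unfolding isCont_def by (intro tendsto_intros)
  have ev: "\<forall>\<^sub>F z in at ?w. (z - ?w)\<^sup>2 * A.wp z = (z - ?w)\<^sup>2 * F z"
    using eventually_at_in_open[OF W] by (rule eventually_mono) (simp only: eq)
  have "((\<lambda>z. (z - ?w)\<^sup>2 * A.wp z) \<longlongrightarrow> (?w - ?w)\<^sup>2 * F ?w) (at ?w)"
    using lim unfolding tendsto_cong[OF ev] .
  then have "(?w - ?w)\<^sup>2 * F ?w = 1"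
    by (rule tendsto_unique[OF at_neq_bot _ A.wp_pole])
  then show False by simp
qed

text \<open>If both series vanished, then \<open>\<wp>\<close> would satisfy the same equation and initial condition as \<open>1 / z\<^sup>2\<close>, and would have no
  pole at the lattice point \<open>1\<close>.\<close>

lemma eisenstein_not_both_zero:
  assumes "\<tau> \<in> upper_half_plane"
  shows "eisenstein 4 \<tau> \<noteq> 0 \<or> eisenstein 6 \<tau> \<noteq> 0"
proof (rule ccontr)
  assume "\<not> ?thesis"
  then have G: "eisenstein 4 \<tau> = 0" "eisenstein 6 \<tau> = 0" by auto
  interpret half_plane_point \<tau> by standard (rule assms)
  obtain e where e: "e > 0" "ball 0 e \<subseteq> Omega0" by (rule ball_in_Omega0)
  have sub: "z \<in> Omega0" if "z \<in> ball 0 e" for z using e(2) that by blast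
  have wpr0: "wpr z = 0" if "z \<in> ball 0 e" for z
  proof (rule resonant_ode_unique[OF e(1) wpr_derivs[OF sub] _ _ _ _ that, where h = "\<lambda>z. 6 * wpr z"])
    show "continuous_on (ball 0 e) (\<lambda>z. 6 * wpr z)"
      by (intro continuous_intros holomorphic_on_imp_continuous_on[OF holomorphic_on_subset[OF wpr_holomorphic e(2)]])
    show "z\<^sup>2 * (6 * RR 4 z) = (12 + z\<^sup>2 * (6 * wpr z)) * wpr z" if "z \<in> ball 0 e" for z
      using wpr_ode[OF sub[OF that]] G by (simp add: algebra_simps power2_eq_square)
  qed (use G in \<open>simp_all add: RR_0\<close>)
  have "wpr z = 0" if "z \<in> Omega" for z
  proof (rule analytic_continuation[OF _ open_Omega(2) connected_Omega, where f = wpr and U = "ball 0 e - {0}" and \<xi> = "of_real (e / 2)"])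
    show "wpr holomorphic_on Omega"
      by (rule holomorphic_on_subset[OF wpr_holomorphic]) (auto simp: Omega_iff)
    show "ball 0 e - {0} \<subseteq> Omega" using e(2) by (auto simp: Omega_iff)
    have in': "of_real (e / 2) \<in> ball (0::complex) e - {0}" using e(1) by auto
    then show "of_real (e / 2) \<in> Omega" using \<open>ball 0 e - {0} \<subseteq> Omega\<close> by blast
    have "open (ball (0::complex) e - {0})" by (intro open_Diff) auto
    then show "of_real (e / 2) islimpt (ball (0::complex) e - {0})"
      using in' by (rule interior_limit_point[OF interior_maximal[OF order_refl, THEN subsetD]])
  qed (use wpr0 that in auto)
  then have wp_eq: "wp z = 1 / z\<^sup>2" if "z \<in> Omega" for z using that by (simp add: wp_def)
  have lat1: "lat \<tau> (0, 1) = 1" by (simp add: lat_def)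
  have eq: "wp z = 1 / z\<^sup>2" if z: "z \<in> (+) 1 ` Omega0 - {lat \<tau> (0, 1)}" for z
  proof -
    obtain y where y: "z = 1 + y" "y \<in> Omega0" using z by blast
    have "y \<noteq> 0" using z y lat1 by auto
    then have "y + lat \<tau> (0, 1) \<in> Omega" unfolding Omega_translate using y by (simp add: Omega_iff)
    then have "z \<in> Omega" by (simp add: y(1) lat1 add.commute)
    then show ?thesis by (rule wp_eq)
  qed
  have op: "open ((+) 1 ` Omega0)" by (rule open_translation[OF open_Omega(1)])
  have mem: "lat \<tau> (0, 1) \<in> (+) 1 ` Omega0"
    by (rule image_eqI[of _ _ 0]) (simp_all add: lat_def)
  have cont: "isCont (\<lambda>z. 1 / z\<^sup>2) (lat \<tau> (0, 1))"
    unfolding lat1 by (intro continuous_intros) simp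
  show False
    by (rule wp_not_continuous_extension[OF assms op mem eq cont])
qed

text \<open>The functions \<open>\<wp>\<^bsub>\<tau>'\<^esub> z\<close> and \<open>\<lambda>\<^sup>2 \<wp>\<^bsub>\<tau>\<^esub> (\<lambda> z)\<close> satisfy the same equation and initial condition, so
  they coincide; a pole of the first must be a pole of the second.\<close>

lemma lattice_scaled_subset:
  fixes lam :: complex
  assumes t': "\<tau>' \<in> upper_half_plane" and t: "\<tau> \<in> upper_half_plane" and lam: "lam \<noteq> 0"
    and G4: "eisenstein 4 \<tau>' = lam ^ 4 * eisenstein 4 \<tau>"
    and G6: "eisenstein 6 \<tau>' = lam ^ 6 * eisenstein 6 \<tau>"
  shows "\<exists>q. lam * lat \<tau>' p = lat \<tau> q"
proof (rule ccontr)
  assume no: "\<not> ?thesis"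
  interpret A: half_plane_point \<tau>' by standard (rule t')
  interpret B: half_plane_point \<tau> by standard (rule t)
  obtain e1 where e1: "e1 > 0" "ball 0 e1 \<subseteq> A.Omega0" by (rule A.ball_in_Omega0)
  obtain e2 where e2: "e2 > 0" "ball 0 e2 \<subseteq> B.Omega0" by (rule B.ball_in_Omega0)
  define e where "e = min e1 (e2 / norm lam)"
  have e: "e > 0" using e1 e2 lam by (simp add: e_def)
  have sA: "z \<in> A.Omega0" if "z \<in> ball 0 e" for z
    using that e1(2) by (auto simp: e_def)
  have sB: "lam * z \<in> B.Omega0" if "z \<in> ball 0 e" for z
  proof -
    have "norm z < e2 / norm lam" using that by (auto simp: e_def)
    then have "norm (lam * z) < e2" using lam by (simp add: norm_mult field_simps)
    then show ?thesis using e2(2) by auto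
  qed
  have chain: "((\<lambda>z. c * f (lam * z)) has_field_derivative c * lam * D) (at z)"
    if "(f has_field_derivative D) (at (lam * z))" for c D z and f :: "complex \<Rightarrow> complex"
  proof -
    have "((\<lambda>z. f (lam * z)) has_field_derivative D * (lam * 1)) (at z)"
      by (rule DERIV_chain2[OF that DERIV_cmult[OF DERIV_ident]])
    from DERIV_cmult[OF this, of c] show ?thesis by (simp add: mult_ac)
  qed
  have small: "A.wpr z - lam\<^sup>2 * B.wpr (lam * z) = 0" if z: "z \<in> ball 0 e" for z
  proof (rule resonant_ode_unique[OF e _ _ _ _ _ _ _ _ z,
        where h = "\<lambda>z. 6 * (A.wpr z + lam\<^sup>2 * B.wpr (lam * z))"])
    fix z :: complex assume z: "z \<in> ball 0 e"
    show "((\<lambda>z. A.wpr z - lam\<^sup>2 * B.wpr (lam * z)) has_field_derivative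
        - 2 * A.RR 3 z - lam\<^sup>2 * lam * (- 2 * B.RR 3 (lam * z))) (at z)"
      by (rule DERIV_diff[OF A.wpr_derivs(1)[OF sA[OF z]] chain[OF B.wpr_derivs(1)[OF sB[OF z]]]])
    show "((\<lambda>z. - 2 * A.RR 3 z - lam\<^sup>2 * lam * (- 2 * B.RR 3 (lam * z))) has_field_derivative
        6 * A.RR 4 z - lam\<^sup>2 * lam * lam * (6 * B.RR 4 (lam * z))) (at z)"
      by (rule DERIV_diff[OF A.wpr_derivs(2)[OF sA[OF z]] chain[OF B.wpr_derivs(2)[OF sB[OF z]]]])
    show "((\<lambda>z. 6 * A.RR 4 z - lam\<^sup>2 * lam * lam * (6 * B.RR 4 (lam * z))) has_field_derivative
        - 24 * A.RR 5 z - lam\<^sup>2 * lam * lam * lam * (- 24 * B.RR 5 (lam * z))) (at z)"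
      by (rule DERIV_diff[OF A.wpr_derivs(3)[OF sA[OF z]] chain[OF B.wpr_derivs(3)[OF sB[OF z]]]])
    show "((\<lambda>z. - 24 * A.RR 5 z - lam\<^sup>2 * lam * lam * lam * (- 24 * B.RR 5 (lam * z))) has_field_derivative
        120 * A.RR 6 z - lam\<^sup>2 * lam * lam * lam * lam * (120 * B.RR 6 (lam * z))) (at z)"
      by (rule DERIV_diff[OF A.wpr_derivs(4)[OF sA[OF z]] chain[OF B.wpr_derivs(4)[OF sB[OF z]]]])
    have a: "z\<^sup>2 * (6 * A.RR 4 z) =
        12 * A.wpr z + 6 * z\<^sup>2 * (A.wpr z)\<^sup>2 - 30 * (lam ^ 4 * eisenstein 4 \<tau>) * z\<^sup>2"
      using A.wpr_ode[OF sA[OF z]] by (simp only: G4)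
    have b: "(lam * z)\<^sup>2 * (6 * B.RR 4 (lam * z)) =
        12 * B.wpr (lam * z) + 6 * (lam * z)\<^sup>2 * (B.wpr (lam * z))\<^sup>2 - 30 * eisenstein 4 \<tau> * (lam * z)\<^sup>2"
      using B.wpr_ode[OF sB[OF z]] .
    have "z\<^sup>2 * (6 * A.RR 4 z - lam\<^sup>2 * lam * lam * (6 * B.RR 4 (lam * z))) =
        z\<^sup>2 * (6 * A.RR 4 z) - lam\<^sup>2 * ((lam * z)\<^sup>2 * (6 * B.RR 4 (lam * z)))"
      by (simp add: power2_eq_square algebra_simps)
    also have "\<dots> = (12 + z\<^sup>2 * (6 * (A.wpr z + lam\<^sup>2 * B.wpr (lam * z)))) * (A.wpr z - lam\<^sup>2 * B.wpr (lam * z))"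
      unfolding a b by (simp add: power2_eq_square power4_eq_xxxx algebra_simps)
    finally show "z\<^sup>2 * (6 * A.RR 4 z - lam\<^sup>2 * lam * lam * (6 * B.RR 4 (lam * z))) =
        (12 + z\<^sup>2 * (6 * (A.wpr z + lam\<^sup>2 * B.wpr (lam * z)))) * (A.wpr z - lam\<^sup>2 * B.wpr (lam * z))" .
  next
    have "lam\<^sup>2 * lam * lam * lam * lam = lam ^ 6"
      by (simp add: eval_nat_numeral)
    then show "120 * A.RR 6 0 - lam\<^sup>2 * lam * lam * lam * lam * (120 * B.RR 6 (lam * 0)) = 0"
      by (simp add: A.RR_0 B.RR_0 G6)
    have "continuous_on (ball 0 e) A.wpr"
      by (rule holomorphic_on_imp_continuous_on[OF holomorphic_on_subset[OF A.wpr_holomorphic]]) (use sA in blast)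
    moreover have "continuous_on (ball 0 e) (\<lambda>z. B.wpr (lam * z))"
      by (rule continuous_on_compose2[OF holomorphic_on_imp_continuous_on[OF B.wpr_holomorphic]])
        (use sB in \<open>auto intro!: continuous_intros\<close>)
    ultimately show "continuous_on (ball 0 e) (\<lambda>z. 6 * (A.wpr z + lam\<^sup>2 * B.wpr (lam * z)))"
      by (intro continuous_intros)
  qed simp
  define Om where "Om = A.Omega \<inter> {z. lam * z \<in> B.Omega}"
  have opB: "open {z. lam * z \<in> B.Omega}"
  proof -
    have "open ((*) lam -` B.Omega)"
      by (rule open_vimage[OF B.open_Omega(2)]) (intro continuous_intros)
    then show ?thesis by (simp add: vimage_def)
  qed
  have opOm: "open Om"
    unfolding Om_def by (intro open_Int A.open_Omega opB)
  have div: "lam * z = lat \<tau> q \<longleftrightarrow> z = lat \<tau> q / lam" for z q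
    using lam by (auto simp: field_simps)
  have "z \<in> Om \<longleftrightarrow> z \<notin> range (lat \<tau>') \<and> z \<notin> range (\<lambda>q. lat \<tau> q / lam)" for z
    unfolding Om_def A.Omega_def B.Omega_def Int_iff mem_Collect_eq Compl_iff image_iff div by (rule refl)
  then have Om_eq: "Om = - (range (lat \<tau>') \<union> range (\<lambda>q. lat \<tau> q / lam))"
    by blast
  have "countable (range (lat \<tau>') \<union> range (\<lambda>q. lat \<tau> q / lam))"
    by (intro countable_Un countable_image) auto
  then have conOm: "connected Om"
    unfolding Om_eq by (intro path_connected_imp_connected path_connected_complement_countable) auto
  have all: "A.wp z - lam\<^sup>2 * B.wp (lam * z) = 0" if "z \<in> Om" for z
  proof (rule analytic_continuation[OF _ opOm conOm,
        where f = "\<lambda>z. A.wp z - lam\<^sup>2 * B.wp (lam * z)" and U = "ball 0 e - {0}" and \<xi> = "of_real (e / 2)"])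
    have "A.wp holomorphic_on A.Omega"
      using A.wp_deriv unfolding holomorphic_on_open[OF A.open_Omega(2)] by blast
    then have 1: "A.wp holomorphic_on Om" by (rule holomorphic_on_subset) (auto simp: Om_def)
    have "((\<lambda>z. B.wp (lam * z)) has_field_derivative (- 2 * B.PP 3 (lam * z)) * lam) (at z)" if "z \<in> Om" for z
      using DERIV_chain2[OF B.wp_deriv DERIV_cmult_Id[of lam]] that by (simp add: Om_def)
    then have 2: "(\<lambda>z. B.wp (lam * z)) holomorphic_on Om"
      unfolding holomorphic_on_open[OF opOm] by blast
    show "(\<lambda>z. A.wp z - lam\<^sup>2 * B.wp (lam * z)) holomorphic_on Om"
      by (intro holomorphic_intros 1 2)
    show sub: "ball 0 e - {0} \<subseteq> Om"
      using sA sB lam by (auto simp: Om_def A.Omega_iff B.Omega_iff)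
    have in': "of_real (e / 2) \<in> ball (0::complex) e - {0}" using e by auto
    then show "of_real (e / 2) \<in> Om" using sub by blast
    have "open (ball (0::complex) e - {0})" by (intro open_Diff) auto
    then show "of_real (e / 2) islimpt (ball (0::complex) e - {0})"
      using in' by (rule interior_limit_point[OF interior_maximal[OF order_refl, THEN subsetD]])
    fix z :: complex assume z: "z \<in> ball 0 e - {0}"
    have "A.wp z - lam\<^sup>2 * B.wp (lam * z) = A.wpr z - lam\<^sup>2 * B.wpr (lam * z)"
      using z lam by (simp add: A.wp_def B.wp_def field_simps)
    then show "A.wp z - lam\<^sup>2 * B.wp (lam * z) = 0"
      using small z by simp
  qed (rule that)
  define w where "w = lat \<tau>' p"
  have wB: "lam * w \<in> B.Omega" using no by (auto simp: B.Omega_def w_def)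
  define W where "W = (+) w ` A.Omega0 \<inter> {z. lam * z \<in> B.Omega}"
  show False
  proof (rule wp_not_continuous_extension[OF t', where W = W and p = p and F = "\<lambda>z. lam\<^sup>2 * B.wp (lam * z)"])
    show "open W" unfolding W_def by (intro open_Int open_translation A.open_Omega(1) opB)
    have "w \<in> (+) w ` A.Omega0" by (rule image_eqI[of _ _ 0]) simp_all
    then show "lat \<tau>' p \<in> W" using wB by (simp add: W_def w_def)
    have "isCont (\<lambda>z. B.wp (lam * z)) w"
      by (rule isCont_o2[where f = "(*) lam" and g = B.wp and a = w, OF _ B.wp_continuous[OF wB]]) (intro continuous_intros)
    then show "isCont (\<lambda>z. lam\<^sup>2 * B.wp (lam * z)) (lat \<tau>' p)"
      unfolding w_def by (intro continuous_intros)
    fix z assume z: "z \<in> W - {lat \<tau>' p}"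
    then obtain y where y: "z = w + y" "y \<in> A.Omega0" by (auto simp: W_def)
    have "y \<noteq> 0" using z y by (auto simp: w_def)
    then have "y \<in> A.Omega" using y by (simp add: A.Omega_iff)
    then have "z \<in> A.Omega" unfolding y(1) w_def add.commute[of "lat \<tau>' p"] A.Omega_translate .
    then have "z \<in> Om" using z by (simp add: Om_def W_def)
    from all[OF this] show "A.wp z = lam\<^sup>2 * B.wp (lam * z)" by simp
  qed
qed

lemma det_mat2_mult_int:
  fixes a b c d a' b' c' d' :: int
  assumes "a' * a + b' * c = 1" "a' * b + b' * d = 0" "c' * a + d' * c = 0" "c' * b + d' * d = 1"
  shows "(a * d - b * c) * (a' * d' - b' * c') = 1"
proof -
  have "(a * d - b * c) * (a' * d' - b' * c') =
      (a' * a + b' * c) * (c' * b + d' * d) - (a' * b + b' * d) * (c' * a + d' * c)"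
    by (simp add: algebra_simps)
  then show ?thesis using assms by simp
qed

text \<open>By the inclusions of the lattices in both directions, multiplication by \<open>\<lambda>\<close> carries one to the other; the
  two bases differ by an integral matrix, whose determinant is \<open>1\<close> since both points lie in the upper half plane.\<close>

theorem eisenstein_determine_lattice:
  fixes lam :: complex
  assumes t: "\<tau> \<in> upper_half_plane" and t': "\<tau>' \<in> upper_half_plane" and lam: "lam \<noteq> 0"
    and G4: "eisenstein 4 \<tau>' = lam ^ 4 * eisenstein 4 \<tau>"
    and G6: "eisenstein 6 \<tau>' = lam ^ 6 * eisenstein 6 \<tau>"
  obtains \<gamma> where "\<gamma> \<in> SL2Z" "\<tau>' = moebius_act \<gamma> \<tau>"
proof -
  interpret B: half_plane_point \<tau> by standard (rule t)
  note S = lattice_scaled_subset[OF t' t lam G4 G6]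
  have "inverse lam \<noteq> 0" "eisenstein 4 \<tau> = inverse lam ^ 4 * eisenstein 4 \<tau>'"
    "eisenstein 6 \<tau> = inverse lam ^ 6 * eisenstein 6 \<tau>'"
    using lam G4 G6 by (simp_all add: field_simps)
  note S' = lattice_scaled_subset[OF t t' this]
  obtain q1 where q1: "lam * lat \<tau>' (1, 0) = lat \<tau> q1" using S by blast
  obtain q2 where q2: "lam * lat \<tau>' (0, 1) = lat \<tau> q2" using S by blast
  obtain p1 where p1: "inverse lam * lat \<tau> (1, 0) = lat \<tau>' p1" using S' by blast
  obtain p2 where p2: "inverse lam * lat \<tau> (0, 1) = lat \<tau>' p2" using S' by blast
  have lt: "lam * \<tau>' = lat \<tau> q1" using q1 by (simp add: lat_def)
  have l1: "lam = lat \<tau> q2" using q2 by (simp add: lat_def)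
  have lin: "lam * lat \<tau>' p = of_int (fst p) * lat \<tau> q1 + of_int (snd p) * lat \<tau> q2" for p
    using lt l1 by (simp add: lat_def[of \<tau>' p] algebra_simps)
  have comb: "of_int m * lat \<tau> q1 + of_int n * lat \<tau> q2 =
      lat \<tau> (m * fst q1 + n * fst q2, m * snd q1 + n * snd q2)" for m n
    by (simp add: lat_def algebra_simps)
  have "lat \<tau> (1, 0) = lam * lat \<tau>' p1" using p1 lam by (simp add: field_simps)
  then have e1: "(1, 0) = (fst p1 * fst q1 + snd p1 * fst q2, fst p1 * snd q1 + snd p1 * snd q2)"
    unfolding lin comb B.lat_eq_iff .
  have "lat \<tau> (0, 1) = lam * lat \<tau>' p2" using p2 lam by (simp add: field_simps)
  then have e2: "(0, 1) = (fst p2 * fst q1 + snd p2 * fst q2, fst p2 * snd q1 + snd p2 * snd q2)"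
    unfolding lin comb B.lat_eq_iff .
  define \<gamma> where "\<gamma> = mat2 (fst q1) (snd q1) (fst q2) (snd q2)"
  define D where "D = fst q1 * snd q2 - snd q1 * fst q2"
  have "D * (fst p1 * snd p2 - snd p1 * fst p2) = 1"
    unfolding D_def by (rule det_mat2_mult_int) (use e1 e2 in auto)
  then have D1: "D = 1 \<or> D = - 1" using zmult_eq_1_iff by blast
  have "Im (lam * \<tau>' * cnj lam) = Im (lat \<tau> q1 * cnj (lat \<tau> q2))" by (simp only: lt flip: l1)
  also have "\<dots> = D * Im \<tau>" by (simp add: lat_def D_def algebra_simps)
  finally have "D * Im \<tau> = Im (lam * \<tau>' * cnj lam)" by simp
  also have "lam * \<tau>' * cnj lam = of_real ((norm lam)\<^sup>2) * \<tau>'"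
    by (simp only: complex_norm_square mult_ac)
  also have "Im \<dots> = (norm lam)\<^sup>2 * Im \<tau>'" by simp
  also have "\<dots> > 0" using lam t' by (simp add: upper_half_plane_def)
  finally have "D * Im \<tau> > 0" .
  then have "D = 1" using D1 B.Im_pos by auto
  then have "\<gamma> \<in> SL2Z" by (simp add: \<gamma>_def mat2_in_SL2Z D_def)
  moreover have "\<tau>' = moebius_act \<gamma> \<tau>"
  proof -
    have "\<tau>' = (lam * \<tau>') / lam" using lam by simp
    also have "\<dots> = lat \<tau> q1 / lat \<tau> q2" by (simp only: lt flip: l1)
    finally show ?thesis by (simp add: moebius_act_eq denom_def \<gamma>_def lat_def)
  qed
  ultimately show ?thesis by (rule that)
qed

section \<open>The discriminant and the modular invariant\<close>

lemma exists_nth_root: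
  assumes "n > 0" "w \<noteq> 0" shows "\<exists>z :: complex. z ^ n = w"
proof
  show "exp (Ln w / of_nat n) ^ n = w"
    unfolding exp_of_nat_mult[symmetric] using assms by simp
qed

text \<open>Points of the weighted projective line with weights \<open>4\<close> and \<open>6\<close> are determined by the ratio of
  the cube of the first to the square of the second coordinate.\<close>

lemma weighted_proportional:
  fixes x y u v :: complex
  assumes "x \<noteq> 0 \<or> u \<noteq> 0" "y \<noteq> 0 \<or> v \<noteq> 0" and eq: "x ^ 3 * v\<^sup>2 = y ^ 3 * u\<^sup>2"
  obtains lam where "lam \<noteq> 0" "y = lam ^ 4 * x" "v = lam ^ 6 * u"
proof (cases "x = 0")
  case True
  then have "u \<noteq> 0" using assms(1) by simp
  then have "y = 0" using eq True by simp
  then have "v \<noteq> 0" using assms(2) by simp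
  obtain lam where lam: "lam ^ 6 = v / u"
      using exists_nth_root[of 6 "v / u"] \<open>u \<noteq> 0\<close> \<open>v \<noteq> 0\<close> by auto
  show ?thesis
    by (rule that[of lam]) (use lam True \<open>y = 0\<close> \<open>u \<noteq> 0\<close> \<open>v \<noteq> 0\<close> in \<open>auto simp: power_0_left\<close>)
next
  case False
  have "y \<noteq> 0"
  proof
    assume "y = 0"
    then have "v = 0" using eq False by simp
    with \<open>y = 0\<close> show False using assms(2) by simp
  qed
  show ?thesis
  proof (cases "u = 0")
    case True
    then have "v = 0" using eq False by simp
    obtain lam where lam: "lam ^ 4 = y / x"
      using exists_nth_root[of 4 "y / x"] False \<open>y \<noteq> 0\<close> by auto
    show ?thesis
      by (rule that[of lam]) (use lam True False \<open>y \<noteq> 0\<close> \<open>v = 0\<close> in \<open>auto simp: power_0_left\<close>)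
  next
    case u: False
    have "v \<noteq> 0" using eq u \<open>y \<noteq> 0\<close> by auto
    define mu where "mu = (v / u) * (x / y)"
    define lam where "lam = csqrt mu"
    have lam2: "lam\<^sup>2 = mu" by (simp add: lam_def)
    have mu2: "mu\<^sup>2 * x = y"
    proof -
      have "mu\<^sup>2 * x * (u\<^sup>2 * y\<^sup>2) = x ^ 3 * v\<^sup>2"
        using u \<open>y \<noteq> 0\<close> by (simp add: mu_def power2_eq_square power3_eq_cube)
      also have "\<dots> = y * (u\<^sup>2 * y\<^sup>2)"
        unfolding eq by (simp add: power2_eq_square power3_eq_cube)
      finally show ?thesis using u \<open>y \<noteq> 0\<close> by simp
    qed
    have "mu * (mu\<^sup>2 * x) * u = v * x"
      unfolding mu2 using u \<open>y \<noteq> 0\<close> by (simp add: mu_def)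
    then have mu3: "mu ^ 3 * u = v"
      using False by (simp add: power2_eq_square power3_eq_cube mult.assoc)
    have "lam ^ 4 = mu\<^sup>2" "lam ^ 6 = mu ^ 3"
      by (simp_all only: lam2[symmetric] power_mult[symmetric]) simp_all
    moreover have "lam \<noteq> 0" using lam2 u False \<open>y \<noteq> 0\<close> \<open>v \<noteq> 0\<close> by (auto simp: mu_def)
    ultimately show ?thesis using that[of lam] mu2 mu3 by simp
  qed
qed

lemma eisenstein_ratio_injective:
  assumes t: "\<tau> \<in> upper_half_plane" and t': "\<tau>' \<in> upper_half_plane"
    and eq: "eisenstein 4 \<tau> ^ 3 * (eisenstein 6 \<tau>')\<^sup>2 = eisenstein 4 \<tau>' ^ 3 * (eisenstein 6 \<tau>)\<^sup>2"
  shows "\<exists>\<gamma>\<in>SL2Z. \<tau>' = moebius_act \<gamma> \<tau>"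
proof -
  obtain lam where lam: "lam \<noteq> 0" "eisenstein 4 \<tau>' = lam ^ 4 * eisenstein 4 \<tau>"
    "eisenstein 6 \<tau>' = lam ^ 6 * eisenstein 6 \<tau>"
    by (rule weighted_proportional[OF eisenstein_not_both_zero[OF t] eisenstein_not_both_zero[OF t'] eq])
  obtain \<gamma> where "\<gamma> \<in> SL2Z" "\<tau>' = moebius_act \<gamma> \<tau>"
    by (rule eisenstein_determine_lattice[OF t t' lam])
  then show ?thesis by blast
qed

text \<open>The cusp is approached inside a strip that contains the fundamental domain, where the Eisenstein series have limits.\<close>

definition cusp_filter :: "complex filter" where
  "cusp_filter = inf (filtercomap Im at_top) (principal {\<tau>. \<bar>Re \<tau>\<bar> \<le> 1 / 2})"

lemma eventually_cusp_filter:
  "eventually P cusp_filter \<longleftrightarrow> (\<exists>Y. \<forall>\<tau>. \<bar>Re \<tau>\<bar> \<le> 1 / 2 \<longrightarrow> Im \<tau> \<ge> Y \<longrightarrow> P \<tau>)"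
  unfolding cusp_filter_def eventually_inf_principal eventually_filtercomap eventually_at_top_linorder
  by (auto; metis)

lemma filterlim_Im_cusp: "filterlim Im at_top cusp_filter"
  unfolding filterlim_at_top eventually_cusp_filter by blast

lemma eisenstein_tendsto_cusp:
  assumes "k \<ge> 4" shows "(eisenstein k \<longlongrightarrow> eisenstein_cusp k) cusp_filter"
proof -
  obtain C where C: "C \<ge> 0" "\<And>\<tau>. \<bar>Re \<tau>\<bar> \<le> 1 / 2 \<Longrightarrow> Im \<tau> \<ge> 1 \<Longrightarrow>
    norm (eisenstein k \<tau> - eisenstein_cusp k) \<le> C / Im \<tau>"
    using eisenstein_cusp_bound[OF assms] by blast
  have "((\<lambda>\<tau>. C / Im \<tau>) \<longlongrightarrow> 0) cusp_filter"
    by (rule real_tendsto_divide_at_top[OF tendsto_const filterlim_Im_cusp])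
  then have "((\<lambda>\<tau>. eisenstein k \<tau> - eisenstein_cusp k) \<longlongrightarrow> 0) cusp_filter"
  proof (rule Lim_null_comparison[rotated])
    show "\<forall>\<^sub>F \<tau> in cusp_filter. norm (eisenstein k \<tau> - eisenstein_cusp k) \<le> C / Im \<tau>"
      unfolding eventually_cusp_filter using C(2) by blast
  qed
  then show ?thesis by (rule LIM_zero_cancel)
qed

text \<open>A multiple of the classical \<open>\<Delta>\<close>: the combination of \<open>G\<^sub>4\<^sup>3\<close> and \<open>G\<^sub>6\<^sup>2\<close> that vanishes at the cusp.  Keeping
  the values at the cusp as coefficients avoids evaluating \<open>\<zeta> 4\<close> and \<open>\<zeta> 6\<close>.\<close>

definition discriminant :: "complex \<Rightarrow> complex" where
  "discriminant \<tau> = (eisenstein_cusp 6)\<^sup>2 * eisenstein 4 \<tau> ^ 3 - eisenstein_cusp 4 ^ 3 * (eisenstein 6 \<tau>)\<^sup>2"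

lemma discriminant_holomorphic: "discriminant holomorphic_on upper_half_plane"
proof -
  have "eisenstein 4 holomorphic_on upper_half_plane" "eisenstein 6 holomorphic_on upper_half_plane"
    by (simp_all add: eisenstein_holomorphic)
  then show ?thesis unfolding discriminant_def by (intro holomorphic_intros)
qed

lemma discriminant_modular:
  assumes "\<gamma> \<in> SL2Z" "\<tau> \<in> upper_half_plane"
  shows "discriminant (moebius_act \<gamma> \<tau>) = denom \<gamma> \<tau> ^ 12 * discriminant \<tau>"
  by (simp add: discriminant_def eisenstein_modular[OF assms] power_mult_distrib algebra_simps flip: power_mult)

lemma discriminant_tendsto_cusp: "(discriminant \<longlongrightarrow> 0) cusp_filter"
proof -
  have "(discriminant \<longlongrightarrow> (eisenstein_cusp 6)\<^sup>2 * eisenstein_cusp 4 ^ 3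
      - eisenstein_cusp 4 ^ 3 * (eisenstein_cusp 6)\<^sup>2) cusp_filter"
    unfolding discriminant_def by (intro tendsto_intros eisenstein_tendsto_cusp) simp_all
  then show ?thesis by simp
qed

text \<open>An orbit is countable.\<close>

lemma not_all_equivalent:
  assumes "r > 0" "ball \<tau> r \<subseteq> upper_half_plane"
  shows "\<exists>\<sigma>\<in>ball \<tau> r. \<not> (\<exists>\<gamma>\<in>SL2Z. \<sigma> = moebius_act \<gamma> \<tau>)"
proof (rule ccontr)
  assume "\<not> ?thesis"
  then have "ball \<tau> r \<subseteq> (\<lambda>\<gamma>. moebius_act \<gamma> \<tau>) ` SL2Z" by blast
  then have "countable (ball \<tau> r)"
    by (rule countable_subset) (rule countable_image[OF countable_SL2Z])
  then show False using uncountable_ball[OF assms(1)] by blast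
qed

text \<open>If the discriminant vanished at \<open>\<tau>\<close>, then by the open mapping theorem the values of
  \<open>G\<^sub>6\<^sup>2 / G\<^sub>4\<^sup>3\<close> near the cusp would also be attained near \<open>\<tau>\<close>; but equal values mean
  equivalent points, and the imaginary parts of the points equivalent to points near \<open>\<tau>\<close>
  are bounded.\<close>

lemma discriminant_nonzero:
  assumes t: "\<tau> \<in> upper_half_plane"
  shows "discriminant \<tau> \<noteq> 0"
proof
  assume D: "discriminant \<tau> = 0"
  have G4: "eisenstein 4 \<tau> \<noteq> 0"
  proof
    assume "eisenstein 4 \<tau> = 0"
    then have "eisenstein 6 \<tau> = 0" using D eisenstein_cusp_nonzero by (simp add: discriminant_def)
    with \<open>eisenstein 4 \<tau> = 0\<close> show False using eisenstein_not_both_zero[OF t] by simp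
  qed
  have hol4: "eisenstein 4 holomorphic_on upper_half_plane" and hol6: "eisenstein 6 holomorphic_on upper_half_plane"
    by (simp_all add: eisenstein_holomorphic)
  have pos: "Im \<tau> > 0" using t by (simp add: upper_half_plane_def)
  have "isCont (eisenstein 4) \<tau>"
    using holomorphic_on_imp_continuous_on[OF hol4] t
    unfolding continuous_on_eq_continuous_at[OF open_upper_half_plane] by blast
  then have "\<forall>\<^sub>F z in nhds \<tau>. eisenstein 4 z \<noteq> 0"
    using tendsto_imp_eventually_ne[of "eisenstein 4" "eisenstein 4 \<tau>" "at \<tau>" 0] G4
    by (simp add: isCont_def eventually_nhds_conv_at)
  moreover have "\<forall>\<^sub>F z in nhds \<tau>. z \<in> upper_half_plane"
    by (rule eventually_nhds_in_open[OF open_upper_half_plane t])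
  moreover have "\<forall>\<^sub>F z in nhds \<tau>. z \<in> ball \<tau> (Im \<tau> / 2)"
    by (rule eventually_nhds_in_open) (use pos in auto)
  ultimately have "\<forall>\<^sub>F z in nhds \<tau>. eisenstein 4 z \<noteq> 0 \<and> z \<in> upper_half_plane \<and> z \<in> ball \<tau> (Im \<tau> / 2)"
    by (intro eventually_conj)
  then obtain r where r: "r > 0" "\<And>z. dist z \<tau> < r \<Longrightarrow>
      eisenstein 4 z \<noteq> 0 \<and> z \<in> upper_half_plane \<and> z \<in> ball \<tau> (Im \<tau> / 2)"
    unfolding eventually_nhds_metric by blast
  have in_ball: "eisenstein 4 z \<noteq> 0" "z \<in> upper_half_plane" "Im z > Im \<tau> / 2" "Im z < 2 * Im \<tau>"
    if "z \<in> ball \<tau> r" for z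
  proof -
    have z: "eisenstein 4 z \<noteq> 0" "z \<in> upper_half_plane" "z \<in> ball \<tau> (Im \<tau> / 2)"
      using r(2)[of z] that by (simp_all add: dist_commute)
    then show "eisenstein 4 z \<noteq> 0" "z \<in> upper_half_plane" by auto
    have "\<bar>Im (z - \<tau>)\<bar> < Im \<tau> / 2"
      using abs_Im_le_cmod[of "z - \<tau>"] z(3) by (simp add: dist_norm norm_minus_commute)
    then have "\<bar>Im z - Im \<tau>\<bar> < Im \<tau> / 2" by simp
    then show "Im z > Im \<tau> / 2" "Im z < 2 * Im \<tau>" using pos by linarith+
  qed
  have ball_sub: "ball \<tau> r \<subseteq> upper_half_plane" using in_ball(2) by blast
  define f where "f z = (eisenstein 6 z)\<^sup>2 / eisenstein 4 z ^ 3" for z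
  have f_eq: "\<exists>\<gamma>\<in>SL2Z. \<sigma> = moebius_act \<gamma> z"
    if "f z = f \<sigma>" "z \<in> upper_half_plane" "\<sigma> \<in> upper_half_plane" "eisenstein 4 z \<noteq> 0" "eisenstein 4 \<sigma> \<noteq> 0" for z \<sigma>
    by (rule eisenstein_ratio_injective) (use that in \<open>simp_all add: f_def field_simps\<close>)
  have holf: "f holomorphic_on ball \<tau> r"
    unfolding f_def using in_ball(1)
    by (intro holomorphic_intros holomorphic_on_subset[OF hol4 ball_sub] holomorphic_on_subset[OF hol6 ball_sub]) auto
  have nonconst: "\<not> f constant_on ball \<tau> r"
  proof
    assume "f constant_on ball \<tau> r"
    then obtain c where c: "\<And>z. z \<in> ball \<tau> r \<Longrightarrow> f z = c"
      unfolding constant_on_def by blast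
    obtain \<sigma> where \<sigma>: "\<sigma> \<in> ball \<tau> r" "\<not> (\<exists>\<gamma>\<in>SL2Z. \<sigma> = moebius_act \<gamma> \<tau>)"
      using not_all_equivalent[OF r(1) ball_sub] by blast
    have "\<tau> \<in> ball \<tau> r" using r(1) by simp
    then have "f \<tau> = f \<sigma>" using c \<sigma>(1) by simp
    from f_eq[OF this t in_ball(2)[OF \<sigma>(1)] G4 in_ball(1)[OF \<sigma>(1)]] \<sigma>(2) show False by blast
  qed
  have "open (f ` ball \<tau> r)"
    by (rule open_mapping_thm[OF holf open_ball connected_ball open_ball order_refl nonconst])
  moreover have "f \<tau> \<in> f ` ball \<tau> r" using r(1) by simp
  ultimately have nh: "\<forall>\<^sub>F w in nhds (f \<tau>). w \<in> f ` ball \<tau> r"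
    by (rule eventually_nhds_in_open)
  have "(f \<longlongrightarrow> (eisenstein_cusp 6)\<^sup>2 / eisenstein_cusp 4 ^ 3) cusp_filter"
    unfolding f_def by (intro tendsto_intros eisenstein_tendsto_cusp) (use eisenstein_cusp_nonzero in simp_all)
  moreover have "(eisenstein_cusp 6)\<^sup>2 / eisenstein_cusp 4 ^ 3 = f \<tau>"
    using D G4 eisenstein_cusp_nonzero by (simp add: discriminant_def f_def field_simps)
  ultimately have lim: "(f \<longlongrightarrow> f \<tau>) cusp_filter" by simp
  have "\<forall>\<^sub>F z in cusp_filter. f z \<in> f ` ball \<tau> r"
    using lim nh unfolding filterlim_iff by blast
  moreover have "\<forall>\<^sub>F z in cusp_filter. eisenstein 4 z \<noteq> 0"
    by (rule tendsto_imp_eventually_ne[OF eisenstein_tendsto_cusp eisenstein_cusp_nonzero]) simp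
  ultimately have "\<forall>\<^sub>F z in cusp_filter. f z \<in> f ` ball \<tau> r \<and> eisenstein 4 z \<noteq> 0"
    by (rule eventually_conj)
  then obtain Y where Y: "\<And>z. \<bar>Re z\<bar> \<le> 1 / 2 \<Longrightarrow> Im z \<ge> Y \<Longrightarrow> f z \<in> f ` ball \<tau> r \<and> eisenstein 4 z \<noteq> 0"
    unfolding eventually_cusp_filter by blast
  define y where "y = max Y (2 * Im \<tau> + 2 / Im \<tau> + 1)"
  define \<sigma> where "\<sigma> = Complex 0 y"
  have y1: "y \<ge> 2 * Im \<tau> + 2 / Im \<tau> + 1" by (simp add: y_def)
  have "0 < 2 / Im \<tau>" using pos by simp
  then have y0: "y > 0" using y1 pos by linarith
  have "f \<sigma> \<in> f ` ball \<tau> r" "eisenstein 4 \<sigma> \<noteq> 0"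
    using Y[of \<sigma>] by (auto simp: \<sigma>_def y_def)
  then obtain z where z: "z \<in> ball \<tau> r" "f \<sigma> = f z" "eisenstein 4 \<sigma> \<noteq> 0" by blast
  have \<sigma>h: "\<sigma> \<in> upper_half_plane" using y0 by (simp add: \<sigma>_def upper_half_plane_def)
  obtain \<gamma> where \<gamma>: "\<gamma> \<in> SL2Z" "\<sigma> = moebius_act \<gamma> z"
    using f_eq[OF z(2)[symmetric] in_ball(2)[OF z(1)] \<sigma>h in_ball(1)[OF z(1)] z(3)] by blast
  have "y \<le> max (Im z) (1 / Im z)"
    using Im_moebius_act_le[OF \<gamma>(1) in_ball(2)[OF z(1)]] unfolding \<gamma>(2)[symmetric]
    by (simp add: \<sigma>_def)
  moreover have "1 / Im z \<le> 2 / Im \<tau>"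
  proof -
    have "1 / Im z \<le> 1 / (Im \<tau> / 2)"
      using in_ball(3)[OF z(1)] pos by (intro divide_left_mono) auto
    then show ?thesis by simp
  qed
  ultimately show False
    using in_ball(4)[OF z(1)] y1 pos \<open>0 < 2 / Im \<tau>\<close> by linarith
qed

text \<open>A multiple of the classical \<open>j\<close>.\<close>

definition jinv :: "complex \<Rightarrow> complex" where
  "jinv \<tau> = eisenstein 4 \<tau> ^ 3 / discriminant \<tau>"

lemma jinv_holomorphic: "jinv holomorphic_on upper_half_plane"
proof -
  have "eisenstein 4 holomorphic_on upper_half_plane" "eisenstein 6 holomorphic_on upper_half_plane"
    by (simp_all add: eisenstein_holomorphic)
  with discriminant_holomorphic show ?thesis
    unfolding jinv_def by (intro holomorphic_intros) (use discriminant_nonzero in auto)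
qed

lemma jinv_invariant:
  assumes "\<gamma> \<in> SL2Z" "\<tau> \<in> upper_half_plane"
  shows "jinv (moebius_act \<gamma> \<tau>) = jinv \<tau>"
proof -
  have "eisenstein 4 (moebius_act \<gamma> \<tau>) ^ 3 = denom \<gamma> \<tau> ^ 12 * eisenstein 4 \<tau> ^ 3"
    by (simp add: eisenstein_modular[OF assms] power_mult_distrib flip: power_mult)
  then show ?thesis
    using denom_nonzero[OF assms] by (simp add: jinv_def discriminant_modular[OF assms])
qed

lemma jinv_eqD:
  assumes t: "\<tau> \<in> upper_half_plane" "\<tau>' \<in> upper_half_plane" and eq: "jinv \<tau> = jinv \<tau>'"
  shows "\<exists>\<gamma>\<in>SL2Z. \<tau>' = moebius_act \<gamma> \<tau>"
proof (rule eisenstein_ratio_injective[OF t])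
  have "eisenstein 4 \<tau> ^ 3 * discriminant \<tau>' = eisenstein 4 \<tau>' ^ 3 * discriminant \<tau>"
    using eq discriminant_nonzero[OF t(1)] discriminant_nonzero[OF t(2)]
    by (simp add: jinv_def frac_eq_eq)
  then have eq': "eisenstein_cusp 4 ^ 3 * (eisenstein 4 \<tau> ^ 3 * (eisenstein 6 \<tau>')\<^sup>2) =
      eisenstein_cusp 4 ^ 3 * (eisenstein 4 \<tau>' ^ 3 * (eisenstein 6 \<tau>)\<^sup>2)"
    by (auto simp: discriminant_def algebra_simps)
  have nz: "eisenstein_cusp 4 ^ 3 \<noteq> 0" using eisenstein_cusp_nonzero by simp
  show "eisenstein 4 \<tau> ^ 3 * (eisenstein 6 \<tau>')\<^sup>2 = eisenstein 4 \<tau>' ^ 3 * (eisenstein 6 \<tau>)\<^sup>2"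
    using eq' unfolding mult_left_cancel[OF nz] .
qed

lemma jinv_nonconstant:
  assumes "r > 0" "ball \<tau> r \<subseteq> upper_half_plane" shows "\<not> jinv constant_on ball \<tau> r"
proof
  assume "jinv constant_on ball \<tau> r"
  then obtain c where c: "\<And>z. z \<in> ball \<tau> r \<Longrightarrow> jinv z = c"
    unfolding constant_on_def by blast
  obtain \<sigma> where \<sigma>: "\<sigma> \<in> ball \<tau> r" "\<not> (\<exists>\<gamma>\<in>SL2Z. \<sigma> = moebius_act \<gamma> \<tau>)"
    using not_all_equivalent[OF assms] by blast
  have t: "\<tau> \<in> ball \<tau> r" using assms by simp
  then have "jinv \<tau> = jinv \<sigma>" using c \<sigma>(1) by simp
  then show False using jinv_eqD[of \<tau> \<sigma>] \<sigma> t assms(2) by blast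
qed

lemma jinv_open_map:
  assumes "open U" "U \<subseteq> upper_half_plane" shows "open (jinv ` U)"
proof (rule open_mapping_thm[OF jinv_holomorphic open_upper_half_plane connected_upper_half_plane assms])
  show "\<not> jinv constant_on upper_half_plane"
  proof
    assume c: "jinv constant_on upper_half_plane"
    obtain r where r: "r > 0" "ball \<i> r \<subseteq> upper_half_plane"
      using open_upper_half_plane i_in_half_plane open_contains_ball by blast
    show False using jinv_nonconstant[OF r] constant_on_subset[OF c r(2)] by blast
  qed
qed

text \<open>The image is open, and it is closed because \<open>j\<close> tends to infinity at the cusp.\<close>

theorem jinv_surj: "jinv ` upper_half_plane = UNIV"
proof -
  have inf: "filterlim jinv at_infinity cusp_filter"
    unfolding jinv_def
  proof (rule filterlim_divide_at_infinity)
    show "((\<lambda>\<tau>. eisenstein 4 \<tau> ^ 3) \<longlongrightarrow> eisenstein_cusp 4 ^ 3) cusp_filter"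
      by (intro tendsto_intros eisenstein_tendsto_cusp) simp
    show "filterlim discriminant (at 0) cusp_filter"
    proof (rule filterlim_atI[OF discriminant_tendsto_cusp])
      show "\<forall>\<^sub>F \<tau> in cusp_filter. discriminant \<tau> \<noteq> 0"
        unfolding eventually_cusp_filter
        by (rule exI[of _ 1]) (auto intro!: discriminant_nonzero simp: upper_half_plane_def)
    qed
    show "eisenstein_cusp 4 ^ 3 \<noteq> 0" using eisenstein_cusp_nonzero by simp
  qed
  have "closed (jinv ` upper_half_plane)"
    unfolding closed_limpt islimpt_sequential
  proof safe
    fix w X assume X: "\<forall>n. X n \<in> jinv ` upper_half_plane - {w}" and lim: "X \<longlonglongrightarrow> w"
    have "\<exists>\<tau>. \<tau> \<in> upper_half_plane \<and> \<bar>Re \<tau>\<bar> \<le> 1 / 2 \<and> Im \<tau> \<ge> 1 / 2 \<and> jinv \<tau> = X n" for n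
    proof -
      obtain \<sigma> where \<sigma>: "\<sigma> \<in> upper_half_plane" "X n = jinv \<sigma>" using X by blast
      obtain \<gamma> where \<gamma>: "\<gamma> \<in> SL2Z" "\<bar>Re (moebius_act \<gamma> \<sigma>)\<bar> \<le> 1 / 2" "norm (moebius_act \<gamma> \<sigma>) \<ge> 1"
        by (rule reduce_to_fundamental_domain[OF \<sigma>(1)])
      have h: "moebius_act \<gamma> \<sigma> \<in> upper_half_plane" using \<gamma>(1) \<sigma>(1) by blast
      show ?thesis
        using h \<gamma>(2) fundamental_domain_Im(2)[OF h \<gamma>(2,3)] jinv_invariant[OF \<gamma>(1) \<sigma>(1)] \<sigma>(2) by metis
    qed
    then obtain t where t: "\<And>n. t n \<in> upper_half_plane" "\<And>n. \<bar>Re (t n)\<bar> \<le> 1 / 2" "\<And>n. Im (t n) \<ge> 1 / 2"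
      "\<And>n. jinv (t n) = X n" by metis
    have "\<forall>\<^sub>F z in cusp_filter. norm (jinv z) \<ge> norm w + 1"
      using inf unfolding filterlim_at_infinity[OF order_refl] by (metis less_add_one norm_ge_zero order_le_less_trans)
    then obtain Y where Y: "\<And>z. \<bar>Re z\<bar> \<le> 1 / 2 \<Longrightarrow> Im z \<ge> Y \<Longrightarrow> norm (jinv z) \<ge> norm w + 1"
      unfolding eventually_cusp_filter by blast
    define K where "K = cbox (Complex (- 1 / 2) (1 / 2)) (Complex (1 / 2) Y)"
    have Kh: "K \<subseteq> upper_half_plane" by (auto simp: K_def in_cbox_complex_iff upper_half_plane_def)
    have "compact (jinv ` K)"
      by (intro compact_continuous_image holomorphic_on_imp_continuous_on[OF holomorphic_on_subset[OF jinv_holomorphic Kh]])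
        (simp add: K_def compact_cbox)
    then have cl: "closed (jinv ` K)" by (rule compact_imp_closed)
    have "\<forall>\<^sub>F n in sequentially. norm (X n) < norm w + 1"
      by (rule order_tendstoD(2)[OF tendsto_norm[OF lim]]) simp
    then have "\<forall>\<^sub>F n in sequentially. X n \<in> jinv ` K"
    proof (rule eventually_mono)
      fix n assume n: "norm (X n) < norm w + 1"
      have "Im (t n) < Y"
      proof (rule ccontr)
        assume "\<not> Im (t n) < Y"
        then show False using Y[of "t n"] t(2)[of n] t(4)[of n] n by simp
      qed
      then have "t n \<in> K" using t(2,3)[of n] by (auto simp: K_def in_cbox_complex_iff abs_le_iff)
      then show "X n \<in> jinv ` K" using t(4)[of n] by (metis image_eqI)
    qed
    then have "w \<in> jinv ` K"
      using Lim_in_closed_set[OF cl _ sequentially_bot lim] by blast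
    then show "w \<in> jinv ` upper_half_plane" using Kh by blast
  qed
  moreover have "open (jinv ` upper_half_plane)"
    by (rule jinv_open_map[OF open_upper_half_plane order_refl])
  moreover have "jinv ` upper_half_plane \<noteq> {}" using i_in_half_plane by blast
  ultimately show ?thesis
    using clopen[of "jinv ` upper_half_plane"] by blast
qed

text \<open>Invariant holomorphic functions descend along \<open>j\<close>: off the critical values by local inverses
  of \<open>j\<close>, and the critical values are isolated.\<close>

lemma descend_along_jinv:
  assumes V: "open V" and f: "f holomorphic_on {\<tau> \<in> upper_half_plane. jinv \<tau> \<in> V}"
    and inv: "\<And>\<gamma> \<tau>. \<gamma> \<in> SL2Z \<Longrightarrow> \<tau> \<in> upper_half_plane \<Longrightarrow> jinv \<tau> \<in> V \<Longrightarrow> f (moebius_act \<gamma> \<tau>) = f \<tau>"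
  obtains g where "g holomorphic_on V" "\<And>\<tau>. \<tau> \<in> upper_half_plane \<Longrightarrow> jinv \<tau> \<in> V \<Longrightarrow> f \<tau> = g (jinv \<tau>)"
proof -
  define s where "s w = (SOME \<tau>. \<tau> \<in> upper_half_plane \<and> jinv \<tau> = w)" for w
  have s: "s w \<in> upper_half_plane" "jinv (s w) = w" for w
  proof -
    have "\<exists>\<tau>. \<tau> \<in> upper_half_plane \<and> jinv \<tau> = w" using jinv_surj by (metis UNIV_I imageE)
    from someI_ex[OF this] show "s w \<in> upper_half_plane" "jinv (s w) = w" by (simp_all add: s_def)
  qed
  define g where "g w = f (s w)" for w
  have fg: "f \<tau> = g (jinv \<tau>)" if \<tau>: "\<tau> \<in> upper_half_plane" "jinv \<tau> \<in> V" for \<tau>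
  proof -
    obtain \<gamma> where "\<gamma> \<in> SL2Z" "s (jinv \<tau>) = moebius_act \<gamma> \<tau>"
      using jinv_eqD[OF \<tau>(1) s(1) s(2)[symmetric]] by blast
    then show ?thesis using inv[of \<gamma> \<tau>] \<tau> by (simp add: g_def)
  qed
  define T where "T = {\<tau> \<in> upper_half_plane. jinv \<tau> \<in> V}"
  have contj: "continuous_on upper_half_plane jinv"
    by (rule holomorphic_on_imp_continuous_on[OF jinv_holomorphic])
  have opT: "open T"
  proof -
    have "T = upper_half_plane \<inter> jinv -` V" by (auto simp: T_def)
    then show ?thesis using continuous_open_preimage[OF contj open_upper_half_plane V] by simp
  qed
  have contf: "continuous_on T f"
    using holomorphic_on_imp_continuous_on[OF f] by (simp add: T_def)
  have contg: "continuous_on V g"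
    unfolding continuous_on_open_vimage[OF V]
  proof (intro allI impI)
    fix B :: "complex set" assume "open B"
    then have "open (f -` B \<inter> T)"
      using contf unfolding continuous_on_open_vimage[OF opT] by blast
    then have "open (jinv ` (f -` B \<inter> T))"
      by (rule jinv_open_map) (auto simp: T_def)
    moreover have "g -` B \<inter> V = jinv ` (f -` B \<inter> T)"
    proof (intro equalityI subsetI)
      fix w assume w: "w \<in> g -` B \<inter> V"
      then have "s w \<in> f -` B \<inter> T" using s[of w] by (simp add: T_def g_def)
      then show "w \<in> jinv ` (f -` B \<inter> T)" using s(2)[of w] by (metis image_eqI)
    next
      fix w assume "w \<in> jinv ` (f -` B \<inter> T)"
      then obtain \<tau> where "w = jinv \<tau>" "f \<tau> \<in> B" "\<tau> \<in> upper_half_plane" "jinv \<tau> \<in> V" by (auto simp: T_def)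
      then show "w \<in> g -` B \<inter> V" using fg[of \<tau>] by simp
    qed
    ultimately show "open (g -` B \<inter> V)" by simp
  qed
  have der: "\<exists>D. (g has_field_derivative D) (at (jinv \<tau>))" if t: "\<tau> \<in> T" and d: "deriv jinv \<tau> \<noteq> 0" for \<tau>
  proof -
    have th: "\<tau> \<in> upper_half_plane" using t by (simp add: T_def)
    obtain r where r: "r > 0" "ball \<tau> r \<subseteq> T" "inj_on jinv (ball \<tau> r)"
    proof -
      have "jinv holomorphic_on T" by (rule holomorphic_on_subset[OF jinv_holomorphic]) (auto simp: T_def)
      from has_complex_derivative_locally_injective[OF this t opT d] that show ?thesis by blast
    qed
    have holj: "jinv holomorphic_on ball \<tau> r"
      by (rule holomorphic_on_subset[OF jinv_holomorphic]) (use r(2) in \<open>auto simp: T_def\<close>)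
    obtain k where k: "k holomorphic_on jinv ` ball \<tau> r" "\<And>z. z \<in> ball \<tau> r \<Longrightarrow> k (jinv z) = z"
      using holomorphic_has_inverse[OF holj open_ball r(3)] by metis
    have op: "open (jinv ` ball \<tau> r)"
      by (rule jinv_open_map) (use r(2) in \<open>auto simp: T_def\<close>)
    have "(f \<circ> k) holomorphic_on jinv ` ball \<tau> r"
    proof (rule holomorphic_on_compose_gen[OF k(1) f])
      show "k ` jinv ` ball \<tau> r \<subseteq> {\<tau> \<in> upper_half_plane. jinv \<tau> \<in> V}"
        using k(2) r(2) by (auto simp: T_def)
    qed
    then have "g holomorphic_on jinv ` ball \<tau> r"
    proof (rule holomorphic_transform)
      fix w assume "w \<in> jinv ` ball \<tau> r"
      then obtain z where z: "z \<in> ball \<tau> r" "w = jinv z" by blast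
      then have "z \<in> T" using r(2) by blast
      then show "(f \<circ> k) w = g w" using k(2)[OF z(1)] fg[of z] z(2) by (simp add: T_def)
    qed
    moreover have "jinv \<tau> \<in> jinv ` ball \<tau> r" using r(1) by simp
    ultimately show ?thesis
      unfolding holomorphic_on_open[OF op] by blast
  qed
  have "\<exists>D. (g has_field_derivative D) (at w)" if w: "w \<in> V" for w
  proof -
    define \<tau> where "\<tau> = s w"
    have t: "\<tau> \<in> T" "jinv \<tau> = w" using s[of w] w by (auto simp: T_def \<tau>_def)
    have th: "\<tau> \<in> upper_half_plane" using t by (simp add: T_def)
    have dj: "deriv jinv holomorphic_on upper_half_plane"
      by (rule holomorphic_deriv[OF jinv_holomorphic open_upper_half_plane])
    have "\<exists>r>0. ball \<tau> r \<subseteq> T \<and> (\<forall>z\<in>ball \<tau> r - {\<tau>}. deriv jinv z \<noteq> 0)"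
    proof (cases "deriv jinv \<tau> = 0")
      case True
      have nc: "\<exists>\<beta>\<in>upper_half_plane. deriv jinv \<beta> \<noteq> 0"
      proof (rule ccontr)
        assume "\<not> ?thesis"
        then have "(jinv has_field_derivative 0) (at z)" if "z \<in> upper_half_plane" for z
          using holomorphic_derivI[OF jinv_holomorphic open_upper_half_plane that] that by simp
        then have "jinv constant_on upper_half_plane"
          by (intro has_field_derivative_0_imp_constant_on connected_upper_half_plane open_upper_half_plane)
        moreover obtain r where "r > 0" "ball \<i> r \<subseteq> upper_half_plane"
          using open_upper_half_plane i_in_half_plane open_contains_ball by blast
        ultimately show False using jinv_nonconstant constant_on_subset by blast
      qed
      then obtain \<beta> where \<beta>: "\<beta> \<in> upper_half_plane" "deriv jinv \<beta> \<noteq> 0" by blast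
      obtain r where r: "0 < r" "ball \<tau> r \<subseteq> upper_half_plane"
        "\<And>z. z \<in> ball \<tau> r - {\<tau>} \<Longrightarrow> deriv jinv z \<noteq> 0"
        by (rule isolated_zeros[OF dj open_upper_half_plane connected_upper_half_plane th True \<beta>]) blast
      obtain r' where r': "r' > 0" "ball \<tau> r' \<subseteq> T" using opT t(1) open_contains_ball by blast
      show ?thesis
        by (rule exI[of _ "min r r'"]) (use r r' in auto)
    next
      case False
      have "continuous_on upper_half_plane (deriv jinv)" by (rule holomorphic_on_imp_continuous_on[OF dj])
      then have "open (upper_half_plane \<inter> deriv jinv -` (- {0}))"
        by (rule continuous_open_preimage[OF _ open_upper_half_plane]) auto
      then have "open (T \<inter> (upper_half_plane \<inter> deriv jinv -` (- {0})))" using opT by blast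
      moreover have "\<tau> \<in> T \<inter> (upper_half_plane \<inter> deriv jinv -` (- {0}))" using t th False by auto
      ultimately obtain r where "r > 0" "ball \<tau> r \<subseteq> T \<inter> (upper_half_plane \<inter> deriv jinv -` (- {0}))"
        using open_contains_ball by blast
      then show ?thesis by blast
    qed
    then obtain r where r: "r > 0" "ball \<tau> r \<subseteq> T" "\<And>z. z \<in> ball \<tau> r \<Longrightarrow> z \<noteq> \<tau> \<Longrightarrow> deriv jinv z \<noteq> 0" by blast
    define N where "N = jinv ` ball \<tau> r"
    have opN: "open N" unfolding N_def by (rule jinv_open_map) (use r(2) in \<open>auto simp: T_def\<close>)
    have NV: "N \<subseteq> V" using r(2) by (auto simp: N_def T_def)
    have wN: "w \<in> N" using t(2) r(1) by (auto simp: N_def)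
    have "\<exists>D. (g has_field_derivative D) (at v)" if v: "v \<in> N - {w}" for v
    proof -
      obtain z where z: "z \<in> ball \<tau> r" "v = jinv z" using v by (auto simp: N_def)
      moreover have "z \<noteq> \<tau>" using z v t(2) by auto
      ultimately show ?thesis using der[of z] r(2) r(3)[of z] by blast
    qed
    then have "g holomorphic_on N - {w}"
      using opN by (subst holomorphic_on_open) auto
    then have "g holomorphic_on N"
      by (intro no_isolated_singularity[OF continuous_on_subset[OF contg NV] _ opN, of "{w}"]) auto
    then show ?thesis using wN unfolding holomorphic_on_open[OF opN] by blast
  qed
  then have "g holomorphic_on V" unfolding holomorphic_on_open[OF V] by blast
  with fg show ?thesis by (intro that)
qed

section \<open>Factors of automorphy\<close>

text \<open>A holomorphic one-cocycle of the modular group with values in the nonvanishing functions.\<close>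

definition automorphy_factor :: "(int^2^2 \<Rightarrow> complex \<Rightarrow> complex) \<Rightarrow> bool" where
  "automorphy_factor J \<longleftrightarrow>
     (\<forall>\<gamma>\<in>SL2Z. J \<gamma> holomorphic_on upper_half_plane) \<and>
     (\<forall>\<gamma>\<in>SL2Z. \<forall>\<tau>\<in>upper_half_plane. J \<gamma> \<tau> \<noteq> 0) \<and>
     (\<forall>\<gamma>\<in>SL2Z. \<forall>\<delta>\<in>SL2Z. \<forall>\<tau>\<in>upper_half_plane. J (\<gamma> ** \<delta>) \<tau> = J \<gamma> (moebius_act \<delta> \<tau>) * J \<delta> \<tau>)"

lemma automorphy_factorD:
  assumes "automorphy_factor J" "\<gamma> \<in> SL2Z"
  shows "J \<gamma> holomorphic_on upper_half_plane" "\<tau> \<in> upper_half_plane \<Longrightarrow> J \<gamma> \<tau> \<noteq> 0"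
    "\<delta> \<in> SL2Z \<Longrightarrow> \<tau> \<in> upper_half_plane \<Longrightarrow> J (\<gamma> ** \<delta>) \<tau> = J \<gamma> (moebius_act \<delta> \<tau>) * J \<delta> \<tau>"
  using assms unfolding automorphy_factor_def by blast+

lemma automorphy_factor_one:
  assumes J: "automorphy_factor J" and t: "\<tau> \<in> upper_half_plane"
  shows "J (mat 1) \<tau> = 1"
proof -
  have "J (mat 1) \<tau> = J (mat 1) \<tau> * J (mat 1) \<tau>"
    using automorphy_factorD(3)[OF J SL2Z_one SL2Z_one t] by simp
  then show ?thesis using automorphy_factorD(2)[OF J SL2Z_one t] by simp
qed

text \<open>By proper discontinuity only finitely many elements have to be avoided, and each of those moves \<open>\<tau>0\<close> away from itself.\<close>

lemma isolated_orbit_neighbourhood: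
  assumes t: "\<tau>0 \<in> upper_half_plane"
  obtains r where "r > 0" "ball \<tau>0 r \<subseteq> upper_half_plane"
    "\<And>\<gamma> z. \<gamma> \<in> SL2Z \<Longrightarrow> z \<in> ball \<tau>0 r \<Longrightarrow> moebius_act \<gamma> z \<in> ball \<tau>0 r \<Longrightarrow> moebius_act \<gamma> \<tau>0 = \<tau>0"
proof -
  have pos: "Im \<tau>0 > 0" using t by (simp add: upper_half_plane_def)
  define A where "A = \<bar>Re \<tau>0\<bar> + Im \<tau>0"
  define S where "S = {\<gamma> \<in> SL2Z. \<exists>\<tau>. \<bar>Re \<tau>\<bar> \<le> A \<and> Im \<tau>0 / 2 \<le> Im \<tau> \<and> Im \<tau> \<le> 2 * Im \<tau>0 \<and>
    \<bar>Re (moebius_act \<gamma> \<tau>)\<bar> \<le> A \<and> Im \<tau>0 / 2 \<le> Im (moebius_act \<gamma> \<tau>) \<and> Im (moebius_act \<gamma> \<tau>) \<le> 2 * Im \<tau>0}"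
  have finS: "finite S" unfolding S_def by (rule finite_SL2Z_meeting) (use pos in simp)
  define S' where "S' = {\<gamma> \<in> S. moebius_act \<gamma> \<tau>0 \<noteq> \<tau>0}"
  have finS': "finite S'" using finS by (simp add: S'_def)
  define d where "d = Min (insert 1 ((\<lambda>\<gamma>. dist (moebius_act \<gamma> \<tau>0) \<tau>0) ` S')) / 2"
  have "Min (insert 1 ((\<lambda>\<gamma>. dist (moebius_act \<gamma> \<tau>0) \<tau>0) ` S')) > 0"
    using finS' by (subst Min_gr_iff) (auto simp: S'_def)
  then have d: "d > 0" by (simp add: d_def)
  have d_less: "d < dist (moebius_act \<gamma> \<tau>0) \<tau>0" if "\<gamma> \<in> S'" for \<gamma>
  proof -
    have "Min (insert 1 ((\<lambda>\<gamma>. dist (moebius_act \<gamma> \<tau>0) \<tau>0) ` S')) \<le> dist (moebius_act \<gamma> \<tau>0) \<tau>0"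
      by (rule Min_le) (use finS' that in auto)
    then show ?thesis using d by (simp add: d_def)
  qed
  have "\<forall>\<^sub>F z in nhds \<tau>0. d < dist (moebius_act \<gamma> z) z" if \<gamma>: "\<gamma> \<in> S'" for \<gamma>
  proof -
    have "\<gamma> \<in> SL2Z" using \<gamma> by (simp add: S'_def S_def)
    then have "isCont (moebius_act \<gamma>) \<tau>0"
      using holomorphic_on_imp_continuous_on[OF moebius_act_holomorphic] t
      unfolding continuous_on_eq_continuous_at[OF open_upper_half_plane] by blast
    then have "(moebius_act \<gamma> \<longlongrightarrow> moebius_act \<gamma> \<tau>0) (nhds \<tau>0)"
      by (simp add: isCont_def tendsto_at_iff_tendsto_nhds)
    then have "((\<lambda>z. dist (moebius_act \<gamma> z) z) \<longlongrightarrow> dist (moebius_act \<gamma> \<tau>0) \<tau>0) (nhds \<tau>0)"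
      by (intro tendsto_dist) (simp_all add: filterlim_ident)
    then show ?thesis by (rule order_tendstoD(1)) (rule d_less[OF \<gamma>])
  qed
  then have "\<forall>\<^sub>F z in nhds \<tau>0. \<forall>\<gamma>\<in>S'. d < dist (moebius_act \<gamma> z) z"
    using finS' by (simp add: eventually_ball_finite)
  then obtain r0 where r0: "r0 > 0" "\<And>z \<gamma>. dist z \<tau>0 < r0 \<Longrightarrow> \<gamma> \<in> S' \<Longrightarrow> d < dist (moebius_act \<gamma> z) z"
    unfolding eventually_nhds_metric by blast
  define r where "r = Min {r0, d / 2, Im \<tau>0 / 2}"
  have r: "r > 0" "r \<le> r0" "r \<le> d / 2" "r \<le> Im \<tau>0 / 2"
    using r0(1) d pos by (auto simp: r_def)
  have near: "\<bar>Re z\<bar> \<le> A" "Im \<tau>0 / 2 \<le> Im z" "Im z \<le> 2 * Im \<tau>0" "Im z > 0" if "z \<in> ball \<tau>0 r" for z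
  proof -
    have "norm (z - \<tau>0) < r" using that by (simp add: dist_norm norm_minus_commute)
    then have "\<bar>Re (z - \<tau>0)\<bar> < r" "\<bar>Im (z - \<tau>0)\<bar> < r"
      using abs_Re_le_cmod[of "z - \<tau>0"] abs_Im_le_cmod[of "z - \<tau>0"] by linarith+
    then have "\<bar>Re z - Re \<tau>0\<bar> < r" "\<bar>Im z - Im \<tau>0\<bar> < r" by simp_all
    then show "\<bar>Re z\<bar> \<le> A" "Im \<tau>0 / 2 \<le> Im z" "Im z \<le> 2 * Im \<tau>0" "Im z > 0"
      using r(4) pos unfolding A_def by linarith+
  qed
  show ?thesis
  proof (rule that[OF r(1)])
    show "ball \<tau>0 r \<subseteq> upper_half_plane" using near(4) by (auto simp: upper_half_plane_def)
    fix \<gamma> z assume \<gamma>: "\<gamma> \<in> SL2Z" and z: "z \<in> ball \<tau>0 r" "moebius_act \<gamma> z \<in> ball \<tau>0 r"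
    show "moebius_act \<gamma> \<tau>0 = \<tau>0"
    proof (rule ccontr)
      assume "moebius_act \<gamma> \<tau>0 \<noteq> \<tau>0"
      moreover have "\<gamma> \<in> S"
        unfolding S_def by (intro CollectI conjI \<gamma> exI[of _ z] near[OF z(1)] near[OF z(2)])
      ultimately have "\<gamma> \<in> S'" by (simp add: S'_def)
      moreover have "dist z \<tau>0 < r0" using z(1) r(2) by (simp add: dist_commute)
      ultimately have "d < dist (moebius_act \<gamma> z) z" using r0(2) by blast
      also have "\<dots> \<le> dist (moebius_act \<gamma> z) \<tau>0 + dist \<tau>0 z" by (rule dist_triangle)
      also have "\<dots> < r + r" using z by (simp add: dist_commute)
      finally show False using r(3) by simp
    qed
  qed
qed

text \<open>Averaging over the stabiliser of a point gives a solution near that point, which is carried to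
  the whole preimage of a disc under \<open>j\<close> by the group.\<close>

lemma automorphy_factor_trivial_locally:
  assumes J: "automorphy_factor J"
    and stab: "\<And>\<gamma> \<tau>. \<gamma> \<in> SL2Z \<Longrightarrow> \<tau> \<in> upper_half_plane \<Longrightarrow> moebius_act \<gamma> \<tau> = \<tau> \<Longrightarrow> J \<gamma> \<tau> = 1"
  shows "\<exists>r>0. \<exists>u. u holomorphic_on {\<tau> \<in> upper_half_plane. jinv \<tau> \<in> ball w r} \<and>
    (\<forall>\<tau>. \<tau> \<in> upper_half_plane \<longrightarrow> jinv \<tau> \<in> ball w r \<longrightarrow> u \<tau> \<noteq> 0 \<and>
      (\<forall>\<gamma>\<in>SL2Z. u (moebius_act \<gamma> \<tau>) = J \<gamma> \<tau> * u \<tau>))"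
proof -
  note hol = automorphy_factorD(1)[OF J] and nz = automorphy_factorD(2)[OF J] and mult = automorphy_factorD(3)[OF J]
  obtain \<tau>0 where \<tau>0: "\<tau>0 \<in> upper_half_plane" "jinv \<tau>0 = w"
    using jinv_surj by (metis UNIV_I imageE)
  obtain r1 where r1: "r1 > 0" "ball \<tau>0 r1 \<subseteq> upper_half_plane"
    "\<And>\<gamma> z. \<gamma> \<in> SL2Z \<Longrightarrow> z \<in> ball \<tau>0 r1 \<Longrightarrow> moebius_act \<gamma> z \<in> ball \<tau>0 r1 \<Longrightarrow> moebius_act \<gamma> \<tau>0 = \<tau>0"
    using isolated_orbit_neighbourhood[OF \<tau>0(1)] by metis
  define H where "H = {\<gamma> \<in> SL2Z. moebius_act \<gamma> \<tau>0 = \<tau>0}"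
  have finH: "finite H"
  proof (rule finite_subset)
    have "0 < Im \<tau>0" using \<tau>0(1) by (simp add: upper_half_plane_def)
    from finite_SL2Z_meeting[OF this, of "\<bar>Re \<tau>0\<bar>" "Im \<tau>0"]
    show "finite {\<gamma> \<in> SL2Z. \<exists>\<tau>. \<bar>Re \<tau>\<bar> \<le> \<bar>Re \<tau>0\<bar> \<and> Im \<tau>0 \<le> Im \<tau> \<and> Im \<tau> \<le> Im \<tau>0 \<and>
      \<bar>Re (moebius_act \<gamma> \<tau>)\<bar> \<le> \<bar>Re \<tau>0\<bar> \<and> Im \<tau>0 \<le> Im (moebius_act \<gamma> \<tau>) \<and> Im (moebius_act \<gamma> \<tau>) \<le> Im \<tau>0}" .
    show "H \<subseteq> {\<gamma> \<in> SL2Z. \<exists>\<tau>. \<bar>Re \<tau>\<bar> \<le> \<bar>Re \<tau>0\<bar> \<and> Im \<tau>0 \<le> Im \<tau> \<and> Im \<tau> \<le> Im \<tau>0 \<and>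
      \<bar>Re (moebius_act \<gamma> \<tau>)\<bar> \<le> \<bar>Re \<tau>0\<bar> \<and> Im \<tau>0 \<le> Im (moebius_act \<gamma> \<tau>) \<and> Im (moebius_act \<gamma> \<tau>) \<le> Im \<tau>0}"
      unfolding H_def by (auto intro!: exI[of _ \<tau>0])
  qed
  have HS: "\<gamma> \<in> SL2Z" "moebius_act \<gamma> \<tau>0 = \<tau>0" if "\<gamma> \<in> H" for \<gamma> using that by (simp_all add: H_def)
  have H_mult: "\<gamma> ** \<delta> \<in> H" if "\<gamma> \<in> H" "\<delta> \<in> H" for \<gamma> \<delta>
    using that \<tau>0(1) by (simp add: H_def moebius_act_mult)
  have H_inv: "inv2 \<gamma> \<in> H" if "\<gamma> \<in> H" for \<gamma>
    using that moebius_act_inv2(1)[OF HS(1)[OF that] \<tau>0(1)] by (simp add: H_def)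
  define a where "a \<tau> = (\<Sum>\<gamma>\<in>H. 1 / J \<gamma> \<tau>)" for \<tau>
  have a_hol: "a holomorphic_on upper_half_plane"
    unfolding a_def by (intro holomorphic_intros hol) (use HS nz in auto)
  have a_act: "a (moebius_act \<delta> \<tau>) = J \<delta> \<tau> * a \<tau>" if \<delta>: "\<delta> \<in> H" and t: "\<tau> \<in> upper_half_plane" for \<delta> \<tau>
  proof -
    have cancel: "\<gamma> ** inv2 \<delta> ** \<delta> = \<gamma>" "\<gamma> ** \<delta> ** inv2 \<delta> = \<gamma>" for \<gamma> :: "int^2^2"
      by (simp_all add: matrix_mul_assoc[symmetric] inv2_mult[OF HS(1)[OF \<delta>]])
    have "J \<delta> \<tau> * a \<tau> = (\<Sum>\<gamma>\<in>H. J \<delta> \<tau> * (1 / J \<gamma> \<tau>))"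
      by (simp add: a_def sum_distrib_left)
    also have "\<dots> = (\<Sum>\<gamma>\<in>H. 1 / J \<gamma> (moebius_act \<delta> \<tau>))"
    proof (rule sum.reindex_bij_witness[of _ "\<lambda>\<gamma>. \<gamma> ** \<delta>" "\<lambda>\<gamma>. \<gamma> ** inv2 \<delta>"])
      fix \<gamma> assume \<gamma>: "\<gamma> \<in> H"
      show "1 / J (\<gamma> ** inv2 \<delta>) (moebius_act \<delta> \<tau>) = J \<delta> \<tau> * (1 / J \<gamma> \<tau>)"
        using mult[of "\<gamma> ** inv2 \<delta>" \<delta> \<tau>] nz[of \<delta> \<tau>] nz[of \<gamma> \<tau>] nz[of "\<gamma> ** inv2 \<delta>" "moebius_act \<delta> \<tau>"]
          HS(1)[OF \<delta>] HS(1)[OF \<gamma>] t by (simp add: cancel field_simps)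
    qed (use H_mult H_inv \<delta> cancel in auto)
    finally show ?thesis by (simp add: a_def)
  qed
  have "a \<tau>0 = of_nat (card H)"
    using stab HS \<tau>0(1) by (simp add: a_def)
  moreover have "mat 1 \<in> H" using \<tau>0 by (simp add: H_def)
  ultimately have a0: "a \<tau>0 \<noteq> 0" using finH by auto
  have "open (upper_half_plane \<inter> a -` (- {0}))"
    by (rule continuous_open_preimage[OF holomorphic_on_imp_continuous_on[OF a_hol] open_upper_half_plane]) auto
  moreover have "\<tau>0 \<in> upper_half_plane \<inter> a -` (- {0})" using \<tau>0 a0 by simp
  ultimately obtain r2 where r2: "r2 > 0" "ball \<tau>0 r2 \<subseteq> upper_half_plane \<inter> a -` (- {0})"
    using open_contains_ball by blast
  define N where "N = ball \<tau>0 (min r1 r2)"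
  have N12: "z \<in> ball \<tau>0 r1" "z \<in> ball \<tau>0 r2" if "z \<in> N" for z
    using that by (auto simp: N_def)
  have N: "open N" "\<tau>0 \<in> N" "N \<subseteq> upper_half_plane" "\<And>z. z \<in> N \<Longrightarrow> a z \<noteq> 0"
    "\<And>\<gamma> z. \<gamma> \<in> SL2Z \<Longrightarrow> z \<in> N \<Longrightarrow> moebius_act \<gamma> z \<in> N \<Longrightarrow> \<gamma> \<in> H"
  proof -
    show "open N" "\<tau>0 \<in> N" using r1(1) r2(1) by (auto simp: N_def)
    show "N \<subseteq> upper_half_plane" "\<And>z. z \<in> N \<Longrightarrow> a z \<noteq> 0"
      using N12(2) r2(2) by blast+
    show "\<gamma> \<in> H" if "\<gamma> \<in> SL2Z" "z \<in> N" "moebius_act \<gamma> z \<in> N" for \<gamma> z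
      using r1(3)[OF that(1) N12(1)[OF that(2)] N12(1)[OF that(3)]] that(1) by (simp add: H_def)
  qed
  have opj: "open (jinv ` N)" by (rule jinv_open_map[OF N(1,3)])
  moreover have "w \<in> jinv ` N" using N(2) \<tau>0(2) by blast
  ultimately obtain r where r: "r > 0" "ball w r \<subseteq> jinv ` N"
    using open_contains_ball by blast
  have ex: "\<exists>\<gamma>. \<gamma> \<in> SL2Z \<and> moebius_act \<gamma> \<sigma> \<in> N" if s: "\<sigma> \<in> upper_half_plane" "jinv \<sigma> \<in> ball w r" for \<sigma>
  proof -
    obtain z where z: "z \<in> N" "jinv \<sigma> = jinv z" using s(2) r(2) by blast
    then have "z \<in> upper_half_plane" using N(3) by blast
    from jinv_eqD[OF s(1) this z(2)] show ?thesis using z(1) by metis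
  qed
  define u where "u \<sigma> = (let \<gamma> = SOME \<gamma>. \<gamma> \<in> SL2Z \<and> moebius_act \<gamma> \<sigma> \<in> N in a (moebius_act \<gamma> \<sigma>) / J \<gamma> \<sigma>)" for \<sigma>
  have u: "u \<sigma> = a (moebius_act \<gamma> \<sigma>) / J \<gamma> \<sigma>"
    if s: "\<sigma> \<in> upper_half_plane" and \<gamma>: "\<gamma> \<in> SL2Z" "moebius_act \<gamma> \<sigma> \<in> N" for \<sigma> \<gamma>
  proof -
    define \<beta> where "\<beta> = (SOME \<gamma>. \<gamma> \<in> SL2Z \<and> moebius_act \<gamma> \<sigma> \<in> N)"
    have \<beta>: "\<beta> \<in> SL2Z" "moebius_act \<beta> \<sigma> \<in> N"
      using someI[of "\<lambda>\<gamma>. \<gamma> \<in> SL2Z \<and> moebius_act \<gamma> \<sigma> \<in> N" \<gamma>] \<gamma> by (simp_all add: \<beta>_def)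
    define \<delta> where "\<delta> = \<beta> ** inv2 \<gamma>"
    have \<delta>\<gamma>: "\<delta> ** \<gamma> = \<beta>"
      by (simp add: \<delta>_def matrix_mul_assoc[symmetric] inv2_mult[OF \<gamma>(1)])
    have \<delta>S: "\<delta> \<in> SL2Z" using \<beta> \<gamma> by (simp add: \<delta>_def)
    have act: "moebius_act \<beta> \<sigma> = moebius_act \<delta> (moebius_act \<gamma> \<sigma>)"
      using moebius_act_mult[OF \<delta>S \<gamma>(1) s] by (simp add: \<delta>\<gamma>)
    then have "\<delta> \<in> H" using N(5)[OF \<delta>S \<gamma>(2)] \<beta>(2) by simp
    have gs: "moebius_act \<gamma> \<sigma> \<in> upper_half_plane" using \<gamma>(1) s by blast
    have "u \<sigma> = a (moebius_act \<beta> \<sigma>) / J \<beta> \<sigma>"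
      by (simp add: u_def \<beta>_def Let_def)
    also have "\<dots> = (J \<delta> (moebius_act \<gamma> \<sigma>) * a (moebius_act \<gamma> \<sigma>)) / (J \<delta> (moebius_act \<gamma> \<sigma>) * J \<gamma> \<sigma>)"
      using a_act[OF \<open>\<delta> \<in> H\<close> gs] mult[OF \<delta>S \<gamma>(1) s] by (simp only: act \<delta>\<gamma>)
    also have "\<dots> = a (moebius_act \<gamma> \<sigma>) / J \<gamma> \<sigma>"
      using nz[OF \<delta>S gs] by simp
    finally show ?thesis .
  qed
  let ?P = "{\<tau> \<in> upper_half_plane. jinv \<tau> \<in> ball w r}"
  have "u holomorphic_on (\<Union>\<gamma>\<in>SL2Z. upper_half_plane \<inter> moebius_act \<gamma> -` N)"
  proof (rule holomorphic_on_UN_open)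
    fix \<gamma> assume \<gamma>: "\<gamma> \<in> SL2Z"
    let ?W = "upper_half_plane \<inter> moebius_act \<gamma> -` N"
    show "open ?W"
      by (rule continuous_open_preimage[OF holomorphic_on_imp_continuous_on[OF moebius_act_holomorphic[OF \<gamma>]]
            open_upper_half_plane N(1)])
    have "(\<lambda>\<sigma>. (a \<circ> moebius_act \<gamma>) \<sigma> / J \<gamma> \<sigma>) holomorphic_on ?W"
    proof (intro holomorphic_intros)
      show "(a \<circ> moebius_act \<gamma>) holomorphic_on ?W"
        by (rule holomorphic_on_compose_gen[OF holomorphic_on_subset[OF moebius_act_holomorphic[OF \<gamma>]] a_hol])
          (use N(3) in auto)
      show "J \<gamma> holomorphic_on ?W" by (rule holomorphic_on_subset[OF hol[OF \<gamma>]]) auto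
    qed (use nz[OF \<gamma>] in auto)
    then show "u holomorphic_on ?W"
      by (rule holomorphic_transform) (use u \<gamma> in auto)
  qed
  then have "u holomorphic_on ?P"
  proof (rule holomorphic_on_subset, intro subsetI)
    fix \<sigma> assume s: "\<sigma> \<in> ?P"
    then obtain \<gamma> where "\<gamma> \<in> SL2Z" "moebius_act \<gamma> \<sigma> \<in> N" using ex[of \<sigma>] by auto
    then show "\<sigma> \<in> (\<Union>\<gamma>\<in>SL2Z. upper_half_plane \<inter> moebius_act \<gamma> -` N)" using s by auto
  qed
  moreover have "u \<tau> \<noteq> 0 \<and> (\<forall>\<gamma>\<in>SL2Z. u (moebius_act \<gamma> \<tau>) = J \<gamma> \<tau> * u \<tau>)"
    if t: "\<tau> \<in> upper_half_plane" "jinv \<tau> \<in> ball w r" for \<tau>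
  proof -
    obtain \<gamma> where \<gamma>: "\<gamma> \<in> SL2Z" "moebius_act \<gamma> \<tau> \<in> N" using ex[OF t] by blast
    have "u (moebius_act \<beta> \<tau>) = J \<beta> \<tau> * u \<tau>" if \<beta>: "\<beta> \<in> SL2Z" for \<beta>
    proof -
      define \<delta> where "\<delta> = \<gamma> ** inv2 \<beta>"
      have \<delta>\<beta>: "\<delta> ** \<beta> = \<gamma>" by (simp add: \<delta>_def matrix_mul_assoc[symmetric] inv2_mult[OF \<beta>])
      have \<delta>S: "\<delta> \<in> SL2Z" using \<beta> \<gamma> by (simp add: \<delta>_def)
      have bt: "moebius_act \<beta> \<tau> \<in> upper_half_plane" using \<beta> t(1) by blast
      have act: "moebius_act \<delta> (moebius_act \<beta> \<tau>) = moebius_act \<gamma> \<tau>"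
        using moebius_act_mult[OF \<delta>S \<beta> t(1)] by (simp add: \<delta>\<beta>)
      then have "u (moebius_act \<beta> \<tau>) = a (moebius_act \<gamma> \<tau>) / J \<delta> (moebius_act \<beta> \<tau>)"
        using u[OF bt \<delta>S] \<gamma>(2) by simp
      moreover have "J \<gamma> \<tau> = J \<delta> (moebius_act \<beta> \<tau>) * J \<beta> \<tau>"
        using mult[OF \<delta>S \<beta> t(1)] by (simp add: \<delta>\<beta>)
      ultimately show ?thesis
        using u[OF t(1) \<gamma>] nz[OF \<delta>S bt] nz[OF \<beta> t(1)] by simp
    qed
    then show ?thesis using u[OF t(1) \<gamma>] N(4)[OF \<gamma>(2)] nz[OF \<gamma>(1) t(1)] by simp
  qed
  ultimately show ?thesis using r(1) by blast
qed

text \<open>The local solutions over discs in the \<open>j\<close>-plane differ by invariant functions.  These descend to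
  transition functions on the plane, which split.\<close>

theorem automorphy_factor_trivial:
  assumes J: "automorphy_factor J"
    and stab: "\<And>\<gamma> \<tau>. \<gamma> \<in> SL2Z \<Longrightarrow> \<tau> \<in> upper_half_plane \<Longrightarrow> moebius_act \<gamma> \<tau> = \<tau> \<Longrightarrow> J \<gamma> \<tau> = 1"
  obtains u where "u holomorphic_on upper_half_plane" "\<And>\<tau>. \<tau> \<in> upper_half_plane \<Longrightarrow> u \<tau> \<noteq> 0"
    "\<And>\<gamma> \<tau>. \<gamma> \<in> SL2Z \<Longrightarrow> \<tau> \<in> upper_half_plane \<Longrightarrow> u (moebius_act \<gamma> \<tau>) = J \<gamma> \<tau> * u \<tau>"
proof -
  have local: "\<exists>r>0. \<exists>u. u holomorphic_on {\<tau> \<in> upper_half_plane. jinv \<tau> \<in> ball w r} \<and>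
    (\<forall>\<tau>. \<tau> \<in> upper_half_plane \<longrightarrow> jinv \<tau> \<in> ball w r \<longrightarrow> u \<tau> \<noteq> 0 \<and>
      (\<forall>\<gamma>\<in>SL2Z. u (moebius_act \<gamma> \<tau>) = J \<gamma> \<tau> * u \<tau>))" for w
    by (rule automorphy_factor_trivial_locally[OF J stab])
  define frame where "frame w r u \<longleftrightarrow> r > 0 \<and> u holomorphic_on {\<tau> \<in> upper_half_plane. jinv \<tau> \<in> ball w r} \<and>
    (\<forall>\<tau>. \<tau> \<in> upper_half_plane \<longrightarrow> jinv \<tau> \<in> ball w r \<longrightarrow> u \<tau> \<noteq> 0 \<and>
      (\<forall>\<gamma>\<in>SL2Z. u (moebius_act \<gamma> \<tau>) = J \<gamma> \<tau> * u \<tau>))" for w r u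
  have "\<exists>r u. frame w r u" for w
    using local[of w] unfolding frame_def Bex_def by blast
  then obtain r v where "\<And>w. frame w (r w) (v w)" by metis
  note rv = this[unfolded frame_def]
  note r = conjunct1[OF rv] and v = conjunct1[OF conjunct2[OF rv]]
  have v': "v w \<tau> \<noteq> 0 \<and> (\<forall>\<gamma>\<in>SL2Z. v w (moebius_act \<gamma> \<tau>) = J \<gamma> \<tau> * v w \<tau>)"
    if "\<tau> \<in> upper_half_plane" "jinv \<tau> \<in> ball w (r w)" for w \<tau>
    using conjunct2[OF conjunct2[OF rv[of w]]] that by blast
  define U where "U w = ball w (r w)" for w
  have vnz: "v w \<tau> \<noteq> 0" if "\<tau> \<in> upper_half_plane" "jinv \<tau> \<in> U w" for w \<tau>
    using v'[OF that(1) that(2)[unfolded U_def]] by blast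
  have vact: "v w (moebius_act \<gamma> \<tau>) = J \<gamma> \<tau> * v w \<tau>"
    if "\<tau> \<in> upper_half_plane" "jinv \<tau> \<in> U w" "\<gamma> \<in> SL2Z" for w \<tau> \<gamma>
    using v'[OF that(1) that(2)[unfolded U_def]] that(3) by blast
  have "\<exists>g. g holomorphic_on U w \<inter> U w' \<and>
      (\<forall>\<tau>. \<tau> \<in> upper_half_plane \<longrightarrow> jinv \<tau> \<in> U w \<inter> U w' \<longrightarrow> v w \<tau> / v w' \<tau> = g (jinv \<tau>))" for w w'
  proof -
    have op: "open (U w \<inter> U w')" by (simp add: U_def open_Int)
    have 1: "(\<lambda>\<tau>. v w \<tau> / v w' \<tau>) holomorphic_on {\<tau> \<in> upper_half_plane. jinv \<tau> \<in> U w \<inter> U w'}"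
      by (intro holomorphic_intros holomorphic_on_subset[OF v]) (use vnz in \<open>auto simp: U_def\<close>)
    have 2: "v w (moebius_act \<gamma> \<tau>) / v w' (moebius_act \<gamma> \<tau>) = v w \<tau> / v w' \<tau>"
      if "\<gamma> \<in> SL2Z" "\<tau> \<in> upper_half_plane" "jinv \<tau> \<in> U w \<inter> U w'" for \<gamma> \<tau>
      using that vact[of \<tau> w \<gamma>] vact[of \<tau> w' \<gamma>] automorphy_factorD(2)[OF J] by simp
    show ?thesis
    proof (rule descend_along_jinv[OF op 1])
      show "v w (moebius_act \<gamma> \<tau>) / v w' (moebius_act \<gamma> \<tau>) = v w \<tau> / v w' \<tau>"
        if "\<gamma> \<in> SL2Z" "\<tau> \<in> upper_half_plane" "jinv \<tau> \<in> U w \<inter> U w'" for \<gamma> \<tau>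
        by (rule 2[OF that])
      fix g assume "g holomorphic_on U w \<inter> U w'"
        "\<And>\<tau>. \<tau> \<in> upper_half_plane \<Longrightarrow> jinv \<tau> \<in> U w \<inter> U w' \<Longrightarrow> v w \<tau> / v w' \<tau> = g (jinv \<tau>)"
      then show ?thesis by (intro exI[of _ g] conjI) auto
    qed
  qed
  then obtain g where g0: "\<And>w w'. g w w' holomorphic_on U w \<inter> U w' \<and>
      (\<forall>\<tau>. \<tau> \<in> upper_half_plane \<longrightarrow> jinv \<tau> \<in> U w \<inter> U w' \<longrightarrow> v w \<tau> / v w' \<tau> = g w w' (jinv \<tau>))"
    by metis
  have g: "g w w' holomorphic_on U w \<inter> U w'"
    "\<tau> \<in> upper_half_plane \<Longrightarrow> jinv \<tau> \<in> U w \<Longrightarrow> jinv \<tau> \<in> U w' \<Longrightarrow> g w w' (jinv \<tau>) = v w \<tau> / v w' \<tau>" for w w' \<tau>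
    using g0[of w w'] by simp_all
  have jx: "\<exists>\<tau>. \<tau> \<in> upper_half_plane \<and> jinv \<tau> = z" for z
    using jinv_surj by (metis UNIV_I imageE)
  have self: "z \<in> U z" for z using r by (simp add: U_def)
  interpret multiplicative_cocycle UNIV U g
  proof
    show "UNIV \<subseteq> (\<Union>w. U w)" using self by blast
    fix w w' z assume z: "z \<in> U w" "z \<in> U w'"
    obtain \<tau> where t: "\<tau> \<in> upper_half_plane" "jinv \<tau> = z" using jx by blast
    have e: "g p q z = v p \<tau> / v q \<tau>" if "z \<in> U p" "z \<in> U q" for p q
      using g(2)[of \<tau> p q] t that by simp
    have n: "v p \<tau> \<noteq> 0" if "z \<in> U p" for p
      using vnz[of \<tau> p] t that by simp
    show "g w w' z \<noteq> 0" using e[OF z] n[OF z(1)] n[OF z(2)] by simp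
    fix w'' assume z3: "z \<in> U w''"
    show "g w w' z * g w' w'' z = g w w'' z"
      using e[OF z] e[OF z(2) z3] e[OF z(1) z3] n[OF z(2)] by simp
  next
    show "g w w' holomorphic_on U w \<inter> U w'" for w w' by (rule g(1))
    show "open (U w)" for w by (simp add: U_def)
  qed simp
  obtain h where h: "splits_on UNIV h"
    using cousin_plane[OF multiplicative_cocycle_axioms] by blast
  define u where "u \<tau> = v (jinv \<tau>) \<tau> / h (jinv \<tau>) (jinv \<tau>)" for \<tau>
  have hnz: "h w z \<noteq> 0" if "z \<in> U w" for w z
    using splits_onD(4)[OF h that] by simp
  have u: "u \<tau> = v w \<tau> / h w (jinv \<tau>)" if t: "\<tau> \<in> upper_half_plane" "jinv \<tau> \<in> U w" for w \<tau>
  proof -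
    have "h (jinv \<tau>) (jinv \<tau>) = v (jinv \<tau>) \<tau> / v w \<tau> * h w (jinv \<tau>)"
      using splits_onD(5)[OF h self t(2) UNIV_I] g(2)[OF t(1) self t(2)] by simp
    then show ?thesis
      using vnz[OF t(1) self] vnz[OF t] hnz[OF t(2)] by (simp add: u_def)
  qed
  show ?thesis
  proof (rule that[of u])
    have "u holomorphic_on (\<Union>w. upper_half_plane \<inter> jinv -` U w)"
    proof (rule holomorphic_on_UN_open)
      fix w
      let ?W = "upper_half_plane \<inter> jinv -` U w"
      show "open ?W"
        by (rule continuous_open_preimage[OF holomorphic_on_imp_continuous_on[OF jinv_holomorphic] open_upper_half_plane])
          (simp add: U_def)
      have "(\<lambda>\<tau>. v w \<tau> / (h w \<circ> jinv) \<tau>) holomorphic_on ?W"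
      proof (intro holomorphic_intros)
        show "v w holomorphic_on ?W" by (rule holomorphic_on_subset[OF v]) (auto simp: U_def)
        have "h w holomorphic_on U w" using splits_onD(3)[OF h, of w] by simp
        then show "(h w \<circ> jinv) holomorphic_on ?W"
          by (intro holomorphic_on_compose_gen[OF holomorphic_on_subset[OF jinv_holomorphic]]) auto
      qed (use hnz in auto)
      then show "u holomorphic_on ?W"
        by (rule holomorphic_transform) (auto simp: u[of _ w])
    qed
    then show "u holomorphic_on upper_half_plane"
      by (rule holomorphic_on_subset) (use self in auto)
    show "u \<tau> \<noteq> 0" if "\<tau> \<in> upper_half_plane" for \<tau>
      using vnz[OF that self] hnz[OF self] by (simp add: u_def)
    show "u (moebius_act \<gamma> \<tau>) = J \<gamma> \<tau> * u \<tau>" if "\<gamma> \<in> SL2Z" "\<tau> \<in> upper_half_plane" for \<gamma> \<tau>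
      using vact[OF that(2) self that(1)] jinv_invariant[OF that] by (simp add: u_def)
  qed
qed

text \<open>The values at the generators of the two special stabilisers decide.  At \<open>-1\<close> the factor takes values in
  \<open>{1, -1}\<close>, so it is constant on the half plane and can be read off at \<open>i\<close>.\<close>

lemma automorphy_factor_fixed_points:
  assumes J: "automorphy_factor J" and S: "J mat_S \<i> = 1" and U: "J mat_U rho = 1"
    and \<gamma>: "\<gamma> \<in> SL2Z" and t: "\<tau> \<in> upper_half_plane" and fx: "moebius_act \<gamma> \<tau> = \<tau>"
  shows "J \<gamma> \<tau> = 1"
proof -
  note hol = automorphy_factorD(1)[OF J] and nz = automorphy_factorD(2)[OF J] and mult = automorphy_factorD(3)[OF J]
  have at_i: "J \<delta> \<i> = 1" if "\<delta> \<in> SL2Z" "moebius_act \<delta> \<i> = \<i>" for \<delta>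
    by (rule stabiliser_i_induct[OF that]) (simp_all add: automorphy_factor_one[OF J] mult S)
  have at_rho: "J \<delta> rho = 1" if "\<delta> \<in> SL2Z" "moebius_act \<delta> rho = rho" for \<delta>
    by (rule stabiliser_rho_induct[OF that]) (simp_all add: automorphy_factor_one[OF J] mult U)
  have conj: "J \<gamma> \<tau> = 1"
    if s: "\<sigma> \<in> upper_half_plane" "\<And>\<beta>. \<beta> \<in> SL2Z \<Longrightarrow> moebius_act \<beta> \<sigma> = \<sigma> \<Longrightarrow> J \<beta> \<sigma> = 1"
      and \<delta>: "\<delta> \<in> SL2Z" "\<tau> = moebius_act \<delta> \<sigma>" for \<sigma> \<delta>
  proof -
    define \<beta> where "\<beta> = inv2 \<delta> ** (\<gamma> ** \<delta>)"
    have \<beta>: "\<beta> \<in> SL2Z" using \<gamma> \<delta>(1) by (simp add: \<beta>_def)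
    have eq: "\<delta> ** \<beta> = \<gamma> ** \<delta>"
      by (simp add: \<beta>_def matrix_mul_assoc inv2_mult[OF \<delta>(1)])
    have "moebius_act \<beta> \<sigma> = moebius_act (inv2 \<delta>) (moebius_act \<gamma> \<tau>)"
      using \<gamma> \<delta> s(1) by (simp add: \<beta>_def moebius_act_mult)
    then have \<beta>s: "moebius_act \<beta> \<sigma> = \<sigma>"
      using fx moebius_act_inv2(1)[OF \<delta>(1) s(1)] \<delta>(2) by simp
    have "J \<gamma> \<tau> * J \<delta> \<sigma> = J (\<delta> ** \<beta>) \<sigma>"
      using mult[OF \<gamma> \<delta>(1) s(1)] by (simp add: eq \<delta>(2))
    also have "\<dots> = J \<delta> \<sigma>"
      using mult[OF \<delta>(1) \<beta> s(1)] s(2)[OF \<beta> \<beta>s] by (simp add: \<beta>s)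
    finally show ?thesis using nz[OF \<delta>(1) s(1)] by simp
  qed
  have m1: "(- mat 1 :: int^2^2) \<in> SL2Z" by (simp add: SL2Z_iff)
  have m1_act: "moebius_act (- mat 1) z = z" for z by (simp add: moebius_act_eq denom_def)
  from fixed_point_cases[OF \<gamma> t fx] consider "\<gamma> = mat 1" | "\<gamma> = - mat 1"
    | \<delta> where "\<delta> \<in> SL2Z" "\<tau> = moebius_act \<delta> \<i>" | \<delta> where "\<delta> \<in> SL2Z" "\<tau> = moebius_act \<delta> rho" by blast
  then show ?thesis
  proof cases
    case 2
    have "- mat 1 ** - mat 1 = (mat 1 :: int^2^2)"
      by (simp add: mat2_eq_iff matrix_mult_nth_2)
    then have sq: "J (- mat 1) z * J (- mat 1) z = 1" if "z \<in> upper_half_plane" for z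
      using mult[OF m1 m1 that] automorphy_factor_one[OF J that] by (simp add: m1_act)
    have "J (- mat 1) ` upper_half_plane \<subseteq> {1, - 1}"
      using sq by (auto simp: square_eq_1_iff)
    then have "finite (J (- mat 1) ` upper_half_plane)"
      by (rule finite_subset) simp
    then have "J (- mat 1) constant_on upper_half_plane"
      by (intro continuous_finite_range_constant connected_upper_half_plane
          holomorphic_on_imp_continuous_on[OF hol[OF m1]])
    then have "J (- mat 1) \<tau> = J (- mat 1) \<i>"
      using t i_in_half_plane unfolding constant_on_def by metis
    then show ?thesis using 2 at_i[OF m1 m1_act] by simp
  next
    case (3 \<delta>)
    then show ?thesis using conj[OF i_in_half_plane at_i] by blast
  next
    case (4 \<delta>)
    then show ?thesis using conj[OF rho_in_half_plane at_rho] by blast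
  qed (simp add: automorphy_factor_one[OF J t])
qed

text \<open>The possible characters \<open>A = i\<^sup>a\<close> and \<open>B = \<zeta>\<^sup>b\<close> of the stabilisers of \<open>i\<close> and \<open>\<rho>\<close> agree on
  \<open>-1\<close>, so that \<open>a\<close> and \<open>b\<close> have the same parity; by the Chinese remainder theorem they come from
  the weight \<open>9 a + 4 b\<close>.\<close>

lemma root_of_unity_pairs:
  fixes A B z :: complex
  assumes "A ^ 4 = 1" "B ^ 6 = 1" "A ^ 2 = B ^ 3" and z: "z * z = z - 1"
  obtains k :: nat where "A = \<i> ^ k" "B = z ^ k"
proof -
  have z3: "z ^ 3 = - 1" 
  proof -
    have "z ^ 3 = z * (z * z)" by (simp add: power3_eq_cube)
    also have "\<dots> = z * z - z" unfolding z by (simp add: right_diff_distrib z)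
    also have "\<dots> = - 1" by (simp add: z)
    finally show ?thesis .
  qed
  have z4: "z ^ 4 = - z" using z3 by (simp add: power4_eq_xxxx power3_eq_cube)
  have "(A - 1) * (A + 1) * (A - \<i>) * (A + \<i>) = A ^ 4 - 1"
    by (simp add: power4_eq_xxxx algebra_simps)
  then have "(A - 1) * (A + 1) * (A - \<i>) * (A + \<i>) = 0" using assms(1) by simp
  then have "A = 1 \<or> A = - 1 \<or> A = \<i> \<or> A = - \<i>" by (auto simp: eq_neg_iff_add_eq_0)
  then have "A = \<i> ^ 0 \<or> A = \<i> ^ 1 \<or> A = \<i> ^ 2 \<or> A = \<i> ^ 3" by (auto simp: power3_eq_cube)
  then obtain a where a: "A = \<i> ^ a" by blast
  have "(B - 1) * (B + 1) * ((B - z) * (B + z)) * ((B - (z - 1)) * (B + (z - 1))) =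
      (B * B - 1) * (B * B - z * z) * (B * B - (z - 1) * (z - 1))"
    by (simp add: algebra_simps)
  also have "(z - 1) * (z - 1) = - z" using z by (simp add: algebra_simps)
  also have "(B * B - 1) * (B * B - z * z) * (B * B - - z) =
      (B * B - 1) * (B * B * (B * B) + B * B * (z - z * z) - z * z * z)"
    by (simp add: algebra_simps)
  also have "z - z * z = 1" using z by simp
  also have "z * z * z = - 1" using z3 by (simp add: power3_eq_cube)
  also have "(B * B - 1) * (B * B * (B * B) + B * B * 1 - - 1) = B ^ 6 - 1"
    by (simp add: eval_nat_numeral algebra_simps)
  finally have "(B - 1) * (B + 1) * ((B - z) * (B + z)) * ((B - (z - 1)) * (B + (z - 1))) = 0"
    using assms(2) by simp
  then consider "B - 1 = 0" | "B + 1 = 0" | "B - z = 0" | "B + z = 0" | "B - (z - 1) = 0" | "B + (z - 1) = 0"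
    unfolding mult_eq_0_iff by blast
  then have "\<exists>b. B = z ^ b"
  proof cases
    case 1
    then show ?thesis by (intro exI[of _ 0]) simp
  next
    case 2
    then show ?thesis by (intro exI[of _ 3]) (simp add: z3 eq_neg_iff_add_eq_0)
  next
    case 3
    then show ?thesis by (intro exI[of _ 1]) simp
  next
    case 4
    then show ?thesis by (intro exI[of _ 4]) (simp add: z4 eq_neg_iff_add_eq_0)
  next
    case 5
    then show ?thesis by (intro exI[of _ 2]) (simp add: power2_eq_square z)
  next
    case 6
    have "z ^ 5 = z ^ 3 * (z * z)" by (simp add: eval_nat_numeral)
    also have "\<dots> = 1 - z" unfolding z3 z by simp
    finally have "z ^ 5 = 1 - z" .
    moreover have "B = 1 - z" using 6 by (simp add: algebra_simps)
    ultimately show ?thesis by metis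
  qed
  then obtain b where b: "B = z ^ b" by blast
  have "(- 1) ^ a = (- 1 :: complex) ^ b"
  proof -
    have "(- 1) ^ a = (\<i> ^ 2) ^ a" by simp
    also have "\<dots> = A ^ 2" by (simp only: a power_mult[symmetric] mult.commute)
    also have "\<dots> = (z ^ 3) ^ b" using assms(3) by (simp only: b power_mult[symmetric] mult.commute)
    finally show ?thesis by (simp only: z3)
  qed
  then have sgn: "(- 1) ^ a * (- 1 :: complex) ^ b = 1"
    by (simp flip: power_mult_distrib)
  have i9: "\<i> ^ 9 = \<i>" and i4: "\<i> ^ 4 = 1" by (simp_all add: eval_nat_numeral)
  have z9: "z ^ 9 = - 1"
  proof -
    have "z ^ 9 = (z ^ 3) ^ 3" by (simp flip: power_mult)
    then show ?thesis by (simp add: z3)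
  qed
  show ?thesis
  proof (rule that[of "9 * a + 4 * b"])
    show "A = \<i> ^ (9 * a + 4 * b)" by (simp only: a power_add power_mult i9 i4) simp
    have "z ^ (9 * a + 4 * b) = (- 1) ^ a * ((- 1) * z) ^ b"
      by (simp only: power_add power_mult z9 z4) simp
    also have "\<dots> = ((- 1) ^ a * (- 1) ^ b) * z ^ b" by (simp only: power_mult_distrib mult.assoc)
    finally show "B = z ^ (9 * a + 4 * b)" by (simp only: sgn b) simp
  qed
qed

text \<open>The factor restricts to characters of the stabilisers of \<open>i\<close> and \<open>\<rho>\<close>.  Once \<open>k\<close> is chosen to match both, the
  quotient by \<open>(c \<tau> + d)\<^sup>k\<close> is trivial on all stabilisers.\<close>

theorem automorphy_factor_weight:
  assumes J: "automorphy_factor J"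
  obtains k u where "u holomorphic_on upper_half_plane" "\<And>\<tau>. \<tau> \<in> upper_half_plane \<Longrightarrow> u \<tau> \<noteq> 0"
    "\<And>\<gamma> \<tau>. \<gamma> \<in> SL2Z \<Longrightarrow> \<tau> \<in> upper_half_plane \<Longrightarrow>
      denom \<gamma> \<tau> ^ k * u (moebius_act \<gamma> \<tau>) = J \<gamma> \<tau> * u \<tau>"
proof -
  note hol = automorphy_factorD(1)[OF J] and nz = automorphy_factorD(2)[OF J] and mult = automorphy_factorD(3)[OF J]
  have m1: "(- mat 1 :: int^2^2) \<in> SL2Z" by (simp add: SL2Z_iff)
  have m1_act: "moebius_act (- mat 1) z = z" for z by (simp add: moebius_act_eq denom_def)
  have m1_sq: "- mat 1 ** - mat 1 = (mat 1 :: int^2^2)"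
    by (simp add: mat2_eq_iff matrix_mult_nth_2)
  have Ssq: "mat_S ** mat_S = - mat 1" and Ucube: "mat_U ** (mat_U ** mat_U) = - mat 1"
    by (simp_all add: mat2_eq_iff matrix_mult_nth_2 mat_S_def mat_U_def)
  have fS: "moebius_act mat_S \<i> = \<i>"
    by (simp add: moebius_act_eq denom_def mat_S_def divide_simps)
  have dU: "denom mat_U rho = rho + 1" by (simp add: denom_def mat_U_def)
  have z: "(rho + 1) * (rho + 1) = (rho + 1) - 1"
    using rho_square by (simp add: algebra_simps)
  have fU: "moebius_act mat_U rho = rho"
  proof -
    have "rho + 1 \<noteq> 0" using denom_nonzero[of mat_U rho] dU by auto
    moreover have "rho * (rho + 1) = - 1" by (simp add: rho_square distrib_left)
    ultimately have "- 1 / (rho + 1) = rho" by (metis nonzero_mult_div_cancel_right)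
    then show ?thesis by (simp add: moebius_act_eq denom_def mat_U_def)
  qed
  have sq: "J (- mat 1) z * J (- mat 1) z = 1" if "z \<in> upper_half_plane" for z
    using mult[OF m1 m1 that] automorphy_factor_one[OF J that] by (simp add: m1_act m1_sq)
  have "J (- mat 1) ` upper_half_plane \<subseteq> {1, - 1}"
    using sq by (auto simp: square_eq_1_iff)
  then have "finite (J (- mat 1) ` upper_half_plane)"
    by (rule finite_subset) simp
  then have "J (- mat 1) constant_on upper_half_plane"
    by (intro continuous_finite_range_constant connected_upper_half_plane
        holomorphic_on_imp_continuous_on[OF hol[OF m1]])
  then have const: "J (- mat 1) \<i> = J (- mat 1) rho"
    using i_in_half_plane rho_in_half_plane unfolding constant_on_def by metis
  define A where "A = J mat_S \<i>"
  define B where "B = J mat_U rho"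
  have A2: "A ^ 2 = J (- mat 1) \<i>"
    using mult[of mat_S mat_S \<i>] by (simp add: A_def fS Ssq power2_eq_square)
  have "J (mat_U ** mat_U) rho = B * B"
    using mult[of mat_U mat_U rho] by (simp add: B_def fU)
  then have B3: "B ^ 3 = J (- mat 1) rho"
    using mult[of mat_U "mat_U ** mat_U" rho] by (simp add: B_def fU Ucube power3_eq_cube moebius_act_mult)
  have "A ^ 4 = A ^ 2 * A ^ 2" "B ^ 6 = B ^ 3 * B ^ 3" by (simp_all flip: power_add)
  then have "A ^ 4 = 1" "B ^ 6 = 1" "A ^ 2 = B ^ 3"
    using sq[OF i_in_half_plane] sq[OF rho_in_half_plane] const by (simp_all add: A2 B3)
  from root_of_unity_pairs[OF this z] obtain k where k: "A = \<i> ^ k" "B = (rho + 1) ^ k" by metis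
  \<comment> \<open>The part of weight \<open>0\<close>, trivial on the stabilisers by the choice of \<open>k\<close>.\<close>
  define J' where "J' \<gamma> \<tau> = J \<gamma> \<tau> / denom \<gamma> \<tau> ^ k" for \<gamma> \<tau>
  have J': "automorphy_factor J'"
    unfolding automorphy_factor_def
  proof (intro conjI ballI)
    fix \<gamma> assume \<gamma>: "\<gamma> \<in> SL2Z"
    show "J' \<gamma> holomorphic_on upper_half_plane"
      unfolding J'_def by (intro holomorphic_intros hol[OF \<gamma>]) (use denom_nonzero[OF \<gamma>] in auto)
    fix \<tau> assume t: "\<tau> \<in> upper_half_plane"
    then show "J' \<gamma> \<tau> \<noteq> 0" using nz[OF \<gamma> t] denom_nonzero[OF \<gamma> t] by (simp add: J'_def)
  next
    fix \<gamma> \<delta> \<tau> assume "\<gamma> \<in> SL2Z" "\<delta> \<in> SL2Z" "\<tau> \<in> upper_half_plane"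
    then show "J' (\<gamma> ** \<delta>) \<tau> = J' \<gamma> (moebius_act \<delta> \<tau>) * J' \<delta> \<tau>"
      by (simp add: J'_def mult denom_mult power_mult_distrib)
  qed
  have S': "J' mat_S \<i> = 1" using k(1) by (simp add: J'_def A_def)
  have U': "J' mat_U rho = 1"
    using k(2) denom_nonzero[of mat_U rho] by (simp add: J'_def B_def dU)
  obtain u where u: "u holomorphic_on upper_half_plane" "\<And>\<tau>. \<tau> \<in> upper_half_plane \<Longrightarrow> u \<tau> \<noteq> 0"
    "\<And>\<gamma> \<tau>. \<gamma> \<in> SL2Z \<Longrightarrow> \<tau> \<in> upper_half_plane \<Longrightarrow> u (moebius_act \<gamma> \<tau>) = J' \<gamma> \<tau> * u \<tau>"
    by (rule automorphy_factor_trivial[OF J' automorphy_factor_fixed_points[OF J' S' U']], assumption+)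
      (rule that; assumption)
  show ?thesis
  proof (rule that[of u k, OF u(1,2)])
    show "denom \<gamma> \<tau> ^ k * u (moebius_act \<gamma> \<tau>) = J \<gamma> \<tau> * u \<tau>"
      if "\<gamma> \<in> SL2Z" "\<tau> \<in> upper_half_plane" for \<gamma> \<tau>
      using u(3)[OF that] denom_nonzero[OF that] by (simp add: J'_def)
  qed
qed

section \<open>Line bundles with a global frame\<close>

text \<open>A global frame is recorded as the map \<open>F \<tau> z = z s(\<tau>)\<close>, where \<open>s\<close> is a nowhere vanishing holomorphic
  section.  It is an isomorphism from the trivial bundle and turns all computations in fibres into computations with numbers.\<close>

definition holomorphic_frame :: "'a orbi_bundle \<Rightarrow> (complex \<Rightarrow> complex \<Rightarrow> 'a) \<Rightarrow> bool" where
  "holomorphic_frame L F \<longleftrightarrow>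
     proj L ` total L \<subseteq> upper_half_plane \<and>
     (\<forall>\<tau>\<in>upper_half_plane. \<exists>(U, \<phi>)\<in>trivs L. \<tau> \<in> U) \<and>
     (\<forall>U \<phi>. (U, \<phi>) \<in> trivs L \<longrightarrow> open U \<and> U \<subseteq> upper_half_plane \<and>
        (\<exists>a. a holomorphic_on U \<and> (\<forall>\<tau>\<in>U. a \<tau> \<noteq> 0 \<and> (\<forall>z. \<phi> (F \<tau> z) = a \<tau> * z)))) \<and>
     (\<forall>\<tau>\<in>upper_half_plane. fibre L \<tau> = range (F \<tau>) \<and>
        (\<forall>z w. add L (F \<tau> z) (F \<tau> w) = F \<tau> (z + w)) \<and>
        (\<forall>c z. scale L c (F \<tau> z) = F \<tau> (c * z)))"

definition framed :: "(int^2^2 \<Rightarrow> complex \<Rightarrow> complex) \<Rightarrow> 'a orbi_bundle \<Rightarrow> (complex \<Rightarrow> complex \<Rightarrow> 'a) \<Rightarrow> bool" where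
  "framed J L F \<longleftrightarrow> automorphy_factor J \<and> holomorphic_frame L F \<and>
     (\<forall>\<gamma>\<in>SL2Z. \<forall>\<tau>\<in>upper_half_plane. \<forall>z. act L \<gamma> (F \<tau> z) = F (moebius_act \<gamma> \<tau>) (J \<gamma> \<tau> * z))"

lemma holomorphic_frameD:
  assumes "holomorphic_frame L F"
  shows "v \<in> total L \<Longrightarrow> proj L v \<in> upper_half_plane"
    and "(U, \<phi>) \<in> trivs L \<Longrightarrow> open U"
    and "(U, \<phi>) \<in> trivs L \<Longrightarrow> U \<subseteq> upper_half_plane"
    and "\<tau> \<in> upper_half_plane \<Longrightarrow> \<exists>U \<phi>. (U, \<phi>) \<in> trivs L \<and> \<tau> \<in> U"
    and "\<tau> \<in> upper_half_plane \<Longrightarrow> fibre L \<tau> = range (F \<tau>)"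
    and "\<tau> \<in> upper_half_plane \<Longrightarrow> add L (F \<tau> z) (F \<tau> w) = F \<tau> (z + w)"
    and "\<tau> \<in> upper_half_plane \<Longrightarrow> scale L c (F \<tau> z) = F \<tau> (c * z)"
proof -
  show "v \<in> total L \<Longrightarrow> proj L v \<in> upper_half_plane"
    using assms unfolding holomorphic_frame_def by blast
  show "\<tau> \<in> upper_half_plane \<Longrightarrow> \<exists>U \<phi>. (U, \<phi>) \<in> trivs L \<and> \<tau> \<in> U"
    using assms unfolding holomorphic_frame_def by fast
qed (use assms in \<open>simp_all add: holomorphic_frame_def\<close>)

lemma holomorphic_frame_coordinate:
  assumes "holomorphic_frame L F" "(U, \<phi>) \<in> trivs L"
  obtains a where "a holomorphic_on U" "\<And>\<tau>. \<tau> \<in> U \<Longrightarrow> a \<tau> \<noteq> 0" "\<And>\<tau> z. \<tau> \<in> U \<Longrightarrow> \<phi> (F \<tau> z) = a \<tau> * z"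
proof -
  have "\<exists>a. a holomorphic_on U \<and> (\<forall>\<tau>\<in>U. a \<tau> \<noteq> 0 \<and> (\<forall>z. \<phi> (F \<tau> z) = a \<tau> * z))"
    using assms unfolding holomorphic_frame_def by simp
  then obtain a where "a holomorphic_on U \<and> (\<forall>\<tau>\<in>U. a \<tau> \<noteq> 0 \<and> (\<forall>z. \<phi> (F \<tau> z) = a \<tau> * z))"
    by (rule exE)
  then show thesis by (intro that[of a]) simp_all
qed

lemma framedD:
  assumes "framed J L F"
  shows "automorphy_factor J" "holomorphic_frame L F"
    "\<gamma> \<in> SL2Z \<Longrightarrow> \<tau> \<in> upper_half_plane \<Longrightarrow> act L \<gamma> (F \<tau> z) = F (moebius_act \<gamma> \<tau>) (J \<gamma> \<tau> * z)"
  using assms by (simp_all add: framed_def)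

lemma holomorphic_frame_inj:
  assumes F: "holomorphic_frame L F" and t: "\<tau> \<in> upper_half_plane"
  shows "F \<tau> z = F \<tau> w \<longleftrightarrow> z = w"
proof -
  obtain U \<phi> where U: "(U, \<phi>) \<in> trivs L" "\<tau> \<in> U" using holomorphic_frameD(4)[OF F t] by blast
  obtain a where "a holomorphic_on U" "\<And>\<tau>. \<tau> \<in> U \<Longrightarrow> a \<tau> \<noteq> 0" "\<And>\<tau> z. \<tau> \<in> U \<Longrightarrow> \<phi> (F \<tau> z) = a \<tau> * z"
    by (rule holomorphic_frame_coordinate[OF F U(1)]) (rule that; assumption)
  note a = this(2)[OF U(2)] this(3)[OF U(2)]
  show ?thesis
  proof (rule iffI)
    assume "F \<tau> z = F \<tau> w"
    then have "\<phi> (F \<tau> z) = \<phi> (F \<tau> w)" by simp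
    then show "z = w" using a(1) by (simp add: a(2))
  qed simp
qed

lemma holomorphic_frame_fibre:
  assumes F: "holomorphic_frame L F" and t: "\<tau> \<in> upper_half_plane"
  shows "F \<tau> z \<in> fibre L \<tau>" "F \<tau> z \<in> total L" "proj L (F \<tau> z) = \<tau>"
  using holomorphic_frameD(5)[OF F t] unfolding fibre_def by blast+

lemma holomorphic_frame_total:
  assumes F: "holomorphic_frame L F" and v: "v \<in> total L"
  obtains \<tau> z where "\<tau> \<in> upper_half_plane" "v = F \<tau> z"
proof -
  have t: "proj L v \<in> upper_half_plane" using holomorphic_frameD(1)[OF F v] .
  have "v \<in> fibre L (proj L v)" using v by (simp add: fibre_def)
  then obtain z where "v = F (proj L v) z" using holomorphic_frameD(5)[OF F t] by auto
  with t that show thesis by blast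
qed

lemma holomorphic2_on_linear:
  assumes "open S" "m holomorphic_on S"
  shows "holomorphic2_on (\<lambda>(\<tau>, z). m \<tau> * z) {(\<tau>, z). \<tau> \<in> S}"
  unfolding holomorphic2_on_def
proof
  fix p :: "complex \<times> complex" assume "p \<in> {(\<tau>, z). \<tau> \<in> S}"
  then obtain \<tau> z where p: "p = (\<tau>, z)" "\<tau> \<in> S" by auto
  have "(m has_derivative (\<lambda>h. deriv m \<tau> * h)) (at (fst p))"
    using holomorphic_derivI[OF assms(2,1) p(2)] p(1) by (simp add: has_field_derivative_def)
  from has_derivative_compose[OF has_derivative_fst[OF has_derivative_ident] this]
  have "((\<lambda>q. m (fst q)) has_derivative (\<lambda>q. deriv m \<tau> * fst q)) (at p within {(\<tau>, z). \<tau> \<in> S})" .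
  from has_derivative_mult[OF this has_derivative_snd[OF has_derivative_ident]]
  have "((\<lambda>(\<tau>, z). m \<tau> * z) has_derivative (\<lambda>(h, k). deriv m \<tau> * z * h + m \<tau> * k)) (at p within {(\<tau>, z). \<tau> \<in> S})"
    by (simp add: p(1) case_prod_unfold algebra_simps)
  then show "\<exists>a b. ((\<lambda>(\<tau>, z). m \<tau> * z) has_derivative (\<lambda>(h, k). a * h + b * k)) (at p within {(\<tau>, z). \<tau> \<in> S})"
    by blast
qed

text \<open>In terms of frames, a bundle map is multiplication by a holomorphic function; this covers the
  action, isomorphisms, and the compatibility of the trivialisations.\<close>

lemma bundle_map_over_frames:
  assumes F: "holomorphic_frame L F" and G: "holomorphic_frame M G"
    and f: "f holomorphic_on upper_half_plane" "\<And>\<tau>. \<tau> \<in> upper_half_plane \<Longrightarrow> f \<tau> \<in> upper_half_plane"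
    and c: "c holomorphic_on upper_half_plane"
    and H: "\<And>\<tau> z. \<tau> \<in> upper_half_plane \<Longrightarrow> H (F \<tau> z) = G (f \<tau>) (c \<tau> * z)"
  shows "bundle_map_over f H L M"
  unfolding bundle_map_over_def
proof
  show "fibrewise_linear_over f H L M"
    unfolding fibrewise_linear_over_def
  proof (intro ballI)
    fix \<tau> v assume t: "\<tau> \<in> upper_half_plane" and "v \<in> fibre L \<tau>"
    then obtain z where v: "v = F \<tau> z" using holomorphic_frameD(5)[OF F t] by auto
    show "H v \<in> fibre M (f \<tau>) \<and> (\<forall>w\<in>fibre L \<tau>. H (add L v w) = add M (H v) (H w)) \<and>
        (\<forall>c. H (scale L c v) = scale M c (H v))"
      using holomorphic_frameD(5)[OF F t]
      by (auto simp: v H[OF t] holomorphic_frameD(6,7)[OF F t] holomorphic_frameD(6,7)[OF G f(2)[OF t]]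
          holomorphic_frame_fibre[OF G f(2)[OF t]] algebra_simps)
  qed
  show "holomorphic_over f H L M"
    unfolding holomorphic_over_def
  proof (intro conjI f ballI, clarify)
    fix U \<phi> V \<psi> assume U: "(U, \<phi>) \<in> trivs L" and V: "(V, \<psi>) \<in> trivs M"
    obtain a where a: "a holomorphic_on U" "\<And>\<tau>. \<tau> \<in> U \<Longrightarrow> a \<tau> \<noteq> 0" "\<And>\<tau> z. \<tau> \<in> U \<Longrightarrow> \<phi> (F \<tau> z) = a \<tau> * z"
      by (rule holomorphic_frame_coordinate[OF F U]) (rule that; assumption)
    obtain b where b: "b holomorphic_on V" "\<And>\<tau>. \<tau> \<in> V \<Longrightarrow> b \<tau> \<noteq> 0" "\<And>\<tau> z. \<tau> \<in> V \<Longrightarrow> \<psi> (G \<tau> z) = b \<tau> * z"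
      by (rule holomorphic_frame_coordinate[OF G V]) (rule that; assumption)
    note Uh = holomorphic_frameD(3)[OF F U]
    define S where "S = U \<inter> f -` V"
    define m where "m \<tau> = (b \<circ> f) \<tau> * c \<tau> / a \<tau>" for \<tau>
    have "f holomorphic_on U" using holomorphic_on_subset[OF f(1) Uh] .
    then have "open S"
      unfolding S_def
      by (intro continuous_open_preimage holomorphic_on_imp_continuous_on
          holomorphic_frameD(2)[OF F U] holomorphic_frameD(2)[OF G V])
    have "m holomorphic_on S"
      unfolding m_def
    proof (intro holomorphic_intros)
      show "(b \<circ> f) holomorphic_on S"
        by (rule holomorphic_on_compose_gen[OF holomorphic_on_subset[OF f(1)] b(1)]) (use Uh in \<open>auto simp: S_def\<close>)
      show "c holomorphic_on S" by (rule holomorphic_on_subset[OF c]) (use Uh in \<open>auto simp: S_def\<close>)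
      show "a holomorphic_on S" by (rule holomorphic_on_subset[OF a(1)]) (auto simp: S_def)
      show "a \<tau> \<noteq> 0" if "\<tau> \<in> S" for \<tau> using a(2) that by (simp add: S_def)
    qed
    have hol: "holomorphic2_on (\<lambda>(\<tau>, z). m \<tau> * z) {(\<tau>, z). \<tau> \<in> U \<and> f \<tau> \<in> V}"
      using holomorphic2_on_linear[OF \<open>open S\<close> \<open>m holomorphic_on S\<close>] by (simp add: S_def)
    have "\<psi> (H v) = m \<tau> * \<phi> v" if t: "\<tau> \<in> U" "v \<in> fibre L \<tau>" "f \<tau> \<in> V" for \<tau> v
    proof -
      have th: "\<tau> \<in> upper_half_plane" using t(1) Uh by blast
      obtain z where "v = F \<tau> z" using holomorphic_frameD(5)[OF F th] t(2) by auto
      then show ?thesis using a(2)[OF t(1)] by (simp add: H[OF th] a(3)[OF t(1)] b(3)[OF t(3)] m_def)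
    qed
    then show "\<exists>G. holomorphic2_on G {(\<tau>, z). \<tau> \<in> U \<and> f \<tau> \<in> V} \<and>
        (\<forall>\<tau>\<in>U. \<forall>v\<in>fibre L \<tau>. f \<tau> \<in> V \<longrightarrow> \<psi> (H v) = G (\<tau>, \<phi> v))"
      using hol by (intro exI[of _ "\<lambda>(\<tau>, z). m \<tau> * z"]) simp
  qed
qed

lemma holomorphic_frame_line_bundle:
  assumes F: "holomorphic_frame L F"
  shows "holomorphic_line_bundle L"
  unfolding holomorphic_line_bundle_def
proof (intro conjI ballI)
  show "proj L ` total L \<subseteq> upper_half_plane" using holomorphic_frameD(1)[OF F] by blast
  show "\<exists>(U, \<phi>)\<in>trivs L. \<tau> \<in> U" if "\<tau> \<in> upper_half_plane" for \<tau>
    using holomorphic_frameD(4)[OF F that] by fast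
  have "bundle_map_over id id L L"
    by (rule bundle_map_over_frames[OF F F, where c = "\<lambda>_. 1"]) (auto simp: id_def)
  then show "holomorphic_over id id L L" by (simp add: bundle_map_over_def)
  fix p assume p: "p \<in> trivs L"
  obtain U \<phi> where p_eq: "p = (U, \<phi>)" by (cases p)
  then have U: "(U, \<phi>) \<in> trivs L" using p by simp
  obtain a where "a holomorphic_on U" and a: "\<And>\<tau>. \<tau> \<in> U \<Longrightarrow> a \<tau> \<noteq> 0" "\<And>\<tau> z. \<tau> \<in> U \<Longrightarrow> \<phi> (F \<tau> z) = a \<tau> * z"
    by (rule holomorphic_frame_coordinate[OF F U]) (rule that; assumption)
  have bij: "bij_betw \<phi> (fibre L \<tau>) UNIV" if t: "\<tau> \<in> U" for \<tau>
  proof -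
    have th: "\<tau> \<in> upper_half_plane" using t holomorphic_frameD(3)[OF F U] by blast
    have "\<exists>z. y = a \<tau> * z" for y using a(1)[OF t] by (intro exI[of _ "y / a \<tau>"]) simp
    then have "\<phi> ` range (F \<tau>) = UNIV" using a(2)[OF t] by (auto simp: image_iff)
    moreover have "inj_on \<phi> (range (F \<tau>))" using a[OF t] by (auto simp: inj_on_def)
    ultimately show ?thesis by (simp add: bij_betw_def holomorphic_frameD(5)[OF F th])
  qed
  have lin: "(\<forall>w\<in>fibre L \<tau>. add L v w \<in> fibre L \<tau> \<and> \<phi> (add L v w) = \<phi> v + \<phi> w) \<and>
        (\<forall>c. scale L c v \<in> fibre L \<tau> \<and> \<phi> (scale L c v) = c * \<phi> v)"
    if t: "\<tau> \<in> U" and v: "v \<in> fibre L \<tau>" for \<tau> v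
  proof -
    have th: "\<tau> \<in> upper_half_plane" using t holomorphic_frameD(3)[OF F U] by blast
    show ?thesis using v unfolding holomorphic_frameD(5)[OF F th]
      by (auto simp: holomorphic_frameD(6,7)[OF F th] a(2)[OF t] algebra_simps)
  qed
  show "case p of (U, \<phi>) \<Rightarrow> open U \<and> U \<subseteq> upper_half_plane \<and>
        (\<forall>\<tau>\<in>U. bij_betw \<phi> (fibre L \<tau>) UNIV \<and>
           (\<forall>v\<in>fibre L \<tau>.
              (\<forall>w\<in>fibre L \<tau>. add L v w \<in> fibre L \<tau> \<and> \<phi> (add L v w) = \<phi> v + \<phi> w) \<and>
              (\<forall>c. scale L c v \<in> fibre L \<tau> \<and> \<phi> (scale L c v) = c * \<phi> v)))"
    unfolding p_eq prod.case
    by (intro conjI ballI holomorphic_frameD(2,3)[OF F U] bij) (use lin in simp_all)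
qed

lemma framed_line_bundle:
  assumes L: "framed J L F"
  shows "orbi_line_bundle L"
  unfolding orbi_line_bundle_def
proof (intro conjI ballI)
  note J = framedD(1)[OF L] and F = framedD(2)[OF L] and act = framedD(3)[OF L]
  show "holomorphic_line_bundle L" by (rule holomorphic_frame_line_bundle[OF F])
  show "bundle_map_over (moebius_act \<gamma>) (act L \<gamma>) L L" if "\<gamma> \<in> SL2Z" for \<gamma>
    by (rule bundle_map_over_frames[OF F F moebius_act_holomorphic[OF that] _ automorphy_factorD(1)[OF J that] act[OF that]])
      (use that in auto)
  show "act L (mat 1) v = v" if v: "v \<in> total L" for v
  proof -
    obtain \<tau> z where "\<tau> \<in> upper_half_plane" "v = F \<tau> z" by (rule holomorphic_frame_total[OF F v])
    then show ?thesis by (simp add: act automorphy_factor_one[OF J])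
  qed
  show "act L (\<gamma> ** \<delta>) v = act L \<gamma> (act L \<delta> v)" if g: "\<gamma> \<in> SL2Z" "\<delta> \<in> SL2Z" and v: "v \<in> total L" for \<gamma> \<delta> v
  proof -
    obtain \<tau> z where "\<tau> \<in> upper_half_plane" "v = F \<tau> z" by (rule holomorphic_frame_total[OF F v])
    with g show ?thesis
      by (simp add: act automorphy_factorD(3)[OF J] moebius_act_mult mult.assoc)
  qed
qed

lemma framed_hom:
  assumes L: "framed J L F" and M: "framed J M G"
  shows "\<exists>H. orbi_hom H L M \<and> (\<forall>\<tau>\<in>upper_half_plane. \<forall>z. H (F \<tau> z) = G \<tau> z)"
proof -
  note F = framedD(2)[OF L] and G = framedD(2)[OF M]
  define H where "H v = G (proj L v) (inv_into UNIV (F (proj L v)) v)" for v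
  have H: "H (F \<tau> z) = G \<tau> z" if "\<tau> \<in> upper_half_plane" for \<tau> z
  proof -
    have "inj (F \<tau>)" using holomorphic_frame_inj[OF F that] by (auto intro: injI)
    then show ?thesis by (simp add: H_def holomorphic_frame_fibre[OF F that])
  qed
  have "bundle_map_over id H L M"
    by (rule bundle_map_over_frames[OF F G, where c = "\<lambda>_. 1"]) (auto simp: id_def H)
  moreover have "H (act L \<gamma> v) = act M \<gamma> (H v)" if g: "\<gamma> \<in> SL2Z" and v: "v \<in> total L" for \<gamma> v
  proof -
    obtain \<tau> z where "\<tau> \<in> upper_half_plane" "v = F \<tau> z" by (rule holomorphic_frame_total[OF F v])
    with g show ?thesis by (simp add: framedD(3)[OF L] framedD(3)[OF M] H)
  qed
  ultimately have "orbi_hom H L M" unfolding orbi_hom_def by simp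
  then show ?thesis using H by (intro exI[of _ H]) simp
qed

lemma framed_iso:
  assumes L: "framed J L F" and M: "framed J M G"
  shows "orbi_iso L M"
proof -
  obtain H where H: "orbi_hom H L M \<and> (\<forall>\<tau>\<in>upper_half_plane. \<forall>z. H (F \<tau> z) = G \<tau> z)"
    using framed_hom[OF L M] by (rule exE)
  obtain K where K: "orbi_hom K M L \<and> (\<forall>\<tau>\<in>upper_half_plane. \<forall>z. K (G \<tau> z) = F \<tau> z)"
    using framed_hom[OF M L] by (rule exE)
  have "K (H v) = v" if "v \<in> total L" for v
    by (rule holomorphic_frame_total[OF framedD(2)[OF L] that]) (use H K in simp)
  moreover have "H (K v) = v" if "v \<in> total M" for v
    by (rule holomorphic_frame_total[OF framedD(2)[OF M] that]) (use H K in simp)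
  ultimately show ?thesis unfolding orbi_iso_def using H K
    by (intro exI[of _ H] exI[of _ K]) simp
qed

text \<open>Changing the frame by a nonvanishing function changes the factor of automorphy by a coboundary.\<close>

lemma framed_rescale:
  assumes L: "framed J L F" and J': "automorphy_factor J'"
    and u: "u holomorphic_on upper_half_plane" "\<And>\<tau>. \<tau> \<in> upper_half_plane \<Longrightarrow> u \<tau> \<noteq> 0"
    and eq: "\<And>\<gamma> \<tau>. \<gamma> \<in> SL2Z \<Longrightarrow> \<tau> \<in> upper_half_plane \<Longrightarrow> J' \<gamma> \<tau> * u (moebius_act \<gamma> \<tau>) = J \<gamma> \<tau> * u \<tau>"
  shows "framed J' L (\<lambda>\<tau> z. F \<tau> (u \<tau> * z))"
  unfolding framed_def
proof (intro conjI ballI allI J')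
  note F = framedD(2)[OF L]
  show "holomorphic_frame L (\<lambda>\<tau> z. F \<tau> (u \<tau> * z))"
    unfolding holomorphic_frame_def
  proof (intro conjI ballI allI impI)
    show "proj L ` total L \<subseteq> upper_half_plane" using holomorphic_frameD(1)[OF F] by blast
    show "\<exists>(U, \<phi>)\<in>trivs L. \<tau> \<in> U" if "\<tau> \<in> upper_half_plane" for \<tau>
      using holomorphic_frameD(4)[OF F that] by fast
    fix \<tau> assume t: "\<tau> \<in> upper_half_plane"
    have "range ((*) (u \<tau>)) = UNIV"
      using u(2)[OF t] by (intro surjI[of _ "\<lambda>z. z / u \<tau>"]) simp
    then show "fibre L \<tau> = range (\<lambda>z. F \<tau> (u \<tau> * z))"
      using image_image[of "F \<tau>" "(*) (u \<tau>)" UNIV] by (simp add: holomorphic_frameD(5)[OF F t])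
    show "add L (F \<tau> (u \<tau> * z)) (F \<tau> (u \<tau> * w)) = F \<tau> (u \<tau> * (z + w))" for z w
      by (simp add: holomorphic_frameD(6)[OF F t] algebra_simps)
    show "scale L c (F \<tau> (u \<tau> * z)) = F \<tau> (u \<tau> * (c * z))" for c z
      by (simp add: holomorphic_frameD(7)[OF F t] algebra_simps)
  next
    fix U \<phi> assume U: "(U, \<phi>) \<in> trivs L"
    show "open U" "U \<subseteq> upper_half_plane" using holomorphic_frameD(2,3)[OF F U] by auto
    obtain a where a: "a holomorphic_on U" "\<And>\<tau>. \<tau> \<in> U \<Longrightarrow> a \<tau> \<noteq> 0" "\<And>\<tau> z. \<tau> \<in> U \<Longrightarrow> \<phi> (F \<tau> z) = a \<tau> * z"
      by (rule holomorphic_frame_coordinate[OF F U]) (rule that; assumption)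
    have "(\<lambda>\<tau>. a \<tau> * u \<tau>) holomorphic_on U"
      by (intro holomorphic_intros a(1) holomorphic_on_subset[OF u(1) holomorphic_frameD(3)[OF F U]])
    then show "\<exists>a. a holomorphic_on U \<and> (\<forall>\<tau>\<in>U. a \<tau> \<noteq> 0 \<and> (\<forall>z. \<phi> (F \<tau> (u \<tau> * z)) = a \<tau> * z))"
      using a(2,3) u(2) holomorphic_frameD(3)[OF F U]
      by (intro exI[of _ "\<lambda>\<tau>. a \<tau> * u \<tau>"]) auto
  qed
  fix \<gamma> \<tau> z assume gt: "\<gamma> \<in> SL2Z" "\<tau> \<in> upper_half_plane"
  have "u (moebius_act \<gamma> \<tau>) * (J' \<gamma> \<tau> * z) = J' \<gamma> \<tau> * u (moebius_act \<gamma> \<tau>) * z" by (simp only: ac_simps)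
  also have "\<dots> = J \<gamma> \<tau> * (u \<tau> * z)" by (simp only: eq[OF gt] mult.assoc)
  finally show "act L \<gamma> (F \<tau> (u \<tau> * z)) = F (moebius_act \<gamma> \<tau>) (u (moebius_act \<gamma> \<tau>) * (J' \<gamma> \<tau> * z))"
    by (simp only: framedD(3)[OF L gt])
qed

section \<open>Every orbifold line bundle has a frame of some weight\<close>

lemma holomorphic2_on_along_graph:
  assumes G: "holomorphic2_on G {(\<tau>, z). \<tau> \<in> S}" and S: "open S" and c: "c holomorphic_on S"
  shows "(\<lambda>\<tau>. G (\<tau>, c \<tau>)) holomorphic_on S"
  unfolding holomorphic_on_def
proof
  fix \<tau> assume t: "\<tau> \<in> S"
  have "(\<tau>, c \<tau>) \<in> {(\<tau>, z). \<tau> \<in> S}" using t by simp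
  with G obtain a b where
    "(G has_derivative (\<lambda>(h, k). a * h + b * k)) (at (\<tau>, c \<tau>) within {(\<tau>, z). \<tau> \<in> S})"
    unfolding holomorphic2_on_def by blast
  then have D: "(G has_derivative (\<lambda>(h, k). a * h + b * k)) (at (\<tau>, c \<tau>) within (\<lambda>\<tau>. (\<tau>, c \<tau>)) ` S)"
    by (rule has_derivative_subset) auto
  have "(c has_derivative (\<lambda>h. deriv c \<tau> * h)) (at \<tau>)"
    using holomorphic_derivI[OF c S t] by (simp add: has_field_derivative_def)
  then have "((\<lambda>\<tau>. (\<tau>, c \<tau>)) has_derivative (\<lambda>h. (h, deriv c \<tau> * h))) (at \<tau> within S)"
    by (intro has_derivative_Pair has_derivative_ident) (rule has_derivative_at_withinI)
  from has_derivative_in_compose[OF this D]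
  have "((\<lambda>\<tau>. G (\<tau>, c \<tau>)) has_derivative (\<lambda>h. (a + b * deriv c \<tau>) * h)) (at \<tau> within S)"
    by (simp add: algebra_simps)
  then show "(\<lambda>\<tau>. G (\<tau>, c \<tau>)) field_differentiable at \<tau> within S"
    unfolding field_differentiable_def has_field_derivative_def by (rule exI)
qed

lemma holomorphic_over_coordinates:
  assumes F: "holomorphic_over f F L M" and U: "(U, \<phi>) \<in> trivs L" and V: "(V, \<psi>) \<in> trivs M"
  obtains G where "holomorphic2_on G {(\<tau>, z). \<tau> \<in> U \<and> f \<tau> \<in> V}"
    "\<And>\<tau> v. \<tau> \<in> U \<Longrightarrow> f \<tau> \<in> V \<Longrightarrow> v \<in> fibre L \<tau> \<Longrightarrow> \<psi> (F v) = G (\<tau>, \<phi> v)"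
proof -
  note conjunct2[OF F[unfolded holomorphic_over_def], THEN bspec, OF U, unfolded prod.case, THEN bspec, OF V,
      unfolded prod.case]
  then obtain G where G: "holomorphic2_on G {(\<tau>, z). \<tau> \<in> U \<and> f \<tau> \<in> V} \<and>
      (\<forall>\<tau>\<in>U. \<forall>v\<in>fibre L \<tau>. f \<tau> \<in> V \<longrightarrow> \<psi> (F v) = G (\<tau>, \<phi> v))"
    by (rule exE)
  show thesis by (rule that[OF conjunct1[OF G]]) (use conjunct2[OF G] in simp)
qed

text \<open>The transition functions of the atlas form a multiplicative cocycle on the half plane; a splitting consists of
  the local coordinates of a nowhere vanishing section.\<close>

theorem global_frame_exists:
  fixes L :: "'a orbi_bundle"
  assumes L: "holomorphic_line_bundle L"
  shows "\<exists>F. holomorphic_frame L F"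
proof -
  \<comment> \<open>All pairs of a set and a function serve as indices; those outside the atlas get the empty set.\<close>
  define U where "U i = (if i \<in> trivs L then fst i else {})" for i :: "complex set \<times> ('a \<Rightarrow> complex)"
  have triv: "open (fst i) \<and> fst i \<subseteq> upper_half_plane \<and> (\<forall>\<tau>\<in>fst i. bij_betw (snd i) (fibre L \<tau>) UNIV \<and>
           (\<forall>v\<in>fibre L \<tau>.
              (\<forall>w\<in>fibre L \<tau>. add L v w \<in> fibre L \<tau> \<and> snd i (add L v w) = snd i v + snd i w) \<and>
              (\<forall>c. scale L c v \<in> fibre L \<tau> \<and> snd i (scale L c v) = c * snd i v)))" if "i \<in> trivs L" for i
    using L that unfolding holomorphic_line_bundle_def by (simp add: case_prod_unfold)
  have UD: "i \<in> trivs L" "\<tau> \<in> fst i" if "\<tau> \<in> U i" for i \<tau>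
    using that by (auto simp: U_def split: if_splits)
  have opU: "open (U i)" for i using triv by (simp add: U_def)
  have Usub: "U i \<subseteq> upper_half_plane" for i using triv by (simp add: U_def)
  have bij: "bij_betw (snd i) (fibre L \<tau>) UNIV" if "\<tau> \<in> U i" for i \<tau>
    using triv[OF UD(1)[OF that]] UD(2)[OF that] by simp
  have add: "add L v w \<in> fibre L \<tau>" "snd i (add L v w) = snd i v + snd i w"
    if "\<tau> \<in> U i" "v \<in> fibre L \<tau>" "w \<in> fibre L \<tau>" for i \<tau> v w
    using triv[OF UD(1)[OF that(1)]] UD(2)[OF that(1)] that(2,3) by simp_all
  have scl: "scale L c v \<in> fibre L \<tau>" "snd i (scale L c v) = c * snd i v"
    if "\<tau> \<in> U i" "v \<in> fibre L \<tau>" for i \<tau> v c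
    using triv[OF UD(1)[OF that(1)]] UD(2)[OF that(1)] that(2) by simp_all
  have cov: "\<exists>i. \<tau> \<in> U i" if "\<tau> \<in> upper_half_plane" for \<tau>
  proof -
    have "\<exists>i\<in>trivs L. \<tau> \<in> fst i"
      using L that unfolding holomorphic_line_bundle_def by (simp add: case_prod_unfold)
    then obtain i where "i \<in> trivs L" "\<tau> \<in> fst i" by (rule bexE)
    then have "\<tau> \<in> U i" by (simp add: U_def)
    then show ?thesis by (rule exI)
  qed
  have inj: "v = w" if "\<tau> \<in> U i" "v \<in> fibre L \<tau>" "w \<in> fibre L \<tau>" "snd i v = snd i w" for i \<tau> v w
    using bij_betw_imp_inj_on[OF bij[OF that(1)]] that(2-4) by (simp add: inj_on_def)
  have inv: "inv_into (fibre L \<tau>) (snd i) c \<in> fibre L \<tau>" "snd i (inv_into (fibre L \<tau>) (snd i) c) = c"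
    if "\<tau> \<in> U i" for i \<tau> c
  proof -
    have "c \<in> snd i ` fibre L \<tau>" using bij_betw_imp_surj_on[OF bij[OF that]] by simp
    then show "inv_into (fibre L \<tau>) (snd i) c \<in> fibre L \<tau>" "snd i (inv_into (fibre L \<tau>) (snd i) c) = c"
      by (rule inv_into_into, rule f_inv_into_f)
  qed
  \<comment> \<open>The local frame with coordinate \<open>1\<close>, whose other coordinates are the transition functions.\<close>
  define e where "e i \<tau> = inv_into (fibre L \<tau>) (snd i) 1" for i :: "complex set \<times> ('a \<Rightarrow> complex)" and \<tau>
  have e: "e i \<tau> \<in> fibre L \<tau>" "snd i (e i \<tau>) = 1" if "\<tau> \<in> U i" for i \<tau>
    using inv[OF that] by (simp_all add: e_def)
  define g where "g i j \<tau> = snd i (e j \<tau>)" for i j :: "complex set \<times> ('a \<Rightarrow> complex)" and \<tau>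
  have change: "snd i v = g i j \<tau> * snd j v" if t: "\<tau> \<in> U i" "\<tau> \<in> U j" and v: "v \<in> fibre L \<tau>" for i j \<tau> v
  proof -
    have "v = scale L (snd j v) (e j \<tau>)"
      by (rule inj[OF t(2) v scl(1)[OF t(2) e(1)[OF t(2)]]]) (simp add: scl(2)[OF t(2) e(1)[OF t(2)]] e(2)[OF t(2)])
    then have "snd i v = snd i (scale L (snd j v) (e j \<tau>))" by simp
    also have "\<dots> = snd j v * g i j \<tau>" by (simp add: scl(2)[OF t(1) e(1)[OF t(2)]] g_def)
    finally show ?thesis by (simp add: mult.commute)
  qed
  have cocycle: "multiplicative_cocycle {z. Im z > 0} U g"
  proof
    show "open {z. Im z > 0}" by (rule open_halfspace_Im_gt)
    show "{z. Im z > 0} \<subseteq> (\<Union>i. U i)" using cov by (auto simp: upper_half_plane_def)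
    show "open (U i)" for i by (rule opU)
    show "g i j holomorphic_on U i \<inter> U j" for i j
    proof (cases "i \<in> trivs L \<and> j \<in> trivs L")
      case True
      have "holomorphic_over id id L L" using L unfolding holomorphic_line_bundle_def by simp
      moreover have "(fst j, snd j) \<in> trivs L" "(fst i, snd i) \<in> trivs L" using True by simp_all
      ultimately obtain H where H: "holomorphic2_on H {(\<tau>, z). \<tau> \<in> fst j \<and> id \<tau> \<in> fst i}"
          "\<And>\<tau> v. \<tau> \<in> fst j \<Longrightarrow> id \<tau> \<in> fst i \<Longrightarrow> v \<in> fibre L \<tau> \<Longrightarrow> snd i (id v) = H (\<tau>, snd j v)"
        by (rule holomorphic_over_coordinates) (rule that; assumption)
      have hol: "holomorphic2_on H {(\<tau>, z). \<tau> \<in> U i \<inter> U j}"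
        using H(1) True by (simp add: U_def conj_commute)
      have "(\<lambda>\<tau>. H (\<tau>, 1)) holomorphic_on U i \<inter> U j"
        by (rule holomorphic2_on_along_graph[OF hol]) (auto intro: opU)
      then show ?thesis
      proof (rule holomorphic_transform)
        fix \<tau> assume "\<tau> \<in> U i \<inter> U j"
        then have t: "\<tau> \<in> U i" "\<tau> \<in> U j" by simp_all
        have "snd i (id (e j \<tau>)) = H (\<tau>, snd j (e j \<tau>))"
          by (rule H(2)) (simp_all add: UD[OF t(1)] UD[OF t(2)] e[OF t(2)])
        then show "H (\<tau>, 1) = g i j \<tau>" by (simp add: e(2)[OF t(2)] g_def)
      qed
    next
      case False
      then have "U i \<inter> U j = {}" by (auto simp: U_def)
      then show ?thesis by (simp add: holomorphic_on_def)
    qed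
    show mult: "g i j z * g j k z = g i k z" if "z \<in> U i" "z \<in> U j" "z \<in> U k" for i j k z
      using change[OF that(1,2) e(1)[OF that(3)]] by (simp add: g_def)
    show "g i j z \<noteq> 0" if "z \<in> U i" "z \<in> U j" for i j z
      using mult[OF that that(1)] e(2)[OF that(1)] by (auto simp: g_def)
  qed
  then interpret multiplicative_cocycle "{z. Im z > 0}" U g .
  obtain h where "splits_on {z. Im z > 0} h" using cousin_half_plane[OF cocycle] by (rule exE)
  then have h: "splits_on upper_half_plane h" by (simp add: upper_half_plane_def)
  define I where "I \<tau> = (SOME i. \<tau> \<in> U i)" for \<tau>
  have I: "\<tau> \<in> U (I \<tau>)" if "\<tau> \<in> upper_half_plane" for \<tau>
    unfolding I_def by (rule someI_ex[OF cov[OF that]])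
  define F where "F \<tau> w = inv_into (fibre L \<tau>) (snd (I \<tau>)) (h (I \<tau>) \<tau> * w)" for \<tau> w
  have Ff: "F \<tau> w \<in> fibre L \<tau>" if "\<tau> \<in> upper_half_plane" for \<tau> w
    unfolding F_def by (rule inv(1)[OF I[OF that]])
  have Fc: "snd i (F \<tau> w) = h i \<tau> * w" if t: "\<tau> \<in> U i" for i \<tau> w
  proof -
    have th: "\<tau> \<in> upper_half_plane" using t Usub by blast
    have "snd (I \<tau>) (F \<tau> w) = h (I \<tau>) \<tau> * w" unfolding F_def by (rule inv(2)[OF I[OF th]])
    then show ?thesis
      using change[OF t I[OF th] Ff[OF th]] splits_onD(5)[OF h t I[OF th] th] by simp
  qed
  have "holomorphic_frame L F"
    unfolding holomorphic_frame_def
  proof (intro conjI ballI allI impI)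
    show "proj L ` total L \<subseteq> upper_half_plane" using L by (simp add: holomorphic_line_bundle_def)
    show "\<exists>(U, \<phi>)\<in>trivs L. \<tau> \<in> U" if "\<tau> \<in> upper_half_plane" for \<tau>
      using L that unfolding holomorphic_line_bundle_def by simp
    fix \<tau> assume t: "\<tau> \<in> upper_half_plane"
    note I = I[OF t]
    have nz: "h (I \<tau>) \<tau> \<noteq> 0" by (rule splits_onD(4)[OF h I t])
    show "fibre L \<tau> = range (F \<tau>)"
    proof
      show "range (F \<tau>) \<subseteq> fibre L \<tau>" by (rule image_subsetI) (rule Ff[OF t])
      show "fibre L \<tau> \<subseteq> range (F \<tau>)"
      proof
        fix v assume v: "v \<in> fibre L \<tau>"
        have "v = F \<tau> (snd (I \<tau>) v / h (I \<tau>) \<tau>)"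
          by (rule inj[OF I v Ff[OF t]]) (simp add: Fc[OF I] nz)
        then show "v \<in> range (F \<tau>)" by (rule range_eqI)
      qed
    qed
    show "add L (F \<tau> z) (F \<tau> w) = F \<tau> (z + w)" for z w
      by (rule inj[OF I add(1)[OF I Ff[OF t] Ff[OF t]] Ff[OF t]])
        (simp add: add(2)[OF I Ff[OF t] Ff[OF t]] Fc[OF I] algebra_simps)
    show "scale L c (F \<tau> z) = F \<tau> (c * z)" for c z
      by (rule inj[OF I scl(1)[OF I Ff[OF t]] Ff[OF t]]) (simp add: scl(2)[OF I Ff[OF t]] Fc[OF I])
  next
    fix V \<phi> assume V: "(V, \<phi>) \<in> trivs L"
    then have UV: "U (V, \<phi>) = V" by (simp add: U_def)
    show "open V" "V \<subseteq> upper_half_plane" using opU[of "(V, \<phi>)"] Usub[of "(V, \<phi>)"] by (simp_all add: UV)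
    have "V \<inter> upper_half_plane = V" using Usub[of "(V, \<phi>)"] by (auto simp: UV)
    then have "h (V, \<phi>) holomorphic_on V" using splits_onD(3)[OF h, of "(V, \<phi>)"] by (simp add: UV)
    moreover have "h (V, \<phi>) \<tau> \<noteq> 0" if "\<tau> \<in> V" for \<tau>
      using splits_onD(4)[OF h, of \<tau> "(V, \<phi>)"] that Usub[of "(V, \<phi>)"] by (auto simp: UV)
    moreover have "\<phi> (F \<tau> z) = h (V, \<phi>) \<tau> * z" if "\<tau> \<in> V" for \<tau> z
      using Fc[of \<tau> "(V, \<phi>)"] that by (simp add: UV)
    ultimately show "\<exists>a. a holomorphic_on V \<and> (\<forall>\<tau>\<in>V. a \<tau> \<noteq> 0 \<and> (\<forall>z. \<phi> (F \<tau> z) = a \<tau> * z))"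
      by (intro exI[of _ "h (V, \<phi>)"]) simp
  qed
  then show ?thesis by (intro exI[of _ F])
qed

text \<open>With respect to a global frame each group element acts by a number depending on the point.  That it
  depends holomorphically is read off in local trivialisations.\<close>

lemma orbi_line_bundle_framed:
  fixes L :: "'a orbi_bundle"
  assumes L: "orbi_line_bundle L"
  shows "\<exists>J F. framed J L F"
proof -
  have hlb: "holomorphic_line_bundle L"
    and bm: "\<And>\<gamma>. \<gamma> \<in> SL2Z \<Longrightarrow> bundle_map_over (moebius_act \<gamma>) (act L \<gamma>) L L"
    and one: "\<And>v. v \<in> total L \<Longrightarrow> act L (mat 1) v = v"
    and mult: "\<And>\<gamma> \<delta> v. \<gamma> \<in> SL2Z \<Longrightarrow> \<delta> \<in> SL2Z \<Longrightarrow> v \<in> total L \<Longrightarrow> act L (\<gamma> ** \<delta>) v = act L \<gamma> (act L \<delta> v)"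
    using L unfolding orbi_line_bundle_def by simp_all
  obtain F where F: "holomorphic_frame L F" using global_frame_exists[OF hlb] by (rule exE)
  define J where "J \<gamma> \<tau> = inv_into UNIV (F (moebius_act \<gamma> \<tau>)) (act L \<gamma> (F \<tau> 1))" for \<gamma> \<tau>
  have act: "act L \<gamma> (F \<tau> z) = F (moebius_act \<gamma> \<tau>) (J \<gamma> \<tau> * z)"
    if \<gamma>: "\<gamma> \<in> SL2Z" and t: "\<tau> \<in> upper_half_plane" for \<gamma> \<tau> z
  proof -
    have lin: "act L \<gamma> v \<in> fibre L (moebius_act \<gamma> \<tau>) \<and> (\<forall>c. act L \<gamma> (scale L c v) = scale L c (act L \<gamma> v))"
      if "v \<in> fibre L \<tau>" for v
      using bm[OF \<gamma>] t that unfolding bundle_map_over_def fibrewise_linear_over_def by simp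
    note gt = moebius_act_in_half_plane[OF \<gamma> t] and F1 = holomorphic_frame_fibre(1)[OF F t, of 1]
    have "act L \<gamma> (F \<tau> 1) \<in> range (F (moebius_act \<gamma> \<tau>))"
      using lin[OF F1] by (simp add: holomorphic_frameD(5)[OF F gt])
    then have "act L \<gamma> (F \<tau> 1) = F (moebius_act \<gamma> \<tau>) (J \<gamma> \<tau>)"
      unfolding J_def by (rule f_inv_into_f[symmetric])
    moreover have "act L \<gamma> (scale L z (F \<tau> 1)) = scale L z (act L \<gamma> (F \<tau> 1))" using lin[OF F1] by simp
    ultimately show ?thesis
      by (simp add: holomorphic_frameD(7)[OF F t] holomorphic_frameD(7)[OF F gt] mult.commute)
  qed
  have Jmult: "J (\<gamma> ** \<delta>) \<tau> = J \<gamma> (moebius_act \<delta> \<tau>) * J \<delta> \<tau>"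
    if g: "\<gamma> \<in> SL2Z" "\<delta> \<in> SL2Z" and t: "\<tau> \<in> upper_half_plane" for \<gamma> \<delta> \<tau>
  proof -
    have gt: "moebius_act (\<gamma> ** \<delta>) \<tau> \<in> upper_half_plane" using g t by simp
    have "F (moebius_act (\<gamma> ** \<delta>) \<tau>) (J (\<gamma> ** \<delta>) \<tau>) = act L (\<gamma> ** \<delta>) (F \<tau> 1)"
      using act[of "\<gamma> ** \<delta>" \<tau> 1] g t by simp
    also have "\<dots> = act L \<gamma> (act L \<delta> (F \<tau> 1))" by (rule mult[OF g holomorphic_frame_fibre(2)[OF F t]])
    also have "\<dots> = F (moebius_act (\<gamma> ** \<delta>) \<tau>) (J \<gamma> (moebius_act \<delta> \<tau>) * J \<delta> \<tau>)"
      using g t by (simp add: act moebius_act_mult)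
    finally show ?thesis by (simp add: holomorphic_frame_inj[OF F gt])
  qed
  have J1: "J (mat 1) \<tau> = 1" if t: "\<tau> \<in> upper_half_plane" for \<tau>
  proof -
    have "F \<tau> (J (mat 1) \<tau>) = F \<tau> 1"
      using act[OF SL2Z_one t, of 1] one[OF holomorphic_frame_fibre(2)[OF F t]] by simp
    then show ?thesis by (simp add: holomorphic_frame_inj[OF F t])
  qed
  have "automorphy_factor J"
    unfolding automorphy_factor_def
  proof (intro conjI ballI Jmult)
    fix \<gamma> \<tau> assume \<gamma>: "\<gamma> \<in> SL2Z" and t: "\<tau> \<in> upper_half_plane"
    show "J \<gamma> \<tau> \<noteq> 0"
      using Jmult[OF inv2_in_SL2Z[OF \<gamma>] \<gamma> t] J1[OF t] by (auto simp: inv2_mult[OF \<gamma>])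
  next
    fix \<gamma> assume \<gamma>: "\<gamma> \<in> SL2Z"
    show "J \<gamma> holomorphic_on upper_half_plane"
      unfolding holomorphic_on_def
    proof
      fix \<tau> assume t: "\<tau> \<in> upper_half_plane"
      obtain U \<phi> where U: "(U, \<phi>) \<in> trivs L" "\<tau> \<in> U" using holomorphic_frameD(4)[OF F t] by blast
      obtain V \<psi> where V: "(V, \<psi>) \<in> trivs L" "moebius_act \<gamma> \<tau> \<in> V"
        using holomorphic_frameD(4)[OF F moebius_act_in_half_plane[OF \<gamma> t]] by blast
      obtain a where a: "a holomorphic_on U" "\<And>\<tau>. \<tau> \<in> U \<Longrightarrow> a \<tau> \<noteq> 0" "\<And>\<tau> z. \<tau> \<in> U \<Longrightarrow> \<phi> (F \<tau> z) = a \<tau> * z"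
        by (rule holomorphic_frame_coordinate[OF F U(1)]) (rule that; assumption)
      obtain b where b: "b holomorphic_on V" "\<And>\<tau>. \<tau> \<in> V \<Longrightarrow> b \<tau> \<noteq> 0" "\<And>\<tau> z. \<tau> \<in> V \<Longrightarrow> \<psi> (F \<tau> z) = b \<tau> * z"
        by (rule holomorphic_frame_coordinate[OF F V(1)]) (rule that; assumption)
      note Uh = holomorphic_frameD(3)[OF F U(1)]
      have "holomorphic_over (moebius_act \<gamma>) (act L \<gamma>) L L" using bm[OF \<gamma>] by (simp add: bundle_map_over_def)
      then obtain G where G: "holomorphic2_on G {(\<tau>, z). \<tau> \<in> U \<and> moebius_act \<gamma> \<tau> \<in> V}"
          "\<And>\<tau> v. \<tau> \<in> U \<Longrightarrow> moebius_act \<gamma> \<tau> \<in> V \<Longrightarrow> v \<in> fibre L \<tau> \<Longrightarrow> \<psi> (act L \<gamma> v) = G (\<tau>, \<phi> v)"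
        by (rule holomorphic_over_coordinates[OF _ U(1) V(1)]) (rule that; assumption)
      define S where "S = U \<inter> moebius_act \<gamma> -` V"
      have hU: "moebius_act \<gamma> holomorphic_on U" using holomorphic_on_subset[OF moebius_act_holomorphic[OF \<gamma>] Uh] .
      have S: "open S"
        unfolding S_def
        by (intro continuous_open_preimage holomorphic_on_imp_continuous_on[OF hU]
            holomorphic_frameD(2)[OF F U(1)] holomorphic_frameD(2)[OF F V(1)])
      have hol: "holomorphic2_on G {(\<tau>, z). \<tau> \<in> S}" using G(1) by (simp add: S_def)
      have "(\<lambda>\<sigma>. G (\<sigma>, a \<sigma>) / (b \<circ> moebius_act \<gamma>) \<sigma>) holomorphic_on S"
      proof (intro holomorphic_intros)
        show "(\<lambda>\<sigma>. G (\<sigma>, a \<sigma>)) holomorphic_on S"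
          by (rule holomorphic2_on_along_graph[OF hol S]) (rule holomorphic_on_subset[OF a(1)], simp add: S_def)
        show "(b \<circ> moebius_act \<gamma>) holomorphic_on S"
          by (rule holomorphic_on_compose_gen[OF holomorphic_on_subset[OF hU] b(1)]) (auto simp: S_def)
      qed (use b(2) in \<open>simp add: S_def\<close>)
      then have "J \<gamma> holomorphic_on S"
      proof (rule holomorphic_transform)
        fix \<sigma> assume s: "\<sigma> \<in> S"
        then have sU: "\<sigma> \<in> U" "moebius_act \<gamma> \<sigma> \<in> V" by (simp_all add: S_def)
        then have sh: "\<sigma> \<in> upper_half_plane" using Uh by blast
        have "\<psi> (act L \<gamma> (F \<sigma> 1)) = G (\<sigma>, \<phi> (F \<sigma> 1))"
          by (rule G(2)[OF sU holomorphic_frame_fibre(1)[OF F sh]])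
        then have "b (moebius_act \<gamma> \<sigma>) * J \<gamma> \<sigma> = G (\<sigma>, a \<sigma>)"
          by (simp add: act[OF \<gamma> sh] a(3)[OF sU(1)] b(3)[OF sU(2)])
        then show "G (\<sigma>, a \<sigma>) / (b \<circ> moebius_act \<gamma>) \<sigma> = J \<gamma> \<sigma>" using b(2)[OF sU(2)] by (simp add: field_simps)
      qed
      moreover have "\<tau> \<in> S" using U V by (simp add: S_def)
      ultimately have "J \<gamma> field_differentiable at \<tau>"
        by (rule holomorphic_on_imp_differentiable_at[OF _ S])
      then show "J \<gamma> field_differentiable at \<tau> within upper_half_plane"
        by (rule field_differentiable_at_within)
    qed
  qed
  with F act have "framed J L F"
    unfolding framed_def by (intro conjI ballI allI)
  then show ?thesis by (intro exI[of _ J] exI[of _ F])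
qed

abbreviation weight_factor :: "int \<Rightarrow> int^2^2 \<Rightarrow> complex \<Rightarrow> complex" where
  "weight_factor k \<equiv> \<lambda>\<gamma> \<tau>. denom \<gamma> \<tau> powi k"

lemma weight_factor_automorphy: "automorphy_factor (weight_factor k)"
  unfolding automorphy_factor_def
proof (intro conjI ballI)
  show "(\<lambda>\<tau>. denom \<gamma> \<tau> powi k) holomorphic_on upper_half_plane" if "\<gamma> \<in> SL2Z" for \<gamma>
    by (intro holomorphic_intros) (use denom_nonzero[OF that] in auto)
  show "denom \<gamma> \<tau> powi k \<noteq> 0" if "\<gamma> \<in> SL2Z" "\<tau> \<in> upper_half_plane" for \<gamma> \<tau>
    using denom_nonzero[OF that] by simp
qed (simp add: denom_mult power_int_mult_distrib)

theorem orbi_line_bundle_weight_framed: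
  fixes L :: "'a orbi_bundle"
  assumes L: "orbi_line_bundle L"
  shows "\<exists>k F. framed (weight_factor k) L F"
proof -
  obtain J F where F: "framed J L F" using orbi_line_bundle_framed[OF L] by (elim exE)
  obtain k u where u: "u holomorphic_on upper_half_plane" "\<And>\<tau>. \<tau> \<in> upper_half_plane \<Longrightarrow> u \<tau> \<noteq> 0"
    "\<And>\<gamma> \<tau>. \<gamma> \<in> SL2Z \<Longrightarrow> \<tau> \<in> upper_half_plane \<Longrightarrow> denom \<gamma> \<tau> ^ k * u (moebius_act \<gamma> \<tau>) = J \<gamma> \<tau> * u \<tau>"
    by (rule automorphy_factor_weight[OF framedD(1)[OF F]]) (rule that; assumption)
  have "framed (weight_factor (int k)) L (\<lambda>\<tau> z. F \<tau> (u \<tau> * z))"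
    by (rule framed_rescale[OF F weight_factor_automorphy u(1,2)]) (simp_all only: power_int_of_nat u(3))
  then show ?thesis by (intro exI)
qed

section \<open>The weight of a bundle modulo 12\<close>

text \<open>An equivariant isomorphism intertwines the actions of the stabiliser on the two one-dimensional fibres, so these are
  the same scalars.\<close>

lemma orbi_iso_weights_agree_at_fixed_point:
  fixes L :: "'a orbi_bundle" and M :: "'b orbi_bundle"
  assumes L: "framed (weight_factor k) L F" and M: "framed (weight_factor l) M G" and iso: "orbi_iso L M"
    and t: "\<tau> \<in> upper_half_plane" and \<gamma>: "\<gamma> \<in> SL2Z" and fx: "moebius_act \<gamma> \<tau> = \<tau>"
  shows "denom \<gamma> \<tau> powi k = denom \<gamma> \<tau> powi l"
proof -
  note F = framedD(2)[OF L] and G = framedD(2)[OF M]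
  from iso obtain H K where hom: "orbi_hom H L M" and inv: "\<forall>v\<in>total L. K (H v) = v"
    unfolding orbi_iso_def by blast
  note F1 = holomorphic_frame_fibre(1)[OF F t, of 1]
  have lin: "H v \<in> fibre M \<tau> \<and> (\<forall>c. H (scale L c v) = scale M c (H v))" if "v \<in> fibre L \<tau>" for v
    using hom t that unfolding orbi_hom_def bundle_map_over_def fibrewise_linear_over_def by simp
  have equi: "H (act L \<gamma> v) = act M \<gamma> (H v)" if "v \<in> total L" for v
    using hom \<gamma> that unfolding orbi_hom_def by simp
  have "H (F \<tau> 1) \<in> range (G \<tau>)" using lin[OF F1] holomorphic_frameD(5)[OF G t] by simp
  then obtain c where c: "H (F \<tau> 1) = G \<tau> c" by blast
  have Hz: "H (F \<tau> z) = G \<tau> (z * c)" for z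
  proof -
    have "H (scale L z (F \<tau> 1)) = scale M z (H (F \<tau> 1))" using lin[OF F1] by simp
    then show ?thesis by (simp add: c holomorphic_frameD(7)[OF F t] holomorphic_frameD(7)[OF G t])
  qed
  have c0: "c \<noteq> 0"
  proof
    assume "c = 0"
    then have "H (F \<tau> 1) = H (F \<tau> 0)" by (simp add: Hz)
    then have "K (H (F \<tau> 1)) = K (H (F \<tau> 0))" by simp
    then have "F \<tau> 1 = F \<tau> 0" using inv holomorphic_frame_fibre(2)[OF F t] by simp
    then show False by (simp add: holomorphic_frame_inj[OF F t])
  qed
  have "H (act L \<gamma> (F \<tau> 1)) = act M \<gamma> (H (F \<tau> 1))" by (rule equi[OF holomorphic_frame_fibre(2)[OF F t]])
  then have "G \<tau> (denom \<gamma> \<tau> powi k * c) = G \<tau> (denom \<gamma> \<tau> powi l * c)"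
    by (simp add: framedD(3)[OF L \<gamma> t] framedD(3)[OF M \<gamma> t] fx Hz)
  then show ?thesis using c0 by (simp add: holomorphic_frame_inj[OF G t])
qed

lemma primitive_root_powi_eq_1:
  fixes z :: complex
  assumes m: "m > 0" and root: "z ^ m = 1" and prim: "\<And>r. 0 < r \<Longrightarrow> r < m \<Longrightarrow> z ^ r \<noteq> 1"
    and n: "z powi n = 1"
  shows "int m dvd n"
proof -
  have z: "z \<noteq> 0" using m root by (cases "z = 0") (simp_all add: power_0_left)
  define r where "r = nat (n mod int m)"
  have r: "int r = n mod int m" using m by (simp add: r_def)
  have "z powi n = z powi (int m * (n div int m) + int r)" by (simp add: r)
  also have "\<dots> = z powi (int m * (n div int m)) * z powi int r"
    by (rule power_int_add) (simp add: z)
  also have "z powi (int m * (n div int m)) = 1" by (simp add: power_int_mult root)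
  finally have "z ^ r = 1" using n by simp
  moreover have "r < m"
  proof -
    have "int r < int m" using m by (simp add: r)
    then show ?thesis by simp
  qed
  ultimately have "r = 0" using prim[of r] by (cases "r = 0") simp_all
  then have "n mod int m = 0" using r by simp
  then show ?thesis by (simp add: dvd_eq_mod_eq_0)
qed

text \<open>At \<open>i\<close> the scalars are powers of \<open>i\<close>, at \<open>\<rho>\<close> powers of \<open>\<rho> + 1\<close>, a primitive sixth root of unity.\<close>

theorem orbi_iso_weights_cong:
  fixes L :: "'a orbi_bundle" and M :: "'b orbi_bundle"
  assumes L: "framed (weight_factor k) L F" and M: "framed (weight_factor l) M G" and iso: "orbi_iso L M"
  shows "12 dvd (k - l)"
proof -
  have period: "z powi (k - l) = 1" if "z powi k = z powi l" "z \<noteq> 0" for z :: complex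
    using that by (simp add: power_int_diff)
  have "moebius_act mat_S \<i> = \<i>" by (simp add: moebius_act_eq denom_def mat_S_def divide_simps)
  from orbi_iso_weights_agree_at_fixed_point[OF L M iso i_in_half_plane mat_STU_in_SL2Z(1) this]
  have i: "\<i> powi (k - l) = 1" by (intro period) simp_all
  have "int 4 dvd k - l"
  proof (rule primitive_root_powi_eq_1[OF _ _ _ i])
    show "\<i> ^ 4 = 1" by (simp add: eval_nat_numeral)
    fix r :: nat assume "0 < r" "r < 4"
    then consider "r = 1" | "r = 2" | "r = 3" by linarith
    then show "\<i> ^ r \<noteq> 1"
      by cases (simp_all add: complex_eq_iff power3_eq_cube)
  qed simp
  define z where "z = rho + 1"
  have zz: "z * z = z - 1" using rho_square by (simp add: z_def algebra_simps)
  have Im_z: "Im z \<noteq> 0" using rho_in_half_plane by (simp add: z_def upper_half_plane_def)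
  then have z0: "z \<noteq> 0" by auto
  have dU: "denom mat_U rho = z" by (simp add: denom_def mat_U_def z_def)
  have "- 1 = rho * z" by (simp add: z_def rho_square distrib_left)
  then have "moebius_act mat_U rho = rho"
    using z0 by (simp add: moebius_act_eq dU) (simp add: mat_U_def)
  from orbi_iso_weights_agree_at_fixed_point[OF L M iso rho_in_half_plane mat_STU_in_SL2Z(2) this]
  have rho: "z powi (k - l) = 1" using z0 by (intro period) (simp_all add: dU)
  have z2: "z ^ 2 = z - 1" by (simp add: power2_eq_square zz)
  have "z ^ 3 = z * (z * z)" by (simp add: power3_eq_cube)
  also have "\<dots> = z * (z - 1)" by (simp only: zz)
  also have "\<dots> = z * z - z" by (simp add: right_diff_distrib)
  finally have z3: "z ^ 3 = - 1" by (simp add: zz)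
  have "z ^ 4 = z ^ 3 * z" "z ^ 5 = z ^ 3 * (z * z)" "z ^ 6 = z ^ 3 * z ^ 3"
    by (simp_all add: eval_nat_numeral)
  then have z4: "z ^ 4 = - z" and z5: "z ^ 5 = 1 - z" and z6: "z ^ 6 = 1" by (simp_all add: z3 zz)
  have "int 6 dvd k - l"
  proof (rule primitive_root_powi_eq_1[OF _ z6 _ rho])
    fix r :: nat assume "0 < r" "r < 6"
    then consider "r = 1" | "r = 2" | "r = 3" | "r = 4" | "r = 5" by linarith
    then show "z ^ r \<noteq> 1"
      by cases (use Im_z in \<open>simp_all add: z2 z3 z4 z5 complex_eq_iff\<close>)
  qed simp
  with \<open>int 4 dvd k - l\<close> show ?thesis by simp presburger
qed

text \<open>A power of the discriminant is a nonvanishing change of frame that shifts the weight by a multiple of \<open>12\<close>.\<close>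

lemma framed_change_weight:
  assumes L: "framed (weight_factor k) L F" and kl: "12 dvd (k - l)"
  shows "\<exists>F'. framed (weight_factor l) L F'"
proof -
  obtain m where "k - l = 12 * m" using kl by (rule dvdE)
  then have k: "k = l + 12 * m" by simp
  have "framed (weight_factor l) L (\<lambda>\<tau> z. F \<tau> (discriminant \<tau> powi m * z))"
  proof (rule framed_rescale[OF L weight_factor_automorphy])
    show "(\<lambda>\<tau>. discriminant \<tau> powi m) holomorphic_on upper_half_plane"
      by (intro holomorphic_intros discriminant_holomorphic) (use discriminant_nonzero in auto)
    show "discriminant \<tau> powi m \<noteq> 0" if "\<tau> \<in> upper_half_plane" for \<tau>
      using discriminant_nonzero[OF that] by simp
    fix \<gamma> \<tau> assume gt: "\<gamma> \<in> SL2Z" "\<tau> \<in> upper_half_plane"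
    have "denom \<gamma> \<tau> powi k = denom \<gamma> \<tau> powi l * denom \<gamma> \<tau> powi (12 * m)"
      unfolding k by (rule power_int_add) (simp add: denom_nonzero[OF gt])
    also have "denom \<gamma> \<tau> powi (12 * m) = (denom \<gamma> \<tau> ^ 12) powi m" by (simp add: power_int_mult)
    finally show "denom \<gamma> \<tau> powi l * discriminant (moebius_act \<gamma> \<tau>) powi m = denom \<gamma> \<tau> powi k * discriminant \<tau> powi m"
      by (simp only: discriminant_modular[OF gt] power_int_mult_distrib mult.assoc)
  qed
  then show ?thesis by (rule exI[where P = "framed (weight_factor l) L"])
qed

section \<open>Models and tensor products\<close>

lemma framed_weight_bundle: "framed (weight_factor k) (weight_bundle k) (\<lambda>\<tau> z. (z, \<tau>))"
  unfolding framed_def holomorphic_frame_def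
proof (intro conjI ballI allI impI weight_factor_automorphy)
  show "\<exists>a. a holomorphic_on U \<and> (\<forall>\<tau>\<in>U. a \<tau> \<noteq> 0 \<and> (\<forall>z. \<phi> (z, \<tau>) = a \<tau> * z))"
    if "(U, \<phi>) \<in> trivs (weight_bundle k)" for U \<phi>
    using that by (intro exI[of _ "\<lambda>_. 1"]) (simp add: weight_bundle_def)
  show "fibre (weight_bundle k) \<tau> = range (\<lambda>z. (z, \<tau>))" if "\<tau> \<in> upper_half_plane" for \<tau>
    using that by (auto simp: fibre_def weight_bundle_def)
qed (auto simp: weight_bundle_def denom_def open_upper_half_plane)

text \<open>A copy of \<open>\<L>\<^sub>k\<close> inside a given type, showing that all isomorphism classes are represented there.\<close>

definition transported_weight_bundle :: "(complex \<times> complex \<Rightarrow> 'a) \<Rightarrow> int \<Rightarrow> 'a orbi_bundle" where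
  "transported_weight_bundle e k =
     (let e' = inv_into UNIV e in
     \<lparr>total = e ` (UNIV \<times> upper_half_plane),
      proj = (\<lambda>v. snd (e' v)),
      add = (\<lambda>v w. e (fst (e' v) + fst (e' w), snd (e' v))),
      scale = (\<lambda>c v. e (c * fst (e' v), snd (e' v))),
      trivs = {(upper_half_plane, \<lambda>v. fst (e' v))},
      act = (\<lambda>\<gamma> v. e (denom \<gamma> (snd (e' v)) powi k * fst (e' v), moebius_act \<gamma> (snd (e' v))))\<rparr>)"

lemma framed_transported_weight_bundle:
  assumes e: "inj e"
  shows "framed (weight_factor k) (transported_weight_bundle e k) (\<lambda>\<tau> z. e (z, \<tau>))"
  unfolding framed_def holomorphic_frame_def
proof (intro conjI ballI allI impI weight_factor_automorphy)
  have e': "inv_into UNIV e (e p) = p" for p by (simp add: inv_into_f_f[OF e])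
  show "\<exists>a. a holomorphic_on U \<and> (\<forall>\<tau>\<in>U. a \<tau> \<noteq> 0 \<and> (\<forall>z. \<phi> (e (z, \<tau>)) = a \<tau> * z))"
    if "(U, \<phi>) \<in> trivs (transported_weight_bundle e k)" for U \<phi>
    using that by (intro exI[of _ "\<lambda>_. 1"]) (simp add: transported_weight_bundle_def Let_def e')
  show "fibre (transported_weight_bundle e k) \<tau> = range (\<lambda>z. e (z, \<tau>))" if "\<tau> \<in> upper_half_plane" for \<tau>
    using that by (auto simp: fibre_def transported_weight_bundle_def Let_def e')
qed (auto simp: transported_weight_bundle_def Let_def inv_into_f_f[OF e] open_upper_half_plane)

text \<open>A bilinear form on a product of lines is determined by one number.\<close>

lemma bilinear_forms_framed:
  assumes F: "holomorphic_frame L F" and G: "holomorphic_frame M G" and t: "\<tau> \<in> upper_half_plane"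
  shows "\<beta> \<in> bilinear_forms L M \<tau> \<longleftrightarrow>
    (\<forall>v w. \<not> (v \<in> fibre L \<tau> \<and> w \<in> fibre M \<tau>) \<longrightarrow> \<beta> v w = 0) \<and>
    (\<exists>c. \<forall>z w. \<beta> (F \<tau> z) (G \<tau> w) = c * z * w)" (is "_ \<longleftrightarrow> ?zero \<and> ?form")
proof (intro iffI conjI)
  assume b: "\<beta> \<in> bilinear_forms L M \<tau>"
  show ?zero using b unfolding bilinear_forms_def by simp
  have b': "\<beta> (scale L c v) w = c * \<beta> v w" "\<beta> v (scale M c w) = c * \<beta> v w"
    if "v \<in> fibre L \<tau>" "w \<in> fibre M \<tau>" for v w c
    using b that unfolding bilinear_forms_def by simp_all
  show ?form
  proof (intro exI[of _ "\<beta> (F \<tau> 1) (G \<tau> 1)"] allI)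
    fix z w
    have "\<beta> (F \<tau> z) (G \<tau> w) = z * \<beta> (F \<tau> 1) (G \<tau> w)"
      using b'(1)[OF holomorphic_frame_fibre(1)[OF F t] holomorphic_frame_fibre(1)[OF G t], of z 1 w]
      by (simp add: holomorphic_frameD(7)[OF F t])
    moreover have "\<beta> (F \<tau> 1) (G \<tau> w) = w * \<beta> (F \<tau> 1) (G \<tau> 1)"
      using b'(2)[OF holomorphic_frame_fibre(1)[OF F t] holomorphic_frame_fibre(1)[OF G t], of 1 w 1]
      by (simp add: holomorphic_frameD(7)[OF G t])
    ultimately show "\<beta> (F \<tau> z) (G \<tau> w) = \<beta> (F \<tau> 1) (G \<tau> 1) * z * w" by simp
  qed
next
  assume "?zero \<and> ?form"
  then have zero: ?zero and form: ?form by (rule conjunct1, rule conjunct2)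
  from form obtain c where c: "\<forall>z w. \<beta> (F \<tau> z) (G \<tau> w) = c * z * w" by (rule exE)
  show "\<beta> \<in> bilinear_forms L M \<tau>"
    unfolding bilinear_forms_def mem_Collect_eq
  proof (rule conjI[OF zero], intro ballI)
    fix v w assume "v \<in> fibre L \<tau>" "w \<in> fibre M \<tau>"
    then obtain x y where vw: "v = F \<tau> x" "w = G \<tau> y"
      unfolding holomorphic_frameD(5)[OF F t] holomorphic_frameD(5)[OF G t] by blast
    show "(\<forall>v'\<in>fibre L \<tau>. \<beta> (add L v v') w = \<beta> v w + \<beta> v' w) \<and>
          (\<forall>w'\<in>fibre M \<tau>. \<beta> v (add M w w') = \<beta> v w + \<beta> v w') \<and>
          (\<forall>c. \<beta> (scale L c v) w = c * \<beta> v w \<and> \<beta> v (scale M c w) = c * \<beta> v w)"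
      unfolding holomorphic_frameD(5)[OF F t] holomorphic_frameD(5)[OF G t] vw
      by (auto simp: holomorphic_frameD(6,7)[OF F t] holomorphic_frameD(6,7)[OF G t] c algebra_simps)
  qed
qed

lemma extend_by_zero_framed:
  assumes F: "holomorphic_frame L F" and G: "holomorphic_frame M G" and t: "\<tau> \<in> upper_half_plane"
    and c: "\<And>z w. \<beta> (F \<tau> z) (G \<tau> w) = c * z * w"
  shows "extend_by_zero L M \<tau> \<beta> \<in> bilinear_forms L M \<tau>"
    "extend_by_zero L M \<tau> \<beta> (F \<tau> z) (G \<tau> w) = c * z * w"
proof -
  show e: "extend_by_zero L M \<tau> \<beta> (F \<tau> z) (G \<tau> w) = c * z * w" for z w
    by (simp add: extend_by_zero_def holomorphic_frame_fibre(1)[OF F t] holomorphic_frame_fibre(1)[OF G t] c)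
  show "extend_by_zero L M \<tau> \<beta> \<in> bilinear_forms L M \<tau>"
    unfolding bilinear_forms_framed[OF F G t]
  proof
    show "\<forall>v w. \<not> (v \<in> fibre L \<tau> \<and> w \<in> fibre M \<tau>) \<longrightarrow> extend_by_zero L M \<tau> \<beta> v w = 0"
      unfolding extend_by_zero_def by simp
    show "\<exists>c. \<forall>z w. extend_by_zero L M \<tau> \<beta> (F \<tau> z) (G \<tau> w) = c * z * w"
      by (rule exI[of _ c]) (simp add: e)
  qed
qed

text \<open>The space of bilinear forms is a line, and so is its dual; it is spanned by evaluation at the two frames, the pure tensor of
  the frames.\<close>

lemma tensor_fibre_framed:
  assumes F: "holomorphic_frame L F" and G: "holomorphic_frame M G" and t: "\<tau> \<in> upper_half_plane"
  shows "tensor_fibre L M \<tau> =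
    range (\<lambda>z \<beta>. if \<beta> \<in> bilinear_forms L M \<tau> then z * \<beta> (F \<tau> 1) (G \<tau> 1) else 0)" (is "_ = range ?T")
proof (intro equalityI subsetI)
  fix \<theta> assume "\<theta> \<in> range ?T"
  then obtain z where \<theta>: "\<theta> = ?T z" by (rule rangeE)
  have sum: "(\<lambda>v w. \<beta> v w + \<beta>' v w) \<in> bilinear_forms L M \<tau>"
    if b: "\<beta> \<in> bilinear_forms L M \<tau>" "\<beta>' \<in> bilinear_forms L M \<tau>" for \<beta> \<beta>'
  proof -
    obtain c where c: "\<forall>z w. \<beta> (F \<tau> z) (G \<tau> w) = c * z * w"
      using b(1) unfolding bilinear_forms_framed[OF F G t] by blast
    obtain c' where c': "\<forall>z w. \<beta>' (F \<tau> z) (G \<tau> w) = c' * z * w"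
      using b(2) unfolding bilinear_forms_framed[OF F G t] by blast
    show ?thesis
      unfolding bilinear_forms_framed[OF F G t]
    proof
      show "\<forall>v w. \<not> (v \<in> fibre L \<tau> \<and> w \<in> fibre M \<tau>) \<longrightarrow> \<beta> v w + \<beta>' v w = 0"
        using b unfolding bilinear_forms_framed[OF F G t] by simp
      show "\<exists>c. \<forall>z w. \<beta> (F \<tau> z) (G \<tau> w) + \<beta>' (F \<tau> z) (G \<tau> w) = c * z * w"
        by (rule exI[of _ "c + c'"]) (simp add: c c' algebra_simps)
    qed
  qed
  have multiple: "(\<lambda>v w. d * \<beta> v w) \<in> bilinear_forms L M \<tau>"
    if b: "\<beta> \<in> bilinear_forms L M \<tau>" for \<beta> d
  proof -
    obtain c where c: "\<forall>z w. \<beta> (F \<tau> z) (G \<tau> w) = c * z * w"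
      using b unfolding bilinear_forms_framed[OF F G t] by blast
    show ?thesis
      unfolding bilinear_forms_framed[OF F G t]
    proof
      show "\<forall>v w. \<not> (v \<in> fibre L \<tau> \<and> w \<in> fibre M \<tau>) \<longrightarrow> d * \<beta> v w = 0"
        using b unfolding bilinear_forms_framed[OF F G t] by simp
      show "\<exists>c. \<forall>z w. d * \<beta> (F \<tau> z) (G \<tau> w) = c * z * w"
        by (rule exI[of _ "d * c"]) (simp add: c)
    qed
  qed
  show "\<theta> \<in> tensor_fibre L M \<tau>"
    unfolding tensor_fibre_def mem_Collect_eq \<theta>
  proof (intro conjI allI ballI impI)
    show "?T z \<beta> = 0" if "\<beta> \<notin> bilinear_forms L M \<tau>" for \<beta> using that by simp
    show "?T z (\<lambda>v w. \<beta> v w + \<beta>' v w) = ?T z \<beta> + ?T z \<beta>'"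
      if "\<beta> \<in> bilinear_forms L M \<tau>" "\<beta>' \<in> bilinear_forms L M \<tau>" for \<beta> \<beta>'
      using that sum[OF that] by (simp add: distrib_left)
    show "?T z (\<lambda>v w. c * \<beta> v w) = c * ?T z \<beta>" if "\<beta> \<in> bilinear_forms L M \<tau>" for \<beta> c
      using that multiple[OF that, of c] by simp
  qed
next
  fix \<theta> assume \<theta>: "\<theta> \<in> tensor_fibre L M \<tau>"
  \<comment> \<open>The product of the coordinates is a basis of the space of forms.\<close>
  define \<beta>0 where "\<beta>0 = extend_by_zero L M \<tau> (\<lambda>v w. inv_into UNIV (F \<tau>) v * inv_into UNIV (G \<tau>) w)"
  have inj: "inj (F \<tau>)" "inj (G \<tau>)"
    by (rule injI, simp only: holomorphic_frame_inj[OF F t] holomorphic_frame_inj[OF G t])+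
  have coord: "inv_into UNIV (F \<tau>) (F \<tau> z) * inv_into UNIV (G \<tau>) (G \<tau> w) = 1 * z * w" for z w
    by (simp add: inv_into_f_f[OF inj(1)] inv_into_f_f[OF inj(2)])
  note b0 = extend_by_zero_framed[OF F G t, of "\<lambda>v w. inv_into UNIV (F \<tau>) v * inv_into UNIV (G \<tau>) w", OF coord,
      folded \<beta>0_def]
  have "\<theta> \<beta> = ?T (\<theta> \<beta>0) \<beta>" for \<beta>
  proof (cases "\<beta> \<in> bilinear_forms L M \<tau>")
    case True
    note b_in = True
    obtain c where c: "\<forall>z w. \<beta> (F \<tau> z) (G \<tau> w) = c * z * w"
      using True unfolding bilinear_forms_framed[OF F G t] by blast
    have "\<beta> v w = c * \<beta>0 v w" for v w
    proof (cases "v \<in> fibre L \<tau> \<and> w \<in> fibre M \<tau>")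
      case True
      then obtain x y where "v = F \<tau> x" "w = G \<tau> y"
        unfolding holomorphic_frameD(5)[OF F t] holomorphic_frameD(5)[OF G t] by blast
      then show ?thesis by (simp add: c b0(2))
    next
      case False
      have "\<beta>0 v w = 0" unfolding \<beta>0_def extend_by_zero_def by (rule if_not_P[OF False])
      moreover have "\<beta> v w = 0"
        using conjunct1[OF b_in[unfolded bilinear_forms_framed[OF F G t]]] False by blast
      ultimately show ?thesis by simp
    qed
    then have "\<beta> = (\<lambda>v w. c * \<beta>0 v w)" by (intro ext)
    moreover have "\<theta> (\<lambda>v w. c * \<beta>0 v w) = c * \<theta> \<beta>0"
      using \<theta> b0(1) unfolding tensor_fibre_def by simp
    ultimately have "\<theta> \<beta> = c * \<theta> \<beta>0" by simp
    then show ?thesis using True by (simp add: c)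
  next
    case False
    then have "\<theta> \<beta> = 0" using \<theta> unfolding tensor_fibre_def by simp
    then show ?thesis using False by simp
  qed
  then have "\<theta> = ?T (\<theta> \<beta>0)" by (intro ext)
  then show "\<theta> \<in> range ?T" by (rule range_eqI)
qed

text \<open>The pure tensors of the frames form a frame of the tensor product, on which the factors of automorphy multiply.\<close>

theorem framed_tensor_bundle:
  assumes L: "framed J L F" and M: "framed J' M G"
  shows "framed (\<lambda>\<gamma> \<tau>. J \<gamma> \<tau> * J' \<gamma> \<tau>) (tensor_bundle L M)
    (\<lambda>\<tau> z. (\<tau>, \<lambda>\<beta>. if \<beta> \<in> bilinear_forms L M \<tau> then z * \<beta> (F \<tau> 1) (G \<tau> 1) else 0))"
    (is "framed _ _ ?F")
proof -
  note F = framedD(2)[OF L] and G = framedD(2)[OF M]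
  note JL = framedD(1)[OF L] and JM = framedD(1)[OF M]
  have "automorphy_factor (\<lambda>\<gamma> \<tau>. J \<gamma> \<tau> * J' \<gamma> \<tau>)"
    unfolding automorphy_factor_def
  proof (intro conjI ballI)
    show "(\<lambda>\<tau>. J \<gamma> \<tau> * J' \<gamma> \<tau>) holomorphic_on upper_half_plane" if "\<gamma> \<in> SL2Z" for \<gamma>
      by (rule holomorphic_on_mult[OF automorphy_factorD(1)[OF JL that] automorphy_factorD(1)[OF JM that]])
  qed (simp_all add: automorphy_factorD(2,3)[OF JL] automorphy_factorD(2,3)[OF JM])
  moreover have "holomorphic_frame (tensor_bundle L M) ?F"
    unfolding holomorphic_frame_def
  proof (intro conjI ballI allI impI)
    show "proj (tensor_bundle L M) ` total (tensor_bundle L M) \<subseteq> upper_half_plane"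
      by (auto simp: tensor_bundle_def)
    show "\<exists>(U, \<phi>)\<in>trivs (tensor_bundle L M). \<tau> \<in> U" if t: "\<tau> \<in> upper_half_plane" for \<tau>
    proof -
      obtain U \<phi> where U: "(U, \<phi>) \<in> trivs L" "\<tau> \<in> U" using holomorphic_frameD(4)[OF F t] by blast
      obtain V \<psi> where V: "(V, \<psi>) \<in> trivs M" "\<tau> \<in> V" using holomorphic_frameD(4)[OF G t] by blast
      have "(U \<inter> V, \<lambda>(\<tau>, \<theta>). \<theta> (extend_by_zero L M \<tau> (\<lambda>v w. \<phi> v * \<psi> w))) \<in> trivs (tensor_bundle L M)"
        unfolding tensor_bundle_def using U(1) V(1) by auto
      then show ?thesis by (rule bexI[rotated]) (simp add: U(2) V(2))
    qed
    fix \<tau> assume t: "\<tau> \<in> upper_half_plane"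
    show "fibre (tensor_bundle L M) \<tau> = range (?F \<tau>)"
      using t tensor_fibre_framed[OF F G t] by (auto simp: fibre_def tensor_bundle_def)
    show "add (tensor_bundle L M) (?F \<tau> z) (?F \<tau> w) = ?F \<tau> (z + w)" for z w
      by (auto simp: tensor_bundle_def distrib_right)
    show "scale (tensor_bundle L M) c (?F \<tau> z) = ?F \<tau> (c * z)" for c z
      by (auto simp: tensor_bundle_def)
  next
    fix W \<omega> assume "(W, \<omega>) \<in> trivs (tensor_bundle L M)"
    then obtain U \<phi> V \<psi> where U: "(U, \<phi>) \<in> trivs L" and V: "(V, \<psi>) \<in> trivs M" and W: "W = U \<inter> V"
      and \<omega>: "\<omega> = (\<lambda>(\<tau>, \<theta>). \<theta> (extend_by_zero L M \<tau> (\<lambda>v w. \<phi> v * \<psi> w)))"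
      unfolding tensor_bundle_def by auto
    show "open W" "W \<subseteq> upper_half_plane"
      using holomorphic_frameD(2,3)[OF F U] holomorphic_frameD(2,3)[OF G V] by (auto simp: W)
    obtain a where a: "a holomorphic_on U" "\<And>\<tau>. \<tau> \<in> U \<Longrightarrow> a \<tau> \<noteq> 0" "\<And>\<tau> z. \<tau> \<in> U \<Longrightarrow> \<phi> (F \<tau> z) = a \<tau> * z"
      by (rule holomorphic_frame_coordinate[OF F U]) (rule that; assumption)
    obtain b where b: "b holomorphic_on V" "\<And>\<tau>. \<tau> \<in> V \<Longrightarrow> b \<tau> \<noteq> 0" "\<And>\<tau> z. \<tau> \<in> V \<Longrightarrow> \<psi> (G \<tau> z) = b \<tau> * z"
      by (rule holomorphic_frame_coordinate[OF G V]) (rule that; assumption)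
    show "\<exists>c. c holomorphic_on W \<and> (\<forall>\<tau>\<in>W. c \<tau> \<noteq> 0 \<and> (\<forall>z. \<omega> (?F \<tau> z) = c \<tau> * z))"
    proof (intro exI[of _ "\<lambda>\<tau>. a \<tau> * b \<tau>"] conjI ballI allI)
      show "(\<lambda>\<tau>. a \<tau> * b \<tau>) holomorphic_on W"
        by (intro holomorphic_on_mult holomorphic_on_subset[OF a(1)] holomorphic_on_subset[OF b(1)]) (simp_all add: W)
      fix \<tau> assume "\<tau> \<in> W"
      then have tU: "\<tau> \<in> U" "\<tau> \<in> V" by (simp_all add: W)
      then have t: "\<tau> \<in> upper_half_plane" using holomorphic_frameD(3)[OF F U] by blast
      show "a \<tau> * b \<tau> \<noteq> 0" using a(2)[OF tU(1)] b(2)[OF tU(2)] by simp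
      have c: "\<phi> (F \<tau> z) * \<psi> (G \<tau> w) = (a \<tau> * b \<tau>) * z * w" for z w
        by (simp add: a(3)[OF tU(1)] b(3)[OF tU(2)])
      note ez = extend_by_zero_framed[OF F G t, of "\<lambda>v w. \<phi> v * \<psi> w", OF c]
      show "\<omega> (?F \<tau> z) = a \<tau> * b \<tau> * z" for z
        unfolding \<omega> prod.case by (simp add: ez(1) ez(2)[of 1 1])
    qed
  qed
  moreover have "act (tensor_bundle L M) \<gamma> (?F \<tau> z) = ?F (moebius_act \<gamma> \<tau>) (J \<gamma> \<tau> * J' \<gamma> \<tau> * z)"
    if g: "\<gamma> \<in> SL2Z" and t: "\<tau> \<in> upper_half_plane" for \<gamma> \<tau> z
  proof -
    let ?s = "moebius_act \<gamma> \<tau>"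
    have s: "?s \<in> upper_half_plane" using g t by simp
    have eq: "(if extend_by_zero L M \<tau> (\<lambda>v w. \<beta> (act L \<gamma> v) (act M \<gamma> w)) \<in> bilinear_forms L M \<tau>
        then z * extend_by_zero L M \<tau> (\<lambda>v w. \<beta> (act L \<gamma> v) (act M \<gamma> w)) (F \<tau> 1) (G \<tau> 1) else 0) =
        J \<gamma> \<tau> * J' \<gamma> \<tau> * z * \<beta> (F ?s 1) (G ?s 1)"
      if b: "\<beta> \<in> bilinear_forms L M ?s" for \<beta>
    proof -
      obtain c where c: "\<forall>z w. \<beta> (F ?s z) (G ?s w) = c * z * w"
        using b unfolding bilinear_forms_framed[OF F G s] by blast
      have d: "\<beta> (act L \<gamma> (F \<tau> x)) (act M \<gamma> (G \<tau> y)) = (c * J \<gamma> \<tau> * J' \<gamma> \<tau>) * x * y" for x y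
        by (simp add: framedD(3)[OF L g t] framedD(3)[OF M g t] c)
      note ez = extend_by_zero_framed[OF F G t, of "\<lambda>v w. \<beta> (act L \<gamma> v) (act M \<gamma> w)", OF d]
      show ?thesis by (simp add: ez(1) ez(2)[of 1 1] c)
    qed
    show ?thesis
      unfolding tensor_bundle_def orbi_bundle.simps prod.case prod.inject
      by (rule conjI[OF refl]) (rule ext, simp only: eq cong: if_cong)
  qed
  ultimately show ?thesis unfolding framed_def by (intro conjI ballI allI)
qed

lemma framed_tensor_weights:
  assumes L: "framed (weight_factor k) L F" and M: "framed (weight_factor l) M G"
  shows "\<exists>H. framed (weight_factor (k + l)) (tensor_bundle L M) H"
  by (intro exI, rule framed_rescale[OF framed_tensor_bundle[OF L M] weight_factor_automorphy, where u = "\<lambda>_. 1"])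
    (simp_all add: power_int_add denom_nonzero)

section \<open>The Picard group\<close>

definition weight_class :: "int \<Rightarrow> 'a orbi_bundle set" where
  "weight_class k = {L. \<exists>F. framed (weight_factor k) L F}"

lemma iso_class_framed:
  assumes M: "framed (weight_factor k) M G"
  shows "iso_class M = (weight_class k :: 'a orbi_bundle set)"
proof (intro equalityI subsetI)
  fix L :: "'a orbi_bundle" assume "L \<in> iso_class M"
  then have L: "orbi_line_bundle L" "orbi_iso L M" by (simp_all add: iso_class_def)
  obtain l F where F: "framed (weight_factor l) L F" using orbi_line_bundle_weight_framed[OF L(1)] by (elim exE)
  have "\<exists>F'. framed (weight_factor k) L F'"
    by (rule framed_change_weight[OF F orbi_iso_weights_cong[OF F M L(2)]])
  then show "L \<in> weight_class k" by (simp add: weight_class_def)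
next
  fix L :: "'a orbi_bundle" assume "L \<in> weight_class k"
  then obtain F where F: "framed (weight_factor k) L F" unfolding weight_class_def by blast
  show "L \<in> iso_class M"
    using framed_line_bundle[OF F] framed_iso[OF F M] by (simp add: iso_class_def)
qed

lemma weight_class_mono: "12 dvd (k - l) \<Longrightarrow> weight_class k \<subseteq> weight_class l"
  unfolding weight_class_def using framed_change_weight by blast

lemma weight_class_nonempty:
  fixes e :: "complex \<times> complex \<Rightarrow> 'a"
  assumes "inj e"
  shows "transported_weight_bundle e k \<in> weight_class k"
  unfolding weight_class_def using framed_transported_weight_bundle[OF assms] by blast

lemma weight_class_eq_iff:
  fixes e :: "complex \<times> complex \<Rightarrow> 'a"
  assumes e: "inj e"
  shows "(weight_class k :: 'a orbi_bundle set) = weight_class l \<longleftrightarrow> 12 dvd (k - l)"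
proof
  assume "(weight_class k :: 'a orbi_bundle set) = weight_class l"
  then have "transported_weight_bundle e k \<in> weight_class l" using weight_class_nonempty[OF e, of k] by simp
  then obtain F where F: "framed (weight_factor l) (transported_weight_bundle e k) F"
    unfolding weight_class_def by blast
  show "12 dvd (k - l)"
    by (rule orbi_iso_weights_cong[OF framed_transported_weight_bundle[OF e] F framed_iso[OF F F]])
next
  assume kl: "12 dvd (k - l)"
  then have "12 dvd (l - k)" by presburger
  with kl show "(weight_class k :: 'a orbi_bundle set) = weight_class l"
    by (intro equalityI weight_class_mono)
qed

lemma orbi_iso_sym: "orbi_iso L M \<Longrightarrow> orbi_iso M L"
  unfolding orbi_iso_def by blast

lemma carrier_Pic:
  fixes e :: "complex \<times> complex \<Rightarrow> 'a"
  assumes e: "inj e"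
  shows "carrier (Pic TYPE('a)) = range (weight_class :: int \<Rightarrow> 'a orbi_bundle set)"
proof -
  let ?R = "{(L, M). orbi_line_bundle L \<and> orbi_line_bundle M \<and> orbi_iso L M} :: ('a orbi_bundle \<times> 'a orbi_bundle) set"
  have image: "?R `` {L} = weight_class k" if F: "framed (weight_factor k) L F" for L :: "'a orbi_bundle" and k F
  proof -
    have "?R `` {L} = iso_class L"
      using framed_line_bundle[OF F] orbi_iso_sym by (auto simp: iso_class_def)
    then show ?thesis by (simp add: iso_class_framed[OF F])
  qed
  have "{L. orbi_line_bundle L} // ?R = range (weight_class :: int \<Rightarrow> 'a orbi_bundle set)"
  proof (intro equalityI subsetI)
    fix A assume "A \<in> {L. orbi_line_bundle L} // ?R"
    then obtain L where L: "orbi_line_bundle L" "A = ?R `` {L}" by (auto elim: quotientE)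
    obtain k F where F: "framed (weight_factor k) L F" using orbi_line_bundle_weight_framed[OF L(1)] by (elim exE)
    show "A \<in> range weight_class" unfolding L(2) image[OF F] by (rule rangeI)
  next
    fix A :: "'a orbi_bundle set" assume "A \<in> range weight_class"
    then obtain k where A: "A = weight_class k" by (rule rangeE)
    note F = framed_transported_weight_bundle[OF e, of k]
    have "?R `` {transported_weight_bundle e k} \<in> {L. orbi_line_bundle L} // ?R"
      by (rule quotientI) (simp add: framed_line_bundle[OF F])
    then show "A \<in> {L. orbi_line_bundle L} // ?R" unfolding A image[OF F] .
  qed
  then show ?thesis by (simp add: Pic_def)
qed

lemma mult_Pic:
  fixes e :: "complex \<times> complex \<Rightarrow> 'a"
  assumes e: "inj e"
  shows "mult (Pic TYPE('a)) (weight_class k) (weight_class l) = weight_class (k + l)"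
proof -
  have cls: "iso_class (tensor_bundle L M) = (weight_class (k + l) :: 'a orbi_bundle set)"
    if LM: "L \<in> weight_class k" "M \<in> weight_class l" for L M :: "'a orbi_bundle"
  proof -
    obtain F where F: "framed (weight_factor k) L F" using LM(1) unfolding weight_class_def by blast
    obtain G where G: "framed (weight_factor l) M G" using LM(2) unfolding weight_class_def by blast
    obtain H where "framed (weight_factor (k + l)) (tensor_bundle L M) H"
      using framed_tensor_weights[OF F G] by (rule exE)
    then show ?thesis by (rule iso_class_framed)
  qed
  have "(\<Union>L\<in>weight_class k :: 'a orbi_bundle set. \<Union>M\<in>weight_class l :: 'a orbi_bundle set.
      iso_class (tensor_bundle L M)) = (weight_class (k + l) :: 'a orbi_bundle set)"
    using weight_class_nonempty[OF e, of k] weight_class_nonempty[OF e, of l] by (auto simp: cls)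
  then show ?thesis by (simp add: Pic_def)
qed

lemma one_Pic: "one (Pic TYPE('a)) = weight_class 0"
  by (simp add: Pic_def iso_class_framed[OF framed_weight_bundle])

theorem theorem6p6:
  fixes e :: "complex \<times> complex \<Rightarrow> 'a"
  assumes "inj e"
  shows "group (Pic TYPE('a)) \<and> cyclic_group (Pic TYPE('a)) \<and> order (Pic TYPE('a)) = 12 \<and>
         iso_class (weight_bundle 1) \<in> carrier (Pic TYPE('a)) \<and>
         carrier (Pic TYPE('a)) = generate (Pic TYPE('a)) {iso_class (weight_bundle 1)}"
proof -
  let ?P = "Pic TYPE('a)"
  let ?C = "weight_class :: int \<Rightarrow> 'a orbi_bundle set"
  note car = carrier_Pic[OF assms] and mult = mult_Pic[OF assms]
  have grp: "group ?P"
  proof (rule groupI)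
    show "\<exists>y\<in>carrier ?P. mult ?P y x = one ?P" if x: "x \<in> carrier ?P" for x
    proof -
      obtain k where x: "x = ?C k" using x unfolding car by (rule rangeE)
      show ?thesis by (rule bexI[of _ "?C (- k)"]) (simp_all add: x mult one_Pic car)
    qed
  qed (auto simp: car mult one_Pic add.assoc)
  then interpret group ?P .
  have inv: "m_inv ?P (?C k) = ?C (- k)" for k
    by (rule inv_equality) (simp_all add: mult one_Pic car)
  have pow_nat: "pow ?P (?C 1) n = ?C (int n)" for n :: nat
  proof (induction n)
    case 0 show ?case by (simp add: one_Pic)
  next
    case (Suc n) then show ?case by (simp add: mult add.commute)
  qed
  have pow: "pow ?P (?C 1) n = ?C n" for n :: int
    by (simp add: int_pow_def2 pow_nat inv)
  have L1: "iso_class (weight_bundle 1) = ?C 1" by (rule iso_class_framed[OF framed_weight_bundle])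
  have in_car: "?C 1 \<in> carrier ?P" by (simp add: car)
  have powers: "carrier ?P = range (\<lambda>n::int. pow ?P (?C 1) n)" by (simp add: pow car)
  have cyc: "cyclic_group ?P" unfolding cyclic_group using in_car powers by blast
  have gen: "carrier ?P = generate ?P {?C 1}"
    unfolding generate_pow[OF in_car] using powers by auto
  have "carrier ?P = ?C ` {0..<12}"
  proof
    show "carrier ?P \<subseteq> ?C ` {0..<12}"
      unfolding car
    proof (rule image_subsetI)
      fix k :: int
      have "12 dvd (k - k mod 12)" by (simp add: dvd_minus_mod)
      then have "?C k = ?C (k mod 12)" by (simp only: weight_class_eq_iff[OF assms])
      then show "?C k \<in> ?C ` {0..<12}" by (rule image_eqI) simp
    qed
  qed (auto simp: car)
  moreover have "inj_on ?C {0..<12}"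
  proof (rule inj_onI)
    fix k l :: int assume "k \<in> {0..<12}" "l \<in> {0..<12}" "?C k = ?C l"
    then have "0 \<le> k" "k < 12" "0 \<le> l" "l < 12" "12 dvd (k - l)"
      by (simp_all add: weight_class_eq_iff[OF assms])
    then show "k = l" by presburger
  qed
  ultimately have "order ?P = 12" by (simp add: order_def card_image)
  with grp cyc in_car gen show ?thesis by (simp only: L1)
qed

end
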